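(* Let $T>0$. Assume that the drift $f$ satisfies $(\mathbf{a1})$, the running cost $g$ satisfies $(\mathbf{a2})$, the terminal function $p$ satisfies $(\mathbf P)$ with $L_p\le\bar L_p:=\max\{\bar L_k,L_0^*\}$, and $$\sup_{(x,\mu,\alpha)}\|\partial_\alpha\partial_\alpha f(x,\mu,\alpha)\|_{\mathcal L(\mathbb R^{d_\alpha}\times\mathbb R^{d_\alpha};\mathbb R^{d_x})}\,(1+|x|+\|\mu\|_1)\le\frac{\lambda_g}{40\max\{\bar L_k,L_0^*\}}$$ (see context). Then there exists a constant $\epsilon_7=\epsilon_7(\bar L_p;L_f,\Lambda_f,\bar l_f,L_g,\Lambda_g,\bar l_g,L_\alpha)>0$ such that, for any fixed $0\le t\le\tilde T\le T$ with $\tilde T-t\le\epsilon_7$ and $m\in\mathcal P_2(\mathbb R^{d_x})$: if there exist two solution pairs $(X^{t,m}_s(x),Z^{t,m}_s(x))_{x\in\mathbb R^{d_x},s\in[t,\tilde T]}$ and $(\tilde X^{t,m}_s(x),\tilde Z^{t,m}_s(x))_{x\in\mathbb R^{d_x},s\in[t,\tilde T]}$ of the FBODE system with terminal data $p$ on $[t,\tilde T]$, each continuously differentiable in $s\in[t,\tilde T]$, then they must be equal for all $s\in[t,\tilde T]$ and $x\in\mathbb R^{d_x}$.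
   Context: **Notation.** $\mathcal P_2(\mathbb R^d)$: Borel probability measures on $\mathbb R^d$ with finite second moment; $W_p$: $p$-Wasserstein metric; $\|\mu\|_p=(\int|x|^pd\mu)^{1/p}$; $\delta_0$: Dirac mass at $0$; $X\#m$: push-forward of $m$ under $X$; $\|\cdot\|$: operator norm of (multi)linear maps; $a\vee b=\max\{a,b\}$. For $z\in\mathbb R^{d_x}$: $\partial_xf\cdot z=\sum_iz_i\partial_xf_i$, and similarly for $\partial_\alpha f\cdot z$, $\partial_\mu f(\cdot)(\tilde x)\cdot z$. **Derivatives in measure.** $h:\mathcal P_2(\mathbb R^d)\to\mathbb R$ has linear functional derivative $\frac{\delta h}{\delta\mu}(\mu)(x)$ if this function is jointly continuous, $|\frac{\delta h}{\delta\mu}(\mu)(x)|\le c(\mu)(1+|x|^2)$ with $c$ bounded on bounded sets, and $h(\nu_1)-h(\nu_2)=\int_0^1\int\frac{\delta h}{\delta\mu}(\theta\nu_1+(1-\theta)\nu_2)(x)\,d(\nu_1-\nu_2)(x)d\theta$; normalization $\int\frac{\delta h}{\delta\mu}(\mu)d\mu=0$. A second-order linear functional derivative $\frac{\delta^2h}{\delta\mu^2}(\mu)(x,\tilde x)$ is jointly continuous, bounded by $c(\mu)(1+|x|^2+|\tilde x|^2)$, has zero $\mu$-integral in each variable, and satisfies $h(\nu_1)-h(\nu_2)=\int\frac{\delta h}{\delta\mu}(\nu_2)d(\nu_1-\nu_2)+\int_0^1\int_0^1\iint\theta\frac{\delta^2h}{\delta\mu^2}(\nu_2+\lambda\theta(\nu_1-\nu_2))(x,\tilde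 x)d(\nu_1-\nu_2)(x)d(\nu_1-\nu_2)(\tilde x)d\lambda d\theta$. $h$ is second-order regularly differentiable if both exist and $\partial_x\partial_x\frac{\delta h}{\delta\mu}$, $\partial_x\partial_{\tilde x}\frac{\delta^2h}{\delta\mu^2}$ are jointly continuous and bounded by $c(\mu)$. $h$ is $L$-differentiable at $\mu$ if the lift $X\mapsto h(\mathrm{Law}(X))$ on square-integrable random vectors is Fréchet differentiable at some $X$ with law $\mu$; the derivative is represented by $\partial_\mu h(\mu)(X)$, and $\partial_\mu h(\mu)(x)=\partial_x\frac{\delta h}{\delta\mu}(\mu)(x)$ for regularly differentiable $h$. Also $\partial_\mu\partial_\mu h(\mu)(\tilde x,\hat x)=\partial_{\tilde x}\partial_{\hat x}\frac{\delta^2h}{\delta\mu^2}(\mu)(\tilde x,\hat x)$. For vector-valued maps everything is componentwise. **(a1)** $f:\mathbb R^{d_x}\times\mathcal P_2(\mathbb R^{d_x})\times\mathbb R^{d_\alpha}\to\mathbb R^{d_x}$ is twice differentiable in $x,\alpha$, second-order regularly differentiable in $\mu$, with jointly continuous derivatives, and for constants $\lambda_f,\Lambda_f,\bar l_f,\mathrm{Lip}_f>0$ and all arguments: (i) $\sum_{i,j}(\xi_i\partial_\alpha f_i)\cdot(\xi_j\partial_\alpha f_j)\ge\lambda_f|\xi|^2$ for $\xi\in\mathbb R^{d_x}$; (ii) $\|\partial_\alpha f\|\vee\|\partial_\mu f(x,\mu,\alpha)(\tilde x)\|\vee\|\partial_xf\|\le\Lambda_f$; (iii) each of $\partial_\mu\partial_\mu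 f(x,\mu,\alpha)(\tilde x,\hat x)$, $\partial_\alpha\partial_\alpha f$, $\partial_\mu\partial_\alpha f(\cdot)(\tilde x)$, $\partial_\alpha\partial_xf$, $\partial_x\partial_xf$, $\partial_{\tilde x}\partial_\mu f(\cdot)(\tilde x)$, $\partial_x\partial_\mu f(\cdot)(\tilde x)$ has norm at most $\bar l_f/(1+|x|+\|\mu\|_1)$; (iv) each of these is jointly Lipschitz with constant $\mathrm{Lip}_f/(1+\max\{|x|,|x'|\}+\max\{\|\mu\|_1,\|\mu'\|_1\})$ with respect to $|x-x'|+W_2(\mu,\mu')+|\alpha-\alpha'|$ (plus $|\tilde x-\tilde x'|$, $|\hat x-\hat x'|$ when these variables occur). **(a2)** $g:\mathbb R^{d_x}\times\mathcal P_2(\mathbb R^{d_x})\times\mathbb R^{d_\alpha}\to\mathbb R$ is twice differentiable in $x,\alpha$, second-order regularly differentiable in $\mu$, with jointly Lipschitz second-order derivatives, and for constants $\lambda_g,\Lambda_g,\bar l_g>0$, $l_g\ge0$: (i) $\xi^\top\partial_\alpha\partial_\alpha g\,\xi\ge\lambda_g|\xi|^2$; (ii) with $G(x,\mu,\alpha):=g(x,\mu,\alpha)+\int\frac{\delta}{\delta\mu}g(\tilde x,\mu,\alpha)(x)d\mu(\tilde x)$: $\xi^\top\partial_x\partial_xG\,\xi\ge\lambda_g|\xi|^2$ and $\int(G(x,\mu',\alpha)-G(x,\mu,\alpha))d(\mu'-\mu)(x)\ge-l_g|\int y\,d(\mu-\mu')(y)|^2$ for all $\mu,\mu',\alpha$,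 with $l_g\le\frac12\lambda_g$; (iii) the norms of $\partial_\mu\partial_\mu g(\cdot)(\tilde x,\hat x)$, $\partial_\alpha\partial_\alpha g$, $\partial_x\partial_\mu g(\cdot)(\tilde x)$, $\partial_x\partial_xg$, $\partial_{\tilde x}\partial_\mu g(\cdot)(\tilde x)$ are $\le\Lambda_g$, and those of $\partial_x\partial_\alpha g$, $\partial_\alpha\partial_\mu g(\cdot)(\tilde x)$ are $\le\bar l_g$. **(P)** $p:\mathbb R^{d_x}\times\mathcal P_2(\mathbb R^{d_x})\to\mathbb R^{d_x}$ is differentiable in $x$ and $L$-differentiable in $\mu$, with first-order derivatives Lipschitz continuous in their arguments, and $\|\partial_xp(x,\mu)\|\vee\|\partial_\mu p(x,\mu)(\tilde x)\|\le L_p$, $|p(x,\mu)|\le\bar L_p(1+|x|+\|\mu\|_1)$ for all $x,\mu,\tilde x$. **Constants.** $\lambda_k,\Lambda_k>0$ are given constants (in the paper, the convexity and second-derivative bounds of the terminal cost $k$). $\bar L_k=3\Lambda_k$; $\lambda_z=\frac{\lambda_f^2}{\Lambda_g+\lambda_g/20}$, $\lambda_x=\frac{17}{20}\lambda_g$, $\bar\lambda_k=\frac14\lambda_k$, $\bar\lambda_z=\frac12\lambda_z$, $\bar\lambda_x=\frac1{40}\lambda_g$; $\kappa_1=\min\{\frac{\lambda_k}4,\frac{\lambda_z}2,\frac{\lambda_g}{40}\}$, $\kappa_2=\min\{\frac{\lambda_k}4,\frac{\lambda_z}4,\frac{\lambda_g}5\}$; $L_1^*=\max\{\frac{4\Lambda_k^2}{\lambda_k},\frac1{\lambda_z}(2\Lambda_g+\frac3{20}\lambda_g),\frac1{\lambda_x}(\frac52\Lambda_f+2\Lambda_g+\frac3{20}\lambda_g)\}$;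 $L_4^*=\max\{\frac{\Lambda_k^2}{\kappa_1\lambda_k},\frac1{4\kappa_1\lambda_x}(\frac{25}{16}\Lambda_f^2+(2\Lambda_g+\frac15\lambda_g)^2)\}$; $L_5^*=\max\{\frac{9\Lambda_k^2}{4\kappa_2\bar\lambda_k},\frac{25\Lambda_f^2}{64\kappa_2\bar\lambda_z},\frac1{4\kappa_2\bar\lambda_x}(\frac{25}{16}\Lambda_f^2+9(\frac1{10}\lambda_g+\Lambda_g)^2)\}$; $L_6^*=\max\{\frac{27\Lambda_k^2}{\bar\lambda_k},\frac{\Lambda_g+\lambda_g/10}{\bar\lambda_x},\frac{\Lambda_g+\lambda_g/10}{\bar\lambda_z},\frac{12\Lambda_k^2}{\lambda_k},\frac{2\Lambda_g+\lambda_g/5}{\lambda_x},\frac{6\Lambda_k^2}{\bar\lambda_k},\frac{2\Lambda_g+3\lambda_g/20}{\bar\lambda_x},\frac{\frac{15}4\Lambda_f+7\Lambda_g+\frac{13}{20}\lambda_g}{\bar\lambda_z}\}$; $L_0^*=d_x\max\{L_1^*,\sqrt{(L_4^*(2+L_5^* )+1)L_1^*L_6^*}\}$; $k_0=4\max\{\bar L_k,L_0^*\}$; $L_f=\max\{\Lambda_f,|f(0,\delta_0,0)|\}$; $L_g=\max\{|\partial_\mu g(0,\delta_0,0)(0)|,|\partial_xg(0,\delta_0,0)|,|\partial_\alpha g(0,\delta_0,0)|,\Lambda_g,\bar l_g\}$. **Optimal control.** $\alpha(x,\mu,z)\in\mathbb R^{d_\alpha}$ denotes the optimal control: a minimizer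 of $a\mapsto f(x,\mu,a)\cdot z+g(x,\mu,a)$ over $\mathbb R^{d_\alpha}$, which solves the first order condition $\partial_\alpha f(x,\mu,\alpha)\cdot z+\partial_\alpha g(x,\mu,\alpha)=0$. Under the assumptions of the claim it is uniquely determined by this condition whenever $(x,\mu,z)$ lies in $c_{k_0}=\{(x,\mu,z)\in\mathbb R^{d_x}\times\mathcal P_2(\mathbb R^{d_x})\times\mathbb R^{d_x}:|z|\le\frac12k_0(1+|x|+\|\mu\|_1)\}$. $L_\alpha:=\max\{\frac{20\Lambda_f}{19\lambda_g},\frac{20(\bar l_g+\frac12k_0\bar l_f)}{19\lambda_g},|\alpha(0,\delta_0,0)|\}$. **FBODE system.** For maps $X,Z:\mathbb R^{d_x}\to\mathbb R^{d_x}$ put $a_x=\alpha(X(x),X\#m,Z(x))$ and $\Phi(X,Z,m)(x)=\partial_xf(X(x),X\#m,a_x)\cdot Z(x)+\partial_xg(X(x),X\#m,a_x)+\int\big(\partial_\mu f(X(\tilde x),X\#m,a_{\tilde x})(X(x))\cdot Z(\tilde x)+\partial_\mu g(X(\tilde x),X\#m,a_{\tilde x})(X(x))\big)dm(\tilde x)$. The FBODE system on $[t,\tilde T]$ with terminal data $p$: for all $x\in\mathbb R^{d_x}$, $s\in[t,\tilde T]$, $\frac d{ds}X^{t,m}_s(x)=f(X^{t,m}_s(x),X^{t,m}_s\#m,\alpha(X^{t,m}_s(x),X^{t,m}_s\#m,Z^{t,m}_s(x)))$, $X^{t,m}_t(x)=x$; $\frac d{ds}Z^{t,m}_s(x)=-\Phi(X^{t,m}_s,Z^{t,m}_s,m)(x)$,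 $Z^{t,m}_{\tilde T}(x)=p(X^{t,m}_{\tilde T}(x),X^{t,m}_{\tilde T}\#m)$. A solution pair is a pair solving this system collectively for all $x\in\mathbb R^{d_x}$; membership of $(X_s(x),X_s\#m,Z_s(x))$ in $c_{k_0}$ is not assumed. *)

theory Defs
  imports "HOL-Probability.Probability"
begin

section \<open>The Wasserstein space of order two\<close>

definition P2 :: "(real^'n) measure set" where
  "P2 = {\<mu>. prob_space \<mu> \<and> sets \<mu> = sets borel \<and> integrable \<mu> (\<lambda>x. (norm x)\<^sup>2)}"

definition moment1 :: "(real^'n) measure \<Rightarrow> real" where
  "moment1 \<mu> = (\<integral>x. norm x \<partial>\<mu>)"

definition moment2 :: "(real^'n) measure \<Rightarrow> real" where
  "moment2 \<mu> = sqrt (\<integral>x. (norm x)\<^sup>2 \<partial>\<mu>)"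

definition couplings ::
  "(real^'n) measure \<Rightarrow> (real^'n) measure \<Rightarrow> ((real^'n) \<times> (real^'n)) measure set" where
  "couplings \<mu> \<nu> = {\<pi>. prob_space \<pi> \<and> sets \<pi> = sets borel \<and>
      distr \<pi> borel fst = \<mu> \<and> distr \<pi> borel snd = \<nu>}"

definition W2 :: "(real^'n) measure \<Rightarrow> (real^'n) measure \<Rightarrow> real" where
  "W2 \<mu> \<nu> = sqrt (INF \<pi>\<in>couplings \<mu> \<nu>. \<integral>(x, y). (norm (x - y))\<^sup>2 \<partial>\<pi>)"

abbreviation dirac0 :: "(real^'n) measure" where
  "dirac0 \<equiv> return borel 0"

text \<open>The convex combination \<open>\<theta> \<nu>\<^sub>1 + (1 - \<theta>) \<nu>\<^sub>2\<close>, for \<open>0 \<le> \<theta> \<le> 1\<close>.\<close>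

definition mix :: "real \<Rightarrow> (real^'n) measure \<Rightarrow> (real^'n) measure \<Rightarrow> (real^'n) measure" where
  "mix \<theta> \<nu>1 \<nu>2 = measure_of UNIV (sets borel)
     (\<lambda>A. ennreal \<theta> * emeasure \<nu>1 A + ennreal (1 - \<theta>) * emeasure \<nu>2 A)"

text \<open>Integration against the signed measure \<open>\<nu>\<^sub>1 - \<nu>\<^sub>2\<close>.\<close>

definition int_diff :: "(real^'n) measure \<Rightarrow> (real^'n) measure \<Rightarrow>
    (real^'n \<Rightarrow> 'v::{banach, second_countable_topology}) \<Rightarrow> 'v" where
  "int_diff \<nu>1 \<nu>2 \<phi> = (\<integral>x. \<phi> x \<partial>\<nu>1) - (\<integral>x. \<phi> x \<partial>\<nu>2)"

text \<open>Joint continuity in the measure (for \<^const>\<open>W2\<close>) and the remaining variables, which are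
  collected in one (tuple) argument.\<close>

definition jointly_continuous ::
  "((real^'n) measure \<Rightarrow> 'e::metric_space \<Rightarrow> 'v::metric_space) \<Rightarrow> bool" where
  "jointly_continuous F \<longleftrightarrow> (\<forall>\<mu>\<in>P2. \<forall>e. \<forall>\<epsilon>>0. \<exists>\<delta>>0. \<forall>\<mu>'\<in>P2. \<forall>e'.
      W2 \<mu> \<mu>' < \<delta> \<and> dist e e' < \<delta> \<longrightarrow> dist (F \<mu> e) (F \<mu>' e') < \<epsilon>)"

text \<open>\<open>|F \<mu> e| \<le> c(\<mu>) w(e)\<close> with \<open>c\<close> bounded on bounded subsets of \<^const>\<open>P2\<close>.\<close>

definition locally_bounded_by ::
  "((real^'n) measure \<Rightarrow> 'e \<Rightarrow> 'v::real_normed_vector) \<Rightarrow> ('e \<Rightarrow> real) \<Rightarrow> bool" where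
  "locally_bounded_by F w \<longleftrightarrow> (\<exists>c. (\<forall>R. \<exists>C. \<forall>\<mu>\<in>P2. moment2 \<mu> \<le> R \<longrightarrow> c \<mu> \<le> C) \<and>
      (\<forall>\<mu>\<in>P2. \<forall>e. norm (F \<mu> e) \<le> c \<mu> * w e))"

section \<open>Derivatives\<close>

text \<open>Derivatives are bounded linear maps, so that \<^const>\<open>norm\<close> is the operator norm; iterated
  derivatives are curried multilinear maps, whose \<^const>\<open>norm\<close> is the multilinear operator norm.\<close>

definition fderiv ::
  "('a::real_normed_vector \<Rightarrow> 'b::real_normed_vector) \<Rightarrow> 'a \<Rightarrow> ('a \<Rightarrow>\<^sub>L 'b)" where
  "fderiv F x = Blinfun (frechet_derivative F (at x))"

abbreviation diffble :: "('a::real_normed_vector \<Rightarrow> 'b::real_normed_vector) \<Rightarrow> bool" where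
  "diffble F \<equiv> \<forall>x. F differentiable (at x)"

definition D_x :: "('x::real_normed_vector \<Rightarrow> 'm \<Rightarrow> 'a \<Rightarrow> 'v::real_normed_vector) \<Rightarrow>
    'x \<Rightarrow> 'm \<Rightarrow> 'a \<Rightarrow> ('x \<Rightarrow>\<^sub>L 'v)" where
  "D_x F x \<mu> a = fderiv (\<lambda>x. F x \<mu> a) x"

definition D_a :: "('x \<Rightarrow> 'm \<Rightarrow> 'a::real_normed_vector \<Rightarrow> 'v::real_normed_vector) \<Rightarrow>
    'x \<Rightarrow> 'm \<Rightarrow> 'a \<Rightarrow> ('a \<Rightarrow>\<^sub>L 'v)" where
  "D_a F x \<mu> a = fderiv (\<lambda>a. F x \<mu> a) a"

text \<open>If \<open>\<delta>F x \<mu> a y\<close> is the linear functional derivative of \<open>F\<close> in \<open>\<mu>\<close>, then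
  \<open>D_mu \<delta>F x \<mu> a y\<close> is \<open>\<partial>\<^sub>\<mu> F(x,\<mu>,a)(y)\<close>.\<close>

definition D_mu :: "('x \<Rightarrow> 'm \<Rightarrow> 'a \<Rightarrow> 'y::real_normed_vector \<Rightarrow> 'v::real_normed_vector) \<Rightarrow>
    'x \<Rightarrow> 'm \<Rightarrow> 'a \<Rightarrow> 'y \<Rightarrow> ('y \<Rightarrow>\<^sub>L 'v)" where
  "D_mu dF x \<mu> a y = fderiv (dF x \<mu> a) y"

text \<open>Similarly \<open>\<partial>\<^sub>\<mu>\<partial>\<^sub>\<mu> F(x,\<mu>,a)(y,w)\<close>, from the second-order linear functional derivative.\<close>

definition D_mumu ::
  "('x \<Rightarrow> 'm \<Rightarrow> 'a \<Rightarrow> 'y::real_normed_vector \<Rightarrow> 'y \<Rightarrow> 'v::real_normed_vector) \<Rightarrow>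
    'x \<Rightarrow> 'm \<Rightarrow> 'a \<Rightarrow> 'y \<Rightarrow> 'y \<Rightarrow> ('y \<Rightarrow>\<^sub>L 'y \<Rightarrow>\<^sub>L 'v)" where
  "D_mumu d2F x \<mu> a y w = fderiv (\<lambda>y. fderiv (\<lambda>w. d2F x \<mu> a y w) w) y"

text \<open>\<open>\<partial>\<^sub>x \<partial>\<^sub>\<mu> F(x,\<mu>,a)(y)\<close>, \<open>\<partial>\<^sub>\<alpha> \<partial>\<^sub>\<mu> F(x,\<mu>,a)(y)\<close> and \<open>\<partial>\<^sub>y \<partial>\<^sub>\<mu> F(x,\<mu>,a)(y)\<close>.\<close>

definition D_x_mu where "D_x_mu dF x \<mu> a y = D_x (\<lambda>x \<mu> a. D_mu dF x \<mu> a y) x \<mu> a"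
definition D_a_mu where "D_a_mu dF x \<mu> a y = D_a (\<lambda>x \<mu> a. D_mu dF x \<mu> a y) x \<mu> a"
definition D_y_mu where "D_y_mu dF x \<mu> a y = fderiv (\<lambda>y. D_mu dF x \<mu> a y) y"

text \<open>Gradient vectors: of a linear form, and of the \<open>i\<close>-th component of a linear map.\<close>

definition grad :: "((real^'m) \<Rightarrow>\<^sub>L real) \<Rightarrow> real^'m" where
  "grad A = (\<chi> j. blinfun_apply A (axis j 1))"

definition comp_grad :: "((real^'m) \<Rightarrow>\<^sub>L (real^'n)) \<Rightarrow> 'n \<Rightarrow> real^'m" where
  "comp_grad A i = (\<chi> j. blinfun_apply A (axis j 1) $ i)"

text \<open>\<open>\<partial>f \<cdot> z = \<Sum>\<^sub>i z\<^sub>i \<partial>f\<^sub>i\<close>.\<close>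

definition contr :: "((real^'m) \<Rightarrow>\<^sub>L (real^'n)) \<Rightarrow> real^'n \<Rightarrow> real^'m" where
  "contr A z = (\<Sum>i\<in>UNIV. (z $ i) *\<^sub>R comp_grad A i)"

definition is_lfd ::
  "((real^'n) measure \<Rightarrow> real) \<Rightarrow> ((real^'n) measure \<Rightarrow> real^'n \<Rightarrow> real) \<Rightarrow> bool" where
  "is_lfd h D \<longleftrightarrow>
     jointly_continuous D \<and>
     locally_bounded_by D (\<lambda>x. 1 + (norm x)\<^sup>2) \<and>
     (\<forall>\<nu>1\<in>P2. \<forall>\<nu>2\<in>P2.
        ((\<lambda>\<theta>. int_diff \<nu>1 \<nu>2 (D (mix \<theta> \<nu>1 \<nu>2))) has_integral (h \<nu>1 - h \<nu>2)) {0..1}) \<and>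
     (\<forall>\<mu>\<in>P2. (\<integral>x. D \<mu> x \<partial>\<mu>) = 0)"

definition is_lfd2 :: "((real^'n) measure \<Rightarrow> real) \<Rightarrow> ((real^'n) measure \<Rightarrow> real^'n \<Rightarrow> real) \<Rightarrow>
    ((real^'n) measure \<Rightarrow> real^'n \<Rightarrow> real^'n \<Rightarrow> real) \<Rightarrow> bool" where
  "is_lfd2 h D D2 \<longleftrightarrow>
     jointly_continuous (\<lambda>\<mu> (x, y). D2 \<mu> x y) \<and>
     locally_bounded_by (\<lambda>\<mu> (x, y). D2 \<mu> x y) (\<lambda>(x, y). 1 + (norm x)\<^sup>2 + (norm y)\<^sup>2) \<and>
     (\<forall>\<mu>\<in>P2. (\<forall>y. (\<integral>x. D2 \<mu> x y \<partial>\<mu>) = 0) \<and> (\<forall>x. (\<integral>y. D2 \<mu> x y \<partial>\<mu>) = 0)) \<and>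
     (\<forall>\<nu>1\<in>P2. \<forall>\<nu>2\<in>P2.
        h \<nu>1 - h \<nu>2 = int_diff \<nu>1 \<nu>2 (D \<nu>2) +
          integral {0..1} (\<lambda>\<theta>. integral {0..1} (\<lambda>l.
            int_diff \<nu>1 \<nu>2 (\<lambda>y. int_diff \<nu>1 \<nu>2 (\<lambda>x. \<theta> * D2 (mix (l * \<theta>) \<nu>1 \<nu>2) x y)))))"

definition regular2 :: "((real^'n) measure \<Rightarrow> real) \<Rightarrow> ((real^'n) measure \<Rightarrow> real^'n \<Rightarrow> real) \<Rightarrow>
    ((real^'n) measure \<Rightarrow> real^'n \<Rightarrow> real^'n \<Rightarrow> real) \<Rightarrow> bool" where
  "regular2 h D D2 \<longleftrightarrow>
     is_lfd h D \<and> is_lfd2 h D D2 \<and>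
     (\<forall>\<mu>\<in>P2. diffble (D \<mu>) \<and> diffble (fderiv (D \<mu>))) \<and>
     jointly_continuous (\<lambda>\<mu> x. fderiv (fderiv (D \<mu>)) x) \<and>
     locally_bounded_by (\<lambda>\<mu> x. fderiv (fderiv (D \<mu>)) x) (\<lambda>_. 1) \<and>
     (\<forall>\<mu>\<in>P2. \<forall>x y. (\<lambda>y. D2 \<mu> x y) differentiable (at y) \<and>
        (\<lambda>x. fderiv (\<lambda>y. D2 \<mu> x y) y) differentiable (at x)) \<and>
     jointly_continuous (\<lambda>\<mu> (x, y). fderiv (\<lambda>x. fderiv (\<lambda>y. D2 \<mu> x y) y) x) \<and>
     locally_bounded_by (\<lambda>\<mu> (x, y). fderiv (\<lambda>x. fderiv (\<lambda>y. D2 \<mu> x y) y) x) (\<lambda>_. 1)"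

text \<open>Random vectors live on the atomless probability space \<open>[0,1]\<close> with Lebesgue measure, on which
  every law is realised. The gradient \<open>\<psi> = \<partial>\<^sub>\<mu> h(\<mu>)\<close> is determined only \<open>\<mu>\<close>-almost everywhere, so
  it is an argument.\<close>

abbreviation Omega :: "real measure" where
  "Omega \<equiv> uniform_measure lborel {0..1}"

definition sq_int :: "(real \<Rightarrow> real^'n) \<Rightarrow> bool" where
  "sq_int Y \<longleftrightarrow> Y \<in> borel_measurable Omega \<and> integrable Omega (\<lambda>w. (norm (Y w))\<^sup>2)"

definition L2norm :: "(real \<Rightarrow> real^'n) \<Rightarrow> real" where
  "L2norm Y = sqrt (\<integral>w. (norm (Y w))\<^sup>2 \<partial>Omega)"

definition has_L_derivative ::
  "((real^'n) measure \<Rightarrow> real) \<Rightarrow> (real^'n) measure \<Rightarrow> (real^'n \<Rightarrow> real^'n) \<Rightarrow> bool" where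
  "has_L_derivative h \<mu> \<psi> \<longleftrightarrow> (\<exists>X. sq_int X \<and> distr Omega borel X = \<mu> \<and> sq_int (\<lambda>w. \<psi> (X w)) \<and>
     (\<forall>\<epsilon>>0. \<exists>\<delta>>0. \<forall>Y. sq_int Y \<and> L2norm (\<lambda>w. Y w - X w) < \<delta> \<longrightarrow>
        \<bar>h (distr Omega borel Y) - h \<mu> - (\<integral>w. \<psi> (X w) \<bullet> (Y w - X w) \<partial>Omega)\<bar>
          \<le> \<epsilon> * L2norm (\<lambda>w. Y w - X w)))"

section \<open>Assumptions on the drift, the running cost and the terminal function\<close>

text \<open>Bounds and Lipschitz estimates for functions of \<open>(x, \<mu>, a, y, w)\<close>; functions that do not depend
  on \<open>y\<close> or \<open>w\<close> are passed with dummy arguments, for which the extra terms are void.\<close>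

definition bounded_by ::
  "(real^'n \<Rightarrow> (real^'n) measure \<Rightarrow> real) \<Rightarrow>
   (real^'n \<Rightarrow> (real^'n) measure \<Rightarrow> real^'k \<Rightarrow> real^'n \<Rightarrow> real^'n \<Rightarrow> 'v::real_normed_vector) \<Rightarrow> bool" where
  "bounded_by B F \<longleftrightarrow> (\<forall>x. \<forall>\<mu>\<in>P2. \<forall>a y w. norm (F x \<mu> a y w) \<le> B x \<mu>)"

definition lipschitz_by ::
  "(real^'n \<Rightarrow> real^'n \<Rightarrow> (real^'n) measure \<Rightarrow> (real^'n) measure \<Rightarrow> real) \<Rightarrow>
   (real^'n \<Rightarrow> (real^'n) measure \<Rightarrow> real^'k \<Rightarrow> real^'n \<Rightarrow> real^'n \<Rightarrow> 'v::real_normed_vector) \<Rightarrow> bool" where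
  "lipschitz_by K F \<longleftrightarrow> (\<forall>x x'. \<forall>\<mu>\<in>P2. \<forall>\<mu>'\<in>P2. \<forall>a a' y y' w w'.
      norm (F x \<mu> a y w - F x' \<mu>' a' y' w') \<le> K x x' \<mu> \<mu>' *
        (norm (x - x') + W2 \<mu> \<mu>' + norm (a - a') + norm (y - y') + norm (w - w')))"

abbreviation decaying :: "real \<Rightarrow> real^'n \<Rightarrow> (real^'n) measure \<Rightarrow> real" where
  "decaying l x \<mu> \<equiv> l / (1 + norm x + moment1 \<mu>)"

abbreviation decaying2 ::
  "real \<Rightarrow> real^'n \<Rightarrow> real^'n \<Rightarrow> (real^'n) measure \<Rightarrow> (real^'n) measure \<Rightarrow> real" where
  "decaying2 l x x' \<mu> \<mu>' \<equiv>
     l / (1 + max (norm x) (norm x') + max (moment1 \<mu>) (moment1 \<mu>'))"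

text \<open>Existence of all first and second partial derivatives in \<open>x\<close> and \<open>a\<close>.\<close>

definition twice_diffble_xa ::
  "(real^'n \<Rightarrow> (real^'n) measure \<Rightarrow> real^'k \<Rightarrow> 'v::real_normed_vector) \<Rightarrow> bool" where
  "twice_diffble_xa F \<longleftrightarrow> (\<forall>x. \<forall>\<mu>\<in>P2. \<forall>a.
     (\<lambda>x. F x \<mu> a) differentiable (at x) \<and> (\<lambda>a. F x \<mu> a) differentiable (at a) \<and>
     (\<lambda>x. D_x F x \<mu> a) differentiable (at x) \<and> (\<lambda>a. D_x F x \<mu> a) differentiable (at a) \<and>
     (\<lambda>x. D_a F x \<mu> a) differentiable (at x) \<and> (\<lambda>a. D_a F x \<mu> a) differentiable (at a))"

text \<open>\<open>df\<close> is \<open>\<delta>f/\<delta>\<mu>\<close>, \<open>d2f\<close> is \<open>\<delta>\<^sup>2f/\<delta>\<mu>\<^sup>2\<close>, and \<open>Dma x \<mu> a y\<close> is \<open>\<partial>\<^sub>\<mu>\<partial>\<^sub>\<alpha> f(x,\<mu>,a)(y)\<close>, the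
  L-derivative of the matrix-valued map \<open>\<partial>\<^sub>\<alpha> f\<close>. The second-order derivatives are jointly
  continuous by their Lipschitz estimates.\<close>

definition assumption_a1 ::
  "real \<Rightarrow> real \<Rightarrow> real \<Rightarrow> real \<Rightarrow>
   (real^'n \<Rightarrow> (real^'n) measure \<Rightarrow> real^'k \<Rightarrow> real^'n) \<Rightarrow>
   (real^'n \<Rightarrow> (real^'n) measure \<Rightarrow> real^'k \<Rightarrow> real^'n \<Rightarrow> real^'n) \<Rightarrow> bool" where
  "assumption_a1 lam_f Lam_f lb_f Lip_f f df \<longleftrightarrow>
     0 < lam_f \<and> 0 < Lam_f \<and> 0 < lb_f \<and> 0 < Lip_f \<and>
     twice_diffble_xa f \<and>
     (\<forall>x. \<forall>\<mu>\<in>P2. \<forall>a y. (\<lambda>x. D_mu df x \<mu> a y) differentiable (at x)) \<and>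
     jointly_continuous (\<lambda>\<mu> (x, a). D_x f x \<mu> a) \<and>
     jointly_continuous (\<lambda>\<mu> (x, a). D_a f x \<mu> a) \<and>
     jointly_continuous (\<lambda>\<mu> (x, a, y). D_mu df x \<mu> a y) \<and>
     jointly_continuous (\<lambda>\<mu> (x, a). D_x (D_a f) x \<mu> a) \<and>
     (\<forall>x. \<forall>\<mu>\<in>P2. \<forall>a \<xi>.
        (\<Sum>i\<in>UNIV. \<Sum>j\<in>UNIV. ((\<xi> $ i) *\<^sub>R comp_grad (D_a f x \<mu> a) i) \<bullet>
                                ((\<xi> $ j) *\<^sub>R comp_grad (D_a f x \<mu> a) j)) \<ge> lam_f * (norm \<xi>)\<^sup>2) \<and>
     (\<forall>x. \<forall>\<mu>\<in>P2. \<forall>a y.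
        norm (D_a f x \<mu> a) \<le> Lam_f \<and> norm (D_mu df x \<mu> a y) \<le> Lam_f \<and> norm (D_x f x \<mu> a) \<le> Lam_f) \<and>
     (\<exists>d2f (Dma :: real^'n \<Rightarrow> (real^'n) measure \<Rightarrow> real^'k \<Rightarrow> real^'n \<Rightarrow>
              ((real^'n) \<Rightarrow>\<^sub>L (real^'k) \<Rightarrow>\<^sub>L (real^'n))).
        (\<forall>x a i. regular2 (\<lambda>\<mu>. f x \<mu> a $ i) (\<lambda>\<mu> y. df x \<mu> a y $ i)
                         (\<lambda>\<mu> y w. d2f x \<mu> a y w $ i)) \<and>
        (\<forall>x. \<forall>\<mu>\<in>P2. \<forall>a i j. has_L_derivative (\<lambda>\<mu>. comp_grad (D_a f x \<mu> a) i $ j) \<mu>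
           (\<lambda>y. \<chi> l. blinfun_apply (blinfun_apply (Dma x \<mu> a y) (axis l 1)) (axis j 1) $ i)) \<and>
        bounded_by (decaying lb_f) (\<lambda>x \<mu> a y w. D_mumu d2f x \<mu> a y w) \<and>
        bounded_by (decaying lb_f) (\<lambda>x \<mu> a y w. D_a (D_a f) x \<mu> a) \<and>
        bounded_by (decaying lb_f) (\<lambda>x \<mu> a y w. Dma x \<mu> a y) \<and>
        bounded_by (decaying lb_f) (\<lambda>x \<mu> a y w. D_a (D_x f) x \<mu> a) \<and>
        bounded_by (decaying lb_f) (\<lambda>x \<mu> a y w. D_x (D_x f) x \<mu> a) \<and>
        bounded_by (decaying lb_f) (\<lambda>x \<mu> a y w. D_y_mu df x \<mu> a y) \<and>
        bounded_by (decaying lb_f) (\<lambda>x \<mu> a y w. D_x_mu df x \<mu> a y) \<and>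
        lipschitz_by (decaying2 Lip_f) (\<lambda>x \<mu> a y w. D_mumu d2f x \<mu> a y w) \<and>
        lipschitz_by (decaying2 Lip_f) (\<lambda>x \<mu> a y w. D_a (D_a f) x \<mu> a) \<and>
        lipschitz_by (decaying2 Lip_f) (\<lambda>x \<mu> a y w. Dma x \<mu> a y) \<and>
        lipschitz_by (decaying2 Lip_f) (\<lambda>x \<mu> a y w. D_a (D_x f) x \<mu> a) \<and>
        lipschitz_by (decaying2 Lip_f) (\<lambda>x \<mu> a y w. D_x (D_x f) x \<mu> a) \<and>
        lipschitz_by (decaying2 Lip_f) (\<lambda>x \<mu> a y w. D_y_mu df x \<mu> a y) \<and>
        lipschitz_by (decaying2 Lip_f) (\<lambda>x \<mu> a y w. D_x_mu df x \<mu> a y))"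

definition G_fun ::
  "(real^'n \<Rightarrow> (real^'n) measure \<Rightarrow> real^'k \<Rightarrow> real) \<Rightarrow>
   (real^'n \<Rightarrow> (real^'n) measure \<Rightarrow> real^'k \<Rightarrow> real^'n \<Rightarrow> real) \<Rightarrow>
   real^'n \<Rightarrow> (real^'n) measure \<Rightarrow> real^'k \<Rightarrow> real" where
  "G_fun g dg x \<mu> a = g x \<mu> a + (\<integral>y. dg y \<mu> a x \<partial>\<mu>)"

definition assumption_a2 ::
  "real \<Rightarrow> real \<Rightarrow> real \<Rightarrow> real \<Rightarrow>
   (real^'n \<Rightarrow> (real^'n) measure \<Rightarrow> real^'k \<Rightarrow> real) \<Rightarrow>
   (real^'n \<Rightarrow> (real^'n) measure \<Rightarrow> real^'k \<Rightarrow> real^'n \<Rightarrow> real) \<Rightarrow> bool" where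
  "assumption_a2 lam_g Lam_g lb_g l_g g dg \<longleftrightarrow>
     0 < lam_g \<and> 0 < Lam_g \<and> 0 < lb_g \<and> 0 \<le> l_g \<and>
     twice_diffble_xa g \<and>
     (\<forall>x. \<forall>\<mu>\<in>P2. \<forall>a y. (\<lambda>x. D_mu dg x \<mu> a y) differentiable (at x) \<and>
                       (\<lambda>a. D_mu dg x \<mu> a y) differentiable (at a)) \<and>
     (\<forall>x. \<forall>\<mu>\<in>P2. \<forall>a \<xi>.
        blinfun_apply (blinfun_apply (D_a (D_a g) x \<mu> a) \<xi>) \<xi> \<ge> lam_g * (norm \<xi>)\<^sup>2) \<and>
     (\<forall>x. \<forall>\<mu>\<in>P2. \<forall>a. (\<lambda>x. G_fun g dg x \<mu> a) differentiable (at x) \<and>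
                     (\<lambda>x. D_x (G_fun g dg) x \<mu> a) differentiable (at x)) \<and>
     (\<forall>x. \<forall>\<mu>\<in>P2. \<forall>a \<xi>.
        blinfun_apply (blinfun_apply (D_x (D_x (G_fun g dg)) x \<mu> a) \<xi>) \<xi> \<ge> lam_g * (norm \<xi>)\<^sup>2) \<and>
     (\<forall>\<mu>\<in>P2. \<forall>\<mu>'\<in>P2. \<forall>a.
        int_diff \<mu>' \<mu> (\<lambda>x. G_fun g dg x \<mu>' a - G_fun g dg x \<mu> a)
          \<ge> - l_g * (norm (int_diff \<mu> \<mu>' (\<lambda>y. y)))\<^sup>2) \<and>
     l_g \<le> lam_g / 2 \<and>
     (\<exists>d2g.
        (\<forall>x a. regular2 (\<lambda>\<mu>. g x \<mu> a) (\<lambda>\<mu> y. dg x \<mu> a y) (\<lambda>\<mu> y w. d2g x \<mu> a y w)) \<and>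
        bounded_by (\<lambda>_ _. Lam_g) (\<lambda>x \<mu> a y w. D_mumu d2g x \<mu> a y w) \<and>
        bounded_by (\<lambda>_ _. Lam_g) (\<lambda>x \<mu> a y w. D_a (D_a g) x \<mu> a) \<and>
        bounded_by (\<lambda>_ _. Lam_g) (\<lambda>x \<mu> a y w. D_x_mu dg x \<mu> a y) \<and>
        bounded_by (\<lambda>_ _. Lam_g) (\<lambda>x \<mu> a y w. D_x (D_x g) x \<mu> a) \<and>
        bounded_by (\<lambda>_ _. Lam_g) (\<lambda>x \<mu> a y w. D_y_mu dg x \<mu> a y) \<and>
        bounded_by (\<lambda>_ _. lb_g) (\<lambda>x \<mu> a y w. D_x (D_a g) x \<mu> a) \<and>
        bounded_by (\<lambda>_ _. lb_g) (\<lambda>x \<mu> a y w. D_a_mu dg x \<mu> a y) \<and>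
        (\<exists>K.
          lipschitz_by (\<lambda>_ _ _ _. K) (\<lambda>x \<mu> a y w. D_mumu d2g x \<mu> a y w) \<and>
          lipschitz_by (\<lambda>_ _ _ _. K) (\<lambda>x \<mu> a y w. D_a (D_a g) x \<mu> a) \<and>
          lipschitz_by (\<lambda>_ _ _ _. K) (\<lambda>x \<mu> a y w. D_x_mu dg x \<mu> a y) \<and>
          lipschitz_by (\<lambda>_ _ _ _. K) (\<lambda>x \<mu> a y w. D_x (D_x g) x \<mu> a) \<and>
          lipschitz_by (\<lambda>_ _ _ _. K) (\<lambda>x \<mu> a y w. D_y_mu dg x \<mu> a y) \<and>
          lipschitz_by (\<lambda>_ _ _ _. K) (\<lambda>x \<mu> a y w. D_x (D_a g) x \<mu> a) \<and>
          lipschitz_by (\<lambda>_ _ _ _. K) (\<lambda>x \<mu> a y w. D_a_mu dg x \<mu> a y)))"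

text \<open>\<open>Dm x \<mu> y\<close> is \<open>\<partial>\<^sub>\<mu> p(x,\<mu>)(y)\<close>.\<close>

definition assumption_P ::
  "real \<Rightarrow> real \<Rightarrow> (real^'n \<Rightarrow> (real^'n) measure \<Rightarrow> real^'n) \<Rightarrow> bool" where
  "assumption_P L_p Lbar_p p \<longleftrightarrow>
     (\<forall>\<mu>\<in>P2. diffble (\<lambda>x. p x \<mu>)) \<and>
     (\<exists>Dm. (\<forall>x. \<forall>\<mu>\<in>P2. \<forall>i. has_L_derivative (\<lambda>\<mu>. p x \<mu> $ i) \<mu> (\<lambda>y. comp_grad (Dm x \<mu> y) i)) \<and>
        (\<exists>K. \<forall>x x'. \<forall>\<mu>\<in>P2. \<forall>\<mu>'\<in>P2. \<forall>y y'.
           norm (fderiv (\<lambda>x. p x \<mu>) x - fderiv (\<lambda>x. p x \<mu>') x') \<le> K * (norm (x - x') + W2 \<mu> \<mu>') \<and>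
           norm (Dm x \<mu> y - Dm x' \<mu>' y') \<le> K * (norm (x - x') + W2 \<mu> \<mu>' + norm (y - y'))) \<and>
        (\<forall>x. \<forall>\<mu>\<in>P2. \<forall>y. norm (fderiv (\<lambda>x. p x \<mu>) x) \<le> L_p \<and> norm (Dm x \<mu> y) \<le> L_p)) \<and>
     (\<forall>x. \<forall>\<mu>\<in>P2. norm (p x \<mu>) \<le> Lbar_p * (1 + norm x + moment1 \<mu>))"

section \<open>Constants\<close>

context
  fixes d :: nat and lam_f Lam_f lam_g Lam_g lam_k Lam_k :: real
begin

definition "lambda_z = lam_f\<^sup>2 / (Lam_g + lam_g / 20)"
definition "lambda_x = 17 / 20 * lam_g"
definition "lambda_k_bar = lam_k / 4"
definition "lambda_z_bar = lambda_z / 2"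
definition "lambda_x_bar = lam_g / 40"
definition "kappa1 = Min {lam_k / 4, lambda_z / 2, lam_g / 40}"
definition "kappa2 = Min {lam_k / 4, lambda_z / 4, lam_g / 5}"

definition "L1_star = Max {4 * Lam_k\<^sup>2 / lam_k,
    1 / lambda_z * (2 * Lam_g + 3 / 20 * lam_g),
    1 / lambda_x * (5 / 2 * Lam_f + 2 * Lam_g + 3 / 20 * lam_g)}"

definition "L4_star = Max {Lam_k\<^sup>2 / (kappa1 * lam_k),
    1 / (4 * kappa1 * lambda_x) * (25 / 16 * Lam_f\<^sup>2 + (2 * Lam_g + lam_g / 5)\<^sup>2)}"

definition "L5_star = Max {9 * Lam_k\<^sup>2 / (4 * kappa2 * lambda_k_bar),
    25 * Lam_f\<^sup>2 / (64 * kappa2 * lambda_z_bar),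
    1 / (4 * kappa2 * lambda_x_bar) * (25 / 16 * Lam_f\<^sup>2 + 9 * (lam_g / 10 + Lam_g)\<^sup>2)}"

definition "L6_star = Max {27 * Lam_k\<^sup>2 / lambda_k_bar,
    (Lam_g + lam_g / 10) / lambda_x_bar,
    (Lam_g + lam_g / 10) / lambda_z_bar,
    12 * Lam_k\<^sup>2 / lam_k,
    (2 * Lam_g + lam_g / 5) / lambda_x,
    6 * Lam_k\<^sup>2 / lambda_k_bar,
    (2 * Lam_g + 3 * lam_g / 20) / lambda_x_bar,
    (15 / 4 * Lam_f + 7 * Lam_g + 13 / 20 * lam_g) / lambda_z_bar}"

definition "L0_star = real d * max L1_star (sqrt ((L4_star * (2 + L5_star) + 1) * L1_star * L6_star))"

text \<open>The constant \<open>max {Lbar_k, L0_star}\<close> with \<open>Lbar_k = 3 Lam_k\<close>.\<close>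

definition "Lbar_p_const = max (3 * Lam_k) L0_star"
definition "k0_const = 4 * Lbar_p_const"

end

definition L_f_const :: "real \<Rightarrow> (real^'n \<Rightarrow> (real^'n) measure \<Rightarrow> real^'k \<Rightarrow> real^'n) \<Rightarrow> real" where
  "L_f_const Lam_f f = max Lam_f (norm (f 0 dirac0 0))"

definition L_g_const :: "real \<Rightarrow> real \<Rightarrow> (real^'n \<Rightarrow> (real^'n) measure \<Rightarrow> real^'k \<Rightarrow> real) \<Rightarrow>
    (real^'n \<Rightarrow> (real^'n) measure \<Rightarrow> real^'k \<Rightarrow> real^'n \<Rightarrow> real) \<Rightarrow> real" where
  "L_g_const Lam_g lb_g g dg = Max {norm (D_mu dg 0 dirac0 0 0), norm (D_x g 0 dirac0 0),
     norm (D_a g 0 dirac0 0), Lam_g, lb_g}"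

definition L_alpha_const :: "real \<Rightarrow> real \<Rightarrow> real \<Rightarrow> real \<Rightarrow> real \<Rightarrow>
    (real^'n \<Rightarrow> (real^'n) measure \<Rightarrow> real^'n \<Rightarrow> real^'k) \<Rightarrow> real" where
  "L_alpha_const Lam_f lb_f lam_g lb_g k0 \<alpha> = Max {20 * Lam_f / (19 * lam_g),
     20 * (lb_g + k0 * lb_f / 2) / (19 * lam_g), norm (\<alpha> 0 dirac0 0)}"

section \<open>Optimal control and the forward-backward system\<close>

text \<open>A selection of minimisers on the whole space. Minimisers always exist (\<open>f\<close> has linear growth
  in the control, \<open>g\<close> is strongly convex in it), but may fail to be unique for large \<open>z\<close>.\<close>

definition optimal_control ::
  "(real^'n \<Rightarrow> (real^'n) measure \<Rightarrow> real^'k \<Rightarrow> real^'n) \<Rightarrow>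
   (real^'n \<Rightarrow> (real^'n) measure \<Rightarrow> real^'k \<Rightarrow> real) \<Rightarrow>
   (real^'n \<Rightarrow> (real^'n) measure \<Rightarrow> real^'n \<Rightarrow> real^'k) \<Rightarrow> bool" where
  "optimal_control f g \<alpha> \<longleftrightarrow> (\<forall>x. \<forall>\<mu>\<in>P2. \<forall>z.
     (\<forall>a. f x \<mu> (\<alpha> x \<mu> z) \<bullet> z + g x \<mu> (\<alpha> x \<mu> z) \<le> f x \<mu> a \<bullet> z + g x \<mu> a) \<and>
     contr (D_a f x \<mu> (\<alpha> x \<mu> z)) z + grad (D_a g x \<mu> (\<alpha> x \<mu> z)) = 0)"

context
  fixes f :: "real^'n \<Rightarrow> (real^'n) measure \<Rightarrow> real^'k \<Rightarrow> real^'n"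
    and df :: "real^'n \<Rightarrow> (real^'n) measure \<Rightarrow> real^'k \<Rightarrow> real^'n \<Rightarrow> real^'n"
    and g :: "real^'n \<Rightarrow> (real^'n) measure \<Rightarrow> real^'k \<Rightarrow> real"
    and dg :: "real^'n \<Rightarrow> (real^'n) measure \<Rightarrow> real^'k \<Rightarrow> real^'n \<Rightarrow> real"
    and \<alpha> :: "real^'n \<Rightarrow> (real^'n) measure \<Rightarrow> real^'n \<Rightarrow> real^'k"
begin

definition control ::
  "(real^'n \<Rightarrow> real^'n) \<Rightarrow> (real^'n \<Rightarrow> real^'n) \<Rightarrow> (real^'n) measure \<Rightarrow> real^'n \<Rightarrow> real^'k" where
  "control X Z m x = \<alpha> (X x) (distr m borel X) (Z x)"

definition Phi_integrand ::
  "(real^'n \<Rightarrow> real^'n) \<Rightarrow> (real^'n \<Rightarrow> real^'n) \<Rightarrow> (real^'n) measure \<Rightarrow> real^'n \<Rightarrow> real^'n \<Rightarrow> real^'n" where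
  "Phi_integrand X Z m x y =
     contr (D_mu df (X y) (distr m borel X) (control X Z m y) (X x)) (Z y) +
     grad (D_mu dg (X y) (distr m borel X) (control X Z m y) (X x))"

definition Phi ::
  "(real^'n \<Rightarrow> real^'n) \<Rightarrow> (real^'n \<Rightarrow> real^'n) \<Rightarrow> (real^'n) measure \<Rightarrow> real^'n \<Rightarrow> real^'n" where
  "Phi X Z m x =
     contr (D_x f (X x) (distr m borel X) (control X Z m x)) (Z x) +
     grad (D_x g (X x) (distr m borel X) (control X Z m x)) +
     (\<integral>y. Phi_integrand X Z m x y \<partial>m)"

text \<open>\<open>X s x\<close> and \<open>Z s x\<close> stand for \<open>X\<^sub>s(x)\<close> and \<open>Z\<^sub>s(x)\<close>. The first conjunct makes the
  push-forward \<open>X\<^sub>s # m\<close> an element of \<^const>\<open>P2\<close> and the integral in \<^const>\<open>Phi\<close> meaningful; no bound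
  uniform in \<open>s\<close> or \<open>x\<close> is imposed.\<close>

definition fbode_solution ::
  "(real^'n \<Rightarrow> (real^'n) measure \<Rightarrow> real^'n) \<Rightarrow> real \<Rightarrow> real \<Rightarrow> (real^'n) measure \<Rightarrow>
   (real \<Rightarrow> real^'n \<Rightarrow> real^'n) \<Rightarrow> (real \<Rightarrow> real^'n \<Rightarrow> real^'n) \<Rightarrow> bool" where
  "fbode_solution p t T' m X Z \<longleftrightarrow>
     (\<forall>s\<in>{t..T'}. X s \<in> borel_measurable borel \<and> distr m borel (X s) \<in> P2 \<and>
        integrable m (Z s) \<and> (\<forall>x. integrable m (Phi_integrand (X s) (Z s) m x))) \<and>
     (\<forall>x. \<forall>s\<in>{t..T'}.
        ((\<lambda>r. X r x) has_vector_derivative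
           f (X s x) (distr m borel (X s)) (\<alpha> (X s x) (distr m borel (X s)) (Z s x)))
          (at s within {t..T'}) \<and>
        ((\<lambda>r. Z r x) has_vector_derivative - Phi (X s) (Z s) m x) (at s within {t..T'})) \<and>
     (\<forall>x. X t x = x) \<and>
     (\<forall>x. Z T' x = p (X T' x) (distr m borel (X T')))"

end

definition C1_in_time :: "real \<Rightarrow> real \<Rightarrow> (real \<Rightarrow> real^'n \<Rightarrow> real^'n) \<Rightarrow> bool" where
  "C1_in_time t T' Y \<longleftrightarrow> (\<forall>x. \<exists>Y'. continuous_on {t..T'} Y' \<and>
     (\<forall>s\<in>{t..T'}. ((\<lambda>r. Y r x) has_vector_derivative Y' s) (at s within {t..T'})))"

end

theory Submission
  imports Defs
begin

text \<open>A solution pair need not satisfy any growth bound in \<open>x\<close>, and the optimal control is only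
  well behaved on the cone \<open>c_k0\<close>, so the core of the argument is an a priori estimate. The quantity
  \<open>U(s) = \<integral>|X_s| + |Z_s| dm\<close> is finite and lower semicontinuous in time; a Baire argument makes it
  bounded, and on a short horizon Gronwall-type estimates turn this into linear growth of \<open>X_s\<close> and
  \<open>Z_s\<close> with the constant of the terminal data, so that both solutions stay in the cone. There the
  first-order condition and the strong convexity in the control make \<open>\<alpha>\<close> Lipschitz at the scale of
  the weight \<open>1 + |x| + \<parallel>\<mu>\<parallel>\<^sub>1\<close>, and the decay of the second derivatives of \<open>f\<close> compensates the growth
  of \<open>Z\<close>. Lipschitz bounds in the measure are obtained in \<open>W\<^sub>1\<close>: for L-derivatives by displacement
  interpolation of finitely valued maps, for the derivatives of \<open>\<delta>/\<delta>\<mu>\<close> from second differences and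
  Kantorovich duality. Two solutions then differ by a contraction in the weighted sup norm.\<close>

section \<open>Mixtures, couplings and transport costs\<close>

text \<open>The second derivatives of \<open>f\<close> carry the factor
  \<open>1 / (1 + norm x + moment1 \<mu>)\<close>, while \<open>Z\<close> is bounded only by a
  multiple of that weight. Every Lipschitz estimate must therefore keep the weight of an endpoint,
  uniformly along the path joining the two arguments. If the endpoints are closer than a quarter of
  the weight, the path stays where at least half of the weight is left; otherwise the sup bounds on
  the first derivatives are already small enough relative to the displacement. Paths of measures are
  constrained further. An L-derivative is asserted at a single random vector for each law, so an
  interpolation has to be rebuilt on top of that vector. For finitely many values this is possible
  because [0,1] can be cut into events of prescribed probability; general couplings follow by
  approximation. As to the time direction, paths are continuous for each \<open>x\<close> separately
  and without a common integrable majorant, so nothing prevents the means from blowing up between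
  two times at which they are finite. Only lower semicontinuity survives, and this is what brings in
  Baire's theorem.\<close>

lemma P2_prob_space: "\<mu> \<in> P2 \<Longrightarrow> prob_space \<mu>"
  and sets_P2: "\<mu> \<in> P2 \<Longrightarrow> sets \<mu> = sets borel"
  and integrable_P2_square: "\<mu> \<in> P2 \<Longrightarrow> integrable \<mu> (\<lambda>x. (norm x)\<^sup>2)"
  by (auto simp: P2_def)

lemma measurable_P2: "\<mu> \<in> P2 \<Longrightarrow> \<phi> \<in> measurable borel N \<Longrightarrow> \<phi> \<in> measurable \<mu> N"
  by (simp add: sets_P2 cong: measurable_cong_sets)

lemma space_P2: "\<mu> \<in> P2 \<Longrightarrow> space \<mu> = UNIV"
  using sets_eq_imp_space_eq[OF sets_P2] by simp

lemma le_one_plus_square: "r \<le> 1 + r\<^sup>2" for r :: real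
proof -
  have "0 \<le> (r - 1/2)\<^sup>2" by simp
  then show ?thesis by (simp add: power2_eq_square algebra_simps)
qed

lemma integrable_P2_norm: 
  assumes "\<mu> \<in> P2" shows "integrable \<mu> norm"
proof -
  interpret prob_space \<mu> using assms by (rule P2_prob_space)
  have [measurable_cong]: "sets \<mu> = sets borel" using assms by (rule sets_P2)
  have "integrable \<mu> (\<lambda>x. 1 + (norm x)\<^sup>2)" using integrable_P2_square[OF assms] by simp
  then show ?thesis
    by (rule Bochner_Integration.integrable_bound)
      (auto intro!: measurable_P2[OF assms] simp: le_one_plus_square)
qed

lemma integrable_P2_growth:
  fixes \<phi> :: "real^'n \<Rightarrow> 'v::{banach, second_countable_topology}"
  assumes "\<mu> \<in> P2" and [measurable]: "\<phi> \<in> borel_measurable borel"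
    and "\<And>x. norm (\<phi> x) \<le> a + b * norm x + c * (norm x)\<^sup>2"
  shows "integrable \<mu> \<phi>"
proof -
  interpret prob_space \<mu> using assms by (intro P2_prob_space)
  have [measurable_cong]: "sets \<mu> = sets borel" using assms by (intro sets_P2)
  have "integrable \<mu> (\<lambda>x. a + b * norm x + c * (norm x)\<^sup>2)"
    using integrable_P2_square[OF assms(1)] integrable_P2_norm[OF assms(1)] by simp
  then show ?thesis
    by (rule Bochner_Integration.integrable_bound)
      (use assms in \<open>auto intro: measurable_P2[OF assms(1)] order_trans[OF _ abs_ge_self]\<close>)
qed

lemma continuous_on_if_lipschitz:
  fixes \<phi> :: "'a::metric_space \<Rightarrow> 'b::metric_space"
  assumes "\<And>x y. dist (\<phi> x) (\<phi> y) \<le> K * dist x y"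
  shows "continuous_on S \<phi>"
proof -
  have "dist (\<phi> x) (\<phi> y) \<le> max K 0 * dist x y" for x y
    using assms[of x y] by (smt (verit, best) max.cobounded1 mult_right_mono zero_le_dist)
  then have "(max K 0)-lipschitz_on S \<phi>" by (intro lipschitz_onI) auto
  then show ?thesis by (rule lipschitz_on_continuous_on)
qed

lemma integrable_P2_lipschitz:
  fixes \<phi> :: "real^'n \<Rightarrow> real"
  assumes "\<mu> \<in> P2" and "\<And>x y. \<bar>\<phi> x - \<phi> y\<bar> \<le> K * norm (x - y)"
  shows "integrable \<mu> \<phi>"
proof (rule integrable_P2_growth[OF assms(1), where a = "\<bar>\<phi> 0\<bar>" and b = K and c = 0])
  show "\<phi> \<in> borel_measurable borel"
    using continuous_on_if_lipschitz[of \<phi> K UNIV] assms(2)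
    by (auto simp: dist_norm intro: borel_measurable_continuous_onI)
  show "norm (\<phi> x) \<le> \<bar>\<phi> 0\<bar> + K * norm x + 0 * (norm x)\<^sup>2" for x
    using assms(2)[of x 0] by auto
qed

lemma dirac_P2: "return borel y \<in> P2"
  by (auto simp: P2_def prob_space_return integrable_iff_bounded nn_integral_return)

lemma moment1_nonneg: "0 \<le> moment1 \<mu>"
  by (simp add: moment1_def)

lemma moment1_dirac: "moment1 (return borel y) = norm y"
  by (simp add: moment1_def integral_return)

lemma distr_P2:
  assumes "prob_space M" and [measurable]: "X \<in> borel_measurable M" 
  shows "distr M borel X \<in> P2 \<longleftrightarrow> integrable M (\<lambda>u. (norm (X u))\<^sup>2)"
  using assms by (auto simp: P2_def prob_space.prob_space_distr integrable_distr_eq)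

lemma distr_P2_integrable:
  fixes X :: "'a \<Rightarrow> real^'n"
  assumes "prob_space M" and [measurable]: "X \<in> borel_measurable M" and "distr M borel X \<in> P2"
  shows "integrable M X"
  using integrable_P2_norm[OF assms(3)] by (subst (asm) integrable_distr_eq) (auto simp: integrable_norm_iff)

lemma moment1_distr:
  assumes [measurable]: "X \<in> borel_measurable M" 
  shows "moment1 (distr M borel X) = (\<integral>u. norm (X u) \<partial>M)"
  by (simp add: moment1_def integral_distr)

subsection \<open>Mixtures\<close>

lemma sets_mix [simp, measurable_cong]: "sets (mix \<theta> \<nu>1 \<nu>2) = sets borel"
  using sets.sigma_sets_eq[of borel] by (simp add: mix_def)

lemma space_mix [simp]: "space (mix \<theta> \<nu>1 \<nu>2) = UNIV"
  using sets_eq_imp_space_eq[OF sets_mix] by simp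

lemma emeasure_mix:
  assumes "sets \<nu>1 = sets borel" "sets \<nu>2 = sets borel" "A \<in> sets borel"
  shows "emeasure (mix \<theta> \<nu>1 \<nu>2) A = ennreal \<theta> * emeasure \<nu>1 A + ennreal (1 - \<theta>) * emeasure \<nu>2 A"
  unfolding mix_def
proof (rule emeasure_measure_of_sigma)
  show "sigma_algebra UNIV (sets borel)" using sets.sigma_algebra_axioms[of borel] by simp
  show "positive (sets borel) (\<lambda>A. ennreal \<theta> * emeasure \<nu>1 A + ennreal (1 - \<theta>) * emeasure \<nu>2 A)"
    by (simp add: positive_def)
  show "countably_additive (sets borel) (\<lambda>A. ennreal \<theta> * emeasure \<nu>1 A + ennreal (1 - \<theta>) * emeasure \<nu>2 A)"
    using assms by (auto simp: countably_additive_def suminf_emeasure subset_eq simp flip: suminf_add)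
qed fact

text \<open>\<open>mix\<close> is given by its values on sets, so integrals are reached by induction
  over measurable functions.\<close>

lemma nn_integral_mix:
  assumes s: "sets \<nu>1 = sets borel" "sets \<nu>2 = sets borel" and "\<phi> \<in> borel_measurable borel"
  shows "(\<integral>\<^sup>+x. \<phi> x \<partial>mix \<theta> \<nu>1 \<nu>2) = ennreal \<theta> * (\<integral>\<^sup>+x. \<phi> x \<partial>\<nu>1) + ennreal (1 - \<theta>) * (\<integral>\<^sup>+x. \<phi> x \<partial>\<nu>2)"
  using assms(3)
proof (induction rule: borel_measurable_induct)
  case (cong f g)
  then show ?case by (simp add: ext[of f g])
next
  case (set A)
  then show ?case using s by (simp add: emeasure_mix)
next
  case (mult u c)
  then have [measurable]: "u \<in> borel_measurable \<nu>1" "u \<in> borel_measurable \<nu>2" using s by (auto cong: measurable_cong_sets)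
  have "(\<integral>\<^sup>+x. c * u x \<partial>\<nu>) = c * (\<integral>\<^sup>+x. u x \<partial>\<nu>)" if "sets \<nu> = sets borel" for \<nu>
    using that mult(2) by (intro nn_integral_cmult) (simp cong: measurable_cong_sets)
  then show ?case using mult s by (simp add: distrib_left mult_ac)
next
  case (add u v)
  have *: "(\<integral>\<^sup>+x. v x + u x \<partial>\<nu>) = (\<integral>\<^sup>+x. v x \<partial>\<nu>) + (\<integral>\<^sup>+x. u x \<partial>\<nu>)" if "sets \<nu> = sets borel" for \<nu>
    using that add by (intro nn_integral_add) (simp_all cong: measurable_cong_sets)
  have "(\<integral>\<^sup>+x. v x + u x \<partial>mix \<theta> \<nu>1 \<nu>2) =
    (ennreal \<theta> * integral\<^sup>N \<nu>1 v + ennreal (1 - \<theta>) * integral\<^sup>N \<nu>2 v) +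
    (ennreal \<theta> * integral\<^sup>N \<nu>1 u + ennreal (1 - \<theta>) * integral\<^sup>N \<nu>2 u)"
    by (simp only: * sets_mix add.IH)
  also have "\<dots> = ennreal \<theta> * (integral\<^sup>N \<nu>1 v + integral\<^sup>N \<nu>1 u) +
    ennreal (1 - \<theta>) * (integral\<^sup>N \<nu>2 v + integral\<^sup>N \<nu>2 u)"
    by (simp add: distrib_left ac_simps)
  finally show ?case by (simp only: * s)
next
  case (seq U)
  have inc: "incseq (\<lambda>i. integral\<^sup>N \<nu> (U i))" for \<nu>
    using \<open>incseq U\<close> by (auto simp: incseq_def le_fun_def intro!: nn_integral_mono)
  have SUP: "(\<integral>\<^sup>+x. (SUP i. U i x) \<partial>\<nu>) = (SUP i. integral\<^sup>N \<nu> (U i))" if "sets \<nu> = sets borel" for \<nu>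
    using that seq(1) by (intro nn_integral_monotone_convergence_SUP[OF \<open>incseq U\<close>]) (simp cong: measurable_cong_sets)
  have "(\<integral>\<^sup>+x. (SUP i. U i x) \<partial>mix \<theta> \<nu>1 \<nu>2) =
    (SUP i. ennreal \<theta> * integral\<^sup>N \<nu>1 (U i) + ennreal (1 - \<theta>) * integral\<^sup>N \<nu>2 (U i))"
    by (simp only: SUP sets_mix seq.IH)
  also have "\<dots> = (SUP i. ennreal \<theta> * integral\<^sup>N \<nu>1 (U i)) + (SUP i. ennreal (1 - \<theta>) * integral\<^sup>N \<nu>2 (U i))"
    using inc by (intro ennreal_SUP_add) (auto simp: incseq_def intro!: mult_left_mono)
  also have "\<dots> = ennreal \<theta> * (\<integral>\<^sup>+x. (SUP i. U i x) \<partial>\<nu>1) + ennreal (1 - \<theta>) * (\<integral>\<^sup>+x. (SUP i. U i x) \<partial>\<nu>2)"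
    by (simp only: SUP s SUP_mult_left_ennreal)
  finally show ?case by (simp only: SUP_apply)
qed

lemma prob_space_mix:
  assumes "prob_space \<nu>1" "prob_space \<nu>2" "sets \<nu>1 = sets borel" "sets \<nu>2 = sets borel" "0 \<le> \<theta>" "\<theta> \<le> 1"
  shows "prob_space (mix \<theta> \<nu>1 \<nu>2)"
proof
  have "space \<nu>1 = UNIV" "space \<nu>2 = UNIV" using assms(3,4)[THEN sets_eq_imp_space_eq] by auto
  then have "emeasure \<nu>1 UNIV = 1" "emeasure \<nu>2 UNIV = 1"
    using prob_space.emeasure_space_1[OF assms(1)] prob_space.emeasure_space_1[OF assms(2)] by auto
  then show "emeasure (mix \<theta> \<nu>1 \<nu>2) (space (mix \<theta> \<nu>1 \<nu>2)) = 1"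
    using assms by (simp add: emeasure_mix flip: ennreal_plus)
qed

lemma
  fixes \<phi> :: "real^'n \<Rightarrow> real"
  assumes s: "sets \<nu>1 = sets borel" "sets \<nu>2 = sets borel" and \<theta>: "0 \<le> \<theta>" "\<theta> \<le> 1"
    and i: "integrable \<nu>1 \<phi>" "integrable \<nu>2 \<phi>"
  shows integrable_mix: "integrable (mix \<theta> \<nu>1 \<nu>2) \<phi>"
    and integral_mix: "(\<integral>x. \<phi> x \<partial>mix \<theta> \<nu>1 \<nu>2) = \<theta> * (\<integral>x. \<phi> x \<partial>\<nu>1) + (1 - \<theta>) * (\<integral>x. \<phi> x \<partial>\<nu>2)"
proof -
  have [measurable]: "\<phi> \<in> borel_measurable borel"
    using borel_measurable_integrable[OF i(1)] s(1) by (auto cong: measurable_cong_sets)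
  have fin: "(\<integral>\<^sup>+x. ennreal (\<phi> x) \<partial>\<nu>) < \<infinity>" "(\<integral>\<^sup>+x. ennreal (- \<phi> x) \<partial>\<nu>) < \<infinity>" if "integrable \<nu> \<phi>" for \<nu>
    using that by (auto simp: real_integrable_def top.not_eq_extremum)
  show *: "integrable (mix \<theta> \<nu>1 \<nu>2) \<phi>"
    using fin[OF i(1)] fin[OF i(2)]
    by (auto simp: real_integrable_def nn_integral_mix[OF s] ennreal_mult_eq_top_iff cong: measurable_cong_sets)
  have e: "enn2real (ennreal \<theta> * a + ennreal (1 - \<theta>) * b) = \<theta> * enn2real a + (1 - \<theta>) * enn2real b"
    if "a < \<infinity>" "b < \<infinity>" for a b
    using that \<theta> by (cases a; cases b) (auto simp flip: ennreal_mult ennreal_plus)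
  show "(\<integral>x. \<phi> x \<partial>mix \<theta> \<nu>1 \<nu>2) = \<theta> * (\<integral>x. \<phi> x \<partial>\<nu>1) + (1 - \<theta>) * (\<integral>x. \<phi> x \<partial>\<nu>2)"
    using fin[OF i(1)] fin[OF i(2)]
    by (simp add: real_lebesgue_integral_def * i nn_integral_mix[OF s] e algebra_simps)
qed

lemma mix_P2:
  assumes "\<nu>1 \<in> P2" "\<nu>2 \<in> P2" "0 \<le> \<theta>" "\<theta> \<le> 1"
  shows "mix \<theta> \<nu>1 \<nu>2 \<in> P2"
  using assms by (auto simp: P2_def intro!: prob_space_mix integrable_mix)

lemma integral_mix_P2:
  fixes \<phi> :: "real^'n \<Rightarrow> real"
  assumes "\<nu>1 \<in> P2" "\<nu>2 \<in> P2" "0 \<le> \<theta>" "\<theta> \<le> 1" "\<And>\<nu>. \<nu> \<in> P2 \<Longrightarrow> integrable \<nu> \<phi>"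
  shows "(\<integral>x. \<phi> x \<partial>mix \<theta> \<nu>1 \<nu>2) = \<theta> * (\<integral>x. \<phi> x \<partial>\<nu>1) + (1 - \<theta>) * (\<integral>x. \<phi> x \<partial>\<nu>2)"
  using assms by (intro integral_mix) (auto simp: sets_P2)

lemma moment1_mix:
  assumes "\<nu>1 \<in> P2" "\<nu>2 \<in> P2" "0 \<le> \<theta>" "\<theta> \<le> 1"
  shows "moment1 (mix \<theta> \<nu>1 \<nu>2) = \<theta> * moment1 \<nu>1 + (1 - \<theta>) * moment1 \<nu>2"
  unfolding moment1_def using assms by (intro integral_mix_P2) (auto simp: integrable_P2_norm)

subsection \<open>Transport costs\<close>

text \<open>An upper bound certified by a coupling replaces an infimum: no optimal coupling has to
  exist, and for two maps on one probability space the joint law is the certificate. Cost of order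
  one matches the \<open>moment1\<close> in the weights.\<close>

definition W1_le :: "(real^'n) measure \<Rightarrow> (real^'n) measure \<Rightarrow> real \<Rightarrow> bool" where
  "W1_le \<mu> \<nu> c \<longleftrightarrow> (\<exists>\<pi>\<in>couplings \<mu> \<nu>. (\<integral>z. norm (fst z - snd z) \<partial>\<pi>) \<le> c)"

text \<open>The Kantorovich dual of \<^const>\<open>W1_le\<close>, which is linear in \<open>\<nu>\<^sub>1 - \<nu>\<^sub>2\<close>.\<close>

definition kant_le :: "(real^'n) measure \<Rightarrow> (real^'n) measure \<Rightarrow> real \<Rightarrow> bool" where
  "kant_le \<nu>1 \<nu>2 c \<longleftrightarrow> 0 \<le> c \<and> (\<forall>\<phi> K. 0 \<le> K \<longrightarrow> (\<forall>x y. \<bar>\<phi> x - \<phi> y\<bar> \<le> K * norm (x - y)) \<longrightarrow>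
     \<bar>int_diff \<nu>1 \<nu>2 \<phi>\<bar> \<le> K * c)"

lemma kant_leD:
  "kant_le \<nu>1 \<nu>2 c \<Longrightarrow> 0 \<le> K \<Longrightarrow> (\<And>x y. \<bar>\<phi> x - \<phi> y\<bar> \<le> K * norm (x - y)) \<Longrightarrow> \<bar>int_diff \<nu>1 \<nu>2 \<phi>\<bar> \<le> K * c"
  by (auto simp: kant_le_def)

lemma kant_le_mono: "kant_le \<nu>1 \<nu>2 c \<Longrightarrow> c \<le> d \<Longrightarrow> kant_le \<nu>1 \<nu>2 d"
  unfolding kant_le_def by (meson mult_left_mono order_trans)

lemma borel_measurable_fst_snd [measurable]:
  "(fst :: 'a::second_countable_topology \<times> 'b::second_countable_topology \<Rightarrow> 'a) \<in> borel_measurable borel"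
  "(snd :: 'a \<times> 'b \<Rightarrow> 'b) \<in> borel_measurable borel"
  by (auto intro!: borel_measurable_continuous_onI continuous_intros)

lemma couplings_distr:
  fixes X Y :: "'a \<Rightarrow> real^'n"
  assumes "prob_space M" and [measurable]: "X \<in> borel_measurable M" "Y \<in> borel_measurable M"
  shows "distr M borel (\<lambda>u. (X u, Y u)) \<in> couplings (distr M borel X) (distr M borel Y)"
  using assms by (auto simp: couplings_def distr_distr comp_def intro!: prob_space.prob_space_distr)

lemma W1_le_distr:
  fixes X Y :: "'a \<Rightarrow> real^'n"
  assumes "prob_space M" and [measurable]: "X \<in> borel_measurable M" "Y \<in> borel_measurable M"
  shows "W1_le (distr M borel X) (distr M borel Y) (\<integral>u. norm (X u - Y u) \<partial>M)"
  unfolding W1_le_def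
  by (intro bexI[OF _ couplings_distr[OF assms]]) (simp add: integral_distr)

lemma coupling_facts:
  assumes "\<pi> \<in> couplings \<mu> \<nu>" "\<mu> \<in> P2" "\<nu> \<in> P2"
  shows "prob_space \<pi>" "sets \<pi> = sets borel" "fst \<in> borel_measurable \<pi>" "snd \<in> borel_measurable \<pi>"
    "distr \<pi> borel fst = \<mu>" "distr \<pi> borel snd = \<nu>"
    "integrable \<pi> fst" "integrable \<pi> snd" "integrable \<pi> (\<lambda>z. norm (fst z - snd z))"
proof -
  show *: "prob_space \<pi>" "sets \<pi> = sets borel" "distr \<pi> borel fst = \<mu>" "distr \<pi> borel snd = \<nu>"
    using assms by (auto simp: couplings_def)
  then show [measurable]: "fst \<in> borel_measurable \<pi>" "snd \<in> borel_measurable \<pi>"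
    by (auto simp: borel_measurable_fst_snd cong: measurable_cong_sets)
  show "integrable \<pi> fst" "integrable \<pi> snd"
    using * assms by (auto intro!: distr_P2_integrable)
  then show "integrable \<pi> (\<lambda>z. norm (fst z - snd z))" by auto
qed

lemma int_diff_coupling:
  fixes \<phi> :: "real^'n \<Rightarrow> real"
  assumes "\<pi> \<in> couplings \<mu> \<nu>" "\<mu> \<in> P2" "\<nu> \<in> P2" "integrable \<mu> \<phi>" "integrable \<nu> \<phi>"
  shows "integrable \<pi> (\<lambda>z. \<phi> (fst z) - \<phi> (snd z))"
    "int_diff \<mu> \<nu> \<phi> = (\<integral>z. \<phi> (fst z) - \<phi> (snd z) \<partial>\<pi>)"
proof -
  note c = coupling_facts[OF assms(1-3)]
  note [measurable] = c(3,4)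
  have [measurable]: "\<phi> \<in> borel_measurable borel"
    using borel_measurable_integrable[OF assms(4)] sets_P2[OF assms(2)] by (auto cong: measurable_cong_sets)
  have "integrable \<pi> (\<lambda>z. \<phi> (fst z))" "integrable \<pi> (\<lambda>z. \<phi> (snd z))"
    using assms(4,5) unfolding c(5,6)[symmetric] by (simp_all add: integrable_distr_eq)
  then show "integrable \<pi> (\<lambda>z. \<phi> (fst z) - \<phi> (snd z))"
    "int_diff \<mu> \<nu> \<phi> = (\<integral>z. \<phi> (fst z) - \<phi> (snd z) \<partial>\<pi>)"
    unfolding int_diff_def c(5,6)[symmetric] by (simp_all add: integral_distr)
qed

text \<open>The easy half of Kantorovich duality: the test function is integrated along the coupling
  that certifies \<open>W1_le\<close>.\<close>

lemma kant_le_if_W1_le: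
  assumes "W1_le \<mu> \<nu> c" "\<mu> \<in> P2" "\<nu> \<in> P2"
  shows "kant_le \<mu> \<nu> c"
proof -
  obtain \<pi> where \<pi>: "\<pi> \<in> couplings \<mu> \<nu>" and c: "(\<integral>z. norm (fst z - snd z) \<partial>\<pi>) \<le> c"
    using assms(1) unfolding W1_le_def by blast
  have "0 \<le> c" using c by (rule order_trans[rotated]) simp
  moreover have "\<bar>int_diff \<mu> \<nu> \<phi>\<bar> \<le> K * c" if K: "0 \<le> K" "\<forall>x y. \<bar>\<phi> x - \<phi> y\<bar> \<le> K * norm (x - y)" for \<phi> K
  proof -
    have i: "integrable \<mu> \<phi>" "integrable \<nu> \<phi>" using K assms by (auto intro!: integrable_P2_lipschitz)
    have "\<bar>int_diff \<mu> \<nu> \<phi>\<bar> \<le> (\<integral>z. K * norm (fst z - snd z) \<partial>\<pi>)"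
      unfolding int_diff_coupling(2)[OF \<pi> assms(2,3) i] real_norm_def[symmetric]
      by (intro Bochner_Integration.integral_norm_bound_integral int_diff_coupling(1)[OF \<pi> assms(2,3) i] integrable_mult_right
            coupling_facts(9)[OF \<pi> assms(2,3)]) (use K in auto)
    also have "\<dots> \<le> K * c" using c K by (simp add: mult_left_mono)
    finally show ?thesis .
  qed
  ultimately show ?thesis by (auto simp: kant_le_def)
qed

lemma moment1_kant_le: 
  assumes "kant_le \<mu> \<nu> c" shows "\<bar>moment1 \<mu> - moment1 \<nu>\<bar> \<le> c"
  using kant_leD[OF assms, of 1 norm] by (simp add: int_diff_def moment1_def norm_triangle_ineq3)

lemma W1_le_dirac:
  assumes "\<mu> \<in> P2" shows "W1_le \<mu> (return borel y) (\<integral>x. norm (x - y) \<partial>\<mu>)"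
proof -
  note [measurable_cong] = sets_P2[OF assms]
  have "distr \<mu> borel (\<lambda>x. x) = \<mu>" using assms by (intro distr_id2) (simp add: sets_P2)
  moreover have "distr \<mu> borel (\<lambda>x. y) = return borel y"
    using P2_prob_space[OF assms] by (intro prob_space.distr_const) simp_all
  ultimately show ?thesis using W1_le_distr[OF P2_prob_space[OF assms], of "\<lambda>x. x" "\<lambda>x. y"]
    by (simp add: measurable_P2[OF assms])
qed

lemma W1_le_dirac0: "\<mu> \<in> P2 \<Longrightarrow> W1_le \<mu> dirac0 (moment1 \<mu>)"
  using W1_le_dirac[of \<mu> 0] by (simp add: moment1_def)

text \<open>Joint continuity is phrased with \<open>W2\<close>, so freezing the measure requires
  that its distance to itself vanishes. The diagonal coupling has cost 0, and the infimum is
  nonnegative.\<close>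

lemma W2_self [simp]:
  assumes "\<mu> \<in> P2" shows "W2 \<mu> \<mu> = 0"
proof -
  note [measurable_cong] = sets_P2[OF assms]
  have "distr \<mu> borel (\<lambda>x. x) = \<mu>" using assms by (intro distr_id2) (simp add: sets_P2)
  then have c: "distr \<mu> borel (\<lambda>x. (x, x)) \<in> couplings \<mu> \<mu>"
    using couplings_distr[OF P2_prob_space[OF assms], of "\<lambda>x. x" "\<lambda>x. x"] by (simp add: measurable_P2[OF assms])
  have "(INF \<pi>\<in>couplings \<mu> \<mu>. \<integral>(x, y). (norm (x - y))\<^sup>2 \<partial>\<pi>) \<le> (\<integral>(x, y). (norm (x - y))\<^sup>2 \<partial>distr \<mu> borel (\<lambda>x. (x, x)))"
    by (intro cINF_lower c bdd_belowI[of _ 0]) (auto simp: case_prod_beta)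
  also have "\<dots> = 0" unfolding case_prod_beta by (subst integral_distr) (simp_all add: measurable_P2[OF assms])
  moreover have "(INF \<pi>\<in>couplings \<mu> \<mu>. \<integral>(x, y). (norm (x - y))\<^sup>2 \<partial>\<pi>) \<ge> 0"
    by (intro cINF_greatest) (use c in \<open>auto simp: case_prod_beta\<close>)
  ultimately show ?thesis by (simp add: W2_def)
qed

lemma jointly_continuous_at:
  assumes "jointly_continuous D" "\<mu> \<in> P2"
  shows "continuous_on UNIV (D \<mu>)"
proof (rule continuous_on_iff[THEN iffD2], intro ballI allI impI)
  fix x and e :: real assume "0 < e"
  then obtain \<delta> where "\<delta> > 0" "\<forall>\<mu>'\<in>P2. \<forall>e'. W2 \<mu> \<mu>' < \<delta> \<and> dist x e' < \<delta> \<longrightarrow> dist (D \<mu> x) (D \<mu>' e') < e"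
    using assms unfolding jointly_continuous_def by blast
  then have "\<forall>x'\<in>UNIV. dist x' x < \<delta> \<longrightarrow> dist (D \<mu> x') (D \<mu> x) < e"
    using assms(2) by (metis dist_commute W2_self)
  with \<open>\<delta> > 0\<close> show "\<exists>d>0. \<forall>x'\<in>UNIV. dist x' x < d \<longrightarrow> dist (D \<mu> x') (D \<mu> x) < e" by blast
qed

lemma
  assumes "is_lfd h D" "\<mu> \<in> P2"
  shows is_lfd_continuous: "continuous_on UNIV (D \<mu>)"
    and is_lfd_integrable: "\<nu> \<in> P2 \<Longrightarrow> integrable \<nu> (D \<mu>)"
proof -
  show c: "continuous_on UNIV (D \<mu>)"
    using assms by (auto simp: is_lfd_def intro: jointly_continuous_at)
  from assms obtain c where "\<And>e. norm (D \<mu> e) \<le> c \<mu> * (1 + (norm e)\<^sup>2)"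
    unfolding is_lfd_def locally_bounded_by_def by blast
  then show "\<nu> \<in> P2 \<Longrightarrow> integrable \<nu> (D \<mu>)"
    by (intro integrable_P2_growth[of _ _ "c \<mu>" 0 "c \<mu>"] borel_measurable_continuous_onI c) (auto simp: algebra_simps)
qed

text \<open>Each derivative along the mixture segment is an admissible Kantorovich test function,
  and the duality bound is integrated over the mixing parameter. Asking for the Lipschitz bound on
  the segment only leaves room for bounds that decay in the measure.\<close>

lemma lfd_lipschitz:
  assumes "is_lfd h D" "\<nu>1 \<in> P2" "\<nu>2 \<in> P2" "kant_le \<nu>1 \<nu>2 c" "0 \<le> L"
    and "\<And>\<theta> y y'. 0 \<le> \<theta> \<Longrightarrow> \<theta> \<le> 1 \<Longrightarrow> \<bar>D (mix \<theta> \<nu>1 \<nu>2) y - D (mix \<theta> \<nu>1 \<nu>2) y'\<bar> \<le> L * norm (y - y')"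
  shows "\<bar>h \<nu>1 - h \<nu>2\<bar> \<le> L * c"
proof -
  have I: "((\<lambda>\<theta>. int_diff \<nu>1 \<nu>2 (D (mix \<theta> \<nu>1 \<nu>2))) has_integral (h \<nu>1 - h \<nu>2)) {0..1}"
    using assms by (auto simp: is_lfd_def)
  have "0 \<le> L * c" using assms by (auto simp: kant_le_def)
  from has_integral_bound_real[OF this finite.emptyI I] show ?thesis
    using kant_leD[OF assms(4,5) assms(6)] by auto
qed

section \<open>Lipschitz estimates from L-derivatives\<close>

text \<open>If \<open>f\<close> is not integrable, its Bochner integral is 0 by convention and the
  bound still holds.\<close>

lemma norm_integral_le:
  fixes f :: "'a \<Rightarrow> 'b::{banach, second_countable_topology}"
  assumes "integrable M g" "\<And>x. norm (f x) \<le> g x"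
  shows "norm (\<integral>x. f x \<partial>M) \<le> (\<integral>x. g x \<partial>M)"
proof -
  have "0 \<le> (\<integral>x. g x \<partial>M)" using assms(2) by (intro Bochner_Integration.integral_nonneg) (use norm_ge_zero order_trans in blast)
  moreover have "(\<integral>x. norm (f x) \<partial>M) \<le> (\<integral>x. g x \<partial>M)" if "integrable M f"
    using that assms by (intro integral_mono) auto
  ultimately show ?thesis
    using integral_norm_bound[of M f]
    by (cases "integrable M f") (linarith, simp add: not_integrable_integral_eq)
qed

section \<open>Events of prescribed probability in the unit interval\<close>

declare measure_uniform_measure [simp del]

lemma sets_Omega: "sets Omega = sets borel" and space_Omega: "space Omega = UNIV"
  by simp_all

lemma prob_space_Omega: "prob_space Omega"
  by (intro prob_space_uniform_measure) auto

lemma measure_Omega: "A \<in> sets borel \<Longrightarrow> measure Omega A = measure lborel ({0..1} \<inter> A)"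
  by (subst measure_uniform_measure) auto

text \<open>Lebesgue measure has no atoms: the mass of \<open>A\<close> below level \<open>s\<close>
  is 1-Lipschitz in \<open>s\<close>, so the intermediate value theorem finds a level that cuts off
  exactly \<open>w\<close>.\<close>

lemma Omega_split:
  assumes A: "A \<in> sets borel" and w: "0 \<le> w" "w \<le> measure Omega A"
  shows "\<exists>B\<in>sets borel. B \<subseteq> A \<and> measure Omega B = w"
proof -
  interpret prob_space Omega by (rule prob_space_Omega)
  define F where "F s = measure Omega (A \<inter> {..s})" for s
  have *: "\<bar>F s - F s'\<bar> \<le> s' - s" if "s \<le> s'" for s s'
  proof -
    have "A \<inter> {..s'} = (A \<inter> {..s}) \<union> (A \<inter> {s<..s'})" using that by auto
    then have "F s' = F s + measure Omega (A \<inter> {s<..s'})"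
      unfolding F_def using A by (simp add: finite_measure_Union disjoint_iff)
    moreover have "measure Omega (A \<inter> {s<..s'}) \<le> measure Omega {s<..s'}"
      using A by (intro finite_measure_mono) auto
    moreover have "\<dots> \<le> s' - s"
    proof -
      have "measure lborel ({0..1} \<inter> {s<..s'}) \<le> measure lborel {s<..s'}"
        using that by (intro measure_mono_fmeasurable fmeasurableI) auto
      then show ?thesis using that by (subst measure_Omega) auto
    qed
    ultimately show ?thesis by (simp add: measure_nonneg)
  qed
  have "dist (F s) (F s') \<le> 1 * dist s s'" for s s'
    using *[of s s'] *[of s' s] by (cases "s \<le> s'") (auto simp: dist_real_def abs_minus_commute)
  then have cont: "continuous_on {-1..1} F" by (rule continuous_on_if_lipschitz)
  \<comment> \<open>All mass sits in [0,1], so level -1 cuts off nothing and level 1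
    everything.\<close>
  have "F (-1) = 0" "F 1 = measure Omega A"
  proof -
    have "{0..1} \<inter> (A \<inter> {..-1}) = {}" "{0..1} \<inter> (A \<inter> {..1}) = {0..1} \<inter> A" by auto
    then show "F (-1) = 0" "F 1 = measure Omega A" using A by (simp_all add: F_def measure_Omega)
  qed
  then obtain s where "F s = w" using IVT'[of F "-1" w 1, OF _ _ _ cont] w by auto
  then show ?thesis using A by (intro bexI[of _ "A \<inter> {..s}"]) (auto simp: F_def)
qed

text \<open>The pieces are cut off one at a time; each next piece is taken from what is
  left.\<close>

lemma Omega_partition:
  assumes "finite J" "A \<in> sets borel" "\<And>j. j \<in> J \<Longrightarrow> 0 \<le> w j" "measure Omega A = sum w J"
  shows "\<exists>B. disjoint_family_on B J \<and> (\<forall>j\<in>J. B j \<in> sets borel \<and> B j \<subseteq> A \<and> measure Omega (B j) = w j)"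
  using assms
proof (induction J arbitrary: A rule: finite_induct)
  case empty
  then show ?case by (auto simp: disjoint_family_on_def)
next
  case (insert i J)
  interpret prob_space Omega by (rule prob_space_Omega)
  have "w i \<le> measure Omega A" using insert by (simp add: sum_nonneg)
  then obtain C where C: "C \<in> sets borel" "C \<subseteq> A" "measure Omega C = w i"
    using Omega_split[of A "w i"] insert by auto
  have "measure Omega (A - C) = sum w J"
    using C insert by (subst finite_measure_Diff) auto
  then obtain B where B: "disjoint_family_on B J"
    "\<forall>j\<in>J. B j \<in> sets borel \<and> B j \<subseteq> A - C \<and> measure Omega (B j) = w j"
    using insert.IH[of "A - C"] insert.prems C by (metis insertI2 sets.Diff)
  show ?case
    using B C insert(2) by (intro exI[of _ "B(i := C)"]) (auto simp: disjoint_family_on_def)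
qed

text \<open>A random variable \<open>\<Xi>\<close> on \<^const>\<open>Omega\<close> with the law of \<open>g(K)\<close>, where \<open>K\<close> takes finitely many
  values, factors through a copy of \<open>K\<close>; \<open>B j\<close> is the event that the copy takes the value \<open>j\<close>.\<close>

lemma Omega_lift:
  fixes \<Xi> :: "real \<Rightarrow> real^'n"
  assumes "finite J" "\<And>j. j \<in> J \<Longrightarrow> 0 \<le> w j" and \<Xi>: "\<Xi> \<in> borel_measurable borel"
    and law: "\<And>c. c \<in> g ` J \<Longrightarrow> measure Omega (\<Xi> -` {c}) = (\<Sum>j | j \<in> J \<and> g j = c. w j)"
  shows "\<exists>B. disjoint_family_on B J \<and>
    (\<forall>j\<in>J. B j \<in> sets borel \<and> measure Omega (B j) = w j \<and> (\<forall>\<omega>\<in>B j. \<Xi> \<omega> = g j))"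
proof -
  have "\<exists>B. disjoint_family_on B {j\<in>J. g j = c} \<and>
    (\<forall>j\<in>{j\<in>J. g j = c}. B j \<in> sets borel \<and> B j \<subseteq> \<Xi> -` {c} \<and> measure Omega (B j) = w j)" if "c \<in> g ` J" for c
    using assms that measurable_sets[OF \<Xi>, of "{c}"] by (intro Omega_partition) auto
  then have "\<forall>c\<in>g ` J. \<exists>B. disjoint_family_on B {j\<in>J. g j = c} \<and>
    (\<forall>j\<in>{j\<in>J. g j = c}. B j \<in> sets borel \<and> B j \<subseteq> \<Xi> -` {c} \<and> measure Omega (B j) = w j)" by blast
  from bchoice[OF this] obtain B where B: "\<And>c. c \<in> g ` J \<Longrightarrow> disjoint_family_on (B c) {j\<in>J. g j = c}"
    "\<And>c j. c \<in> g ` J \<Longrightarrow> j \<in> J \<Longrightarrow> g j = c \<Longrightarrow>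
      B c j \<in> sets borel \<and> B c j \<subseteq> \<Xi> -` {c} \<and> measure Omega (B c j) = w j"
    by fastforce
  have "disjoint_family_on (\<lambda>j. B (g j) j) J"
    unfolding disjoint_family_on_def
  proof (intro ballI impI)
    fix i j assume ij: "i \<in> J" "j \<in> J" "i \<noteq> j"
    show "B (g i) i \<inter> B (g j) j = {}"
    proof (cases "g i = g j")
      case True
      then show ?thesis using B(1)[of "g i"] ij by (auto simp: disjoint_family_on_def)
    next
      case False
      then show ?thesis using B(2)[of "g i" i] B(2)[of "g j" j] ij by fastforce
    qed
  qed
  then show ?thesis using B(2) by (intro exI[of _ "\<lambda>j. B (g j) j"]) fastforce
qed

lemma (in prob_space) measure_distr_finite:
  fixes X :: "'a \<Rightarrow> real^'n"
  assumes "finite J" "disjoint_family_on A J" "\<And>j. j \<in> J \<Longrightarrow> A j \<in> sets M"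
    and [measurable]: "X \<in> borel_measurable M" "S \<in> sets borel"
    and "(\<Sum>j\<in>J. measure M (A j)) = 1" "\<And>j u. j \<in> J \<Longrightarrow> u \<in> A j \<Longrightarrow> X u = c j"
  shows "measure (distr M borel X) S = (\<Sum>j\<in>J. if c j \<in> S then measure M (A j) else 0)"
proof -
  define U where "U = (\<Union>j\<in>J. A j)"
  have [measurable]: "U \<in> sets M" unfolding U_def using assms by auto
  \<comment> \<open>The events cover the space only up to a null set, which the law does not
    see.\<close>
  have "measure M U = 1"
    unfolding U_def using assms by (subst finite_measure_finite_Union) auto
  then have "AE u in M. u \<in> U" using AE_prob_1 by blast
  then have "measure M (X -` S \<inter> space M) = measure M (X -` S \<inter> space M \<inter> U)"
    by (intro finite_measure_eq_AE) auto
  also have "X -` S \<inter> space M \<inter> U = (\<Union>j\<in>{j\<in>J. c j \<in> S}. A j)"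
    using assms(7) sets.sets_into_space[OF assms(3)] by (force simp: U_def)
  also have "measure M \<dots> = (\<Sum>j\<in>{j\<in>J. c j \<in> S}. measure M (A j))"
    using assms by (intro finite_measure_finite_Union) (auto simp: disjoint_family_on_def)
  also have "\<dots> = (\<Sum>j\<in>J. if c j \<in> S then measure M (A j) else 0)"
    using assms(1) by (simp add: sum.If_cases Collect_conj_eq)
  finally show ?thesis by (simp add: measure_distr)
qed

text \<open>Partitions with matching probabilities, on which the two maps take the same values,
  determine the same law. This carries an interpolation from an arbitrary space over to events in
  [0,1].\<close>

lemma distr_eq_finite:
  fixes X :: "'a \<Rightarrow> real^'n" and Y :: "'b \<Rightarrow> real^'n"
  assumes "prob_space M" "prob_space N" "finite J"
    and [measurable]: "X \<in> borel_measurable M" "Y \<in> borel_measurable N"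
    and "disjoint_family_on A J" "disjoint_family_on B J"
    and "\<And>j. j \<in> J \<Longrightarrow> A j \<in> sets M" "\<And>j. j \<in> J \<Longrightarrow> B j \<in> sets N"
    and eq: "\<And>j. j \<in> J \<Longrightarrow> measure M (A j) = measure N (B j)" and "(\<Sum>j\<in>J. measure N (B j)) = 1"
    and "\<And>j u. j \<in> J \<Longrightarrow> u \<in> A j \<Longrightarrow> X u = c j" "\<And>j u. j \<in> J \<Longrightarrow> u \<in> B j \<Longrightarrow> Y u = c j"
  shows "distr M borel X = distr N borel Y"
proof (rule measure_eqI)
  fix S assume "S \<in> sets (distr M borel X)"
  then have S: "S \<in> sets borel" by simp
  interpret M: prob_space "distr M borel X" using assms by (intro prob_space.prob_space_distr)
  interpret N: prob_space "distr N borel Y" using assms by (intro prob_space.prob_space_distr)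
  have "measure (distr M borel X) S = (\<Sum>j\<in>J. if c j \<in> S then measure M (A j) else 0)"
    using assms S by (intro prob_space.measure_distr_finite) (auto simp: eq)
  moreover have "measure (distr N borel Y) S = (\<Sum>j\<in>J. if c j \<in> S then measure N (B j) else 0)"
    using assms S by (intro prob_space.measure_distr_finite) auto
  ultimately have "measure (distr M borel X) S = measure (distr N borel Y) S"
    by (simp add: eq if_distrib cong: sum.cong if_cong)
  then show "emeasure (distr M borel X) S = emeasure (distr N borel Y) S"
    by (simp add: M.emeasure_eq_measure N.emeasure_eq_measure)
qed simp

section \<open>Displacement interpolation and L-derivatives\<close>

lemma L2norm_scaleR: "L2norm (\<lambda>\<omega>. c *\<^sub>R V \<omega>) = \<bar>c\<bar> * L2norm V"
  by (simp add: L2norm_def power_mult_distrib real_sqrt_mult)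

lemma L2norm_nonneg: "0 \<le> L2norm V"
  by (simp add: L2norm_def)

text \<open>Along the displacement interpolation of two maps with finitely many values, \<open>h\<close> is a
  differentiable function of the interpolation parameter.\<close>

lemma L_derivative_lipschitz_simple:
  fixes h :: "(real^'n) measure \<Rightarrow> real" and X Y :: "'a \<Rightarrow> real^'n"
  assumes M: "prob_space M" and X: "simple_function M X" and Y: "simple_function M Y"
    and law: "\<And>\<theta>. distr M borel (\<lambda>u. (1 - \<theta>) *\<^sub>R X u + \<theta> *\<^sub>R Y u) \<in> P2"
    and L: "\<And>\<mu>. \<mu> \<in> P2 \<Longrightarrow> has_L_derivative h \<mu> (\<psi> \<mu>)"
    and B: "\<And>\<theta> y. 0 \<le> \<theta> \<Longrightarrow> \<theta> \<le> 1 \<Longrightarrow> norm (\<psi> (distr M borel (\<lambda>u. (1 - \<theta>) *\<^sub>R X u + \<theta> *\<^sub>R Y u)) y) \<le> B"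
  shows "\<bar>h (distr M borel Y) - h (distr M borel X)\<bar> \<le> B * (\<integral>u. norm (Y u - X u) \<partial>M)"
proof -
  interpret M: prob_space M by (rule M)
  interpret O: prob_space Omega by (rule prob_space_Omega)
  have [measurable]: "X \<in> borel_measurable M" "Y \<in> borel_measurable M"
    using X Y by (blast intro: borel_measurable_simple_function)+
  define I where "I \<theta> u = (1 - \<theta>) *\<^sub>R X u + \<theta> *\<^sub>R Y u" for \<theta> u
  have [measurable]: "I \<theta> \<in> borel_measurable M" for \<theta> unfolding I_def[abs_def] by measurable
  define \<mu> where "\<mu> \<theta> = distr M borel (I \<theta>)" for \<theta>
  have \<mu>: "\<mu> \<theta> \<in> P2" for \<theta>
    unfolding \<mu>_def I_def[abs_def] by (rule law)
  define J where "J = (\<lambda>u. (X u, Y u)) ` space M"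
  define A where "A j = {u\<in>space M. X u = fst j \<and> Y u = snd j}" for j
  have "finite (X ` space M \<times> Y ` space M)"
    using simple_functionD(1)[OF X] simple_functionD(1)[OF Y] by simp
  then have "finite J" by (rule rev_finite_subset) (auto simp: J_def)
  have [measurable]: "A j \<in> sets M" for j unfolding A_def by simp
  have disj: "disjoint_family_on A J" by (auto simp: disjoint_family_on_def A_def prod_eq_iff)
  have "(\<Union>j\<in>J. A j) = space M" by (auto simp: A_def J_def)
  then have sum1: "(\<Sum>j\<in>J. measure M (A j)) = 1"
    using M.finite_measure_finite_Union[of J A] disj \<open>finite J\<close> M.prob_space
    by (simp add: image_subset_iff)
  define C where "C = (\<integral>u. norm (Y u - X u) \<partial>M)"
  have "C = (\<integral>u. (\<Sum>j\<in>J. indicator (A j) u * norm (snd j - fst j)) \<partial>M)"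
    unfolding C_def
  proof (rule Bochner_Integration.integral_cong[OF refl])
    fix u assume u: "u \<in> space M"
    have "(\<Sum>j\<in>J. indicator (A j) u * norm (snd j - fst j)) = (\<Sum>j\<in>{(X u, Y u)}. indicator (A j) u * norm (snd j - fst j))"
      using u \<open>finite J\<close> by (intro sum.mono_neutral_right) (auto simp: J_def A_def indicator_def)
    then show "norm (Y u - X u) = (\<Sum>j\<in>J. indicator (A j) u * norm (snd j - fst j))"
      using u by (simp add: A_def)
  qed
  also have "\<dots> = (\<Sum>j\<in>J. measure M (A j) * norm (snd j - fst j))"
    by (subst Bochner_Integration.integral_sum) (auto simp: M.emeasure_eq_measure)
  finally have C: "C = (\<Sum>j\<in>J. measure M (A j) * norm (snd j - fst j))" .
  \<comment> \<open>Differentiability holds at every real parameter, since the interpolation extends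
    to a line; the bound is claimed only between 0 and 1, where \<open>B\<close> applies.\<close>
  have "\<exists>D. ((\<lambda>\<theta>. h (\<mu> \<theta>)) has_field_derivative D) (at \<theta>) \<and> (0 \<le> \<theta> \<longrightarrow> \<theta> \<le> 1 \<longrightarrow> norm D \<le> B * C)" for \<theta>
  proof -
    \<comment> \<open>Differentiability is granted at one unspecified vector with this law, so the
      interpolation must be reproduced on it instead of on \<open>M\<close>.\<close>
    obtain \<Xi> where \<Xi>: "sq_int \<Xi>" "distr Omega borel \<Xi> = \<mu> \<theta>"
      and F: "\<And>\<epsilon>. \<epsilon> > 0 \<Longrightarrow> \<exists>\<delta>>0. \<forall>Y. sq_int Y \<and> L2norm (\<lambda>w. Y w - \<Xi> w) < \<delta> \<longrightarrow>
        \<bar>h (distr Omega borel Y) - h (\<mu> \<theta>) - (\<integral>w. \<psi> (\<mu> \<theta>) (\<Xi> w) \<bullet> (Y w - \<Xi> w) \<partial>Omega)\<bar>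
          \<le> \<epsilon> * L2norm (\<lambda>w. Y w - \<Xi> w)"
      using L[OF \<mu>[of \<theta>]] unfolding has_L_derivative_def by blast
    have [measurable]: "\<Xi> \<in> borel_measurable borel" using \<Xi>(1) by (auto simp: sq_int_def)
    define g where "g \<theta> j = (1 - \<theta>) *\<^sub>R fst j + \<theta> *\<^sub>R snd j" for \<theta> and j :: "(real^'n) \<times> (real^'n)"
    have "measure Omega (\<Xi> -` {c}) = (\<Sum>j | j \<in> J \<and> g \<theta> j = c. measure M (A j))" for c
    proof -
      have "measure Omega (\<Xi> -` {c}) = measure (\<mu> \<theta>) {c}"
        unfolding \<Xi>(2)[symmetric] by (subst measure_distr) auto
      also have "\<dots> = measure M (\<Union>j\<in>{j. j \<in> J \<and> g \<theta> j = c}. A j)"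
        unfolding \<mu>_def by (subst measure_distr) (auto intro!: arg_cong[where f="measure M"] simp: A_def J_def I_def g_def)
      also have "\<dots> = (\<Sum>j | j \<in> J \<and> g \<theta> j = c. measure M (A j))"
        using disj \<open>finite J\<close> by (intro M.finite_measure_finite_Union) (auto simp: disjoint_family_on_def)
      finally show ?thesis .
    qed
    then obtain B' where disj': "disjoint_family_on B' J"
      and B': "\<And>j. j \<in> J \<Longrightarrow> B' j \<in> sets borel" "\<And>j. j \<in> J \<Longrightarrow> measure Omega (B' j) = measure M (A j)"
        "\<And>j \<omega>. j \<in> J \<Longrightarrow> \<omega> \<in> B' j \<Longrightarrow> \<Xi> \<omega> = g \<theta> j"
      using Omega_lift[of J "\<lambda>j. measure M (A j)" \<Xi> "g \<theta>"] \<open>finite J\<close> by auto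
    \<comment> \<open>The velocity \<open>Y - X\<close>, copied to the events \<open>B' j\<close>.
      Moving \<open>\<Xi>\<close> along \<open>V\<close> for time
      \<open>\<theta>' - \<theta>\<close> yields the interpolation at \<open>\<theta>'\<close> in
      law.\<close>
    define V where "V \<omega> = (\<Sum>j\<in>J. indicator (B' j) \<omega> *\<^sub>R (snd j - fst j))" for \<omega>
    have [measurable]: "V \<in> borel_measurable borel" unfolding V_def using B'(1) by auto
    have V: "V \<omega> = snd j - fst j" if "j \<in> J" "\<omega> \<in> B' j" for j \<omega>
    proof -
      have "V \<omega> = (\<Sum>i\<in>{j}. indicator (B' i) \<omega> *\<^sub>R (snd i - fst i))"
        unfolding V_def using that disj' \<open>finite J\<close>
        by (intro sum.mono_neutral_right) (auto simp: disjoint_family_on_def indicator_def)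
      then show ?thesis using that by simp
    qed
    have eq: "\<Xi> \<omega> + (\<theta>' - \<theta>) *\<^sub>R V \<omega> = g \<theta>' j" if "j \<in> J" "\<omega> \<in> B' j" for j \<omega> \<theta>'
      unfolding B'(3)[OF that] V[OF that] by (simp add: g_def algebra_simps)
    have law': "distr Omega borel (\<lambda>\<omega>. \<Xi> \<omega> + (\<theta>' - \<theta>) *\<^sub>R V \<omega>) = \<mu> \<theta>'" for \<theta>'
      unfolding \<mu>_def
      by (rule distr_eq_finite[OF prob_space_Omega M \<open>finite J\<close> _ _ disj' disj, where c = "g \<theta>'"])
        (use B'(1,2) eq sum1 in \<open>auto simp: g_def A_def I_def\<close>)
    have sq: "sq_int (\<lambda>\<omega>. \<Xi> \<omega> + (\<theta>' - \<theta>) *\<^sub>R V \<omega>)" for \<theta>'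
      using \<mu>[of \<theta>'] distr_P2[OF prob_space_Omega, of "\<lambda>\<omega>. \<Xi> \<omega> + (\<theta>' - \<theta>) *\<^sub>R V \<omega>"] law'[of \<theta>']
      by (simp add: sq_int_def)
    define D where "D = (\<integral>w. \<psi> (\<mu> \<theta>) (\<Xi> w) \<bullet> V w \<partial>Omega)"
    have deriv: "((\<lambda>\<theta>. h (\<mu> \<theta>)) has_field_derivative D) (at \<theta>)"
      unfolding has_field_derivative_def has_derivative_within_alt
    proof (intro conjI allI impI)
      fix e :: real assume "0 < e"
      \<comment> \<open>The added 1 keeps the quotient meaningful when \<open>V\<close> vanishes
        almost surely.\<close>
      define \<epsilon> where "\<epsilon> = e / (L2norm V + 1)"
      have "0 < \<epsilon>" using \<open>0 < e\<close> L2norm_nonneg[of V] by (simp add: \<epsilon>_def add_nonneg_pos)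
      then obtain \<delta> where \<delta>: "\<delta> > 0" "\<And>Y. sq_int Y \<Longrightarrow> L2norm (\<lambda>w. Y w - \<Xi> w) < \<delta> \<Longrightarrow>
        \<bar>h (distr Omega borel Y) - h (\<mu> \<theta>) - (\<integral>w. \<psi> (\<mu> \<theta>) (\<Xi> w) \<bullet> (Y w - \<Xi> w) \<partial>Omega)\<bar>
          \<le> \<epsilon> * L2norm (\<lambda>w. Y w - \<Xi> w)" using F[OF \<open>0 < \<epsilon>\<close>] by blast
      show "\<exists>d>0. \<forall>y\<in>UNIV. norm (y - \<theta>) < d \<longrightarrow> norm (h (\<mu> y) - h (\<mu> \<theta>) - D * (y - \<theta>)) \<le> e * norm (y - \<theta>)"
      proof (intro exI conjI ballI impI)
        show "0 < \<delta> / (L2norm V + 1)" using \<delta>(1) L2norm_nonneg[of V] by (simp add: add_nonneg_pos)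
        fix y assume "norm (y - \<theta>) < \<delta> / (L2norm V + 1)"
        then have "\<bar>y - \<theta>\<bar> * (L2norm V + 1) < \<delta>"
          using L2norm_nonneg[of V] by (simp add: pos_less_divide_eq add_nonneg_pos)
        moreover have "L2norm (\<lambda>w. (y - \<theta>) *\<^sub>R V w) \<le> \<bar>y - \<theta>\<bar> * (L2norm V + 1)"
          unfolding L2norm_scaleR by (intro mult_left_mono) auto
        ultimately have "L2norm (\<lambda>w. (y - \<theta>) *\<^sub>R V w) < \<delta>" by linarith
        then have "\<bar>h (\<mu> y) - h (\<mu> \<theta>) - (\<integral>w. \<psi> (\<mu> \<theta>) (\<Xi> w) \<bullet> ((y - \<theta>) *\<^sub>R V w) \<partial>Omega)\<bar>
          \<le> \<epsilon> * L2norm (\<lambda>w. (y - \<theta>) *\<^sub>R V w)"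
          using \<delta>(2)[OF sq[of y]] by (simp add: law')
        also have "\<dots> = (e * \<bar>y - \<theta>\<bar>) * (L2norm V / (L2norm V + 1))"
          by (simp add: L2norm_scaleR \<epsilon>_def)
        also have "\<dots> \<le> e * \<bar>y - \<theta>\<bar>"
          using \<open>0 < e\<close> L2norm_nonneg[of V] by (intro mult_left_le) (auto simp: divide_simps)
        finally show "norm (h (\<mu> y) - h (\<mu> \<theta>) - D * (y - \<theta>)) \<le> e * norm (y - \<theta>)"
          by (simp add: D_def mult_ac)
      qed
    qed (rule bounded_linear_mult_right)
    have "norm D \<le> B * C" if "0 \<le> \<theta>" "\<theta> \<le> 1"
    proof -
      have B\<psi>: "norm (\<psi> (\<mu> \<theta>) y) \<le> B" for y
        unfolding \<mu>_def I_def[abs_def] by (rule B[OF that])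
      have B0: "0 \<le> B" using B\<psi> norm_ge_zero order_trans by blast
      have "norm D \<le> (\<integral>\<omega>. (\<Sum>j\<in>J. B * (indicator (B' j) \<omega> * norm (snd j - fst j))) \<partial>Omega)"
        unfolding D_def
      proof (rule norm_integral_le)
        fix \<omega>
        have "norm (V \<omega>) \<le> (\<Sum>j\<in>J. indicator (B' j) \<omega> * norm (snd j - fst j))"
          unfolding V_def by (intro order_trans[OF norm_sum]) simp
        then show "norm (\<psi> (\<mu> \<theta>) (\<Xi> \<omega>) \<bullet> V \<omega>) \<le> (\<Sum>j\<in>J. B * (indicator (B' j) \<omega> * norm (snd j - fst j)))"
          using B\<psi>[of "\<Xi> \<omega>"] B0 unfolding sum_distrib_left[symmetric] real_norm_def
          by (intro order_trans[OF Cauchy_Schwarz_ineq2 mult_mono]) auto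
      qed (use B'(1) in \<open>auto simp: O.emeasure_eq_measure intro!: Bochner_Integration.integrable_sum integrable_mult_right\<close>)
      also have "\<dots> = B * C"
        using B' by (subst Bochner_Integration.integral_sum)
          (auto simp: C O.emeasure_eq_measure sum_distrib_left intro!: integrable_mult_right sum.cong)
      finally show ?thesis .
    qed
    with deriv show ?thesis by blast
  qed
  then obtain D where D: "\<And>\<theta>. ((\<lambda>\<theta>. h (\<mu> \<theta>)) has_field_derivative D \<theta>) (at \<theta>)"
    "\<And>\<theta>. 0 \<le> \<theta> \<Longrightarrow> \<theta> \<le> 1 \<Longrightarrow> norm (D \<theta>) \<le> B * C" by metis
  have "norm (h (\<mu> 1) - h (\<mu> 0)) \<le> B * C * norm (1 - 0 :: real)"
    by (rule field_differentiable_bound[where S = "{0..1}" and f' = D])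
      (use D in \<open>auto intro: has_field_derivative_at_within\<close>)
  then show ?thesis by (simp add: \<mu>_def I_def[abs_def] C_def)
qed

text \<open>Differentiability at the representative \<open>\<Xi>\<close> of \<open>\<mu>\<close>
  already gives continuity of \<open>h\<close> along \<open>S i\<close>: the vector
  \<open>S i (\<Xi> w)\<close> has law \<open>distr \<mu> borel (S i)\<close> and tends to
  \<open>\<Xi>\<close> in mean square, the distance being dominated by three times the norm of
  \<open>\<Xi>\<close>.\<close>

lemma L_derivative_continuous_simple:
  fixes h :: "(real^'n) measure \<Rightarrow> real" and S :: "nat \<Rightarrow> real^'n \<Rightarrow> real^'n"
  assumes "has_L_derivative h \<mu> \<psi>" and B: "\<And>y. norm (\<psi> y) \<le> B"
    and [measurable]: "\<And>i. S i \<in> borel_measurable borel"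
    and S: "\<And>x. (\<lambda>i. S i x) \<longlonglongrightarrow> x" "\<And>i x. norm (S i x) \<le> 2 * norm x"
  shows "(\<lambda>i. h (distr \<mu> borel (S i))) \<longlonglongrightarrow> h \<mu>"
proof -
  interpret O: prob_space Omega by (rule prob_space_Omega)
  obtain \<Xi> where \<Xi>: "sq_int \<Xi>" "distr Omega borel \<Xi> = \<mu>"
      and F: "\<And>\<epsilon>. \<epsilon> > 0 \<Longrightarrow> \<exists>\<delta>>0. \<forall>Y. sq_int Y \<and> L2norm (\<lambda>w. Y w - \<Xi> w) < \<delta> \<longrightarrow>
        \<bar>h (distr Omega borel Y) - h \<mu> - (\<integral>w. \<psi> (\<Xi> w) \<bullet> (Y w - \<Xi> w) \<partial>Omega)\<bar>
          \<le> \<epsilon> * L2norm (\<lambda>w. Y w - \<Xi> w)"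
    using assms(1) unfolding has_L_derivative_def by blast
  have [measurable]: "\<Xi> \<in> borel_measurable borel"
    using \<Xi>(1) measurable_cong_sets[OF sets_Omega refl] unfolding sq_int_def by blast
  have int2: "integrable Omega (\<lambda>w. (norm (\<Xi> w))\<^sup>2)" using \<Xi>(1) by (simp add: sq_int_def)
  have int1: "integrable Omega (\<lambda>w. norm (\<Xi> w))"
    by (rule Bochner_Integration.integrable_bound[where f = "\<lambda>w. 1 + (norm (\<Xi> w))\<^sup>2"])
      (use int2 in \<open>auto simp: le_one_plus_square\<close>)
  have diff: "norm (S i x - x) \<le> 3 * norm x" for i x
    using S(2)[of i x] norm_triangle_ineq4[of "S i x" x] by linarith
  have lim: "(\<lambda>i. norm (S i x - x)) \<longlonglongrightarrow> 0" for x
    using tendsto_norm[OF tendsto_diff[OF S(1)[of x] tendsto_const[of x]]] by simp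
  define b where "b i = (\<integral>w. norm (S i (\<Xi> w) - \<Xi> w) \<partial>Omega)" for i
  define a where "a i = L2norm (\<lambda>w. S i (\<Xi> w) - \<Xi> w)" for i
  have "b \<longlonglongrightarrow> (\<integral>w. 0 \<partial>Omega)"
    unfolding b_def by (rule integral_dominated_convergence[where w = "\<lambda>w. 3 * norm (\<Xi> w)"])
      (use int1 diff lim in auto)
  then have b: "b \<longlonglongrightarrow> 0" by simp
  have "(\<lambda>i. \<integral>w. (norm (S i (\<Xi> w) - \<Xi> w))\<^sup>2 \<partial>Omega) \<longlonglongrightarrow> (\<integral>w. 0 \<partial>Omega)"
  proof (rule integral_dominated_convergence[where w = "\<lambda>w. 9 * (norm (\<Xi> w))\<^sup>2"])
    show "AE w in Omega. (\<lambda>i. (norm (S i (\<Xi> w) - \<Xi> w))\<^sup>2) \<longlonglongrightarrow> 0"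
      by (simp add: lim)
    show "AE w in Omega. norm ((norm (S i (\<Xi> w) - \<Xi> w))\<^sup>2) \<le> 9 * (norm (\<Xi> w))\<^sup>2" for i
      using power_mono[OF diff norm_ge_zero, of i _ 2] by (simp add: power_mult_distrib)
  qed (use int2 in auto)
  then have a: "a \<longlonglongrightarrow> 0"
    unfolding a_def L2norm_def using tendsto_real_sqrt by fastforce
  obtain \<delta> where \<delta>: "\<delta> > 0" "\<And>Y. sq_int Y \<Longrightarrow> L2norm (\<lambda>w. Y w - \<Xi> w) < \<delta> \<Longrightarrow>
        \<bar>h (distr Omega borel Y) - h \<mu> - (\<integral>w. \<psi> (\<Xi> w) \<bullet> (Y w - \<Xi> w) \<partial>Omega)\<bar>
          \<le> 1 * L2norm (\<lambda>w. Y w - \<Xi> w)"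
    using F[of 1] by auto
  have sq: "sq_int (\<lambda>w. S i (\<Xi> w))" for i
  proof -
    have "integrable Omega (\<lambda>w. (norm (S i (\<Xi> w)))\<^sup>2)"
    proof (rule Bochner_Integration.integrable_bound[where f = "\<lambda>w. 4 * (norm (\<Xi> w))\<^sup>2"])
      show "AE w in Omega. norm ((norm (S i (\<Xi> w)))\<^sup>2) \<le> norm (4 * (norm (\<Xi> w))\<^sup>2)"
        using power_mono[OF S(2) norm_ge_zero, of i _ 2] by (simp add: power_mult_distrib)
    qed (use int2 in auto)
    then show ?thesis by (simp add: sq_int_def)
  qed
  have law: "distr Omega borel (\<lambda>w. S i (\<Xi> w)) = distr \<mu> borel (S i)" for i
    unfolding \<Xi>(2)[symmetric] by (subst distr_distr) (auto simp: comp_def)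
  have B0: "0 \<le> B" using B norm_ge_zero order_trans by blast
  have inner: "\<bar>\<integral>w. \<psi> (\<Xi> w) \<bullet> (S i (\<Xi> w) - \<Xi> w) \<partial>Omega\<bar> \<le> B * b i" for i
  proof -
    have "norm (\<integral>w. \<psi> (\<Xi> w) \<bullet> (S i (\<Xi> w) - \<Xi> w) \<partial>Omega) \<le> (\<integral>w. B * norm (S i (\<Xi> w) - \<Xi> w) \<partial>Omega)"
    proof (rule norm_integral_le)
      have "integrable Omega (\<lambda>w. norm (S i (\<Xi> w) - \<Xi> w))"
        by (rule Bochner_Integration.integrable_bound[where f = "\<lambda>w. 3 * norm (\<Xi> w)"]) (use int1 diff in auto)
      then show "integrable Omega (\<lambda>w. B * norm (S i (\<Xi> w) - \<Xi> w))" by (rule integrable_mult_right)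
      show "norm (\<psi> (\<Xi> w) \<bullet> (S i (\<Xi> w) - \<Xi> w)) \<le> B * norm (S i (\<Xi> w) - \<Xi> w)" for w
        unfolding real_norm_def
        by (rule order_trans[OF Cauchy_Schwarz_ineq2 mult_right_mono[OF B norm_ge_zero]])
    qed
    then show ?thesis by (simp add: b_def)
  qed
  have "eventually (\<lambda>i. a i < \<delta>) sequentially" using a \<delta>(1) by (rule order_tendstoD)
  then have "eventually (\<lambda>i. norm (h (distr \<mu> borel (S i)) - h \<mu>) \<le> a i + B * b i) sequentially"
  proof eventually_elim
    case (elim i)
    then show ?case using \<delta>(2)[OF sq[of i]] inner[of i] by (simp add: a_def law)
  qed
  moreover have "(\<lambda>i. a i + B * b i) \<longlonglongrightarrow> 0"
    using tendsto_add[OF a tendsto_mult_left[OF b, of B]] by simp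
  ultimately have "(\<lambda>i. h (distr \<mu> borel (S i)) - h \<mu>) \<longlonglongrightarrow> 0"
    by (rule Lim_null_comparison)
  then show ?thesis by (simp add: LIM_zero_iff)
qed

text \<open>The coupling is pushed through the finitely valued maps \<open>S i\<close>, the finite
  case is applied and the limit is taken. The derivative bound \<open>B\<close> is available only
  where \<open>moment1\<close> is at least \<open>r\<close>, because derivatives decay; the strict
  gap between \<open>r\<close> and \<open>moment1 \<mu> - c\<close> is what the approximation may
  consume.\<close>

lemma L_derivative_lipschitz:
  fixes h :: "(real^'n) measure \<Rightarrow> real"
  assumes L: "\<And>\<mu>. \<mu> \<in> P2 \<Longrightarrow> has_L_derivative h \<mu> (\<psi> \<mu>)"
    and B: "\<And>\<mu> y. \<mu> \<in> P2 \<Longrightarrow> r \<le> moment1 \<mu> \<Longrightarrow> norm (\<psi> \<mu> y) \<le> B"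
    and P2: "\<mu> \<in> P2" "\<nu> \<in> P2" and c: "W1_le \<mu> \<nu> c" "r < moment1 \<mu> - c"
  shows "\<bar>h \<mu> - h \<nu>\<bar> \<le> B * c"
proof -
  obtain \<pi> where \<pi>: "\<pi> \<in> couplings \<mu> \<nu>" and \<pi>c: "(\<integral>z. norm (fst z - snd z) \<partial>\<pi>) \<le> c"
    using c(1) unfolding W1_le_def by blast
  note cf = coupling_facts[OF \<pi> P2]
  note [measurable] = cf(3,4)
  interpret \<pi>: prob_space \<pi> by (rule cf(1))
  have mu: "r \<le> moment1 \<mu>" and nu: "r \<le> moment1 \<nu>" and c0: "0 \<le> c"
    using moment1_kant_le[OF kant_le_if_W1_le[OF c(1) P2]] c(2) by linarith+
  have B0: "0 \<le> B" using B[OF P2(1) mu] norm_ge_zero order_trans by blast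
  obtain S :: "nat \<Rightarrow> real^'n \<Rightarrow> real^'n" where S: "\<And>i. simple_function borel (S i)" "\<And>x. (\<lambda>i. S i x) \<longlonglongrightarrow> x"
    "\<And>i x. dist (S i x) 0 \<le> 2 * dist x 0"
    using borel_measurable_implies_sequence_metric[of "\<lambda>x. x" borel "0::real^'n"] by auto
  have Sn: "norm (S i x) \<le> 2 * norm x" for i x using S(3)[of i x] by simp
  have [measurable]: "S i \<in> borel_measurable borel" for i using S(1) by (rule borel_measurable_simple_function)
  define X where "X i z = S i (fst z)" for i and z :: "(real^'n) \<times> (real^'n)"
  define Y where "Y i z = S i (snd z)" for i and z :: "(real^'n) \<times> (real^'n)"
  have [measurable]: "X i \<in> borel_measurable \<pi>" "Y i \<in> borel_measurable \<pi>" for i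
    unfolding X_def[abs_def] Y_def[abs_def] by measurable
  have simple: "simple_function \<pi> (X i)" "simple_function \<pi> (Y i)" for i
    unfolding X_def[abs_def] Y_def[abs_def] by (rule simple_function_comp[OF _ S(1)], measurable)+
  have hX: "distr \<pi> borel (X i) = distr \<mu> borel (S i)" and hY: "distr \<pi> borel (Y i) = distr \<nu> borel (S i)" for i
    unfolding cf(5,6)[symmetric] X_def[abs_def] Y_def[abs_def]
    by (subst distr_distr, auto simp: comp_def)+
  have lim_mu: "(\<lambda>i. h (distr \<pi> borel (X i))) \<longlonglongrightarrow> h \<mu>"
    unfolding hX by (rule L_derivative_continuous_simple[OF L[OF P2(1)] B[OF P2(1) mu] _ S(2) Sn]) measurable
  have lim_nu: "(\<lambda>i. h (distr \<pi> borel (Y i))) \<longlonglongrightarrow> h \<nu>"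
    unfolding hY by (rule L_derivative_continuous_simple[OF L[OF P2(2)] B[OF P2(2) nu] _ S(2) Sn]) measurable
  define m where "m i = (\<integral>z. norm (X i z) \<partial>\<pi>)" for i
  define C where "C i = (\<integral>z. norm (Y i z - X i z) \<partial>\<pi>)" for i
  have m: "m \<longlonglongrightarrow> (\<integral>z. norm (fst z) \<partial>\<pi>)"
    unfolding m_def
  proof (rule integral_dominated_convergence[where w = "\<lambda>z. 2 * norm (fst z)"])
    show "AE z in \<pi>. (\<lambda>i. norm (X i z)) \<longlonglongrightarrow> norm (fst z)"
      unfolding X_def by (intro AE_I2 tendsto_norm S(2))
    show "AE z in \<pi>. norm (norm (X i z)) \<le> 2 * norm (fst z)" for i
      unfolding X_def using Sn by simp
  qed (use cf(7) in auto)
  have C: "C \<longlonglongrightarrow> (\<integral>z. norm (snd z - fst z) \<partial>\<pi>)"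
    unfolding C_def
  proof (rule integral_dominated_convergence[where w = "\<lambda>z. 2 * norm (snd z) + 2 * norm (fst z)"])
    show "AE z in \<pi>. (\<lambda>i. norm (Y i z - X i z)) \<longlonglongrightarrow> norm (snd z - fst z)"
      unfolding X_def Y_def by (intro AE_I2 tendsto_norm tendsto_diff S(2))
    show "AE z in \<pi>. norm (norm (Y i z - X i z)) \<le> 2 * norm (snd z) + 2 * norm (fst z)" for i
    proof (rule AE_I2)
      fix z
      show "norm (norm (Y i z - X i z)) \<le> 2 * norm (snd z) + 2 * norm (fst z)"
        using norm_triangle_ineq4[of "Y i z" "X i z"] Sn[of i "snd z"] Sn[of i "fst z"] by (simp add: X_def Y_def)
    qed
  qed (use cf(7,8) in auto)
  have mom: "(\<integral>z. norm (fst z) \<partial>\<pi>) = moment1 \<mu>"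
    unfolding cf(5)[symmetric] by (simp add: moment1_distr)
  have Cc: "(\<integral>z. norm (snd z - fst z) \<partial>\<pi>) \<le> c" using \<pi>c by (simp add: norm_minus_commute)
  have "(\<lambda>i. m i - C i) \<longlonglongrightarrow> moment1 \<mu> - (\<integral>z. norm (snd z - fst z) \<partial>\<pi>)"
    using tendsto_diff[OF m C] by (simp add: mom)
  moreover have "r < moment1 \<mu> - (\<integral>z. norm (snd z - fst z) \<partial>\<pi>)" using Cc c(2) by linarith
  ultimately have "eventually (\<lambda>i. r < m i - C i) sequentially" by (rule order_tendstoD)
  then have "eventually (\<lambda>i. \<bar>h (distr \<pi> borel (Y i)) - h (distr \<pi> borel (X i))\<bar> \<le> B * C i) sequentially"
  proof eventually_elim
    case (elim i)
    have bdd: "integrable \<pi> (\<lambda>z. g (X i z) (Y i z))" for g :: "real^'n \<Rightarrow> real^'n \<Rightarrow> real"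
      by (rule integrable_simple_function[OF simple_function_compose2[OF simple]]) simp
    have I: "distr \<pi> borel (\<lambda>u. (1 - \<theta>) *\<^sub>R X i u + \<theta> *\<^sub>R Y i u) \<in> P2" for \<theta>
      by (subst distr_P2[OF cf(1)]) (auto intro: bdd[of "\<lambda>x y. (norm ((1 - \<theta>) *\<^sub>R x + \<theta> *\<^sub>R y))\<^sup>2"])
    have "norm (\<psi> (distr \<pi> borel (\<lambda>u. (1 - \<theta>) *\<^sub>R X i u + \<theta> *\<^sub>R Y i u)) y) \<le> B"
      if "0 \<le> \<theta>" "\<theta> \<le> 1" for \<theta> y
    proof (rule B[OF I])
      \<comment> \<open>An interpolated point differs from \<open>X i\<close> by at most the length
        of \<open>Y i - X i\<close>, so the first moment of its law is at least
        \<open>m i - C i\<close> and the derivative bound \<open>B\<close> applies all along the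
        path.\<close>
      have "m i - C i = (\<integral>z. norm (X i z) - norm (Y i z - X i z) \<partial>\<pi>)"
        unfolding m_def C_def
        by (rule Bochner_Integration.integral_diff[symmetric])
          (rule bdd[of "\<lambda>x y. norm x"], rule bdd[of "\<lambda>x y. norm (y - x)"])
      also have "\<dots> \<le> (\<integral>z. norm ((1 - \<theta>) *\<^sub>R X i z + \<theta> *\<^sub>R Y i z) \<partial>\<pi>)"
      proof (rule integral_mono)
        show "integrable \<pi> (\<lambda>z. norm (X i z) - norm (Y i z - X i z))" by (rule bdd[of "\<lambda>x y. norm x - norm (y - x)"])
        show "integrable \<pi> (\<lambda>z. norm ((1 - \<theta>) *\<^sub>R X i z + \<theta> *\<^sub>R Y i z))"
          by (rule bdd[of "\<lambda>x y. norm ((1 - \<theta>) *\<^sub>R x + \<theta> *\<^sub>R y)"])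
        fix z
        have "norm (\<theta> *\<^sub>R (Y i z - X i z)) \<le> norm (Y i z - X i z)"
          using that by (simp add: mult_left_le_one_le)
        moreover have "X i z = ((1 - \<theta>) *\<^sub>R X i z + \<theta> *\<^sub>R Y i z) - \<theta> *\<^sub>R (Y i z - X i z)"
          by (simp add: algebra_simps)
        then have "norm (X i z) \<le> norm ((1 - \<theta>) *\<^sub>R X i z + \<theta> *\<^sub>R Y i z) + norm (\<theta> *\<^sub>R (Y i z - X i z))"
          using norm_triangle_ineq4 by metis
        ultimately show "norm (X i z) - norm (Y i z - X i z) \<le> norm ((1 - \<theta>) *\<^sub>R X i z + \<theta> *\<^sub>R Y i z)"
          by linarith
      qed
      also have "\<dots> = moment1 (distr \<pi> borel (\<lambda>u. (1 - \<theta>) *\<^sub>R X i u + \<theta> *\<^sub>R Y i u))"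
        by (rule moment1_distr[symmetric]) measurable
      finally show "r \<le> moment1 (distr \<pi> borel (\<lambda>u. (1 - \<theta>) *\<^sub>R X i u + \<theta> *\<^sub>R Y i u))" using elim by linarith
    qed
    then show ?case
      unfolding C_def by (intro L_derivative_lipschitz_simple[OF cf(1) simple I L]) auto
  qed
  then have "\<bar>h \<nu> - h \<mu>\<bar> \<le> B * (\<integral>z. norm (snd z - fst z) \<partial>\<pi>)"
    by (intro tendsto_le[OF sequentially_bot tendsto_mult_left[OF C] tendsto_rabs[OF tendsto_diff[OF lim_nu lim_mu]]])
  also have "\<dots> \<le> B * c" using Cc B0 by (rule mult_left_mono)
  finally show ?thesis by (simp add: abs_minus_commute)
qed

section \<open>Second-order expansions in the measure\<close>

lemma int_diff_diff:
  fixes \<phi> \<psi> :: "real^'n \<Rightarrow> real"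
  assumes "\<And>\<nu>. \<nu> \<in> P2 \<Longrightarrow> integrable \<nu> \<phi>" "\<And>\<nu>. \<nu> \<in> P2 \<Longrightarrow> integrable \<nu> \<psi>" "\<nu>1 \<in> P2" "\<nu>2 \<in> P2"
  shows "int_diff \<nu>1 \<nu>2 (\<lambda>x. \<phi> x - \<psi> x) = int_diff \<nu>1 \<nu>2 \<phi> - int_diff \<nu>1 \<nu>2 \<psi>"
  using assms by (simp add: int_diff_def)

lemma is_lfd2_integrable:
  assumes "is_lfd2 h D D2" "\<mu> \<in> P2" "\<nu> \<in> P2"
  shows "integrable \<nu> (\<lambda>x. D2 \<mu> x y)"
proof -
  have "continuous_on UNIV (\<lambda>(x, y). D2 \<mu> x y)"
    using assms(1,2) unfolding is_lfd2_def by (auto dest: jointly_continuous_at)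
  then have "continuous_on UNIV (\<lambda>x. (\<lambda>(x, y). D2 \<mu> x y) (x, y))"
    by (rule continuous_on_compose2) (auto intro!: continuous_intros)
  then have cont: "continuous_on UNIV (\<lambda>x. D2 \<mu> x y)" by simp
  obtain c where c: "\<And>e. norm (case e of (x, y) \<Rightarrow> D2 \<mu> x y) \<le> c \<mu> * (case e of (x, y) \<Rightarrow> 1 + (norm x)\<^sup>2 + (norm y)\<^sup>2)"
    using assms(1,2) unfolding is_lfd2_def locally_bounded_by_def by blast
  show ?thesis
    by (rule integrable_P2_growth[OF assms(3), where a = "c \<mu> * (1 + (norm y)\<^sup>2)" and b = 0 and c = "c \<mu>"])
      (use c[of "(_, y)"] cont in \<open>auto simp: algebra_simps intro: borel_measurable_continuous_onI\<close>)
qed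

text \<open>\<open>is_lfd2\<close> asserts the value of the remainder but not its integrability. A
  nonintegrable function has \<open>integral\<close> 0, which respects any nonnegative
  bound.\<close>

lemma abs_integral_unit_le:
  fixes F :: "real \<Rightarrow> real"
  assumes "\<And>x. 0 \<le> x \<Longrightarrow> x \<le> 1 \<Longrightarrow> \<bar>F x\<bar> \<le> B"
  shows "\<bar>integral {0..1} F\<bar> \<le> B"
proof (cases "F integrable_on {0..1}")
  case True
  have "0 \<le> B" using assms[of 0] by auto
  from has_integral_bound_real[OF this finite.emptyI integrable_integral[OF True]] show ?thesis
    using assms by auto
next
  case False
  then show ?thesis using assms[of 0] by (auto simp: not_integrable_integral)
qed

text \<open>The bound on the mixed derivative \<open>D_mumu\<close> in derivative-free form: a
  second difference, to which duality can be applied once in each variable.\<close>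

definition mixed_lipschitz :: "real \<Rightarrow> (real^'n \<Rightarrow> real^'n \<Rightarrow> real) \<Rightarrow> bool" where
  "mixed_lipschitz L E \<longleftrightarrow> (\<forall>y y' w w'. \<bar>E y w - E y' w - (E y w' - E y' w')\<bar> \<le> L * norm (y - y') * norm (w - w'))"

text \<open>By duality in the first variable the inner integral is \<open>L * c\<close>-Lipschitz in
  the second; duality once more gives \<open>L * c\<^sup>2\<close>. The factor
  \<open>\<theta>\<close> is estimated by 1, so no 1/2 appears.\<close>

lemma lfd2_taylor:
  assumes h: "is_lfd2 h D D2" and P2: "\<nu>1 \<in> P2" "\<nu>2 \<in> P2" and c: "kant_le \<nu>1 \<nu>2 c" and "0 \<le> L"
    and L: "\<And>\<theta>. 0 \<le> \<theta> \<Longrightarrow> \<theta> \<le> 1 \<Longrightarrow> mixed_lipschitz L (D2 (mix \<theta> \<nu>1 \<nu>2))"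
  shows "\<bar>h \<nu>1 - h \<nu>2 - int_diff \<nu>1 \<nu>2 (D \<nu>2)\<bar> \<le> L * c\<^sup>2"
proof -
  have c0: "0 \<le> c" using c by (simp add: kant_le_def)
  have bound: "\<bar>int_diff \<nu>1 \<nu>2 (\<lambda>y. int_diff \<nu>1 \<nu>2 (\<lambda>x. \<theta> * D2 (mix (l * \<theta>) \<nu>1 \<nu>2) x y))\<bar> \<le> (L * c) * c"
    if "0 \<le> \<theta>" "\<theta> \<le> 1" "0 \<le> l" "l \<le> 1" for \<theta> l
  proof (rule kant_leD[OF c])
    show "0 \<le> L * c" using c0 \<open>0 \<le> L\<close> by simp
    have l\<theta>: "0 \<le> l * \<theta>" "l * \<theta> \<le> 1" using that by (auto simp: mult_le_one)
    then have mix: "mix (l * \<theta>) \<nu>1 \<nu>2 \<in> P2" using P2 by (simp add: mix_P2)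
    fix y y'
    have "int_diff \<nu>1 \<nu>2 (\<lambda>x. \<theta> * D2 (mix (l * \<theta>) \<nu>1 \<nu>2) x y) - int_diff \<nu>1 \<nu>2 (\<lambda>x. \<theta> * D2 (mix (l * \<theta>) \<nu>1 \<nu>2) x y')
      = int_diff \<nu>1 \<nu>2 (\<lambda>x. \<theta> * D2 (mix (l * \<theta>) \<nu>1 \<nu>2) x y - \<theta> * D2 (mix (l * \<theta>) \<nu>1 \<nu>2) x y')"
      by (rule int_diff_diff[symmetric]) (auto intro!: integrable_mult_right is_lfd2_integrable[OF h mix] P2)
    also have "\<bar>\<dots>\<bar> \<le> (L * norm (y - y')) * c"
    proof (rule kant_leD[OF c])
      fix x x'
      have "\<bar>\<theta> * D2 (mix (l * \<theta>) \<nu>1 \<nu>2) x y - \<theta> * D2 (mix (l * \<theta>) \<nu>1 \<nu>2) x y' -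
          (\<theta> * D2 (mix (l * \<theta>) \<nu>1 \<nu>2) x' y - \<theta> * D2 (mix (l * \<theta>) \<nu>1 \<nu>2) x' y')\<bar>
        = \<theta> * \<bar>D2 (mix (l * \<theta>) \<nu>1 \<nu>2) x y - D2 (mix (l * \<theta>) \<nu>1 \<nu>2) x' y -
           (D2 (mix (l * \<theta>) \<nu>1 \<nu>2) x y' - D2 (mix (l * \<theta>) \<nu>1 \<nu>2) x' y')\<bar>"
        using that(1) by (subst abs_of_nonneg[OF that(1), symmetric], subst abs_mult[symmetric]) (simp add: algebra_simps)
      also have "\<dots> \<le> 1 * (L * norm (x - x') * norm (y - y'))"
        using L[OF l\<theta>] that unfolding mixed_lipschitz_def by (intro mult_mono) auto
      finally show "\<bar>\<theta> * D2 (mix (l * \<theta>) \<nu>1 \<nu>2) x y - \<theta> * D2 (mix (l * \<theta>) \<nu>1 \<nu>2) x y' -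
          (\<theta> * D2 (mix (l * \<theta>) \<nu>1 \<nu>2) x' y - \<theta> * D2 (mix (l * \<theta>) \<nu>1 \<nu>2) x' y')\<bar>
        \<le> L * norm (y - y') * norm (x - x')" by (simp add: mult_ac)
    qed (use \<open>0 \<le> L\<close> in simp)
    finally show "\<bar>int_diff \<nu>1 \<nu>2 (\<lambda>x. \<theta> * D2 (mix (l * \<theta>) \<nu>1 \<nu>2) x y) - int_diff \<nu>1 \<nu>2 (\<lambda>x. \<theta> * D2 (mix (l * \<theta>) \<nu>1 \<nu>2) x y')\<bar>
      \<le> L * c * norm (y - y')" by (simp add: mult_ac)
  qed
  have "h \<nu>1 - h \<nu>2 = int_diff \<nu>1 \<nu>2 (D \<nu>2) +
      integral {0..1} (\<lambda>\<theta>. integral {0..1} (\<lambda>l.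
        int_diff \<nu>1 \<nu>2 (\<lambda>y. int_diff \<nu>1 \<nu>2 (\<lambda>x. \<theta> * D2 (mix (l * \<theta>) \<nu>1 \<nu>2) x y))))"
    using h P2 unfolding is_lfd2_def by blast
  moreover have "\<bar>integral {0..1} (\<lambda>\<theta>. integral {0..1} (\<lambda>l.
        int_diff \<nu>1 \<nu>2 (\<lambda>y. int_diff \<nu>1 \<nu>2 (\<lambda>x. \<theta> * D2 (mix (l * \<theta>) \<nu>1 \<nu>2) x y))))\<bar> \<le> L * c * c"
    by (intro abs_integral_unit_le bound)
  ultimately show ?thesis by (simp add: power2_eq_square mult_ac)
qed

subsection \<open>Perturbation by a Dirac mass\<close>

text \<open>Point values of a linear functional derivative are read off by moving a small mass
  \<open>e\<close> to \<open>y\<close>: to first order \<open>h\<close> changes by \<open>e\<close>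
  times the excess of \<open>D \<nu> y\<close> over the mean of \<open>D \<nu>\<close>.\<close>

definition dmix :: "real \<Rightarrow> real^'n \<Rightarrow> (real^'n) measure \<Rightarrow> (real^'n) measure" where
  "dmix e y \<nu> = mix e (return borel y) \<nu>"

lemma dmix_P2: "\<nu> \<in> P2 \<Longrightarrow> 0 \<le> e \<Longrightarrow> e \<le> 1 \<Longrightarrow> dmix e y \<nu> \<in> P2"
  unfolding dmix_def by (intro mix_P2 dirac_P2)

lemma integral_dmix:
  fixes \<phi> :: "real^'n \<Rightarrow> real"
  assumes "\<nu> \<in> P2" "0 \<le> e" "e \<le> 1" "\<And>\<nu>. \<nu> \<in> P2 \<Longrightarrow> integrable \<nu> \<phi>"
  shows "(\<integral>x. \<phi> x \<partial>dmix e y \<nu>) = e * \<phi> y + (1 - e) * (\<integral>x. \<phi> x \<partial>\<nu>)"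
proof -
  have "\<phi> \<in> borel_measurable borel"
    using borel_measurable_integrable[OF assms(4)[OF dirac_P2[of 0]]] by simp
  then show ?thesis
    unfolding dmix_def by (subst integral_mix_P2[OF dirac_P2 assms]) (simp_all add: integral_return)
qed

lemma moment1_dmix:
  assumes "\<nu> \<in> P2" "0 \<le> e" "e \<le> 1" shows "(1 - e) * moment1 \<nu> \<le> moment1 (dmix e y \<nu>)"
  using assms unfolding dmix_def by (subst moment1_mix[OF dirac_P2]) (auto simp: moment1_dirac)

text \<open>Both measures are sampled with the same Bernoulli coin: with probability
  \<open>e\<close> the points are \<open>y\<close> and \<open>y'\<close>, otherwise both equal one
  sample of \<open>\<nu>\<close>. Only the first event has a cost.\<close>

lemma W1_le_dmix:
  fixes \<nu> :: "(real^'n) measure"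
  assumes "\<nu> \<in> P2" "0 \<le> e" "e \<le> 1"
  shows "W1_le (dmix e y \<nu>) (dmix e y' \<nu>) (e * norm (y - y'))"
proof -
  interpret \<nu>: prob_space \<nu> using assms(1) by (rule P2_prob_space)
  define B where "B = measure_pmf (bernoulli_pmf e)"
  have pB: "prob_space B" unfolding B_def by (rule measure_pmf.prob_space_axioms)
  have sB: "sets B = UNIV" by (simp add: B_def)
  interpret B: prob_space B by (rule pB)
  interpret P: pair_prob_space B \<nu> ..
  define M where "M = B \<Otimes>\<^sub>M \<nu>"
  interpret M: prob_space M unfolding M_def by (rule P.P.prob_space_axioms)
  note [measurable_cong] = sets_P2[OF assms(1)]
  have sM [measurable_cong]: "sets M = sets (count_space UNIV \<Otimes>\<^sub>M borel)"
    unfolding M_def by (intro sets_pair_measure_cong sets_P2 assms) (simp add: B_def)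
  define X where "X y z = (if fst z then y else snd z)" for y :: "real^'n" and z :: "bool \<times> (real^'n)"
  have [measurable]: "X y \<in> borel_measurable (count_space UNIV \<Otimes>\<^sub>M borel)" for y
    unfolding X_def[abs_def] by measurable
  have [measurable]: "X y \<in> borel_measurable M" for y
    using measurable_cong_sets[OF sM refl] by auto
  have law: "distr M borel (X y) = dmix e y \<nu>" for y
  proof (rule measure_eqI)
    fix A assume "A \<in> sets (distr M borel (X y))"
    then have A [measurable]: "A \<in> sets borel" by simp
    have "emeasure (distr M borel (X y)) A = emeasure M (X y -` A \<inter> space M)"
      by (rule emeasure_distr) auto
    also have "\<dots> = (\<integral>\<^sup>+b. emeasure \<nu> (Pair b -` (X y -` A \<inter> space M)) \<partial>B)"
      unfolding M_def by (rule \<nu>.emeasure_pair_measure_alt) (unfold M_def[symmetric], measurable)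
    also have "\<dots> = (\<integral>\<^sup>+b. (if b then indicator A y else emeasure \<nu> A) \<partial>B)"
    proof (rule nn_integral_cong)
      fix b
      have "space M = UNIV" unfolding M_def by (simp add: space_pair_measure B_def space_P2[OF assms(1)])
      then have "Pair b -` (X y -` A \<inter> space M) = (if b then (if y \<in> A then UNIV else {}) else A)"
        by (auto simp: X_def)
      then show "emeasure \<nu> (Pair b -` (X y -` A \<inter> space M)) = (if b then indicator A y else emeasure \<nu> A)"
        using \<nu>.emeasure_space_1 by (simp add: space_P2[OF assms(1)])
    qed
    also have "\<dots> = ennreal e * indicator A y + ennreal (1 - e) * emeasure \<nu> A"
      unfolding B_def using assms by (subst nn_integral_bernoulli_pmf) (auto simp: mult_ac)
    also have "\<dots> = emeasure (dmix e y \<nu>) A"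
      unfolding dmix_def using A sets_P2[OF assms(1)] by (subst emeasure_mix) (auto simp: mult_ac)
    finally show "emeasure (distr M borel (X y)) A = emeasure (dmix e y \<nu>) A" .
  qed (simp add: dmix_def)
  have "(\<integral>z. norm (X y z - X y' z) \<partial>M) = (\<integral>z. (if fst z then norm (y - y') else 0) \<partial>M)"
    by (rule Bochner_Integration.integral_cong) (auto simp: X_def)
  also have "\<dots> = (\<integral>b. (if b then norm (y - y') else 0) \<partial>distr M B fst)"
    by (rule integral_distr[symmetric]) (auto simp: M_def B_def)
  also have "distr M B fst = B" unfolding M_def by (rule \<nu>.distr_pair_fst)
  also have "(\<integral>b. (if b then norm (y - y') else 0) \<partial>B) = e * norm (y - y')"
    unfolding B_def using assms by (subst integral_bernoulli_pmf) auto
  finally show ?thesis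
    using W1_le_distr[OF M.prob_space_axioms, of "X y" "X y'"] by (simp add: law)
qed

section \<open>Dual transport bounds for perturbed mixtures\<close>

lemma kant_le_intro:
  assumes "0 \<le> c" and "\<And>\<phi> K. 0 \<le> K \<Longrightarrow> (\<And>x y. \<bar>\<phi> x - \<phi> y\<bar> \<le> K * norm (x - y)) \<Longrightarrow>
    (\<And>\<nu>. \<nu> \<in> P2 \<Longrightarrow> integrable \<nu> \<phi>) \<Longrightarrow> \<bar>int_diff \<nu>1 \<nu>2 \<phi>\<bar> \<le> K * c"
  shows "kant_le \<nu>1 \<nu>2 c"
  unfolding kant_le_def using assms by (blast intro: integrable_P2_lipschitz)

lemma kant_le_trans:
  assumes "kant_le \<nu>1 \<nu>2 c" "kant_le \<nu>2 \<nu>3 d"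
  shows "kant_le \<nu>1 \<nu>3 (c + d)"
proof (rule kant_le_intro)
  fix \<phi> :: "real^'a \<Rightarrow> real" and K :: real
  assume K: "0 \<le> K" "\<And>x y. \<bar>\<phi> x - \<phi> y\<bar> \<le> K * norm (x - y)"
  have "int_diff \<nu>1 \<nu>3 \<phi> = int_diff \<nu>1 \<nu>2 \<phi> + int_diff \<nu>2 \<nu>3 \<phi>" by (simp add: int_diff_def)
  then show "\<bar>int_diff \<nu>1 \<nu>3 \<phi>\<bar> \<le> K * (c + d)"
    using kant_leD[OF assms(1) K] kant_leD[OF assms(2) K] by (simp add: distrib_left)
qed (use assms in \<open>simp add: kant_le_def\<close>)

lemma kant_le_dmix_self:
  assumes "\<nu> \<in> P2" "0 \<le> e" "e \<le> 1" "kant_le (return borel y) \<nu> m"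
  shows "kant_le (dmix e y \<nu>) \<nu> (e * m)"
proof (rule kant_le_intro)
  fix \<phi> :: "real^'a \<Rightarrow> real" and K :: real
  assume K: "0 \<le> K" "\<And>x y. \<bar>\<phi> x - \<phi> y\<bar> \<le> K * norm (x - y)" and i: "\<And>\<nu>. \<nu> \<in> P2 \<Longrightarrow> integrable \<nu> \<phi>"
  have "\<phi> \<in> borel_measurable borel"
    using borel_measurable_integrable[OF i[OF dirac_P2[of 0]]] by simp
  moreover have "(\<integral>x. \<phi> x \<partial>dmix e y \<nu>) = e * \<phi> y + (1 - e) * (\<integral>x. \<phi> x \<partial>\<nu>)"
    by (rule integral_dmix[OF assms(1-3)]) (rule i)
  ultimately have "int_diff (dmix e y \<nu>) \<nu> \<phi> = e * int_diff (return borel y) \<nu> \<phi>"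
    unfolding int_diff_def by (simp add: integral_return algebra_simps)
  then show "\<bar>int_diff (dmix e y \<nu>) \<nu> \<phi>\<bar> \<le> K * (e * m)"
    using mult_left_mono[OF kant_leD[OF assms(4) K] assms(2)] assms(2) by (simp add: abs_mult mult_ac)
qed (use assms in \<open>simp add: kant_le_def\<close>)

lemma kant_le_dmix_points:
  assumes "\<nu> \<in> P2" "0 \<le> e" "e \<le> 1"
  shows "kant_le (dmix e y \<nu>) (dmix e y' \<nu>) (e * norm (y - y'))"
  using assms by (intro kant_le_if_W1_le W1_le_dmix dmix_P2)

text \<open>The signed difference of the two measures is \<open>(1 - e) * (s - s')\<close> times
  \<open>\<nu>1 - \<nu>2\<close>. The dual bound is linear in it and scales accordingly.\<close>

lemma kant_le_dmix_mix:
  assumes "\<nu>1 \<in> P2" "\<nu>2 \<in> P2" "0 \<le> e" "e \<le> 1" "0 \<le> s'" "s' \<le> s" "s \<le> 1" "kant_le \<nu>1 \<nu>2 \<rho>"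
  shows "kant_le (dmix e y (mix s \<nu>1 \<nu>2)) (dmix e y (mix s' \<nu>1 \<nu>2)) ((s - s') * \<rho>)"
proof (rule kant_le_intro)
  fix \<phi> :: "real^'a \<Rightarrow> real" and K :: real
  assume K: "0 \<le> K" "\<And>x y. \<bar>\<phi> x - \<phi> y\<bar> \<le> K * norm (x - y)" and i: "\<And>\<nu>. \<nu> \<in> P2 \<Longrightarrow> integrable \<nu> \<phi>"
  have m: "mix s \<nu>1 \<nu>2 \<in> P2" "mix s' \<nu>1 \<nu>2 \<in> P2" using assms by (auto intro: mix_P2)
  have s: "0 \<le> s" "s' \<le> 1" using assms by auto
  have d: "(\<integral>x. \<phi> x \<partial>dmix e y \<nu>) = e * \<phi> y + (1 - e) * (\<integral>x. \<phi> x \<partial>\<nu>)" if "\<nu> \<in> P2" for \<nu>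
    by (rule integral_dmix[OF that assms(3,4)]) (rule i)
  have x: "(\<integral>x. \<phi> x \<partial>mix s \<nu>1 \<nu>2) = s * (\<integral>x. \<phi> x \<partial>\<nu>1) + (1 - s) * (\<integral>x. \<phi> x \<partial>\<nu>2)"
    "(\<integral>x. \<phi> x \<partial>mix s' \<nu>1 \<nu>2) = s' * (\<integral>x. \<phi> x \<partial>\<nu>1) + (1 - s') * (\<integral>x. \<phi> x \<partial>\<nu>2)"
    by (rule integral_mix_P2[OF assms(1,2) s(1) assms(7) i] integral_mix_P2[OF assms(1,2,5) s(2) i], assumption)+
  have "int_diff (dmix e y (mix s \<nu>1 \<nu>2)) (dmix e y (mix s' \<nu>1 \<nu>2)) \<phi> = ((1 - e) * (s - s')) * int_diff \<nu>1 \<nu>2 \<phi>"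
    unfolding int_diff_def d[OF m(1)] d[OF m(2)] x
    by (simp add: algebra_simps)
  also have "\<bar>\<dots>\<bar> \<le> (1 * (s - s')) * (K * \<rho>)"
    unfolding abs_mult using assms kant_leD[OF assms(8) K] by (intro mult_mono) auto
  finally show "\<bar>int_diff (dmix e y (mix s \<nu>1 \<nu>2)) (dmix e y (mix s' \<nu>1 \<nu>2)) \<phi>\<bar> \<le> K * ((s - s') * \<rho>)"
    by (simp add: mult_ac)
qed (use assms in \<open>simp add: kant_le_def\<close>)

lemma kant_le_dirac:
  assumes "\<nu> \<in> P2" shows "\<exists>m. kant_le (return borel y) \<nu> m"
proof -
  have "kant_le \<nu> (return borel y) (\<integral>x. norm (x - y) \<partial>\<nu>)"
    using assms by (intro kant_le_if_W1_le W1_le_dirac dirac_P2)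
  then show ?thesis unfolding kant_le_def int_diff_def by (metis abs_minus_commute)
qed

lemma mix_0: "\<nu>1 \<in> P2 \<Longrightarrow> \<nu>2 \<in> P2 \<Longrightarrow> mix 0 \<nu>1 \<nu>2 = \<nu>2"
  and mix_1: "\<nu>1 \<in> P2 \<Longrightarrow> \<nu>2 \<in> P2 \<Longrightarrow> mix 1 \<nu>1 \<nu>2 = \<nu>1"
  by (auto intro!: measure_eqI simp: emeasure_mix sets_P2)

lemma le_if_le_plus_eps:
  fixes a b :: real
  assumes "0 < e0" "\<And>e. 0 < e \<Longrightarrow> e < e0 \<Longrightarrow> a \<le> b + K * e"
  shows "a \<le> b"
proof (rule tendsto_lowerbound)
  show "((\<lambda>e. b + K * e) \<longlongrightarrow> b) (at_right 0)" by (auto intro!: tendsto_eq_intros)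
  show "eventually (\<lambda>e. a \<le> b + K * e) (at_right 0)"
    using assms by (auto simp: eventually_at_right_field)
qed simp

lemma small_fraction:
  fixes m r :: real
  assumes "0 \<le> m" "r < m"
  shows "\<exists>e0>0. e0 \<le> 1 \<and> (\<forall>e. 0 < e \<longrightarrow> e < e0 \<longrightarrow> r < (1 - e) * m)"
proof (intro exI conjI allI impI)
  \<comment> \<open>The first moment \<open>m\<close> may be 0; the denominator \<open>m + 1\<close>
    stays positive.\<close>
  show "0 < min 1 ((m - r) / (m + 1))" using assms by simp
  fix e assume e: "0 < e" "e < min 1 ((m - r) / (m + 1))"
  then have "e * (m + 1) < m - r" using assms by (simp add: pos_less_divide_eq)
  then show "r < (1 - e) * m" using e(1) by (simp add: algebra_simps)
qed simp

section \<open>Expansions on the region where the first moment is at least a threshold\<close>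

context
  fixes h :: "(real^'n) measure \<Rightarrow> real" and D D2 and r L :: real
  assumes lfd: "is_lfd h D" and lfd2: "is_lfd2 h D D2" and L0: "0 \<le> L"
    and ml: "\<And>\<mu>. \<mu> \<in> P2 \<Longrightarrow> r \<le> moment1 \<mu> \<Longrightarrow> mixed_lipschitz L (D2 \<mu>)"
begin

text \<open>\<open>moment1\<close> is affine along mixtures, so the segment between two measures
  above the threshold stays above it.\<close>

lemma lfd_taylor:
  assumes "\<mu> \<in> P2" "\<nu> \<in> P2" "r \<le> moment1 \<mu>" "r \<le> moment1 \<nu>" "kant_le \<mu> \<nu> c"
  shows "\<bar>h \<mu> - h \<nu> - int_diff \<mu> \<nu> (D \<nu>)\<bar> \<le> L * c\<^sup>2"
proof (rule lfd2_taylor[OF lfd2 assms(1,2,5) L0])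
  fix \<theta> :: real assume \<theta>: "0 \<le> \<theta>" "\<theta> \<le> 1"
  have "r = \<theta> * r + (1 - \<theta>) * r" by (simp add: algebra_simps)
  also have "\<dots> \<le> \<theta> * moment1 \<mu> + (1 - \<theta>) * moment1 \<nu>"
    using assms \<theta> by (intro add_mono mult_left_mono) auto
  finally show "mixed_lipschitz L (D2 (mix \<theta> \<mu> \<nu>))"
    using assms \<theta> by (intro ml mix_P2) (auto simp: moment1_mix)
qed

text \<open>Both perturbations are expanded around \<open>\<nu>\<close>, and the mean of
  \<open>D \<nu>\<close> drops out of their difference. \<open>K\<close> may depend on the measure
  and the points; only its independence of \<open>e\<close> matters.\<close>

lemma dmix_expansion:
  assumes "\<nu> \<in> P2"
  shows "\<exists>K. \<forall>e. 0 < e \<longrightarrow> e \<le> 1 \<longrightarrow> r \<le> (1 - e) * moment1 \<nu> \<longrightarrow>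
    \<bar>h (dmix e y' \<nu>) - h (dmix e y \<nu>) - e * (D \<nu> y' - D \<nu> y)\<bar> \<le> K * e\<^sup>2"
proof -
  obtain m' m where m: "kant_le (return borel y') \<nu> m'" "kant_le (return borel y) \<nu> m"
    using kant_le_dirac[OF assms] by blast
  have one: "\<bar>h (dmix e z \<nu>) - h \<nu> - e * (D \<nu> z - (\<integral>x. D \<nu> x \<partial>\<nu>))\<bar> \<le> L * (e * m)\<^sup>2"
    if e: "0 < e" "e \<le> 1" "r \<le> (1 - e) * moment1 \<nu>" and m: "kant_le (return borel z) \<nu> m" for e z m
  proof -
    have e': "0 \<le> e" using e by simp
    have i: "integrable \<mu> (D \<nu>)" if "\<mu> \<in> P2" for \<mu> using is_lfd_integrable[OF lfd assms that] .
    have "(\<integral>x. D \<nu> x \<partial>dmix e z \<nu>) = e * D \<nu> z + (1 - e) * (\<integral>x. D \<nu> x \<partial>\<nu>)"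
      by (rule integral_dmix[OF assms e' e(2)]) (rule i)
    then have "int_diff (dmix e z \<nu>) \<nu> (D \<nu>) = e * (D \<nu> z - (\<integral>x. D \<nu> x \<partial>\<nu>))"
      by (simp add: int_diff_def algebra_simps)
    moreover have "(1 - e) * moment1 \<nu> \<le> 1 * moment1 \<nu>"
      using e moment1_nonneg by (intro mult_right_mono) auto
    ultimately show ?thesis
      using lfd_taylor[OF dmix_P2[OF assms e' e(2)] assms _ _ kant_le_dmix_self[OF assms e' e(2) m]]
        moment1_dmix[OF assms e' e(2), of z] e(3) by force
  qed
  show ?thesis
  proof (intro exI allI impI)
    fix e :: real assume e: "0 < e" "e \<le> 1" "r \<le> (1 - e) * moment1 \<nu>"
    show "\<bar>h (dmix e y' \<nu>) - h (dmix e y \<nu>) - e * (D \<nu> y' - D \<nu> y)\<bar> \<le> (L * m'\<^sup>2 + L * m\<^sup>2) * e\<^sup>2"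
      using one[OF e m(1)] one[OF e m(2)] by (simp add: power_mult_distrib algebra_simps)
  qed
qed

text \<open>The second difference of \<open>h\<close> over the two-parameter family \<open>dmix e z (mix s \<nu>1 \<nu>2)\<close> is summed
  over cells of equal size \<open>e |y' - y|\<close> in both directions; on each cell the first-order terms cancel.\<close>

lemma lfd_increment_lipschitz:
  assumes P2: "\<nu>1 \<in> P2" "\<nu>2 \<in> P2" and \<rho>: "kant_le \<nu>1 \<nu>2 \<rho>" and m: "r < moment1 \<nu>1" "r < moment1 \<nu>2"
  shows "\<bar>D \<nu>1 y' - D \<nu>1 y - (D \<nu>2 y' - D \<nu>2 y)\<bar> \<le> 6 * L * \<rho> * norm (y' - y)"
proof (cases "y' = y")
  case True
  then show ?thesis by simp
next
  case False
  define q where "q = norm (y' - y)"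
  have q: "0 < q" using False by (simp add: q_def)
  have \<rho>0: "0 \<le> \<rho>" using \<rho> by (simp add: kant_le_def)
  define A where "A e z s = dmix e z (mix s \<nu>1 \<nu>2)" for e z s
  obtain e0 where e0: "0 < e0" "e0 \<le> 1" "\<And>e. 0 < e \<Longrightarrow> e < e0 \<Longrightarrow> r < (1 - e) * min (moment1 \<nu>1) (moment1 \<nu>2)"
    using small_fraction[of "min (moment1 \<nu>1) (moment1 \<nu>2)" r] m moment1_nonneg[of \<nu>1] moment1_nonneg[of \<nu>2] by auto
  obtain K1 where K1: "\<And>e. 0 < e \<Longrightarrow> e \<le> 1 \<Longrightarrow> r \<le> (1 - e) * moment1 \<nu>1 \<Longrightarrow>
    \<bar>h (dmix e y' \<nu>1) - h (dmix e y \<nu>1) - e * (D \<nu>1 y' - D \<nu>1 y)\<bar> \<le> K1 * e\<^sup>2"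
    using dmix_expansion[OF P2(1), of y' y] by blast
  obtain K2 where K2: "\<And>e. 0 < e \<Longrightarrow> e \<le> 1 \<Longrightarrow> r \<le> (1 - e) * moment1 \<nu>2 \<Longrightarrow>
    \<bar>h (dmix e y' \<nu>2) - h (dmix e y \<nu>2) - e * (D \<nu>2 y' - D \<nu>2 y)\<bar> \<le> K2 * e\<^sup>2"
    using dmix_expansion[OF P2(2), of y' y] by blast
  have "\<bar>D \<nu>1 y' - D \<nu>1 y - (D \<nu>2 y' - D \<nu>2 y)\<bar> \<le> 6 * L * \<rho> * q + (6 * L * q\<^sup>2 + K1 + K2) * e"
    if e: "0 < e" "e < e0" for e
  proof -
    have e1: "0 \<le> e" "e \<le> 1" using e e0 by auto
    have mom: "r < (1 - e) * min (moment1 \<nu>1) (moment1 \<nu>2)" by (rule e0(3)[OF e])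
    have Amom: "r \<le> moment1 (A e z s)" and A: "A e z s \<in> P2" and Mx: "mix s \<nu>1 \<nu>2 \<in> P2"
      if "0 \<le> s" "s \<le> 1" for z s
    proof -
      show Mx: "mix s \<nu>1 \<nu>2 \<in> P2" using that P2 by (simp add: mix_P2)
      then show "A e z s \<in> P2" using e1 unfolding A_def by (intro dmix_P2)
      have "min (moment1 \<nu>1) (moment1 \<nu>2) = s * min (moment1 \<nu>1) (moment1 \<nu>2) + (1 - s) * min (moment1 \<nu>1) (moment1 \<nu>2)"
        by (simp add: algebra_simps)
      also have "\<dots> \<le> moment1 (mix s \<nu>1 \<nu>2)"
        unfolding moment1_mix[OF P2 that] using that by (intro add_mono mult_left_mono) auto
      finally have "(1 - e) * min (moment1 \<nu>1) (moment1 \<nu>2) \<le> (1 - e) * moment1 (mix s \<nu>1 \<nu>2)"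
        using e1 by (intro mult_left_mono) auto
      with moment1_dmix[OF Mx e1, of z] mom show "r \<le> moment1 (A e z s)" unfolding A_def by linarith
    qed
    \<comment> \<open>All three expansions start from the same corner \<open>A e y s'\<close>. The
      signed measure to the opposite corner is the sum of those to the two adjacent corners, so the
      first-order terms cancel. The diagonal costs \<open>2 * (e * q)\<close>, hence 6 = 4 + 1 +
      1.\<close>
    have cell: "\<bar>h (A e y' s) - h (A e y s) - (h (A e y' s') - h (A e y s'))\<bar> \<le> 6 * L * (e * q)\<^sup>2"
      if s: "0 \<le> s'" "s' \<le> s" "s \<le> 1" and \<tau>: "(s - s') * \<rho> \<le> e * q" for s s'
    proof -
      have s': "0 \<le> s" "s' \<le> 1" using s by auto
      have k1: "kant_le (A e y' s') (A e y s') (e * q)"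
        unfolding A_def q_def by (rule kant_le_dmix_points[OF Mx[OF s(1) s'(2)] e1])
      have k2: "kant_le (A e z s) (A e z s') (e * q)" for z
        unfolding A_def by (rule kant_le_mono[OF kant_le_dmix_mix[OF P2 e1 s \<rho>] \<tau>])
      have k3: "kant_le (A e y' s) (A e y s') (e * q + e * q)" by (rule kant_le_trans[OF k2 k1])
      have t1: "\<bar>h (A e y' s') - h (A e y s') - int_diff (A e y' s') (A e y s') (D (A e y s'))\<bar> \<le> L * (e * q)\<^sup>2"
        using s s' by (intro lfd_taylor A Amom k1)
      have t2: "\<bar>h (A e y s) - h (A e y s') - int_diff (A e y s) (A e y s') (D (A e y s'))\<bar> \<le> L * (e * q)\<^sup>2"
        using s s' by (intro lfd_taylor A Amom k2)
      have t3: "\<bar>h (A e y' s) - h (A e y s') - int_diff (A e y' s) (A e y s') (D (A e y s'))\<bar> \<le> L * (e * q + e * q)\<^sup>2"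
        using s s' by (intro lfd_taylor A Amom k3)
      define \<phi> where "\<phi> = D (A e y s')"
      have i: "integrable \<mu> \<phi>" if "\<mu> \<in> P2" for \<mu>
        unfolding \<phi>_def using that s s' by (intro is_lfd_integrable[OF lfd] A)
      have d: "(\<integral>x. \<phi> x \<partial>A e z s) = e * \<phi> z + (1 - e) * (\<integral>x. \<phi> x \<partial>mix s \<nu>1 \<nu>2)" if "0 \<le> s" "s \<le> 1" for z s
        unfolding A_def by (rule integral_dmix[OF Mx[OF that] e1]) (rule i)
      have "int_diff (A e y' s) (A e y s') \<phi> = int_diff (A e y' s') (A e y s') \<phi> + int_diff (A e y s) (A e y s') \<phi>"
        unfolding int_diff_def d[OF s(1) s'(2)] d[OF s'(1) s(3)] by (simp add: algebra_simps)
      then have "\<bar>h (A e y' s) - h (A e y s) - (h (A e y' s') - h (A e y s'))\<bar> \<le>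
        L * (e * q + e * q)\<^sup>2 + L * (e * q)\<^sup>2 + L * (e * q)\<^sup>2"
        using t1 t2 t3 unfolding \<phi>_def[symmetric] by linarith
      also have "\<dots> = 6 * L * (e * q)\<^sup>2" by (simp add: power2_eq_square algebra_simps)
      finally show ?thesis .
    qed
    \<comment> \<open>The remainder is quadratic in the side lengths, so one cell of length
      \<open>\<rho>\<close> would leave an error that does not shrink with \<open>e\<close>. With
      about \<open>\<rho> / (e * q)\<close> cells the total error is linear in \<open>e\<close>, as
      required before dividing by \<open>e\<close>. The added 1 also covers
      \<open>\<rho> = 0\<close>.\<close>
    define N where "N = nat \<lfloor>\<rho> / (e * q)\<rfloor> + 1"
    have eq: "0 < e * q" using e q by simp
    have N: "\<rho> / (e * q) \<le> real N" "real N \<le> \<rho> / (e * q) + 1"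
    proof -
      have "0 \<le> \<rho> / (e * q)" using \<rho>0 eq by simp
      then have "real N = real_of_int \<lfloor>\<rho> / (e * q)\<rfloor> + 1" by (simp add: N_def)
      then show "\<rho> / (e * q) \<le> real N" "real N \<le> \<rho> / (e * q) + 1" by linarith+
    qed
    have N0: "0 < real N" by (simp add: N_def)
    define G where "G s = h (A e y' s) - h (A e y s)" for s
    have "\<bar>G (real k / real N) - G 0\<bar> \<le> real k * (6 * L * (e * q)\<^sup>2)" if "k \<le> N" for k
      using that
    proof (induction k)
      case 0
      then show ?case by simp
    next
      case (Suc k)
      have "\<bar>G (real (Suc k) / real N) - G (real k / real N)\<bar> \<le> 6 * L * (e * q)\<^sup>2"
        unfolding G_def
      proof (rule cell)
        have "real (Suc k) / real N - real k / real N = 1 / real N"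
          by (simp add: diff_divide_distrib[symmetric])
        moreover have "\<rho> \<le> real N * (e * q)" using N(1) eq by (simp add: pos_divide_le_eq)
        then have "1 / real N * \<rho> \<le> e * q" using N0 by (simp add: pos_divide_le_eq mult_ac)
        ultimately show "(real (Suc k) / real N - real k / real N) * \<rho> \<le> e * q" by simp
      qed (use Suc.prems N0 in \<open>auto simp: divide_simps\<close>)
      then show ?case using Suc by (simp add: algebra_simps)
    qed
    from this[of N] have "\<bar>G 1 - G 0\<bar> \<le> real N * (6 * L * (e * q)\<^sup>2)" using N0 by simp
    also have "\<dots> \<le> (\<rho> / (e * q) + 1) * (6 * L * (e * q)\<^sup>2)"
      using N(2) L0 by (intro mult_right_mono) auto
    also have "\<dots> = 6 * L * (\<rho> * (e * q)) + 6 * L * (e * q)\<^sup>2"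
      using eq by (simp add: distrib_right power2_eq_square)
    finally have G: "\<bar>G 1 - G 0\<bar> \<le> 6 * L * (\<rho> * (e * q)) + 6 * L * (e * q)\<^sup>2" .
    have "(1 - e) * min (moment1 \<nu>1) (moment1 \<nu>2) \<le> (1 - e) * moment1 \<nu>1"
      "(1 - e) * min (moment1 \<nu>1) (moment1 \<nu>2) \<le> (1 - e) * moment1 \<nu>2"
      using e1 by (auto intro!: mult_left_mono)
    then have "r \<le> (1 - e) * moment1 \<nu>1" "r \<le> (1 - e) * moment1 \<nu>2" using mom by linarith+
    then have "\<bar>G 1 - e * (D \<nu>1 y' - D \<nu>1 y)\<bar> \<le> K1 * e\<^sup>2" "\<bar>G 0 - e * (D \<nu>2 y' - D \<nu>2 y)\<bar> \<le> K2 * e\<^sup>2"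
      using K1[OF e(1) e1(2)] K2[OF e(1) e1(2)] by (simp_all add: G_def A_def mix_0[OF P2] mix_1[OF P2])
    with G have "\<bar>e * (D \<nu>1 y' - D \<nu>1 y) - e * (D \<nu>2 y' - D \<nu>2 y)\<bar> \<le>
      6 * L * (\<rho> * (e * q)) + 6 * L * (e * q)\<^sup>2 + K1 * e\<^sup>2 + K2 * e\<^sup>2" by linarith
    moreover have "e * (D \<nu>1 y' - D \<nu>1 y) - e * (D \<nu>2 y' - D \<nu>2 y) = e * (D \<nu>1 y' - D \<nu>1 y - (D \<nu>2 y' - D \<nu>2 y))"
      by (simp add: algebra_simps)
    ultimately have "\<bar>e * (D \<nu>1 y' - D \<nu>1 y - (D \<nu>2 y' - D \<nu>2 y))\<bar> \<le>
      6 * L * (\<rho> * (e * q)) + 6 * L * (e * q)\<^sup>2 + K1 * e\<^sup>2 + K2 * e\<^sup>2" by (simp only:)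
    also have "\<dots> = e * (6 * L * \<rho> * q + (6 * L * q\<^sup>2 + K1 + K2) * e)"
      by (simp add: power2_eq_square algebra_simps)
    finally have "e * \<bar>D \<nu>1 y' - D \<nu>1 y - (D \<nu>2 y' - D \<nu>2 y)\<bar> \<le>
      e * (6 * L * \<rho> * q + (6 * L * q\<^sup>2 + K1 + K2) * e)"
      using e(1) by (simp only: abs_mult abs_of_pos)
    then show ?thesis using e(1) by (simp add: mult_le_cancel_left_pos)
  qed
  from le_if_le_plus_eps[OF e0(1) this] show ?thesis by (simp add: q_def)
qed

end

text \<open>Symmetry of mixed second derivatives: a Lipschitz bound for the measure increments of
  \<open>h - h'\<close> is a bound for the increments of \<open>D - D'\<close>.\<close>

lemma lfd_increment_from_W1:
  fixes h :: "(real^'n) measure \<Rightarrow> real"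
  assumes lfd: "is_lfd h D" "is_lfd2 h D D2" "is_lfd h' D'" "is_lfd2 h' D' D2'" and L0: "0 \<le> L"
    and ml: "\<And>\<mu>. \<mu> \<in> P2 \<Longrightarrow> mixed_lipschitz L (D2 \<mu>)" "\<And>\<mu>. \<mu> \<in> P2 \<Longrightarrow> mixed_lipschitz L (D2' \<mu>)"
    and lip: "\<And>\<mu> \<mu>' c. \<mu> \<in> P2 \<Longrightarrow> \<mu>' \<in> P2 \<Longrightarrow> W1_le \<mu> \<mu>' c \<Longrightarrow> r < moment1 \<mu> - c \<Longrightarrow>
      \<bar>h \<mu> - h' \<mu> - (h \<mu>' - h' \<mu>')\<bar> \<le> B * c"
    and \<nu>: "\<nu> \<in> P2" "r < moment1 \<nu>"
  shows "\<bar>D \<nu> y' - D' \<nu> y' - (D \<nu> y - D' \<nu> y)\<bar> \<le> B * norm (y' - y)"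
proof -
  obtain K where K: "\<And>e. 0 < e \<Longrightarrow> e \<le> 1 \<Longrightarrow>
    \<bar>h (dmix e y' \<nu>) - h (dmix e y \<nu>) - e * (D \<nu> y' - D \<nu> y)\<bar> \<le> K * e\<^sup>2"
    using dmix_expansion[OF lfd(1,2) L0 ml(1) \<nu>(1), of 0 y' y] moment1_nonneg[of \<nu>] by auto
  obtain K' where K': "\<And>e. 0 < e \<Longrightarrow> e \<le> 1 \<Longrightarrow>
    \<bar>h' (dmix e y' \<nu>) - h' (dmix e y \<nu>) - e * (D' \<nu> y' - D' \<nu> y)\<bar> \<le> K' * e\<^sup>2"
    using dmix_expansion[OF lfd(3,4) L0 ml(2) \<nu>(1), of 0 y' y] moment1_nonneg[of \<nu>] by auto
  define q where "q = norm (y' - y)"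
  have q: "0 \<le> q" by (simp add: q_def)
  \<comment> \<open>For \<open>e\<close> below \<open>e0\<close> the first moment after the
    perturbation exceeds \<open>r\<close> even when the transport cost \<open>e * q\<close> is
    subtracted.\<close>
  define e0 where "e0 = min 1 ((moment1 \<nu> - r) / (moment1 \<nu> + q + 1))"
  have p: "0 < moment1 \<nu> + q + 1" using moment1_nonneg[of \<nu>] q by simp
  have e0: "0 < e0" unfolding e0_def using p \<nu>(2) by simp
  have "\<bar>D \<nu> y' - D' \<nu> y' - (D \<nu> y - D' \<nu> y)\<bar> \<le> B * q + (K + K') * e" if e: "0 < e" "e < e0" for e
  proof -
    have e1: "0 \<le> e" "e \<le> 1" using e e0_def by auto
    have "e * (moment1 \<nu> + q + 1) < moment1 \<nu> - r"
      using e p by (simp add: e0_def pos_less_divide_eq)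
    then have "r < (1 - e) * moment1 \<nu> - e * q" using e(1) by (simp add: algebra_simps)
    then have r: "r < moment1 (dmix e y' \<nu>) - e * q"
      using moment1_dmix[OF \<nu>(1) e1, of y'] by linarith
    have "\<bar>h (dmix e y' \<nu>) - h' (dmix e y' \<nu>) - (h (dmix e y \<nu>) - h' (dmix e y \<nu>))\<bar> \<le> B * (e * q)"
      by (intro lip dmix_P2 \<nu> e1 r) (simp add: q_def W1_le_dmix[OF \<nu>(1) e1])
    then have "\<bar>e * (D \<nu> y' - D \<nu> y) - e * (D' \<nu> y' - D' \<nu> y)\<bar> \<le> B * (e * q) + K * e\<^sup>2 + K' * e\<^sup>2"
      using K[OF e(1) e1(2)] K'[OF e(1) e1(2)] by linarith
    moreover have "e * (D \<nu> y' - D \<nu> y) - e * (D' \<nu> y' - D' \<nu> y) = e * (D \<nu> y' - D' \<nu> y' - (D \<nu> y - D' \<nu> y))"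
      by (simp add: algebra_simps)
    ultimately have "\<bar>e * (D \<nu> y' - D' \<nu> y' - (D \<nu> y - D' \<nu> y))\<bar> \<le> B * (e * q) + K * e\<^sup>2 + K' * e\<^sup>2"
      by (simp only:)
    also have "\<dots> = e * (B * q + (K + K') * e)" by (simp add: power2_eq_square algebra_simps)
    finally have "e * \<bar>D \<nu> y' - D' \<nu> y' - (D \<nu> y - D' \<nu> y)\<bar> \<le> e * (B * q + (K + K') * e)"
      using e(1) by (simp only: abs_mult abs_of_pos)
    then show ?thesis using e(1) by (simp add: mult_le_cancel_left_pos)
  qed
  from le_if_le_plus_eps[OF e0 this] show ?thesis by (simp add: q_def)
qed

section \<open>Lipschitz estimates for the derivatives of the coefficients\<close>

lemma fderiv_has_derivative:
  assumes "F differentiable (at x)"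
  shows "(F has_derivative blinfun_apply (fderiv F x)) (at x)"
proof -
  have "(F has_derivative frechet_derivative F (at x)) (at x)"
    using assms by (simp add: frechet_derivative_works)
  then show ?thesis
    unfolding fderiv_def by (simp add: bounded_linear_Blinfun_apply has_derivative_bounded_linear)
qed

lemma fderiv_eqI:
  assumes "(F has_derivative blinfun_apply A) (at x)" shows "fderiv F x = A"
  by (metis assms blinfun_apply_inject differentiableI fderiv_has_derivative has_derivative_unique)

lemma fderiv_bound:
  fixes F :: "'a::real_normed_vector \<Rightarrow> 'b::real_normed_vector"
  assumes "\<And>u. F differentiable (at u)" and "\<And>u. u \<in> closed_segment x x' \<Longrightarrow> norm (fderiv F u) \<le> B"
  shows "norm (F x - F x') \<le> B * norm (x - x')"
proof (rule differentiable_bound[where S = "closed_segment x x'" and f' = "\<lambda>u. blinfun_apply (fderiv F u)"])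
  show "(F has_derivative blinfun_apply (fderiv F u)) (at u within closed_segment x x')" for u
    using fderiv_has_derivative[OF assms(1)] by (rule has_derivative_at_withinI)
  show "onorm (blinfun_apply (fderiv F u)) \<le> B" if "u \<in> closed_segment x x'" for u
    using assms(2)[OF that] by (simp add: norm_blinfun.rep_eq)
qed auto

text \<open>Difference quotients of \<open>F - G\<close> at \<open>x\<close>. A local bound on a
  second difference thus becomes a bound on the difference of two derivatives, without
  differentiating in the variable that separates \<open>F\<close> from \<open>G\<close>.\<close>

lemma fderiv_diff_le:
  fixes F G :: "'a::real_normed_vector \<Rightarrow> 'b::real_normed_vector"
  assumes "F differentiable (at x)" "G differentiable (at x)" "0 \<le> B" "0 < e0"
    and "\<And>u. norm (u - x) < e0 \<Longrightarrow> norm (F u - G u - (F x - G x)) \<le> B * norm (u - x)"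
  shows "norm (fderiv F x - fderiv G x) \<le> B"
proof (rule norm_blinfun_bound[OF \<open>0 \<le> B\<close>])
  fix v
  define A where "A = fderiv F x - fderiv G x"
  define H where "H u = F u - G u" for u
  have "((\<lambda>u. F u - G u) has_derivative (\<lambda>v. blinfun_apply (fderiv F x) v - blinfun_apply (fderiv G x) v)) (at x)"
    by (intro has_derivative_diff fderiv_has_derivative assms)
  then have H: "(H has_derivative blinfun_apply A) (at x)"
    by (simp add: A_def H_def[abs_def] blinfun.diff_left[abs_def])
  have "norm (A v) \<le> B * norm v + norm v * e" if "0 < e" "e < 1" for e
  proof -
    obtain d where d: "d > 0" "\<And>y. norm (y - x) < d \<Longrightarrow> norm (H y - H x - A (y - x)) \<le> e * norm (y - x)"
      using H \<open>0 < e\<close> unfolding has_derivative_within_alt by fastforce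
    \<comment> \<open>The step \<open>s *\<^sub>R v\<close> is scaled to lie within both radii,
      \<open>d\<close> from differentiability and \<open>e0\<close> from the assumption.\<close>
    define s where "s = min d e0 / (2 * (norm v + 1))"
    have nv: "0 < norm v + 1" using norm_ge_zero[of v] by linarith
    have s: "0 < s" using d(1) \<open>0 < e0\<close> nv by (simp add: s_def)
    have "s * norm v < min d e0"
    proof -
      have "s * (2 * (norm v + 1)) = min d e0" using nv by (simp add: s_def)
      moreover have "s * norm v < s * (2 * (norm v + 1))" using s nv by (intro mult_strict_left_mono) auto
      ultimately show ?thesis by simp
    qed
    then have u: "norm ((x + s *\<^sub>R v) - x) < d" "norm ((x + s *\<^sub>R v) - x) < e0" using s by auto
    have "norm (H (x + s *\<^sub>R v) - H x) \<le> B * (s * norm v)"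
      using assms(5)[OF u(2)] s by (simp add: H_def)
    moreover have "norm (H (x + s *\<^sub>R v) - H x - A (s *\<^sub>R v)) \<le> e * (s * norm v)"
      using d(2)[OF u(1)] s by simp
    ultimately have "norm (A (s *\<^sub>R v)) \<le> B * (s * norm v) + e * (s * norm v)"
      using norm_triangle_ineq4[of "H (x + s *\<^sub>R v) - H x" "H (x + s *\<^sub>R v) - H x - A (s *\<^sub>R v)"] by simp
    then have "s * norm (A v) \<le> s * (B * norm v + norm v * e)"
      using s by (simp add: blinfun.scaleR_right algebra_simps)
    then show ?thesis using s by simp
  qed
  from le_if_le_plus_eps[OF zero_less_one this]
  show "norm (blinfun_apply (fderiv F x - fderiv G x) v) \<le> B * norm v" by (simp add: A_def)
qed

text \<open>Linear functional derivatives belong to scalar functions, so estimates for vector-valued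
  coefficients pass through coordinates. The factors \<open>DIM('v)\<close> arise here.\<close>

lemma norm_le_components:
  fixes x :: "'v::euclidean_space" and B :: real
  assumes "\<And>b. b \<in> Basis \<Longrightarrow> \<bar>x \<bullet> b\<bar> \<le> B"
  shows "norm x \<le> DIM('v) * B"
  using order_trans[OF norm_le_l1 sum_bounded_above[of Basis "\<lambda>b. \<bar>x \<bullet> b\<bar>" B]] assms by auto

lemma differentiable_components:
  fixes F :: "'a::real_normed_vector \<Rightarrow> 'v::euclidean_space"
  assumes "\<And>b. b \<in> Basis \<Longrightarrow> (\<lambda>x. F x \<bullet> b) differentiable (at x)"
  shows "F differentiable (at x)"
  using differentiable_componentwise_within[of F x UNIV] assms by simp

lemma fderiv_inner:
  assumes "F differentiable (at x)"
  shows "fderiv (\<lambda>x. F x \<bullet> b) x = blinfun_inner_left b o\<^sub>L fderiv F x"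
proof (rule fderiv_eqI)
  have "blinfun_apply (blinfun_inner_left b o\<^sub>L fderiv F x) = (\<lambda>v. fderiv F x v \<bullet> b)"
    by (rule ext) simp
  then show "((\<lambda>x. F x \<bullet> b) has_derivative blinfun_apply (blinfun_inner_left b o\<^sub>L fderiv F x)) (at x)"
    using has_derivative_inner_left[OF fderiv_has_derivative[OF assms], of b] by simp
qed

text \<open>Regularity in the measure is known for components, while \<open>D_mu\<close> is operator
  valued. \<open>G\<close> is reassembled from its finitely many compositions with coordinate
  functionals.\<close>

lemma blinfun_differentiable_components:
  fixes G :: "'a::real_normed_vector \<Rightarrow> 'c::real_normed_vector \<Rightarrow>\<^sub>L 'v::euclidean_space"
  assumes "\<And>b. b \<in> Basis \<Longrightarrow> (\<lambda>x. blinfun_inner_left b o\<^sub>L G x) differentiable (at x)"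
  shows "G differentiable (at x)"
proof -
  have "G = (\<lambda>x. \<Sum>b\<in>Basis. blinfun_scaleR_left b o\<^sub>L (blinfun_inner_left b o\<^sub>L G x))"
    by (rule ext, rule blinfun_eqI) (simp add: blinfun.sum_left euclidean_representation)
  moreover have "(\<lambda>x. \<Sum>b\<in>Basis. blinfun_scaleR_left b o\<^sub>L (blinfun_inner_left b o\<^sub>L G x)) differentiable (at x)"
  proof (rule differentiable_sum, simp, intro ballI)
    fix b :: 'v assume "b \<in> Basis"
    then obtain D where "((\<lambda>x. blinfun_inner_left b o\<^sub>L G x) has_derivative D) (at x)"
      using assms unfolding differentiable_def by blast
    from bounded_linear.has_derivative[OF bounded_bilinear.bounded_linear_right[OF bounded_bilinear_blinfun_compose] this]
    show "(\<lambda>x. blinfun_scaleR_left b o\<^sub>L (blinfun_inner_left b o\<^sub>L G x)) differentiable (at x)"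
      by (rule differentiableI)
  qed
  ultimately show ?thesis by simp
qed

text \<open>\<open>h\<close> and \<open>h'\<close> stand for one coefficient at two states or two
  controls: a mixed second difference in \<open>y\<close> and that variable becomes one in the
  measure and that variable.\<close>

lemma lfd_lipschitz_diff:
  assumes "is_lfd h D" "is_lfd h' D'" "\<nu>1 \<in> P2" "\<nu>2 \<in> P2" "kant_le \<nu>1 \<nu>2 c" "0 \<le> L"
    and "\<And>\<theta> y y'. 0 \<le> \<theta> \<Longrightarrow> \<theta> \<le> 1 \<Longrightarrow>
      \<bar>D (mix \<theta> \<nu>1 \<nu>2) y - D' (mix \<theta> \<nu>1 \<nu>2) y - (D (mix \<theta> \<nu>1 \<nu>2) y' - D' (mix \<theta> \<nu>1 \<nu>2) y')\<bar> \<le> L * norm (y - y')"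
  shows "\<bar>h \<nu>1 - h \<nu>2 - (h' \<nu>1 - h' \<nu>2)\<bar> \<le> L * c"
proof -
  have "((\<lambda>\<theta>. int_diff \<nu>1 \<nu>2 (D (mix \<theta> \<nu>1 \<nu>2))) has_integral (h \<nu>1 - h \<nu>2)) {0..1}"
    "((\<lambda>\<theta>. int_diff \<nu>1 \<nu>2 (D' (mix \<theta> \<nu>1 \<nu>2))) has_integral (h' \<nu>1 - h' \<nu>2)) {0..1}"
    using assms by (auto simp: is_lfd_def)
  from has_integral_diff[OF this]
  have I: "((\<lambda>\<theta>. int_diff \<nu>1 \<nu>2 (D (mix \<theta> \<nu>1 \<nu>2)) - int_diff \<nu>1 \<nu>2 (D' (mix \<theta> \<nu>1 \<nu>2)))
    has_integral (h \<nu>1 - h \<nu>2 - (h' \<nu>1 - h' \<nu>2))) {0..1}" .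
  have L0: "0 \<le> L * c" using assms by (auto simp: kant_le_def)
  have "\<bar>int_diff \<nu>1 \<nu>2 (D (mix \<theta> \<nu>1 \<nu>2)) - int_diff \<nu>1 \<nu>2 (D' (mix \<theta> \<nu>1 \<nu>2))\<bar> \<le> L * c"
    if "0 \<le> \<theta>" "\<theta> \<le> 1" for \<theta>
  proof -
    have m: "mix \<theta> \<nu>1 \<nu>2 \<in> P2" using assms that by (simp add: mix_P2)
    have "int_diff \<nu>1 \<nu>2 (D (mix \<theta> \<nu>1 \<nu>2)) - int_diff \<nu>1 \<nu>2 (D' (mix \<theta> \<nu>1 \<nu>2)) =
      int_diff \<nu>1 \<nu>2 (\<lambda>y. D (mix \<theta> \<nu>1 \<nu>2) y - D' (mix \<theta> \<nu>1 \<nu>2) y)"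
      by (rule int_diff_diff[symmetric]) (rule is_lfd_integrable[OF assms(1) m] is_lfd_integrable[OF assms(2) m] assms, assumption?)+
    also have "\<bar>\<dots>\<bar> \<le> L * c" by (rule kant_leD[OF assms(5,6)]) (rule assms(7)[OF that])
    finally show ?thesis .
  qed
  then show ?thesis using has_integral_bound_real[OF L0 finite.emptyI I] by auto
qed

definition weight :: "real \<Rightarrow> real^'n \<Rightarrow> (real^'n) measure \<Rightarrow> real" where
  "weight \<omega> x \<mu> = 1 + \<omega> * (norm x + moment1 \<mu>)"

lemma weight_ge_1: "0 \<le> \<omega> \<Longrightarrow> 1 \<le> weight \<omega> x \<mu>"
  by (simp add: weight_def moment1_nonneg)

lemma weight_ge:
  assumes "0 \<le> \<omega>" "norm (x - u) \<le> s" "moment1 \<mu> - s' \<le> moment1 \<nu>"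
  shows "weight \<omega> x \<mu> - \<omega> * (s + s') \<le> weight \<omega> u \<nu>"
proof -
  have "norm x - s \<le> norm u" using assms(2) norm_triangle_ineq2[of x u] by linarith
  then have "\<omega> * (norm x + moment1 \<mu> - (s + s')) \<le> \<omega> * (norm u + moment1 \<nu>)"
    using assms by (intro mult_left_mono) auto
  then show ?thesis by (simp add: weight_def algebra_simps)
qed

text \<open>The common structure of the drift (with \<open>\<omega> = 1\<close>) and the running cost (with \<open>\<omega> = 0\<close>):
  second-order derivatives are bounded by \<open>l / weight\<close>; the mixed ones in \<open>(x, \<alpha>)\<close> and \<open>(\<mu>, \<alpha>)\<close>
  enter through second differences, which do not depend on the order of differentiation.\<close>

locale coefficient =
  fixes F :: "real^'n \<Rightarrow> (real^'n) measure \<Rightarrow> real^'k \<Rightarrow> 'v::euclidean_space"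
    and dF :: "real^'n \<Rightarrow> (real^'n) measure \<Rightarrow> real^'k \<Rightarrow> real^'n \<Rightarrow> 'v"
    and d2F :: "real^'n \<Rightarrow> (real^'n) measure \<Rightarrow> real^'k \<Rightarrow> real^'n \<Rightarrow> real^'n \<Rightarrow> 'v"
    and \<omega> l :: real
  assumes omega: "0 \<le> \<omega>" "\<omega> \<le> 1" and l: "0 \<le> l"
    and regular: "\<And>x a b. b \<in> Basis \<Longrightarrow>
      regular2 (\<lambda>\<mu>. F x \<mu> a \<bullet> b) (\<lambda>\<mu> y. dF x \<mu> a y \<bullet> b) (\<lambda>\<mu> y w. d2F x \<mu> a y w \<bullet> b)"
    and twice: "twice_diffble_xa F"
    and diff_mu: "\<And>x \<mu> a y. \<mu> \<in> P2 \<Longrightarrow> (\<lambda>x. D_mu dF x \<mu> a y) differentiable (at x)"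
    and bound_mumu: "\<And>x \<mu> a y w. \<mu> \<in> P2 \<Longrightarrow> norm (D_mumu d2F x \<mu> a y w) \<le> l / weight \<omega> x \<mu>"
    and bound_x_mu: "\<And>x \<mu> a y. \<mu> \<in> P2 \<Longrightarrow> norm (D_x_mu dF x \<mu> a y) \<le> l / weight \<omega> x \<mu>"
    and bound_y_mu: "\<And>x \<mu> a y. \<mu> \<in> P2 \<Longrightarrow> norm (D_y_mu dF x \<mu> a y) \<le> l / weight \<omega> x \<mu>"
    and bound_xx: "\<And>x \<mu> a. \<mu> \<in> P2 \<Longrightarrow> norm (D_x (D_x F) x \<mu> a) \<le> l / weight \<omega> x \<mu>"
    and xa: "\<And>\<mu> R x x' a a'. \<mu> \<in> P2 \<Longrightarrow> 0 < R \<Longrightarrow> (\<And>u. u \<in> closed_segment x x' \<Longrightarrow> R \<le> weight \<omega> u \<mu>) \<Longrightarrow>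
      norm (F x \<mu> a - F x' \<mu> a - (F x \<mu> a' - F x' \<mu> a')) \<le> l / R * norm (x - x') * norm (a - a')"
    and amu: "\<And>\<mu> \<mu>' c R x a a'. \<mu> \<in> P2 \<Longrightarrow> \<mu>' \<in> P2 \<Longrightarrow> W1_le \<mu> \<mu>' c \<Longrightarrow> 0 < R \<Longrightarrow> R < weight \<omega> x \<mu> - \<omega> * c \<Longrightarrow>
      norm (F x \<mu> a - F x \<mu>' a - (F x \<mu> a' - F x \<mu>' a')) \<le> l / R * norm (a - a') * c"
begin

lemma bound_by:
  assumes "t \<le> l / weight \<omega> x \<mu>" "0 < R" "R \<le> weight \<omega> x \<mu>" shows "t \<le> l / R"
  using assms l by (meson divide_left_mono mult_pos_pos order_less_le_trans order_trans)

lemma is_lfd_F: "b \<in> Basis \<Longrightarrow> is_lfd (\<lambda>\<mu>. F x \<mu> a \<bullet> b) (\<lambda>\<mu> y. dF x \<mu> a y \<bullet> b)"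
  and is_lfd2_F: "b \<in> Basis \<Longrightarrow> is_lfd2 (\<lambda>\<mu>. F x \<mu> a \<bullet> b) (\<lambda>\<mu> y. dF x \<mu> a y \<bullet> b) (\<lambda>\<mu> y w. d2F x \<mu> a y w \<bullet> b)"
  using regular unfolding regular2_def by blast+

lemma diff_x: "\<mu> \<in> P2 \<Longrightarrow> (\<lambda>x. F x \<mu> a) differentiable (at x)"
  and diff_a: "\<mu> \<in> P2 \<Longrightarrow> (\<lambda>a. F x \<mu> a) differentiable (at a)"
  and diff_xx: "\<mu> \<in> P2 \<Longrightarrow> (\<lambda>x. D_x F x \<mu> a) differentiable (at x)"
  using twice unfolding twice_diffble_xa_def by blast+

lemma
  assumes "b \<in> Basis" "\<mu> \<in> P2"
  shows diff_dF_component: "(\<lambda>y. dF x \<mu> a y \<bullet> b) differentiable (at y)"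
    and diff_fderiv_dF_component: "fderiv (\<lambda>y. dF x \<mu> a y \<bullet> b) differentiable (at y)"
    and diff_d2F_component: "(\<lambda>w. d2F x \<mu> a y w \<bullet> b) differentiable (at w)"
    and diff_fderiv_d2F_component: "(\<lambda>y. fderiv (\<lambda>w. d2F x \<mu> a y w \<bullet> b) w) differentiable (at y)"
  using regular[OF assms(1), of x a] assms(2) unfolding regular2_def by (elim conjE; simp)+

lemma diff_dF: "\<mu> \<in> P2 \<Longrightarrow> dF x \<mu> a differentiable (at y)"
  by (rule differentiable_components) (rule diff_dF_component)

lemma diff_D_mu:
  assumes "\<mu> \<in> P2" shows "(\<lambda>y. D_mu dF x \<mu> a y) differentiable (at y)"
proof (rule blinfun_differentiable_components)
  fix b :: 'v assume "b \<in> Basis"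
  then have "fderiv (\<lambda>y. dF x \<mu> a y \<bullet> b) differentiable (at y)"
    by (rule diff_fderiv_dF_component[OF _ assms])
  moreover have "fderiv (\<lambda>y. dF x \<mu> a y \<bullet> b) = (\<lambda>y. blinfun_inner_left b o\<^sub>L D_mu dF x \<mu> a y)"
    unfolding D_mu_def by (intro ext fderiv_inner diff_dF assms)
  ultimately show "(\<lambda>y. blinfun_inner_left b o\<^sub>L D_mu dF x \<mu> a y) differentiable (at y)" by simp
qed

lemma mixed_lipschitz_d2F:
  assumes "\<mu> \<in> P2" "0 < R" "R \<le> weight \<omega> x \<mu>" "b \<in> Basis"
  shows "mixed_lipschitz (l / R) (\<lambda>y w. d2F x \<mu> a y w \<bullet> b)"
proof -
  have d: "(\<lambda>w. d2F x \<mu> a y w) differentiable (at w)" for y w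
    by (rule differentiable_components) (rule diff_d2F_component[OF _ assms(1)])
  have d2: "(\<lambda>y. fderiv (\<lambda>w. d2F x \<mu> a y w) w) differentiable (at y)" for y w
  proof (rule blinfun_differentiable_components)
    fix b :: 'v assume "b \<in> Basis"
    then have "(\<lambda>y. fderiv (\<lambda>w. d2F x \<mu> a y w \<bullet> b) w) differentiable (at y)"
      by (rule diff_fderiv_d2F_component[OF _ assms(1)])
    moreover have "(\<lambda>y. fderiv (\<lambda>w. d2F x \<mu> a y w \<bullet> b) w) = (\<lambda>y. blinfun_inner_left b o\<^sub>L fderiv (\<lambda>w. d2F x \<mu> a y w) w)"
      by (intro ext fderiv_inner d)
    ultimately show "(\<lambda>y. blinfun_inner_left b o\<^sub>L fderiv (\<lambda>w. d2F x \<mu> a y w) w) differentiable (at y)" by simp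
  qed
  have B: "norm (fderiv (\<lambda>y. fderiv (\<lambda>w. d2F x \<mu> a y w) w) y) \<le> l / R" for y w
    using bound_mumu[OF assms(1)] unfolding D_mumu_def by (rule bound_by[OF _ assms(2,3)])
  have lR: "0 \<le> l / R" using l assms(2) by simp
  show ?thesis
    unfolding mixed_lipschitz_def
  proof (intro allI)
    fix y y' w w'
    have "norm (d2F x \<mu> a y w - d2F x \<mu> a y' w - (d2F x \<mu> a y w' - d2F x \<mu> a y' w')) \<le> (l / R * norm (y - y')) * norm (w - w')"
    proof (rule fderiv_bound)
      fix u
      show "(\<lambda>w. d2F x \<mu> a y w - d2F x \<mu> a y' w) differentiable (at u)"
        by (intro differentiable_diff d)
      have "fderiv (\<lambda>w. d2F x \<mu> a y w - d2F x \<mu> a y' w) u = fderiv (\<lambda>w. d2F x \<mu> a y w) u - fderiv (\<lambda>w. d2F x \<mu> a y' w) u"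
        using has_derivative_diff[OF fderiv_has_derivative[OF d] fderiv_has_derivative[OF d]]
        by (intro fderiv_eqI) (simp add: blinfun.diff_left[abs_def])
      moreover have "norm (fderiv (\<lambda>w. d2F x \<mu> a y w) u - fderiv (\<lambda>w. d2F x \<mu> a y' w) u) \<le> l / R * norm (y - y')"
        by (rule fderiv_bound[OF d2 B])
      ultimately show "norm (fderiv (\<lambda>w. d2F x \<mu> a y w - d2F x \<mu> a y' w) u) \<le> l / R * norm (y - y')" by simp
    qed
    then show "\<bar>d2F x \<mu> a y w \<bullet> b - d2F x \<mu> a y' w \<bullet> b - (d2F x \<mu> a y w' \<bullet> b - d2F x \<mu> a y' w' \<bullet> b)\<bar>
      \<le> l / R * norm (y - y') * norm (w - w')"
      using Basis_le_norm[OF assms(4)] unfolding inner_diff_left[symmetric] by (meson order_trans)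
  qed
qed

section \<open>Lipschitz bounds for displacements of at most a quarter of the weight\<close>

context
  fixes x x' :: "real^'n" and \<mu> \<mu>' :: "(real^'n) measure" and c R :: real
  assumes P2: "\<mu> \<in> P2" "\<mu>' \<in> P2" and c: "W1_le \<mu> \<mu>' c"
    and near: "\<omega> * (norm (x - x') + c) \<le> R / 2" and R: "weight \<omega> x \<mu> = 2 * R"
begin

lemma kant: "kant_le \<mu> \<mu>' c" and c0: "0 \<le> c" and R0: "0 < R" and lR: "0 \<le> l / R"
  and moment_c: "moment1 \<mu> - c \<le> moment1 \<mu>'"
proof -
  show k: "kant_le \<mu> \<mu>' c" by (intro kant_le_if_W1_le c P2)
  then show "0 \<le> c" by (simp add: kant_le_def)
  show "0 < R" using weight_ge_1[OF omega(1), of x \<mu>] R by simp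
  then show "0 \<le> l / R" using l by (intro divide_nonneg_pos)
  show "moment1 \<mu> - c \<le> moment1 \<mu>'" using moment1_kant_le[OF k] by linarith
qed

text \<open>Going over to \<open>x'\<close> and \<open>\<mu>'\<close> costs at most a quarter of the
  weight \<open>2 * R\<close>. What remains above \<open>R\<close> is a reserve, spent on a
  neighbourhood of \<open>x'\<close> and on the strict inequalities in the estimates for
  measures.\<close>

lemma near': "s \<le> norm (x - x') \<Longrightarrow> s' \<le> c \<Longrightarrow> 3 / 2 * R \<le> weight \<omega> x \<mu> - \<omega> * (s + s')"
  using near R mult_left_mono[OF add_mono omega(1), of s "norm (x - x')" s' c] by linarith

lemma weight_segment: "u \<in> closed_segment x x' \<Longrightarrow> R \<le> weight \<omega> u \<mu>"
  using near'[of "norm (x - x')" 0] c0 R0 weight_ge[OF omega(1), of x u "norm (x - x')" \<mu> 0 \<mu>]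
    segment_bound(1)[of u x x'] by (simp add: norm_minus_commute)

lemma weight_x': "moment1 \<mu> - c \<le> moment1 \<nu> \<Longrightarrow> 3 / 2 * R \<le> weight \<omega> x' \<nu>"
  using near'[of "norm (x - x')" c] weight_ge[OF omega(1), of x x' "norm (x - x')" \<mu> c \<nu>] by simp

lemma weight_near_x':
  assumes "moment1 \<mu> - c \<le> moment1 \<nu>" "norm (u - x') \<le> R / 2"
  shows "R \<le> weight \<omega> u \<nu>"
proof -
  have "weight \<omega> x' \<nu> - \<omega> * (R / 2 + 0) \<le> weight \<omega> u \<nu>"
    using assms by (intro weight_ge omega) (auto simp: norm_minus_commute)
  moreover have "\<omega> * (R / 2) \<le> 1 * (R / 2)" using omega R0 by (intro mult_right_mono) auto
  ultimately show ?thesis using weight_x'[OF assms(1)] by simp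
qed

lemma weight_moment: "moment1 \<mu> - c - R / 2 \<le> moment1 \<nu> \<Longrightarrow> R \<le> weight \<omega> x' \<nu>"
proof -
  assume "moment1 \<mu> - c - R / 2 \<le> moment1 \<nu>"
  then have "weight \<omega> x \<mu> - \<omega> * (norm (x - x') + (c + R / 2)) \<le> weight \<omega> x' \<nu>"
    by (intro weight_ge omega) auto
  moreover have "\<omega> * (R / 2) \<le> 1 * (R / 2)" using omega R0 by (intro mult_right_mono) auto
  ultimately show ?thesis using near'[of "norm (x - x')" c] by (simp add: distrib_left)
qed

lemma moment_mix: "0 \<le> \<theta> \<Longrightarrow> \<theta> \<le> 1 \<Longrightarrow> moment1 \<mu> - c \<le> moment1 (mix \<theta> \<mu> \<mu>')"
proof -
  assume \<theta>: "0 \<le> \<theta>" "\<theta> \<le> 1"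
  have "moment1 \<mu> - c = \<theta> * (moment1 \<mu> - c) + (1 - \<theta>) * (moment1 \<mu> - c)" by (simp add: algebra_simps)
  also have "\<dots> \<le> \<theta> * moment1 \<mu> + (1 - \<theta>) * moment1 \<mu>'"
    using \<theta> moment_c c0 by (intro add_mono mult_left_mono) auto
  finally show ?thesis by (simp add: moment1_mix[OF P2 \<theta>])
qed

text \<open>The arguments move one at a time: state, measure, control. The first move integrates a
  derivative of \<open>D_x F\<close>; the other two compare two functions of the state near
  \<open>x'\<close> through second differences of \<open>F\<close>.\<close>

lemma D_x_lipschitz_near:
  "norm (D_x F x \<mu> a - D_x F x' \<mu>' a') \<le> l / R * (norm (x - x') + DIM('v) * c + norm (a - a'))"
proof -
  have 1: "norm (D_x F x \<mu> a - D_x F x' \<mu> a) \<le> l / R * norm (x - x')"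
  proof (rule fderiv_bound[OF diff_xx[OF P2(1)]])
    fix u assume "u \<in> closed_segment x x'"
    then show "norm (fderiv (\<lambda>x. D_x F x \<mu> a) u) \<le> l / R"
      using bound_xx[OF P2(1), of u a] R0 by (intro bound_by[OF _ _ weight_segment]) (auto simp: D_x_def)
  qed
  \<comment> \<open>\<open>bound_x_mu\<close> is integrated in the state, then in \<open>y\<close>,
    then along the mixtures of \<open>\<mu>\<close> and \<open>\<mu>'\<close>. No derivative of
    \<open>D_x F\<close> in the measure is ever formed.\<close>
  have 2: "norm (D_x F x' \<mu> a - D_x F x' \<mu>' a) \<le> l / R * (DIM('v) * c)"
    unfolding D_x_def
  proof (rule fderiv_diff_le[OF diff_x[OF P2(1)] diff_x[OF P2(2)]])
    show "0 \<le> l / R * (DIM('v) * c)" by (intro mult_nonneg_nonneg lR c0) simp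
    show "0 < R / 2" using R0 by simp
    fix u assume u: "norm (u - x') < R / 2"
    have "norm (F u \<mu> a - F u \<mu>' a - (F x' \<mu> a - F x' \<mu>' a)) \<le> DIM('v) * ((l / R * norm (u - x')) * c)"
    proof (rule norm_le_components)
      fix b :: 'v assume b: "b \<in> Basis"
      have "\<bar>F u \<mu> a \<bullet> b - F u \<mu>' a \<bullet> b - (F x' \<mu> a \<bullet> b - F x' \<mu>' a \<bullet> b)\<bar> \<le> (l / R * norm (u - x')) * c"
      proof (rule lfd_lipschitz_diff[OF is_lfd_F[OF b] is_lfd_F[OF b] P2 kant])
        show "0 \<le> l / R * norm (u - x')" by (intro mult_nonneg_nonneg lR) simp
        fix \<theta> :: real and y y' assume \<theta>: "0 \<le> \<theta>" "\<theta> \<le> 1"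
        define \<nu> where "\<nu> = mix \<theta> \<mu> \<mu>'"
        have \<nu>: "\<nu> \<in> P2" using P2 \<theta> by (simp add: \<nu>_def mix_P2)
        have m: "moment1 \<mu> - c \<le> moment1 \<nu>" unfolding \<nu>_def by (rule moment_mix[OF \<theta>])
        have B: "norm (D_mu dF u \<nu> a y - D_mu dF x' \<nu> a y) \<le> l / R * norm (u - x')" for y
        proof (rule fderiv_bound[OF diff_mu[OF \<nu>]])
          fix v assume "v \<in> closed_segment u x'"
          then have "norm (v - x') \<le> R / 2"
            using segment_bound(2)[of v u x'] u by (simp add: norm_minus_commute)
          then have "R \<le> weight \<omega> v \<nu>" by (rule weight_near_x'[OF m])
          then show "norm (fderiv (\<lambda>x. D_mu dF x \<nu> a y) v) \<le> l / R"
            using bound_by[OF bound_x_mu[OF \<nu>, of v a y] R0] by (simp add: D_x_mu_def D_x_def)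
        qed
        have "norm (dF u \<nu> a y - dF x' \<nu> a y - (dF u \<nu> a y' - dF x' \<nu> a y')) \<le> l / R * norm (u - x') * norm (y - y')"
        proof (rule fderiv_bound)
          fix v
          show "(\<lambda>y. dF u \<nu> a y - dF x' \<nu> a y) differentiable (at v)"
            by (intro differentiable_diff diff_dF \<nu>)
          have "fderiv (\<lambda>y. dF u \<nu> a y - dF x' \<nu> a y) v = D_mu dF u \<nu> a v - D_mu dF x' \<nu> a v"
            using has_derivative_diff[OF fderiv_has_derivative[OF diff_dF[OF \<nu>]] fderiv_has_derivative[OF diff_dF[OF \<nu>]]]
            by (intro fderiv_eqI) (simp add: D_mu_def blinfun.diff_left[abs_def])
          then show "norm (fderiv (\<lambda>y. dF u \<nu> a y - dF x' \<nu> a y) v) \<le> l / R * norm (u - x')" using B by simp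
        qed
        then show "\<bar>dF u (mix \<theta> \<mu> \<mu>') a y \<bullet> b - dF x' (mix \<theta> \<mu> \<mu>') a y \<bullet> b -
          (dF u (mix \<theta> \<mu> \<mu>') a y' \<bullet> b - dF x' (mix \<theta> \<mu> \<mu>') a y' \<bullet> b)\<bar> \<le> l / R * norm (u - x') * norm (y - y')"
          using Basis_le_norm[OF b] unfolding \<nu>_def[symmetric] inner_diff_left[symmetric] by (meson order_trans)
      qed
      then show "\<bar>(F u \<mu> a - F u \<mu>' a - (F x' \<mu> a - F x' \<mu>' a)) \<bullet> b\<bar> \<le> (l / R * norm (u - x')) * c"
        by (simp add: inner_diff_left)
    qed
    then show "norm (F u \<mu> a - F u \<mu>' a - (F x' \<mu> a - F x' \<mu>' a)) \<le> l / R * (DIM('v) * c) * norm (u - x')"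
      by (simp add: mult_ac)
  qed
  have 3: "norm (D_x F x' \<mu>' a - D_x F x' \<mu>' a') \<le> l / R * norm (a - a')"
    unfolding D_x_def
  proof (rule fderiv_diff_le[OF diff_x[OF P2(2)] diff_x[OF P2(2)]])
    show "0 \<le> l / R * norm (a - a')" by (intro mult_nonneg_nonneg lR) simp
    show "0 < R / 2" using R0 by simp
    fix u assume u: "norm (u - x') < R / 2"
    have "norm (F u \<mu>' a - F x' \<mu>' a - (F u \<mu>' a' - F x' \<mu>' a')) \<le> l / R * norm (u - x') * norm (a - a')"
    proof (rule xa[OF P2(2) R0])
      fix v assume "v \<in> closed_segment u x'"
      then have "norm (v - x') \<le> R / 2"
        using segment_bound(2)[of v u x'] u by (simp add: norm_minus_commute)
      then show "R \<le> weight \<omega> v \<mu>'" by (rule weight_near_x'[OF moment_c])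
    qed
    then show "norm (F u \<mu>' a - F u \<mu>' a' - (F x' \<mu>' a - F x' \<mu>' a')) \<le> l / R * norm (a - a') * norm (u - x')"
      by (simp add: algebra_simps)
  qed
  have "norm (D_x F x \<mu> a - D_x F x' \<mu>' a') \<le> norm (D_x F x \<mu> a - D_x F x' \<mu> a)
    + norm (D_x F x' \<mu> a - D_x F x' \<mu>' a) + norm (D_x F x' \<mu>' a - D_x F x' \<mu>' a')"
    using norm_triangle_ineq[of "D_x F x \<mu> a - D_x F x' \<mu> a + (D_x F x' \<mu> a - D_x F x' \<mu>' a)" "D_x F x' \<mu>' a - D_x F x' \<mu>' a'"]
      norm_triangle_ineq[of "D_x F x \<mu> a - D_x F x' \<mu> a" "D_x F x' \<mu> a - D_x F x' \<mu>' a"] by simp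
  also have "\<dots> \<le> l / R * norm (x - x') + l / R * (DIM('v) * c) + l / R * norm (a - a')"
    using 1 2 3 by linarith
  finally show ?thesis by (simp only: distrib_left)
qed

lemma D_a_lipschitz_near:
  "norm (D_a F x \<mu> a - D_a F x' \<mu>' a) \<le> l / R * (norm (x - x') + c)"
proof -
  have 1: "norm (D_a F x \<mu> a - D_a F x' \<mu> a) \<le> l / R * norm (x - x')"
    unfolding D_a_def
  proof (rule fderiv_diff_le[OF diff_a[OF P2(1)] diff_a[OF P2(1)] _ zero_less_one])
    show "0 \<le> l / R * norm (x - x')" by (intro mult_nonneg_nonneg lR) simp
    show "norm (F x \<mu> u - F x' \<mu> u - (F x \<mu> a - F x' \<mu> a)) \<le> l / R * norm (x - x') * norm (u - a)" for u
      by (rule xa[OF P2(1) R0 weight_segment])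
  qed
  have 2: "norm (D_a F x' \<mu> a - D_a F x' \<mu>' a) \<le> l / R * c"
    unfolding D_a_def
  proof (rule fderiv_diff_le[OF diff_a[OF P2(1)] diff_a[OF P2(2)] _ zero_less_one])
    show "0 \<le> l / R * c" by (intro mult_nonneg_nonneg lR c0)
    have "weight \<omega> x \<mu> - \<omega> * (norm (x - x') + 0) \<le> weight \<omega> x' \<mu>" by (intro weight_ge omega) auto
    then have "R < weight \<omega> x' \<mu> - \<omega> * c"
      using near'[of "norm (x - x')" c] R0 by (simp add: distrib_left)
    then show "norm (F x' \<mu> u - F x' \<mu>' u - (F x' \<mu> a - F x' \<mu>' a)) \<le> l / R * c * norm (u - a)" for u
      using amu[OF P2 c R0, of x' u a] by (simp add: mult_ac)
  qed
  have "norm (D_a F x \<mu> a - D_a F x' \<mu>' a) \<le> l / R * norm (x - x') + l / R * c"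
    using norm_triangle_ineq[of "D_a F x \<mu> a - D_a F x' \<mu> a" "D_a F x' \<mu> a - D_a F x' \<mu>' a"] 1 2 by simp
  then show ?thesis by (simp only: distrib_left)
qed

text \<open>Four moves: state, measure, control, evaluation point. The move in the measure uses
  \<open>lfd_increment_lipschitz\<close>, the source of the 6; the move in the control converts the
  second difference \<open>amu\<close> by \<open>lfd_increment_from_W1\<close>.\<close>

lemma D_mu_lipschitz_near:
  "norm (D_mu dF x \<mu> a y - D_mu dF x' \<mu>' a' y') \<le>
    l / R * (norm (x - x') + 6 * DIM('v) * c + DIM('v) * norm (a - a') + norm (y - y'))"
proof -
  have 1: "norm (D_mu dF x \<mu> a y - D_mu dF x' \<mu> a y) \<le> l / R * norm (x - x')"
  proof (rule fderiv_bound[OF diff_mu[OF P2(1)]])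
    fix u assume "u \<in> closed_segment x x'"
    then show "norm (fderiv (\<lambda>x. D_mu dF x \<mu> a y) u) \<le> l / R"
      using bound_x_mu[OF P2(1), of u a y] R0 by (intro bound_by[OF _ _ weight_segment]) (auto simp: D_x_mu_def D_x_def)
  qed
  have 2: "norm (D_mu dF x' \<mu> a y - D_mu dF x' \<mu>' a y) \<le> DIM('v) * (6 * (l / R) * c)"
    unfolding D_mu_def
  proof (rule fderiv_diff_le[OF diff_dF[OF P2(1)] diff_dF[OF P2(2)] _ zero_less_one])
    show "0 \<le> DIM('v) * (6 * (l / R) * c)" by (intro mult_nonneg_nonneg lR c0) simp_all
    fix u
    have "norm (dF x' \<mu> a u - dF x' \<mu>' a u - (dF x' \<mu> a y - dF x' \<mu>' a y)) \<le> DIM('v) * (6 * (l / R) * c * norm (u - y))"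
    proof (rule norm_le_components)
      fix b :: 'v assume b: "b \<in> Basis"
      have "\<bar>dF x' \<mu> a u \<bullet> b - dF x' \<mu> a y \<bullet> b - (dF x' \<mu>' a u \<bullet> b - dF x' \<mu>' a y \<bullet> b)\<bar> \<le> 6 * (l / R) * c * norm (u - y)"
      proof (rule lfd_increment_lipschitz[OF is_lfd_F[OF b] is_lfd2_F[OF b] lR _ P2 kant, where r = "moment1 \<mu> - c - R / 2"])
        show "mixed_lipschitz (l / R) (\<lambda>y w. d2F x' \<nu> a y w \<bullet> b)" if "\<nu> \<in> P2" "moment1 \<mu> - c - R / 2 \<le> moment1 \<nu>" for \<nu>
          by (rule mixed_lipschitz_d2F[OF that(1) R0 weight_moment[OF that(2)] b])
        show "moment1 \<mu> - c - R / 2 < moment1 \<mu>" "moment1 \<mu> - c - R / 2 < moment1 \<mu>'"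
          using c0 R0 moment_c by linarith+
      qed
      then show "\<bar>(dF x' \<mu> a u - dF x' \<mu>' a u - (dF x' \<mu> a y - dF x' \<mu>' a y)) \<bullet> b\<bar> \<le> 6 * (l / R) * c * norm (u - y)"
        by (simp add: inner_diff_left algebra_simps)
    qed
    then show "norm (dF x' \<mu> a u - dF x' \<mu>' a u - (dF x' \<mu> a y - dF x' \<mu>' a y)) \<le> DIM('v) * (6 * (l / R) * c) * norm (u - y)"
      by (simp add: mult_ac)
  qed
  have 3: "norm (D_mu dF x' \<mu>' a y - D_mu dF x' \<mu>' a' y) \<le> DIM('v) * (l / R * norm (a - a'))"
    unfolding D_mu_def
  proof (rule fderiv_diff_le[OF diff_dF[OF P2(2)] diff_dF[OF P2(2)] _ zero_less_one])
    show "0 \<le> DIM('v) * (l / R * norm (a - a'))" by (intro mult_nonneg_nonneg lR) simp_all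
    fix u
    have "norm (dF x' \<mu>' a u - dF x' \<mu>' a' u - (dF x' \<mu>' a y - dF x' \<mu>' a' y)) \<le> DIM('v) * (l / R * norm (a - a') * norm (u - y))"
    proof (rule norm_le_components)
      fix b :: 'v assume b: "b \<in> Basis"
      \<comment> \<open>Here \<open>l\<close> enters only a remainder of order
        \<open>e\<^sup>2\<close>, which disappears in the limit, so the crude weight bound 1 is
        enough.\<close>
      have ml: "mixed_lipschitz l (\<lambda>y w. d2F x' \<nu> a y w \<bullet> b)" if "\<nu> \<in> P2" for \<nu> a
        using mixed_lipschitz_d2F[OF that zero_less_one weight_ge_1[OF omega(1)] b] by simp
      have "\<bar>dF x' \<mu>' a u \<bullet> b - dF x' \<mu>' a' u \<bullet> b - (dF x' \<mu>' a y \<bullet> b - dF x' \<mu>' a' y \<bullet> b)\<bar> \<le> (l / R * norm (a - a')) * norm (u - y)"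
      proof (rule lfd_increment_from_W1[OF is_lfd_F[OF b] is_lfd2_F[OF b] is_lfd_F[OF b] is_lfd2_F[OF b] l ml ml _ P2(2),
            where r = "moment1 \<mu> - c - R / 4"])
        \<comment> \<open>The threshold gives up \<open>R / 4\<close> to make this strict. Of the
          \<open>3 / 2 * R\<close> left after the displacement, \<open>5 / 4 * R\<close> then
          remains, more than the \<open>R\<close> that \<open>amu\<close> asks for.\<close>
        show "moment1 \<mu> - c - R / 4 < moment1 \<mu>'" using R0 moment_c by linarith
        fix \<nu> \<nu>' :: "(real^'n) measure" and d assume \<nu>: "\<nu> \<in> P2" "\<nu>' \<in> P2" "W1_le \<nu> \<nu>' d" "moment1 \<mu> - c - R / 4 < moment1 \<nu> - d"
        have "weight \<omega> x \<mu> - \<omega> * (norm (x - x') + (c + R / 4 - d)) \<le> weight \<omega> x' \<nu>"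
          using \<nu>(4) by (intro weight_ge omega) auto
        moreover have "\<omega> * (R / 4) \<le> 1 * (R / 4)" using omega R0 by (intro mult_right_mono) auto
        moreover have "\<omega> * (norm (x - x') + (c + R / 4 - d)) = \<omega> * (norm (x - x') + c) + \<omega> * (R / 4) - \<omega> * d"
          by (simp add: algebra_simps)
        moreover have "3 / 2 * R \<le> weight \<omega> x \<mu> - \<omega> * (norm (x - x') + c)" by (rule near') auto
        ultimately have "R < weight \<omega> x' \<nu> - \<omega> * d" using R0 by linarith
        then have "norm (F x' \<nu> a - F x' \<nu>' a - (F x' \<nu> a' - F x' \<nu>' a')) \<le> l / R * norm (a - a') * d"
          by (rule amu[OF \<nu>(1-3) R0])
        then have "\<bar>(F x' \<nu> a - F x' \<nu>' a - (F x' \<nu> a' - F x' \<nu>' a')) \<bullet> b\<bar> \<le> l / R * norm (a - a') * d"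
          using Basis_le_norm[OF b] order_trans by blast
        then show "\<bar>F x' \<nu> a \<bullet> b - F x' \<nu> a' \<bullet> b - (F x' \<nu>' a \<bullet> b - F x' \<nu>' a' \<bullet> b)\<bar> \<le> l / R * norm (a - a') * d"
          by (simp add: inner_diff_left algebra_simps)
      qed
      then show "\<bar>(dF x' \<mu>' a u - dF x' \<mu>' a' u - (dF x' \<mu>' a y - dF x' \<mu>' a' y)) \<bullet> b\<bar> \<le> l / R * norm (a - a') * norm (u - y)"
        by (simp add: inner_diff_left)
    qed
    then show "norm (dF x' \<mu>' a u - dF x' \<mu>' a' u - (dF x' \<mu>' a y - dF x' \<mu>' a' y)) \<le> DIM('v) * (l / R * norm (a - a')) * norm (u - y)"
      by (simp add: mult_ac)
  qed
  have 4: "norm (D_mu dF x' \<mu>' a' y - D_mu dF x' \<mu>' a' y') \<le> l / R * norm (y - y')"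
  proof (rule fderiv_bound[OF diff_D_mu[OF P2(2)]])
    fix u
    have "R \<le> weight \<omega> x' \<mu>'" using weight_x'[OF moment_c] R0 by linarith
    then show "norm (fderiv (\<lambda>y. D_mu dF x' \<mu>' a' y) u) \<le> l / R"
      using bound_by[OF bound_y_mu[OF P2(2), of x' a' u] R0] by (simp add: D_y_mu_def)
  qed
  have "norm (D_mu dF x \<mu> a y - D_mu dF x' \<mu>' a' y') \<le>
    l / R * norm (x - x') + DIM('v) * (6 * (l / R) * c) + DIM('v) * (l / R * norm (a - a')) + l / R * norm (y - y')"
    using norm_triangle_ineq[of "D_mu dF x \<mu> a y - D_mu dF x' \<mu> a y" "D_mu dF x' \<mu> a y - D_mu dF x' \<mu>' a y"]
      norm_triangle_ineq[of "D_mu dF x \<mu> a y - D_mu dF x' \<mu>' a y" "D_mu dF x' \<mu>' a y - D_mu dF x' \<mu>' a' y"]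
      norm_triangle_ineq[of "D_mu dF x \<mu> a y - D_mu dF x' \<mu>' a' y" "D_mu dF x' \<mu>' a' y - D_mu dF x' \<mu>' a' y'"]
      1 2 3 4 by simp
  also have "\<dots> = l / R * (norm (x - x') + 6 * DIM('v) * c + DIM('v) * norm (a - a') + norm (y - y'))"
    by (simp add: distrib_left mult_ac)
  finally show ?thesis .
qed

end

end

section \<open>The coefficients of the control problem\<close>

lemma fderiv_bound_diff:
  fixes F G :: "'a::real_normed_vector \<Rightarrow> 'b::real_normed_vector"
  assumes "\<And>u. F differentiable (at u)" "\<And>u. G differentiable (at u)"
    and "\<And>u. u \<in> closed_segment x x' \<Longrightarrow> norm (fderiv F u - fderiv G u) \<le> B"
  shows "norm (F x - G x - (F x' - G x')) \<le> B * norm (x - x')"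
proof (rule fderiv_bound)
  show "(\<lambda>u. F u - G u) differentiable (at u)" for u by (intro differentiable_diff assms)
  fix u assume u: "u \<in> closed_segment x x'"
  have "fderiv (\<lambda>u. F u - G u) u = fderiv F u - fderiv G u"
    using has_derivative_diff[OF fderiv_has_derivative[OF assms(1)] fderiv_has_derivative[OF assms(2)]]
    by (intro fderiv_eqI) (simp add: blinfun.diff_left[abs_def])
  then show "norm (fderiv (\<lambda>u. F u - G u) u) \<le> B" using assms(3)[OF u] by simp
qed

section \<open>Gradients, transposes and matrix entries\<close>

lemma comp_grad_inner: "comp_grad A i \<bullet> v = blinfun_apply A v $ i"
proof -
  have v: "v = (\<Sum>j\<in>UNIV. v $ j *\<^sub>R axis j 1)" using basis_expansion[of v] by (simp add: scalar_mult_eq_scaleR)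
  have "comp_grad A i \<bullet> v = (\<Sum>j\<in>UNIV. v $ j * (blinfun_apply A (axis j 1) $ i))"
    by (simp add: comp_grad_def inner_vec_def mult.commute)
  also have "\<dots> = blinfun_apply A v $ i"
    by (subst (2) v) (simp add: blinfun.sum_right blinfun.scaleR_right)
  finally show ?thesis .
qed

text \<open>\<open>contr A\<close> is the transpose of \<open>A\<close>. Tested against vectors, its
  bounds reduce to the operator norm of \<open>A\<close>.\<close>

lemma contr_inner: "contr A z \<bullet> v = z \<bullet> blinfun_apply A v"
  by (simp add: contr_def inner_sum_left comp_grad_inner inner_vec_def[of z])

lemma grad_inner: "grad A \<bullet> v = blinfun_apply A v"
proof -
  have v: "v = (\<Sum>j\<in>UNIV. v $ j *\<^sub>R axis j 1)" using basis_expansion[of v] by (simp add: scalar_mult_eq_scaleR)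
  show ?thesis
    by (subst (2) v) (simp add: grad_def inner_vec_def blinfun.sum_right blinfun.scaleR_right mult.commute)
qed

lemma norm_le_inner:
  fixes x :: "'a::real_inner"
  assumes "\<And>v. x \<bullet> v \<le> B * norm v" "0 \<le> B" shows "norm x \<le> B"
proof (cases "x = 0")
  case False
  have "norm x * norm x \<le> B * norm x" using assms(1)[of x] by (simp add: dot_square_norm power2_eq_square)
  then show ?thesis using False by simp
qed (use assms in simp)

lemma norm_contr: "norm (contr A z) \<le> norm A * norm z"
proof (rule norm_le_inner)
  fix v
  have "z \<bullet> blinfun_apply A v \<le> norm z * norm (blinfun_apply A v)" by (rule norm_cauchy_schwarz)
  also have "\<dots> \<le> norm z * (norm A * norm v)" by (intro mult_left_mono norm_blinfun) simp
  finally show "contr A z \<bullet> v \<le> norm A * norm z * norm v" by (simp add: contr_inner mult_ac)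
qed simp

lemma norm_grad: "norm (grad A) \<le> norm A"
proof (rule norm_le_inner)
  fix v show "grad A \<bullet> v \<le> norm A * norm v"
    using norm_blinfun[of A v] by (simp add: grad_inner)
qed simp

lemma contr_diff: "contr A z - contr A' z' = contr (A - A') z + contr A' (z - z')"
  by (rule vector_eq_rdot[THEN iffD1])
    (simp add: inner_diff_left inner_add_left contr_inner blinfun.diff_left inner_diff_right)

lemma norm_contr_diff: "norm (contr A z - contr A' z') \<le> norm (A - A') * norm z + norm A' * norm (z - z')"
  unfolding contr_diff by (intro order_trans[OF norm_triangle_ineq] add_mono norm_contr)

lemma norm_grad_diff: "norm (grad A - grad A') \<le> norm (A - A')"
proof -
  have "grad A - grad A' = grad (A - A')" by (simp add: grad_def vec_eq_iff blinfun.diff_left)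
  then show ?thesis using norm_grad[of "A - A'"] by simp
qed

lemma norm_comp_grad: "norm (comp_grad A i) \<le> norm A"
proof (rule norm_le_inner)
  fix v
  have "blinfun_apply A v $ i \<le> norm (blinfun_apply A v)"
    using component_le_norm_cart[of "blinfun_apply A v" i] by simp
  then show "comp_grad A i \<bullet> v \<le> norm A * norm v"
    using norm_blinfun[of A v] by (simp add: comp_grad_inner)
qed simp

text \<open>A crude comparison of norms: the L-derivative of \<open>D_a f\<close> is given entry by
  entry, and so are the increments derived from it.\<close>

lemma norm_blinfun_entries:
  fixes A :: "(real^'k) \<Rightarrow>\<^sub>L (real^'n)" and e :: real
  assumes "\<And>i j. \<bar>comp_grad A i $ j\<bar> \<le> e"
  shows "norm A \<le> CARD('k) * (CARD('n) * e)"
proof (rule norm_blinfun_bound)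
  have e0: "0 \<le> e" using assms abs_ge_zero order_trans by blast
  then show "0 \<le> CARD('k) * (CARD('n) * e)" by simp
  fix v :: "real^'k"
  have v: "v = (\<Sum>j\<in>UNIV. v $ j *\<^sub>R axis j 1)" using basis_expansion[of v] by (simp add: scalar_mult_eq_scaleR)
  have "norm (blinfun_apply A v) = norm (\<Sum>j\<in>UNIV. v $ j *\<^sub>R blinfun_apply A (axis j 1))"
    by (subst (1) v) (simp add: blinfun.sum_right blinfun.scaleR_right)
  also have "\<dots> \<le> (\<Sum>j\<in>(UNIV::'k set). norm v * (CARD('n) * e))"
  proof (rule order_trans[OF norm_sum sum_mono])
    fix j
    have "norm (blinfun_apply A (axis j 1)) \<le> (\<Sum>i\<in>UNIV. \<bar>blinfun_apply A (axis j 1) $ i\<bar>)" by (rule norm_le_l1_cart)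
    also have "\<dots> \<le> (\<Sum>i\<in>(UNIV::'n set). e)" using assms by (intro sum_mono) (simp add: comp_grad_def)
    finally have "norm (blinfun_apply A (axis j 1)) \<le> CARD('n) * e" by simp
    then show "norm (v $ j *\<^sub>R blinfun_apply A (axis j 1)) \<le> norm v * (CARD('n) * e)"
      using component_le_norm_cart[of v j] by (simp add: mult_mono)
  qed
  also have "\<dots> = CARD('k) * (CARD('n) * e) * norm v" by simp
  finally show "norm (blinfun_apply A v) \<le> CARD('k) * (CARD('n) * e) * norm v" .
qed

lemma Basis_cart_inner:
  assumes "b \<in> (Basis :: (real^'n) set)" shows "\<exists>i. b = axis i 1 \<and> (\<forall>x. x \<bullet> b = x $ i)"
  using assms by (auto simp: Basis_vec_def inner_axis)

text \<open>\<open>xa\<close> comes from integrating \<open>D_a (D_x f)\<close>, first in the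
  control and then in the state; \<open>amu\<close> comes from the L-derivatives \<open>Dma\<close>
  of the entries of \<open>D_a f\<close>. Passing from entries to norms costs
  \<open>CARD('n)\<close> for the gradient and \<open>CARD('k) * CARD('n)\<close> for the matrix,
  which explains the factor of \<open>lb_f\<close>.\<close>

lemma coefficient_a1:
  fixes f :: "real^'n \<Rightarrow> (real^'n) measure \<Rightarrow> real^'k \<Rightarrow> real^'n" and lb_f :: real
  assumes a1: "assumption_a1 lam_f Lam_f lb_f Lip_f f df"
  shows "\<exists>d2f. coefficient f df d2f 1 (CARD('n) * (CARD('n) * (CARD('k) * lb_f)))"
proof -
  define l where "l = CARD('n) * (CARD('n) * (CARD('k) * lb_f))"
  have lb0: "0 < lb_f" and tw: "twice_diffble_xa f"
    and dmu: "\<forall>x. \<forall>\<mu>\<in>P2. \<forall>a y. (\<lambda>x. D_mu df x \<mu> a y) differentiable (at x)"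
    using a1 unfolding assumption_a1_def by blast+
  obtain d2f and Dma :: "real^'n \<Rightarrow> (real^'n) measure \<Rightarrow> real^'k \<Rightarrow> real^'n \<Rightarrow>
              ((real^'n) \<Rightarrow>\<^sub>L (real^'k) \<Rightarrow>\<^sub>L (real^'n))"
    where reg: "\<forall>x a i. regular2 (\<lambda>\<mu>. f x \<mu> a $ i) (\<lambda>\<mu> y. df x \<mu> a y $ i) (\<lambda>\<mu> y w. d2f x \<mu> a y w $ i)"
    and Dma: "\<forall>x. \<forall>\<mu>\<in>P2. \<forall>a i j. has_L_derivative (\<lambda>\<mu>. comp_grad (D_a f x \<mu> a) i $ j) \<mu>
           (\<lambda>y. \<chi> l. blinfun_apply (blinfun_apply (Dma x \<mu> a y) (axis l 1)) (axis j 1) $ i)"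
    and B: "bounded_by (decaying lb_f) (\<lambda>x \<mu> a y w. D_mumu d2f x \<mu> a y w)"
        "bounded_by (decaying lb_f) (\<lambda>x \<mu> a y w. Dma x \<mu> a y)"
        "bounded_by (decaying lb_f) (\<lambda>x \<mu> a y w. D_a (D_x f) x \<mu> a)"
        "bounded_by (decaying lb_f) (\<lambda>x \<mu> a y w. D_x (D_x f) x \<mu> a)"
        "bounded_by (decaying lb_f) (\<lambda>x \<mu> a y w. D_y_mu df x \<mu> a y)"
        "bounded_by (decaying lb_f) (\<lambda>x \<mu> a y w. D_x_mu df x \<mu> a y)"
    using a1 unfolding assumption_a1_def by (elim conjE exE) (rule that; assumption)
  have W: "1 + norm x + moment1 \<mu> = weight 1 x \<mu>" for x :: "real^'n" and \<mu> :: "(real^'n) measure" by (simp add: weight_def)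
  have W1: "1 \<le> weight 1 x \<mu>" for x :: "real^'n" and \<mu> :: "(real^'n) measure" by (simp add: weight_ge_1)
  have card: "1 \<le> CARD('n)" "1 \<le> CARD('k)" by (simp_all add: Suc_le_eq)
  then have "1 * (1 * (1 * lb_f)) \<le> l"
    unfolding l_def using lb0 by (intro mult_mono) auto
  then have lbl: "lb_f \<le> l" by simp
  then have l0: "0 \<le> l" using lb0 by simp
  have wl: "t \<le> l / weight 1 x \<mu>" if "t \<le> decaying lb_f x \<mu>" for t x and \<mu> :: "(real^'n) measure"
    using that lbl W1[of x \<mu>] unfolding W
    by (meson divide_right_mono order_trans zero_le_one)
  have wR: "t \<le> lb_f / R" if "t \<le> decaying lb_f x \<mu>" "0 < R" "R \<le> weight 1 x \<mu>" for t R x and \<mu> :: "(real^'n) measure"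
  proof -
    have "lb_f / weight 1 x \<mu> \<le> lb_f / R" using that W1[of x \<mu>] lb0 by (intro divide_left_mono) auto
    then show ?thesis using that(1) unfolding W by linarith
  qed
  have dx: "\<And>\<mu> a x. \<mu> \<in> P2 \<Longrightarrow> (\<lambda>x. f x \<mu> a) differentiable (at x)" and da: "\<And>\<mu> a x. \<mu> \<in> P2 \<Longrightarrow> (\<lambda>a. f x \<mu> a) differentiable (at a)"
    and dxa: "\<And>\<mu> a x. \<mu> \<in> P2 \<Longrightarrow> (\<lambda>a. D_x f x \<mu> a) differentiable (at a)"
    using tw unfolding twice_diffble_xa_def by blast+
  have "coefficient f df d2f 1 l"
  proof
    fix x :: "real^'n" and a :: "real^'k" and b :: "real^'n" assume "b \<in> Basis"
    then show "regular2 (\<lambda>\<mu>. f x \<mu> a \<bullet> b) (\<lambda>\<mu> y. df x \<mu> a y \<bullet> b) (\<lambda>\<mu> y w. d2f x \<mu> a y w \<bullet> b)"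
      using Basis_cart_inner[of b] reg by auto
  next
    fix x :: "real^'n" and \<mu> :: "(real^'n) measure" and a :: "real^'k" and y :: "real^'n" assume "\<mu> \<in> P2"
    then show "(\<lambda>x. D_mu df x \<mu> a y) differentiable (at x)" using dmu by blast
  next
    fix x :: "real^'n" and \<mu> :: "(real^'n) measure" and a :: "real^'k" and y w :: "real^'n" assume \<mu>: "\<mu> \<in> P2"
    show "norm (D_mumu d2f x \<mu> a y w) \<le> l / weight 1 x \<mu>" using B(1) \<mu> unfolding bounded_by_def by (intro wl) blast
  next
    fix x :: "real^'n" and \<mu> :: "(real^'n) measure" and a :: "real^'k" and y :: "real^'n" assume \<mu>: "\<mu> \<in> P2"
    show "norm (D_x_mu df x \<mu> a y) \<le> l / weight 1 x \<mu>" using B(6) \<mu> unfolding bounded_by_def by (intro wl) blast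
    show "norm (D_y_mu df x \<mu> a y) \<le> l / weight 1 x \<mu>" using B(5) \<mu> unfolding bounded_by_def by (intro wl) blast
    show "norm (D_x (D_x f) x \<mu> a) \<le> l / weight 1 x \<mu>" using B(4) \<mu> unfolding bounded_by_def by (intro wl) blast
  next
    fix \<mu> :: "(real^'n) measure" and R :: real and x x' :: "real^'n" and a a' :: "real^'k"
    assume \<mu>: "\<mu> \<in> P2" and R: "0 < R" "\<And>u. u \<in> closed_segment x x' \<Longrightarrow> R \<le> weight 1 u \<mu>"
    have "norm (f x \<mu> a - f x \<mu> a' - (f x' \<mu> a - f x' \<mu> a')) \<le> (lb_f / R * norm (a - a')) * norm (x - x')"
    proof (rule fderiv_bound_diff[OF dx[OF \<mu>] dx[OF \<mu>]])
      fix u assume u: "u \<in> closed_segment x x'"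
      have "norm (D_x f u \<mu> a - D_x f u \<mu> a') \<le> lb_f / R * norm (a - a')"
      proof (rule fderiv_bound[OF dxa[OF \<mu>]])
        fix v
        have "norm (D_a (D_x f) u \<mu> v) \<le> decaying lb_f u \<mu>" using B(3) \<mu> unfolding bounded_by_def by blast
        then show "norm (fderiv (\<lambda>a. D_x f u \<mu> a) v) \<le> lb_f / R"
          unfolding D_a_def by (rule wR[OF _ R(1) R(2)[OF u]])
      qed
      then show "norm (fderiv (\<lambda>x. f x \<mu> a) u - fderiv (\<lambda>x. f x \<mu> a') u) \<le> lb_f / R * norm (a - a')"
        by (simp add: D_x_def)
    qed
    also have "\<dots> \<le> (l / R * norm (a - a')) * norm (x - x')"
      using lbl R(1) by (intro mult_right_mono divide_right_mono) auto
    finally show "norm (f x \<mu> a - f x' \<mu> a - (f x \<mu> a' - f x' \<mu> a')) \<le> l / R * norm (x - x') * norm (a - a')"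
      by (simp add: algebra_simps)
  next
    fix \<mu> \<mu>' :: "(real^'n) measure" and c R :: real and x :: "real^'n" and a a' :: "real^'k"
    assume P2: "\<mu> \<in> P2" "\<mu>' \<in> P2" and c: "W1_le \<mu> \<mu>' c" and R: "0 < R" "R < weight 1 x \<mu> - 1 * c"
    have "norm (f x \<mu> a - f x \<mu>' a - (f x \<mu> a' - f x \<mu>' a')) \<le> (CARD('k) * (CARD('n) * (CARD('n) * (lb_f / R) * c))) * norm (a - a')"
    proof (rule fderiv_bound_diff[OF da[OF P2(1)] da[OF P2(2)]])
      fix u
      have "norm (D_a f x \<mu> u - D_a f x \<mu>' u) \<le> CARD('k) * (CARD('n) * (CARD('n) * (lb_f / R) * c))"
      proof (rule norm_blinfun_entries)
        fix i j
        have "\<bar>comp_grad (D_a f x \<mu> u) i $ j - comp_grad (D_a f x \<mu>' u) i $ j\<bar> \<le> (CARD('n) * (lb_f / R)) * c"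
        proof (rule L_derivative_lipschitz[OF _ _ P2 c, where r = "R - 1 - norm x"])
          \<comment> \<open>The threshold is the condition that the weight at \<open>x\<close> is at
            least \<open>R\<close>, rewritten for the first moment.\<close>
          show "R - 1 - norm x < moment1 \<mu> - c" using R(2) by (simp add: weight_def)
          fix \<nu> :: "(real^'n) measure" assume \<nu>: "\<nu> \<in> P2"
          show "has_L_derivative (\<lambda>\<mu>. comp_grad (D_a f x \<mu> u) i $ j) \<nu>
           (\<lambda>y. \<chi> l. blinfun_apply (blinfun_apply (Dma x \<nu> u y) (axis l 1)) (axis j 1) $ i)" using Dma \<nu> by blast
          fix y assume "R - 1 - norm x \<le> moment1 \<nu>"
          then have wR': "R \<le> weight 1 x \<nu>" by (simp add: weight_def)
          have "norm (Dma x \<nu> u y) \<le> decaying lb_f x \<nu>" using B(2) \<nu> unfolding bounded_by_def by blast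
          then have D: "norm (Dma x \<nu> u y) \<le> lb_f / R" by (rule wR[OF _ R(1) wR'])
          have "\<bar>blinfun_apply (blinfun_apply (Dma x \<nu> u y) (axis l 1)) (axis j 1) $ i\<bar> \<le> lb_f / R" for l
          proof -
            have "\<bar>blinfun_apply (blinfun_apply (Dma x \<nu> u y) (axis l 1)) (axis j 1) $ i\<bar>
              \<le> norm (blinfun_apply (blinfun_apply (Dma x \<nu> u y) (axis l 1)) (axis j 1))" by (rule component_le_norm_cart)
            also have "\<dots> \<le> norm (blinfun_apply (Dma x \<nu> u y) (axis l 1))"
              using norm_blinfun[of "blinfun_apply (Dma x \<nu> u y) (axis l 1)" "axis j 1"] by (simp add: norm_axis_1)
            also have "\<dots> \<le> norm (Dma x \<nu> u y)"
              using norm_blinfun[of "Dma x \<nu> u y" "axis l 1"] by (simp add: norm_axis_1)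
            finally show ?thesis using D by linarith
          qed
          then have "(\<Sum>l\<in>UNIV. \<bar>(\<chi> l. blinfun_apply (blinfun_apply (Dma x \<nu> u y) (axis l 1)) (axis j 1) $ i) $ l\<bar>) \<le> (\<Sum>l\<in>(UNIV::'n set). lb_f / R)"
            by (intro sum_mono) simp
          from order_trans[OF norm_le_l1_cart this] show "norm (\<chi> l. blinfun_apply (blinfun_apply (Dma x \<nu> u y) (axis l 1)) (axis j 1) $ i) \<le> CARD('n) * (lb_f / R)"
            by simp
        qed
        then show "\<bar>comp_grad (D_a f x \<mu> u - D_a f x \<mu>' u) i $ j\<bar> \<le> CARD('n) * (lb_f / R) * c"
          by (simp add: comp_grad_def blinfun.diff_left)
      qed
      then show "norm (fderiv (\<lambda>a. f x \<mu> a) u - fderiv (\<lambda>a. f x \<mu>' a) u) \<le> CARD('k) * (CARD('n) * (CARD('n) * (lb_f / R) * c))"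
        by (simp add: D_a_def)
    qed
    also have "\<dots> = l / R * norm (a - a') * c" by (simp add: l_def)
    finally show "norm (f x \<mu> a - f x \<mu>' a - (f x \<mu> a' - f x \<mu>' a')) \<le> l / R * norm (a - a') * c" .
  qed (use tw l0 in auto)
  then show ?thesis unfolding l_def by blast
qed

text \<open>For the cost the opposite orders of differentiation are controlled,
  \<open>D_x (D_a g)\<close> and \<open>D_a_mu\<close>; integrating them yields the same second
  differences as for the drift. The weight is identically 1.\<close>

lemma coefficient_a2:
  fixes g :: "real^'n \<Rightarrow> (real^'n) measure \<Rightarrow> real^'k \<Rightarrow> real"
  assumes a2: "assumption_a2 lam_g Lam_g lb_g l_g g dg"
  shows "\<exists>d2g. coefficient g dg d2g 0 (Lam_g + lb_g)"
proof -
  define l where "l = Lam_g + lb_g"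
  have lb0: "0 < lb_g" "0 < Lam_g" and tw: "twice_diffble_xa g"
    and dmu: "\<forall>x. \<forall>\<mu>\<in>P2. \<forall>a y. (\<lambda>x. D_mu dg x \<mu> a y) differentiable (at x) \<and>
                       (\<lambda>a. D_mu dg x \<mu> a y) differentiable (at a)"
    using a2 unfolding assumption_a2_def by blast+
  obtain d2g where reg: "\<forall>x a. regular2 (\<lambda>\<mu>. g x \<mu> a) (\<lambda>\<mu> y. dg x \<mu> a y) (\<lambda>\<mu> y w. d2g x \<mu> a y w)"
    and B: "bounded_by (\<lambda>_ _. Lam_g) (\<lambda>x \<mu> a y w. D_mumu d2g x \<mu> a y w)"
        "bounded_by (\<lambda>_ _. Lam_g) (\<lambda>x \<mu> a y w. D_x_mu dg x \<mu> a y)"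
        "bounded_by (\<lambda>_ _. Lam_g) (\<lambda>x \<mu> a y w. D_x (D_x g) x \<mu> a)"
        "bounded_by (\<lambda>_ _. Lam_g) (\<lambda>x \<mu> a y w. D_y_mu dg x \<mu> a y)"
        "bounded_by (\<lambda>_ _. lb_g) (\<lambda>x \<mu> a y w. D_x (D_a g) x \<mu> a)"
        "bounded_by (\<lambda>_ _. lb_g) (\<lambda>x \<mu> a y w. D_a_mu dg x \<mu> a y)"
    using a2 unfolding assumption_a2_def by (elim conjE exE) (rule that; assumption)
  have W: "weight 0 x \<mu> = 1" for x :: "real^'n" and \<mu> :: "(real^'n) measure" by (simp add: weight_def)
  have l0: "0 \<le> l" and bl: "Lam_g \<le> l" "lb_g \<le> l" using lb0 by (auto simp: l_def)
  have lR: "lb_g \<le> l / R" if "0 < R" "R \<le> 1" for R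
  proof -
    have "l / 1 \<le> l / R" using that l0 by (intro divide_left_mono) auto
    then show ?thesis using bl by simp
  qed
  have da: "\<And>\<mu> a x. \<mu> \<in> P2 \<Longrightarrow> (\<lambda>a. g x \<mu> a) differentiable (at a)"
    and dax: "\<And>\<mu> a x. \<mu> \<in> P2 \<Longrightarrow> (\<lambda>x. D_a g x \<mu> a) differentiable (at x)"
    using tw unfolding twice_diffble_xa_def by blast+
  have lfd: "is_lfd (\<lambda>\<mu>. g x \<mu> a) (\<lambda>\<mu> y. dg x \<mu> a y)" for x a
    using reg[rule_format, of x a] unfolding regular2_def by blast
  have ddg: "dg x \<nu> a differentiable (at y)" if "\<nu> \<in> P2" for x a \<nu> y
    using reg[rule_format, of x a] that unfolding regular2_def by blast
  have "coefficient g dg d2g 0 l"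
  proof
    fix x :: "real^'n" and a :: "real^'k" and b :: real assume "b \<in> Basis"
    then show "regular2 (\<lambda>\<mu>. g x \<mu> a \<bullet> b) (\<lambda>\<mu> y. dg x \<mu> a y \<bullet> b) (\<lambda>\<mu> y w. d2g x \<mu> a y w \<bullet> b)"
      using reg by simp
  next
    fix x :: "real^'n" and \<mu> :: "(real^'n) measure" and a :: "real^'k" and y :: "real^'n" assume "\<mu> \<in> P2"
    then show "(\<lambda>x. D_mu dg x \<mu> a y) differentiable (at x)" using dmu by blast
  next
    fix x :: "real^'n" and \<mu> :: "(real^'n) measure" and a :: "real^'k" and y w :: "real^'n" assume \<mu>: "\<mu> \<in> P2"
    show "norm (D_mumu d2g x \<mu> a y w) \<le> l / weight 0 x \<mu>"
      using B(1) \<mu> bl(1) unfolding bounded_by_def W by (simp, meson order_trans)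
  next
    fix x :: "real^'n" and \<mu> :: "(real^'n) measure" and a :: "real^'k" and y :: "real^'n" assume \<mu>: "\<mu> \<in> P2"
    show "norm (D_x_mu dg x \<mu> a y) \<le> l / weight 0 x \<mu>"
      using B(2) \<mu> bl(1) unfolding bounded_by_def W by (simp, meson order_trans)
    show "norm (D_y_mu dg x \<mu> a y) \<le> l / weight 0 x \<mu>"
      using B(4) \<mu> bl(1) unfolding bounded_by_def W by (simp, meson order_trans)
    show "norm (D_x (D_x g) x \<mu> a) \<le> l / weight 0 x \<mu>"
      using B(3) \<mu> bl(1) unfolding bounded_by_def W by (simp, meson order_trans)
  next
    fix \<mu> :: "(real^'n) measure" and R :: real and x x' :: "real^'n" and a a' :: "real^'k"
    assume \<mu>: "\<mu> \<in> P2" and R: "0 < R" "\<And>u. u \<in> closed_segment x x' \<Longrightarrow> R \<le> weight 0 u \<mu>"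
    have R1: "R \<le> 1" using R(2)[of x] by (simp add: W)
    have "norm (g x \<mu> a - g x' \<mu> a - (g x \<mu> a' - g x' \<mu> a')) \<le> (lb_g * norm (x - x')) * norm (a - a')"
    proof (rule fderiv_bound_diff[OF da[OF \<mu>] da[OF \<mu>]])
      fix u
      have "norm (D_a g x \<mu> u - D_a g x' \<mu> u) \<le> lb_g * norm (x - x')"
      proof (rule fderiv_bound[OF dax[OF \<mu>]])
        fix v
        have "norm (D_x (D_a g) v \<mu> u) \<le> lb_g" using B(5) \<mu> unfolding bounded_by_def by blast
        then show "norm (fderiv (\<lambda>x. D_a g x \<mu> u) v) \<le> lb_g" by (simp add: D_x_def)
      qed
      then show "norm (fderiv (\<lambda>a. g x \<mu> a) u - fderiv (\<lambda>a. g x' \<mu> a) u) \<le> lb_g * norm (x - x')"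
        by (simp add: D_a_def)
    qed
    also have "\<dots> \<le> (l / R * norm (x - x')) * norm (a - a')"
      by (intro mult_right_mono lR R R1) auto
    finally show "norm (g x \<mu> a - g x' \<mu> a - (g x \<mu> a' - g x' \<mu> a')) \<le> l / R * norm (x - x') * norm (a - a')" .
  next
    fix \<mu> \<mu>' :: "(real^'n) measure" and c R :: real and x :: "real^'n" and a a' :: "real^'k"
    assume P2: "\<mu> \<in> P2" "\<mu>' \<in> P2" and c: "W1_le \<mu> \<mu>' c" and R: "0 < R" "R < weight 0 x \<mu> - 0 * c"
    have kant: "kant_le \<mu> \<mu>' c" by (intro kant_le_if_W1_le c P2)
    have R1: "R \<le> 1" using R(2) by (simp add: W)
    have "\<bar>g x \<mu> a - g x \<mu>' a - (g x \<mu> a' - g x \<mu>' a')\<bar> \<le> (lb_g * norm (a - a')) * c"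
    proof (rule lfd_lipschitz_diff[OF lfd lfd P2 kant])
      show "0 \<le> lb_g * norm (a - a')" using lb0 by simp
      fix \<theta> :: real and y y' assume \<theta>: "0 \<le> \<theta>" "\<theta> \<le> 1"
      define \<nu> where "\<nu> = mix \<theta> \<mu> \<mu>'"
      have \<nu>: "\<nu> \<in> P2" using P2 \<theta> by (simp add: \<nu>_def mix_P2)
      have "norm (dg x \<nu> a y - dg x \<nu> a' y - (dg x \<nu> a y' - dg x \<nu> a' y')) \<le> lb_g * norm (a - a') * norm (y - y')"
      proof (rule fderiv_bound_diff[OF ddg[OF \<nu>] ddg[OF \<nu>]])
        fix u
        have "norm (D_mu dg x \<nu> a u - D_mu dg x \<nu> a' u) \<le> lb_g * norm (a - a')"
        proof (rule fderiv_bound)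
          fix v
          show "(\<lambda>a. D_mu dg x \<nu> a u) differentiable (at v)" using dmu \<nu> by blast
          have "norm (D_a_mu dg x \<nu> v u) \<le> lb_g" using B(6) \<nu> unfolding bounded_by_def by blast
          then show "norm (fderiv (\<lambda>a. D_mu dg x \<nu> a u) v) \<le> lb_g" by (simp add: D_a_mu_def D_a_def)
        qed
        then show "norm (fderiv (dg x \<nu> a) u - fderiv (dg x \<nu> a') u) \<le> lb_g * norm (a - a')" by (simp add: D_mu_def)
      qed
      then show "\<bar>dg x (mix \<theta> \<mu> \<mu>') a y - dg x (mix \<theta> \<mu> \<mu>') a' y - (dg x (mix \<theta> \<mu> \<mu>') a y' - dg x (mix \<theta> \<mu> \<mu>') a' y')\<bar>
        \<le> lb_g * norm (a - a') * norm (y - y')" unfolding \<nu>_def by simp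
    qed
    also have "\<dots> \<le> (l / R * norm (a - a')) * c"
      using kant unfolding kant_le_def by (intro mult_right_mono lR R R1) auto
    finally show "norm (g x \<mu> a - g x \<mu>' a - (g x \<mu> a' - g x \<mu>' a')) \<le> l / R * norm (a - a') * c" by simp
  qed (use tw l0 in auto)
  then show ?thesis unfolding l_def by blast
qed

text \<open>The estimates for near arguments, evaluated at \<open>R = W / 2\<close>. The 6 dominates
  the numerical factors, the largest being that of the measure in
  \<open>D_mu_lipschitz_near\<close>.\<close>

lemma near_scale:
  fixes t l W S D n :: real
  assumes "t \<le> l / (W / 2) * S" "0 < W" "0 \<le> l" "S \<le> 6 * n * D"
  shows "t \<le> 12 * n * l / W * D"
proof -
  have "l / (W / 2) * S \<le> l / (W / 2) * (6 * n * D)"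
    using assms by (intro mult_left_mono) auto
  also have "\<dots> = 12 * n * l / W * D" by simp
  finally show ?thesis using assms(1) by linarith
qed

text \<open>Outside the near regime \<open>W\<close> is below \<open>4 * D\<close>, and then the sup
  bound \<open>2 * \<Lambda>\<close> is at most \<open>8 * \<Lambda> / W * D\<close>. One constant
  thus serves all displacements.\<close>

lemma near_far:
  fixes t d W \<Lambda> K D C :: real
  assumes "d \<le> W / 4 \<Longrightarrow> t \<le> K / W * D" "t \<le> 2 * \<Lambda>" "d \<le> D" "0 \<le> d" "0 < W" "0 \<le> K" "0 \<le> \<Lambda>" "K + 8 * \<Lambda> \<le> C"
  shows "t \<le> C / W * D"
proof (cases "d \<le> W / 4")
  case True
  have "K / W * D \<le> C / W * D"
    using assms by (intro mult_right_mono divide_right_mono) auto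
  then show ?thesis using assms(1)[OF True] by linarith
next
  case False
  then have "W \<le> 4 * D" using assms by linarith
  then have "2 * \<Lambda> * W \<le> 2 * \<Lambda> * (4 * D)" using assms by (intro mult_left_mono) auto
  also have "\<dots> = (8 * \<Lambda>) * D" by simp
  also have "\<dots> \<le> C * D" using assms by (intro mult_right_mono) auto
  finally have "2 * \<Lambda> \<le> C / W * D" using assms(5) by (simp add: pos_le_divide_eq)
  then show ?thesis using assms(2) by linarith
qed

lemma norm_diff_le_add: "norm (x - y) \<le> norm x + norm y"
  by (rule norm_triangle_ineq4)

lemma norm_le_add_diff: "norm y \<le> B \<Longrightarrow> norm (x - y) \<le> d \<Longrightarrow> norm x \<le> B + d"
  using norm_triangle_sub[of x y] by linarith

text \<open>\<open>C\<close> majorises every constant that occurs: \<open>1 / lam_g\<close> inverts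
  the strong convexity, \<open>CARD('n)\<close> stems from coordinatewise estimates in the measure,
  the values at the origin turn Lipschitz bounds into linear growth, and the last two entries are
  the Lipschitz constants of the derivatives of \<open>f\<close> and \<open>g\<close>.\<close>

locale control_problem =
  fixes f :: "real^'n \<Rightarrow> (real^'n) measure \<Rightarrow> real^'k \<Rightarrow> real^'n"
    and df :: "real^'n \<Rightarrow> (real^'n) measure \<Rightarrow> real^'k \<Rightarrow> real^'n \<Rightarrow> real^'n"
    and g :: "real^'n \<Rightarrow> (real^'n) measure \<Rightarrow> real^'k \<Rightarrow> real"
    and dg :: "real^'n \<Rightarrow> (real^'n) measure \<Rightarrow> real^'k \<Rightarrow> real^'n \<Rightarrow> real"
    and p :: "real^'n \<Rightarrow> (real^'n) measure \<Rightarrow> real^'n"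
    and \<alpha> :: "real^'n \<Rightarrow> (real^'n) measure \<Rightarrow> real^'n \<Rightarrow> real^'k"
    and lam_f Lam_f lb_f Lip_f lam_g Lam_g lb_g l_g L_p Lbar C :: real
  assumes a1: "assumption_a1 lam_f Lam_f lb_f Lip_f f df"
    and a2: "assumption_a2 lam_g Lam_g lb_g l_g g dg"
    and P: "assumption_P L_p Lbar p"
    and Lbar: "0 < Lbar" "L_p \<le> Lbar"
    and D_aa_f: "\<And>x \<mu> a. \<mu> \<in> P2 \<Longrightarrow>
      norm (D_a (D_a f) x \<mu> a) * (1 + norm x + moment1 \<mu>) \<le> lam_g / (40 * Lbar)"
    and optimal: "optimal_control f g \<alpha>"
    and C_ge: "1 \<le> C" "1 / lam_g \<le> C" "CARD('n) * Lam_f \<le> C" "CARD('n) * Lbar \<le> C"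
      "norm (f 0 dirac0 0) \<le> C" "norm (D_a g 0 dirac0 0) \<le> C"
      "norm (D_x g 0 dirac0 0) \<le> C" "norm (D_mu dg 0 dirac0 0 0) \<le> C"
      "12 * CARD('n) * (CARD('n) * (CARD('n) * (CARD('k) * lb_f))) + 8 * Lam_f \<le> C"
      "12 * (Lam_g + lb_g) \<le> C"
begin

lemma card_n: "1 \<le> real CARD('n)"
  by (simp add: Suc_le_eq)

lemma le_card_mult: "0 \<le> t \<Longrightarrow> t \<le> CARD('n) * t" for t :: real
  using mult_right_mono[OF card_n, of t] by simp

lemma constants: "0 < lb_f" "0 < Lam_f" "0 < lam_g" "0 < Lam_g" "0 < lb_g"
  using a1 a2 unfolding assumption_a1_def assumption_a2_def by blast+

lemma twice_f: "twice_diffble_xa f" and twice_g: "twice_diffble_xa g"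
  using a1 a2 unfolding assumption_a1_def assumption_a2_def by blast+

lemma convex_g: "\<mu> \<in> P2 \<Longrightarrow> lam_g * (norm \<xi>)\<^sup>2 \<le> blinfun_apply (blinfun_apply (D_a (D_a g) x \<mu> a) \<xi>) \<xi>"
  using a2 unfolding assumption_a2_def by blast

lemma f_bounds:
  assumes "\<mu> \<in> P2"
  shows "norm (D_a f x \<mu> a) \<le> Lam_f" "norm (D_mu df x \<mu> a y) \<le> Lam_f" "norm (D_x f x \<mu> a) \<le> Lam_f"
  using a1 assms unfolding assumption_a1_def by blast+

lemma Lbar_le: "Lbar \<le> C" and Lam_f_le: "Lam_f \<le> C"
  using le_card_mult[of Lbar] le_card_mult[of Lam_f] C_ge(3,4) Lbar(1) constants(2) by linarith+

context
  fixes \<mu> \<mu>' :: "(real^'n) measure" and c :: real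
  assumes P2: "\<mu> \<in> P2" "\<mu>' \<in> P2" and c: "W1_le \<mu> \<mu>' c"
begin

lemma c_nonneg: "0 \<le> c"
  using kant_le_if_W1_le[OF c P2] by (simp add: kant_le_def)

lemma f_lipschitz: "norm (f x \<mu> a - f x' \<mu>' a') \<le> C * (norm (x - x') + c + norm (a - a'))"
proof -
  obtain d2f where "coefficient f df d2f 1 (CARD('n) * (CARD('n) * (CARD('k) * lb_f)))"
    using coefficient_a1[OF a1] by blast
  then interpret F: coefficient f df d2f 1 "CARD('n) * (CARD('n) * (CARD('k) * lb_f))" .
  have 1: "norm (f x \<mu> a - f x' \<mu> a) \<le> Lam_f * norm (x - x')"
    by (rule fderiv_bound[OF F.diff_x[OF P2(1)]]) (use f_bounds(3)[OF P2(1)] in \<open>simp add: D_x_def\<close>)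
  have 2: "norm (f x' \<mu> a - f x' \<mu>' a) \<le> CARD('n) * (Lam_f * c)"
  proof (rule order_trans[OF norm_le_components])
    fix b :: "real^'n" assume b: "b \<in> Basis"
    have "\<bar>f x' \<mu> a \<bullet> b - f x' \<mu>' a \<bullet> b\<bar> \<le> Lam_f * c"
    proof (rule lfd_lipschitz[OF F.is_lfd_F[OF b] P2 kant_le_if_W1_le[OF c P2]])
      fix \<theta> :: real and y y' :: "real^'n" assume "0 \<le> \<theta>" "\<theta> \<le> 1"
      then have m: "mix \<theta> \<mu> \<mu>' \<in> P2" using P2 by (simp add: mix_P2)
      have "norm (df x' (mix \<theta> \<mu> \<mu>') a y - df x' (mix \<theta> \<mu> \<mu>') a y') \<le> Lam_f * norm (y - y')"
        by (rule fderiv_bound[OF F.diff_dF[OF m]]) (use f_bounds(2)[OF m] in \<open>simp add: D_mu_def\<close>)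
      then show "\<bar>df x' (mix \<theta> \<mu> \<mu>') a y \<bullet> b - df x' (mix \<theta> \<mu> \<mu>') a y' \<bullet> b\<bar> \<le> Lam_f * norm (y - y')"
        using Basis_le_norm[OF b] unfolding inner_diff_left[symmetric] by (meson order_trans)
    qed (use constants in simp)
    then show "\<bar>(f x' \<mu> a - f x' \<mu>' a) \<bullet> b\<bar> \<le> Lam_f * c" by (simp add: inner_diff_left)
  qed simp
  have 3: "norm (f x' \<mu>' a - f x' \<mu>' a') \<le> Lam_f * norm (a - a')"
    by (rule fderiv_bound[OF F.diff_a[OF P2(2)]]) (use f_bounds(1)[OF P2(2)] in \<open>simp add: D_a_def\<close>)
  have "norm (f x \<mu> a - f x' \<mu>' a') \<le> Lam_f * norm (x - x') + CARD('n) * Lam_f * c + Lam_f * norm (a - a')"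
    using norm_triangle_ineq[of "f x \<mu> a - f x' \<mu> a" "f x' \<mu> a - f x' \<mu>' a"]
      norm_triangle_ineq[of "f x \<mu> a - f x' \<mu>' a" "f x' \<mu>' a - f x' \<mu>' a'"] 1 2 3 by simp
  also have "\<dots> \<le> C * norm (x - x') + C * c + C * norm (a - a')"
    using Lam_f_le C_ge(3) c_nonneg by (intro add_mono mult_right_mono) auto
  finally show ?thesis by (simp add: distrib_left)
qed

text \<open>\<open>near_far\<close> with \<open>W\<close> the weight at the unprimed point. For
  \<open>D_a f\<close> the control is held fixed, since its variation is governed by the smallness
  condition \<open>D_aa_f\<close>.\<close>

lemma D_f_lipschitz:
  "norm (D_x f x \<mu> a - D_x f x' \<mu>' a') \<le> C / (1 + norm x + moment1 \<mu>) * (norm (x - x') + c + norm (a - a'))" (is ?x)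
  "norm (D_a f x \<mu> a - D_a f x' \<mu>' a) \<le> C / (1 + norm x + moment1 \<mu>) * (norm (x - x') + c)" (is ?a)
  "norm (D_mu df x \<mu> a y - D_mu df x' \<mu>' a' y') \<le>
    C / (1 + norm x + moment1 \<mu>) * (norm (x - x') + c + norm (a - a') + norm (y - y'))" (is ?m)
proof -
  define l where "l = CARD('n) * (CARD('n) * (CARD('k) * lb_f))"
  obtain d2f where "coefficient f df d2f 1 l"
    using coefficient_a1[OF a1] unfolding l_def by blast
  then interpret F: coefficient f df d2f 1 l .
  define W where "W = 1 + norm x + moment1 \<mu>"
  have W: "0 < W" "weight 1 x \<mu> = 2 * (W / 2)" using moment1_nonneg[of \<mu>] by (auto simp: W_def weight_def add_pos_nonneg)
  have near: "1 * (norm (x - x') + c) \<le> W / 2 / 2" if "norm (x - x') + c \<le> W / 4" using that by simp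
  define n where "n = real CARD('n)"
  have n: "1 \<le> n" unfolding n_def by (rule card_n)
  have K: "0 \<le> 12 * n * l" "12 * n * l + 8 * Lam_f \<le> C"
    using n F.l C_ge(9) by (auto simp: n_def l_def)
  have scale: "t \<le> n * t" if "0 \<le> t" for t using mult_right_mono[OF n that] by simp
  have d0: "0 \<le> norm (x - x') + c" using c_nonneg by simp
  have L0: "0 \<le> Lam_f" using constants by simp
  have "norm (D_x f x \<mu> a - D_x f x' \<mu>' a') \<le> C / W * (norm (x - x') + c + norm (a - a'))"
  proof (rule near_far[OF _ _ _ d0 W(1) K(1) L0 K(2)])
    assume "norm (x - x') + c \<le> W / 4"
    from F.D_x_lipschitz_near[OF P2 c near[OF this] W(2), of a a']
    show "norm (D_x f x \<mu> a - D_x f x' \<mu>' a') \<le> 12 * n * l / W * (norm (x - x') + c + norm (a - a'))"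
    proof (rule near_scale[OF _ W(1) F.l])
      have "norm (x - x') + DIM(real^'n) * c + norm (a - a') \<le> n * (norm (x - x') + c + norm (a - a'))"
        using scale[of "norm (x - x')"] scale[of "norm (a - a')"] by (simp add: n_def[symmetric] distrib_left)
      also have "\<dots> \<le> 6 * n * (norm (x - x') + c + norm (a - a'))"
        using c_nonneg n by simp
      finally show "norm (x - x') + DIM(real^'n) * c + norm (a - a') \<le> 6 * n * (norm (x - x') + c + norm (a - a'))" .
    qed
  qed (use f_bounds(3)[OF P2(1), of x a] f_bounds(3)[OF P2(2), of x' a'] norm_diff_le_add[of "D_x f x \<mu> a" "D_x f x' \<mu>' a'"] in auto)
  then show ?x by (simp add: W_def)
  have "norm (D_a f x \<mu> a - D_a f x' \<mu>' a) \<le> C / W * (norm (x - x') + c)"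
  proof (rule near_far[OF _ _ _ d0 W(1) K(1) L0 K(2)])
    assume "norm (x - x') + c \<le> W / 4"
    from F.D_a_lipschitz_near[OF P2 c near[OF this] W(2), of a]
    show "norm (D_a f x \<mu> a - D_a f x' \<mu>' a) \<le> 12 * n * l / W * (norm (x - x') + c)"
    proof (rule near_scale[OF _ W(1) F.l])
      show "norm (x - x') + c \<le> 6 * n * (norm (x - x') + c)"
        using scale[OF d0] d0 by linarith
    qed
  qed (use f_bounds(1)[OF P2(1), of x a] f_bounds(1)[OF P2(2), of x' a] norm_diff_le_add[of "D_a f x \<mu> a" "D_a f x' \<mu>' a"] in auto)
  then show ?a by (simp add: W_def)
  have "norm (D_mu df x \<mu> a y - D_mu df x' \<mu>' a' y') \<le> C / W * (norm (x - x') + c + norm (a - a') + norm (y - y'))"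
  proof (rule near_far[OF _ _ _ d0 W(1) K(1) L0 K(2)])
    assume "norm (x - x') + c \<le> W / 4"
    from F.D_mu_lipschitz_near[OF P2 c near[OF this] W(2), of a y a' y']
    show "norm (D_mu df x \<mu> a y - D_mu df x' \<mu>' a' y') \<le> 12 * n * l / W * (norm (x - x') + c + norm (a - a') + norm (y - y'))"
    proof (rule near_scale[OF _ W(1) F.l])
      have "6 * n * (norm (x - x') + c + norm (a - a') + norm (y - y')) =
        6 * (n * norm (x - x')) + 6 * n * c + 6 * (n * norm (a - a')) + 6 * (n * norm (y - y'))"
        by (simp add: distrib_left)
      moreover have "norm (x - x') + 6 * n * c + n * norm (a - a') + norm (y - y') \<le> \<dots>"
        using scale[OF norm_ge_zero, of "x - x'"] scale[OF norm_ge_zero, of "y - y'"] scale[OF norm_ge_zero, of "a - a'"]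
          norm_ge_zero[of "x - x'"] norm_ge_zero[of "y - y'"] norm_ge_zero[of "a - a'"] by linarith
      ultimately show "norm (x - x') + 6 * DIM(real^'n) * c + DIM(real^'n) * norm (a - a') + norm (y - y')
        \<le> 6 * n * (norm (x - x') + c + norm (a - a') + norm (y - y'))" by (simp add: n_def)
    qed
  qed (use f_bounds(2)[OF P2(1), of x a y] f_bounds(2)[OF P2(2), of x' a' y']
      norm_diff_le_add[of "D_mu df x \<mu> a y" "D_mu df x' \<mu>' a' y'"] in auto)
  then show ?m by (simp add: W_def)
qed

lemma D_g_lipschitz:
  "norm (D_x g x \<mu> a - D_x g x' \<mu>' a') \<le> C * (norm (x - x') + c + norm (a - a'))" (is ?x)
  "norm (D_a g x \<mu> a - D_a g x' \<mu>' a) \<le> C * (norm (x - x') + c)" (is ?a)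
  "norm (D_mu dg x \<mu> a y - D_mu dg x' \<mu>' a' y') \<le>
    C * (norm (x - x') + c + norm (a - a') + norm (y - y'))" (is ?m)
proof -
  obtain d2g where "coefficient g dg d2g 0 (Lam_g + lb_g)"
    using coefficient_a2[OF a2] by blast
  then interpret G: coefficient g dg d2g 0 "Lam_g + lb_g" .
  \<comment> \<open>With \<open>\<omega> = 0\<close> the weight is 1, so \<open>R\<close> is 1/2 and
    the nearness condition is void.\<close>
  have R: "weight 0 x \<mu> = 2 * (1 / 2)" by (simp add: weight_def)
  have near: "0 * (norm (x - x') + c) \<le> (1 / 2) / 2" by simp
  have up: "t \<le> C * D" if "t \<le> (Lam_g + lb_g) / (1 / 2) * S" "S \<le> 6 * D" "0 \<le> D" for t S D
  proof -
    have "(Lam_g + lb_g) / (1 / 2) * S \<le> (Lam_g + lb_g) / (1 / 2) * (6 * D)"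
      using that G.l by (intro mult_left_mono) auto
    also have "\<dots> = (12 * (Lam_g + lb_g)) * D" by simp
    also have "\<dots> \<le> C * D" using that C_ge(10) by (intro mult_right_mono) auto
    finally show ?thesis using that(1) by linarith
  qed
  show ?x using up[OF G.D_x_lipschitz_near[OF P2 c near R, of a a']] c_nonneg by auto
  show ?a using up[OF G.D_a_lipschitz_near[OF P2 c near R, of a]] c_nonneg by auto
  show ?m using up[OF G.D_mu_lipschitz_near[OF P2 c near R, of a y a' y']] c_nonneg by auto
qed

lemma p_lipschitz: "norm (p x \<mu> - p x' \<mu>') \<le> C * (norm (x - x') + c)"
proof -
  obtain Dm where Dm: "\<forall>x. \<forall>\<mu>\<in>P2. \<forall>i. has_L_derivative (\<lambda>\<mu>. p x \<mu> $ i) \<mu> (\<lambda>y. comp_grad (Dm x \<mu> y) i)"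
    and B: "\<forall>x. \<forall>\<mu>\<in>P2. \<forall>y. norm (fderiv (\<lambda>x. p x \<mu>) x) \<le> L_p \<and> norm (Dm x \<mu> y) \<le> L_p"
    and d: "\<forall>\<mu>\<in>P2. diffble (\<lambda>x. p x \<mu>)"
    using P unfolding assumption_P_def by blast
  have 1: "norm (p x \<mu> - p x' \<mu>) \<le> L_p * norm (x - x')"
    by (rule fderiv_bound) (use d B P2 in blast)+
  have 2: "norm (p x' \<mu> - p x' \<mu>') \<le> CARD('n) * (L_p * c)"
  proof (rule order_trans[OF norm_le_components])
    fix b :: "real^'n" assume "b \<in> Basis"
    then obtain i where b: "\<And>x. x \<bullet> b = x $ i" using Basis_cart_inner by blast
    \<comment> \<open>The bound on \<open>Dm\<close> is uniform in the measure, so any threshold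
      below \<open>moment1 \<mu> - c\<close> serves.\<close>
    have "\<bar>p x' \<mu> $ i - p x' \<mu>' $ i\<bar> \<le> L_p * c"
    proof (rule L_derivative_lipschitz[OF _ _ P2 c, where r = "moment1 \<mu> - c - 1"])
      fix \<nu> :: "(real^'n) measure" and y assume \<nu>: "\<nu> \<in> P2"
      then show "has_L_derivative (\<lambda>\<mu>. p x' \<mu> $ i) \<nu> (\<lambda>y. comp_grad (Dm x' \<nu> y) i)" using Dm by blast
      have "norm (Dm x' \<nu> y) \<le> L_p" using B \<nu> by blast
      then show "norm (comp_grad (Dm x' \<nu> y) i) \<le> L_p" using norm_comp_grad order_trans by blast
    qed simp
    then show "\<bar>(p x' \<mu> - p x' \<mu>') \<bullet> b\<bar> \<le> L_p * c" by (simp add: b)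
  qed simp
  have "norm (p x \<mu> - p x' \<mu>') \<le> L_p * norm (x - x') + CARD('n) * L_p * c"
    using norm_triangle_ineq[of "p x \<mu> - p x' \<mu>" "p x' \<mu> - p x' \<mu>'"] 1 2 by simp
  also have "\<dots> \<le> C * norm (x - x') + C * c"
  proof (intro add_mono mult_right_mono)
    show "L_p \<le> C" using Lbar(2) Lbar_le by linarith
    have "CARD('n) * L_p \<le> CARD('n) * Lbar" using Lbar(2) by (intro mult_left_mono) auto
    then show "CARD('n) * L_p \<le> C" using C_ge(4) by linarith
  qed (use c_nonneg in auto)
  finally show ?thesis by (simp add: distrib_left)
qed

end

lemma p_growth: "\<mu> \<in> P2 \<Longrightarrow> norm (p x \<mu>) \<le> Lbar * (1 + norm x + moment1 \<mu>)"
  using P unfolding assumption_P_def by blast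

section \<open>Linear growth and the optimal control\<close>

lemma growth:
  assumes "\<mu> \<in> P2"
  shows "norm (f x \<mu> a) \<le> C * (1 + norm x + moment1 \<mu> + norm a)"
    "norm (D_x g x \<mu> a) \<le> C * (1 + norm x + moment1 \<mu> + norm a)"
    "norm (D_a g x \<mu> 0) \<le> C * (1 + norm x + moment1 \<mu>)"
    "norm (D_mu dg x \<mu> a y) \<le> C * (1 + norm x + moment1 \<mu> + norm a + norm y)"
proof -
  note c = W1_le_dirac0[OF assms]
  show "norm (f x \<mu> a) \<le> C * (1 + norm x + moment1 \<mu> + norm a)"
    using norm_le_add_diff[OF C_ge(5) f_lipschitz[OF assms dirac_P2 c, of x a 0 0]] by (simp add: algebra_simps)
  show "norm (D_x g x \<mu> a) \<le> C * (1 + norm x + moment1 \<mu> + norm a)"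
    using norm_le_add_diff[OF C_ge(7) D_g_lipschitz(1)[OF assms dirac_P2 c, of x a 0 0]] by (simp add: algebra_simps)
  show "norm (D_a g x \<mu> 0) \<le> C * (1 + norm x + moment1 \<mu>)"
    using norm_le_add_diff[OF C_ge(6) D_g_lipschitz(2)[OF assms dirac_P2 c, of x 0 0]] by (simp add: algebra_simps)
  show "norm (D_mu dg x \<mu> a y) \<le> C * (1 + norm x + moment1 \<mu> + norm a + norm y)"
    using norm_le_add_diff[OF C_ge(8) D_g_lipschitz(3)[OF assms dirac_P2 c, of x a y 0 0 0]] by (simp add: algebra_simps)
qed

text \<open>Strong monotonicity of the gradient from the Hessian bound, by the mean value theorem
  along the segment from \<open>a'\<close> to \<open>a\<close>.\<close>

lemma D_a_g_monotone:
  assumes "\<mu> \<in> P2"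
  shows "lam_g * (norm (a - a'))\<^sup>2 \<le> blinfun_apply (D_a g x \<mu> a - D_a g x \<mu> a') (a - a')"
proof -
  define v where "v = a - a'"
  define H where "H s = D_a (D_a g) x \<mu> (a' + s *\<^sub>R v)" for s
  have diff: "(\<lambda>a. D_a g x \<mu> a) differentiable (at u)" for u
    using twice_g assms unfolding twice_diffble_xa_def by blast
  have "((\<lambda>s. blinfun_apply (D_a g x \<mu> (a' + s *\<^sub>R v)) v) has_field_derivative blinfun_apply (blinfun_apply (H s) v) v) (at s)" for s
  proof -
    have "((\<lambda>s. a' + s *\<^sub>R v) has_derivative (\<lambda>h. h *\<^sub>R v)) (at s)" by (auto intro!: derivative_eq_intros)
    moreover have "((\<lambda>a. D_a g x \<mu> a) has_derivative blinfun_apply (H s)) (at (a' + s *\<^sub>R v))"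
      using fderiv_has_derivative[OF diff] by (simp add: H_def D_a_def[of "D_a g"])
    ultimately have "((\<lambda>s. D_a g x \<mu> (a' + s *\<^sub>R v)) has_derivative (\<lambda>h. blinfun_apply (H s) (h *\<^sub>R v))) (at s)"
      by (rule has_derivative_compose)
    from bounded_linear.has_derivative[OF blinfun.bounded_linear_left this, of v]
    show ?thesis
      by (simp add: has_field_derivative_def blinfun.scaleR_right blinfun.scaleR_left mult_commute_abs)
  qed
  then obtain s where "blinfun_apply (D_a g x \<mu> (a' + 1 *\<^sub>R v)) v - blinfun_apply (D_a g x \<mu> (a' + 0 *\<^sub>R v)) v =
    (1 - 0) * blinfun_apply (blinfun_apply (H s) v) v"
    using MVT2[of 0 1 "\<lambda>s. blinfun_apply (D_a g x \<mu> (a' + s *\<^sub>R v)) v" "\<lambda>s. blinfun_apply (blinfun_apply (H s) v) v"] by auto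
  moreover have "lam_g * (norm v)\<^sup>2 \<le> blinfun_apply (blinfun_apply (H s) v) v"
    unfolding H_def by (rule convex_g[OF assms])
  ultimately show ?thesis by (simp add: v_def blinfun.diff_left)
qed

lemma first_order_condition:
  assumes "\<mu> \<in> P2"
  shows "contr (D_a f x \<mu> (\<alpha> x \<mu> z)) z + grad (D_a g x \<mu> (\<alpha> x \<mu> z)) = 0"
  using optimal assms unfolding optimal_control_def by blast

lemma le_C_mult_if:
  assumes "lam_g * t\<^sup>2 \<le> B * t" "0 \<le> t" "0 \<le> B"
  shows "t \<le> C * B"
proof (cases "t = 0")
  case True
  then show ?thesis using assms(3) C_ge(1) by simp
next
  case False
  then have "lam_g * t \<le> B" using assms by (simp add: power2_eq_square)
  then have "t \<le> B / lam_g" using constants(3) by (simp add: pos_le_divide_eq mult.commute)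
  also have "\<dots> \<le> C * B" using mult_right_mono[OF C_ge(2) assms(3)] by simp
  finally show ?thesis .
qed

text \<open>The first-order condition is tested with the control itself. As \<open>D_a f\<close> is
  bounded, this puts no restriction on \<open>z\<close>; the linear growth is available before a
  solution is known to stay in the cone, and the a priori estimates rest on it.\<close>

lemma alpha_growth:
  assumes \<mu>: "\<mu> \<in> P2"
  shows "norm (\<alpha> x \<mu> z) \<le> C\<^sup>2 * (1 + norm x + moment1 \<mu> + norm z)"
proof -
  define a where "a = \<alpha> x \<mu> z"
  have foc: "contr (D_a f x \<mu> a) z = - grad (D_a g x \<mu> a)"
    using first_order_condition[OF \<mu>] unfolding a_def by (simp add: add_eq_0_iff)
  have B: "0 \<le> C * (1 + norm x + moment1 \<mu> + norm z)" using C_ge(1) moment1_nonneg[of \<mu>] by simp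
  have "lam_g * (norm a)\<^sup>2 \<le> blinfun_apply (D_a g x \<mu> a - D_a g x \<mu> 0) a"
    using D_a_g_monotone[OF \<mu>, of a 0 x] by simp
  also have "\<dots> = - (contr (D_a f x \<mu> a) z + grad (D_a g x \<mu> 0)) \<bullet> a"
    by (simp add: foc inner_diff_left inner_add_left grad_inner blinfun.diff_left)
  also have "\<dots> \<le> norm (contr (D_a f x \<mu> a) z + grad (D_a g x \<mu> 0)) * norm a"
    using norm_cauchy_schwarz[of "- (contr (D_a f x \<mu> a) z + grad (D_a g x \<mu> 0))" a]
    by (simp only: norm_minus_cancel)
  also have "\<dots> \<le> (C * (1 + norm x + moment1 \<mu> + norm z)) * norm a"
  proof (rule mult_right_mono)
    have "norm (contr (D_a f x \<mu> a) z) \<le> C * norm z"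
      using norm_contr[of "D_a f x \<mu> a" z] f_bounds(1)[OF \<mu>, of x a] Lam_f_le
      by (meson mult_right_mono norm_ge_zero order_trans)
    moreover have "norm (grad (D_a g x \<mu> 0)) \<le> C * (1 + norm x + moment1 \<mu>)"
      using norm_grad growth(3)[OF \<mu>] order_trans by blast
    ultimately show "norm (contr (D_a f x \<mu> a) z + grad (D_a g x \<mu> 0)) \<le> C * (1 + norm x + moment1 \<mu> + norm z)"
      using norm_triangle_ineq[of "contr (D_a f x \<mu> a) z" "grad (D_a g x \<mu> 0)"] by (simp add: distrib_left)
  qed simp
  finally have "norm a \<le> C * (C * (1 + norm x + moment1 \<mu> + norm z))"
    by (rule le_C_mult_if[OF _ _ B]) simp
  then show ?thesis by (simp add: a_def power2_eq_square mult_ac)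
qed

text \<open>The two first-order conditions are subtracted so that every increment of
  \<open>D_a f\<close> is multiplied by \<open>z\<close>, and \<open>z - z'\<close> by the bounded
  \<open>D_a f\<close> at the primed point. The cone condition is therefore used at the unprimed
  point; its factor \<open>2 * Lbar\<close> is half of \<open>k0\<close>.\<close>

lemma alpha_lipschitz:
  assumes P2: "\<mu> \<in> P2" "\<mu>' \<in> P2" and c: "W1_le \<mu> \<mu>' c" and z: "norm z \<le> 2 * Lbar * (1 + norm x + moment1 \<mu>)"
  shows "norm (\<alpha> x \<mu> z - \<alpha> x' \<mu>' z') \<le> 6 * C ^ 3 * (norm (x - x') + c + norm (z - z'))"
proof -
  define a where "a = \<alpha> x \<mu> z"
  define a' where "a' = \<alpha> x' \<mu>' z'"
  define W where "W = 1 + norm x + moment1 \<mu>"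
  have W: "0 < W" using moment1_nonneg[of \<mu>] by (simp add: W_def add_pos_nonneg)
  define d where "d = norm (x - x') + c"
  have d: "0 \<le> d" using c_nonneg[OF P2 c] by (simp add: d_def)
  have z': "norm z \<le> 2 * Lbar * W" using z by (simp add: W_def)
  have foc: "grad (D_a g x \<mu> a) = - contr (D_a f x \<mu> a) z" "grad (D_a g x' \<mu>' a') = - contr (D_a f x' \<mu>' a') z'"
    using first_order_condition[OF P2(1), of x z] first_order_condition[OF P2(2), of x' z']
    by (simp_all add: a_def a'_def eq_neg_iff_add_eq_0 add.commute)
  \<comment> \<open>Only the control changes: the decay of \<open>D_a (D_a f)\<close> cancels the
    weight in the bound on \<open>z\<close> and leaves \<open>lam_g / 20\<close>.\<close>
  have near: "norm (contr (D_a f x \<mu> a) z - contr (D_a f x \<mu> a') z) \<le> lam_g / 20 * norm (a - a')"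
  proof -
    have "norm (D_a f x \<mu> a - D_a f x \<mu> a') \<le> lam_g / (40 * Lbar) / W * norm (a - a')"
    proof (rule fderiv_bound)
      fix u
      show "(\<lambda>a. D_a f x \<mu> a) differentiable (at u)"
        using twice_f P2 unfolding twice_diffble_xa_def by blast
      have "norm (D_a (D_a f) x \<mu> u) * W \<le> lam_g / (40 * Lbar)" using D_aa_f[OF P2(1)] by (simp add: W_def)
      then show "norm (fderiv (\<lambda>a. D_a f x \<mu> a) u) \<le> lam_g / (40 * Lbar) / W"
        unfolding D_a_def[of "D_a f"] by (simp only: pos_le_divide_eq[OF W])
    qed
    then have "norm (D_a f x \<mu> a - D_a f x \<mu> a') * norm z \<le> (lam_g / (40 * Lbar) / W * norm (a - a')) * (2 * Lbar * W)"
      using z' W Lbar(1) constants(3) by (intro mult_mono) auto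
    also have "\<dots> = lam_g / 20 * norm (a - a')" using W Lbar(1) by (simp add: field_simps)
    finally show ?thesis using norm_contr_diff[of "D_a f x \<mu> a" z "D_a f x \<mu> a'" z] by simp
  qed
  \<comment> \<open>At a fixed control, the \<open>1 / W\<close> in the Lipschitz bound for
    \<open>D_a f\<close> cancels the \<open>W\<close> in the bound on \<open>z\<close>.\<close>
  have far: "norm (contr (D_a f x \<mu> a') z - contr (D_a f x' \<mu>' a') z') \<le> 2 * C\<^sup>2 * d + C * norm (z - z')"
  proof -
    have "norm (D_a f x \<mu> a' - D_a f x' \<mu>' a') * norm z \<le> (C / W * d) * (2 * Lbar * W)"
      using D_f_lipschitz(2)[OF P2 c, of x a' x'] z' W C_ge(1) d by (intro mult_mono) (auto simp: W_def d_def)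
    also have "\<dots> = 2 * C * Lbar * d" using W by simp
    also have "\<dots> \<le> 2 * C * C * d" using Lbar_le Lbar(1) C_ge(1) d by (intro mult_mono) auto
    moreover have "norm (D_a f x' \<mu>' a') * norm (z - z') \<le> C * norm (z - z')"
      using f_bounds(1)[OF P2(2), of x' a'] Lam_f_le by (intro mult_right_mono) auto
    ultimately show ?thesis
      using norm_contr_diff[of "D_a f x \<mu> a'" z "D_a f x' \<mu>' a'" z'] by (simp add: power2_eq_square)
  qed
  have gfar: "norm (grad (D_a g x \<mu> a') - grad (D_a g x' \<mu>' a')) \<le> C * d"
    using norm_grad_diff D_g_lipschitz(2)[OF P2 c, of x a' x'] unfolding d_def by (rule order_trans)
  define B where "B = (2 * C\<^sup>2 * d + C * norm (z - z')) + C * d"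
  have B0: "0 \<le> B" using d C_ge(1) by (simp add: B_def)
  have "lam_g * (norm (a - a'))\<^sup>2 \<le> (grad (D_a g x \<mu> a) - grad (D_a g x \<mu> a')) \<bullet> (a - a')"
    using D_a_g_monotone[OF P2(1), of a a' x] by (simp add: grad_inner inner_diff_left blinfun.diff_left)
  also have "grad (D_a g x \<mu> a) - grad (D_a g x \<mu> a') =
    - (contr (D_a f x \<mu> a) z - contr (D_a f x \<mu> a') z) - (contr (D_a f x \<mu> a') z - contr (D_a f x' \<mu>' a') z')
    - (grad (D_a g x \<mu> a') - grad (D_a g x' \<mu>' a'))"
    unfolding foc by simp
  also have "\<dots> \<bullet> (a - a') \<le> norm (- (contr (D_a f x \<mu> a) z - contr (D_a f x \<mu> a') z)
    - (contr (D_a f x \<mu> a') z - contr (D_a f x' \<mu>' a') z') - (grad (D_a g x \<mu> a') - grad (D_a g x' \<mu>' a'))) * norm (a - a')"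
    by (rule norm_cauchy_schwarz)
  also have "\<dots> \<le> (lam_g / 20 * norm (a - a') + B) * norm (a - a')"
  proof (rule mult_right_mono)
    have tri: "norm (- u - v - w) \<le> norm u + norm v + norm w" for u v w :: "real^'k"
      using norm_triangle_ineq4[of "- u - v" w] norm_triangle_ineq4[of "- u" v] by simp
    show "norm (- (contr (D_a f x \<mu> a) z - contr (D_a f x \<mu> a') z)
    - (contr (D_a f x \<mu> a') z - contr (D_a f x' \<mu>' a') z') - (grad (D_a g x \<mu> a') - grad (D_a g x' \<mu>' a')))
      \<le> lam_g / 20 * norm (a - a') + B"
      unfolding B_def using near far gfar by (intro order_trans[OF tri]) linarith
  qed simp
  finally have "lam_g * (norm (a - a'))\<^sup>2 \<le> lam_g / 20 * (norm (a - a'))\<^sup>2 + B * norm (a - a')"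
    by (simp add: distrib_right power2_eq_square)
  moreover have "0 \<le> lam_g * (norm (a - a'))\<^sup>2" using constants(3) by simp
  \<comment> \<open>After absorption 19/20 of the convexity is left, more than one half.\<close>
  ultimately have "lam_g * (norm (a - a'))\<^sup>2 \<le> (2 * B) * norm (a - a')" by simp
  then have "norm (a - a') \<le> C * (2 * B)"
    using B0 by (intro le_C_mult_if) auto
  also have "2 * B \<le> 6 * C\<^sup>2 * (d + norm (z - z'))"
  proof -
    have CC: "C \<le> C\<^sup>2" using C_ge(1) by (simp add: power2_eq_square)
    have "C * d \<le> C\<^sup>2 * d" "C * norm (z - z') \<le> C\<^sup>2 * norm (z - z')"
      using CC d by (auto intro: mult_right_mono)
    moreover have "0 \<le> C\<^sup>2 * norm (z - z')" by simp
    ultimately show ?thesis unfolding B_def distrib_left by linarith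
  qed
  finally show ?thesis
    using C_ge(1) by (simp add: a_def a'_def d_def power3_eq_cube power2_eq_square mult_ac)
qed

end

section \<open>A priori estimates for solutions\<close>

lemma vector_mean_value:
  fixes u :: "real \<Rightarrow> 'a::real_normed_vector"
  assumes "a \<le> b" "{a..b} \<subseteq> S" "\<And>r. r \<in> {a..b} \<Longrightarrow> (u has_vector_derivative u' r) (at r within S)"
    and "\<And>r. r \<in> {a..b} \<Longrightarrow> norm (u' r) \<le> K"
  shows "norm (u b - u a) \<le> K * (b - a)"
proof -
  have "norm (u b - u a) \<le> K * norm (b - a)"
  proof (rule differentiable_bound[where S = "{a..b}" and f' = "\<lambda>r h. h *\<^sub>R u' r"])
    fix r assume r: "r \<in> {a..b}"
    show "(u has_derivative (\<lambda>h. h *\<^sub>R u' r)) (at r within {a..b})"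
      using has_vector_derivative_within_subset[OF assms(3)[OF r] assms(2)] by (simp add: has_vector_derivative_def)
    show "onorm (\<lambda>h. h *\<^sub>R u' r) \<le> K"
      using assms(4)[OF r] by (intro onorm_le) (simp add: mult.commute[of K] mult_left_mono)
  qed (use assms(1) in auto)
  then show ?thesis using assms(1) by simp
qed

section \<open>Boundedness in time from lower semicontinuity\<close>

lemma locally_bounded_Icc:
  fixes U :: "real \<Rightarrow> real"
  assumes "a \<le> b" "\<And>s. a \<le> s \<Longrightarrow> s \<le> b \<Longrightarrow> \<exists>\<delta>>0. \<exists>K. \<forall>r. a \<le> r \<longrightarrow> r \<le> b \<longrightarrow> \<bar>r - s\<bar> < \<delta> \<longrightarrow> U r \<le> K"
  shows "\<exists>K. \<forall>r\<in>{a..b}. U r \<le> K"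
proof -
  have "compact {a..b}" by (rule compact_Icc)
  have "\<forall>s\<in>{a..b}. \<exists>\<delta>>0. \<exists>K. \<forall>r. a \<le> r \<longrightarrow> r \<le> b \<longrightarrow> \<bar>r - s\<bar> < \<delta> \<longrightarrow> U r \<le> K" using assms(2) by auto
  then obtain \<delta> K where \<delta>: "\<And>s. s \<in> {a..b} \<Longrightarrow> \<delta> s > 0"
    "\<And>s r. s \<in> {a..b} \<Longrightarrow> r \<in> {a..b} \<Longrightarrow> \<bar>r - s\<bar> < \<delta> s \<Longrightarrow> U r \<le> K s"
    by (metis atLeastAtMost_iff)
  have "{a..b} \<subseteq> (\<Union>s\<in>{a..b}. ball s (\<delta> s))" using \<delta>(1) by auto
  from compactE_image[OF compact_Icc _ this] obtain F where F: "F \<subseteq> {a..b}" "finite F" "{a..b} \<subseteq> (\<Union>s\<in>F. ball s (\<delta> s))"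
    by auto
  have "U r \<le> (\<Sum>s\<in>F. \<bar>K s\<bar>)" if "r \<in> {a..b}" for r
  proof -
    from F(3) that obtain s where s: "s \<in> F" "r \<in> ball s (\<delta> s)" by blast
    then have "U r \<le> K s" using \<delta>(2)[of s r] F(1) that by (auto simp: dist_real_def abs_minus_commute)
    also have "\<dots> \<le> (\<Sum>s\<in>F. \<bar>K s\<bar>)"
      using member_le_sum[of s F "\<lambda>s. \<bar>K s\<bar>"] s F(2) by auto
    finally show ?thesis .
  qed
  then show ?thesis by blast
qed

text \<open>\<open>b\<close> is the first point of \<open>B\<close> at or after \<open>s\<close>.
  Before it \<open>U\<close> is bounded on compact intervals, so \<open>S1\<close> started at
  \<open>s\<close> gives the uniform bound \<open>2 * U s + 1\<close> there. Together with the
  single value \<open>U b\<close> this bounds \<open>U\<close> up to \<open>b\<close>, and now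
  \<open>S1\<close> may start at \<open>b\<close> and run back to \<open>s\<close>.\<close>

lemma reach_bad_point:
  fixes U :: "real \<Rightarrow> real"
  assumes S1: "\<And>a b K s s0. t \<le> a \<Longrightarrow> b \<le> T \<Longrightarrow> \<forall>r\<in>{a..b}. U r \<le> K \<Longrightarrow> s \<in> {a..b} \<Longrightarrow> s0 \<in> {a..b} \<Longrightarrow> U s \<le> 2 * U s0 + 1"
    and B: "closed B" "B \<subseteq> {t..T}"
    and good: "\<And>s. s \<in> {t..T} - B \<Longrightarrow> \<exists>\<delta>>0. \<exists>K. \<forall>r\<in>{t..T}. \<bar>r - s\<bar> < \<delta> \<longrightarrow> U r \<le> K"
    and s: "t \<le> s" "s \<le> b0" "b0 \<in> B"
  shows "\<exists>b\<in>B. s \<le> b \<and> b \<le> b0 \<and> U s \<le> 2 * U b + 1"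
proof -
  define b where "b = Inf (B \<inter> {s..b0})"
  have ne: "B \<inter> {s..b0} \<noteq> {}" using s by auto
  have "closed (B \<inter> {s..b0})" using B(1) by (intro closed_Int) auto
  then have "b \<in> B \<inter> {s..b0}"
    unfolding b_def using ne by (intro closed_contains_Inf) auto
  then have b: "b \<in> B" "s \<le> b" "b \<le> b0" by auto
  have bT: "b \<le> T" using b(1) B(2) by auto
  have nB: "r \<notin> B" if "s \<le> r" "r < b" for r
  proof
    assume "r \<in> B"
    then have "b \<le> r" unfolding b_def using that b by (intro cInf_lower) auto
    then show False using that by simp
  qed
  have "U r \<le> 2 * U s + 1" if r: "s \<le> r" "r < b" for r
  proof -
    have "\<exists>K. \<forall>r'\<in>{s..r}. U r' \<le> K"
    proof (rule locally_bounded_Icc[OF r(1)])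
      fix r' assume r': "s \<le> r'" "r' \<le> r"
      then have "r' \<in> {t..T} - B" using nB r s bT by auto
      from good[OF this] obtain \<delta> K where "\<delta> > 0" "\<forall>r\<in>{t..T}. \<bar>r - r'\<bar> < \<delta> \<longrightarrow> U r \<le> K" by blast
      then show "\<exists>\<delta>>0. \<exists>K. \<forall>q. s \<le> q \<longrightarrow> q \<le> r \<longrightarrow> \<bar>q - r'\<bar> < \<delta> \<longrightarrow> U q \<le> K"
        using s(1) r(2) bT by (intro exI[of _ \<delta>] conjI exI[of _ K]) auto
    qed
    then obtain K where "\<forall>r'\<in>{s..r}. U r' \<le> K" by blast
    then show ?thesis using S1[OF s(1), of r K r s] r bT by auto
  qed
  then have "\<forall>r\<in>{s..b}. U r \<le> max (2 * U s + 1) (U b)"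
    by (metis atLeastAtMost_iff le_max_iff_disj order_le_less order_refl)
  then have "U s \<le> 2 * U b + 1" by (rule S1[OF s(1) bT]) (use b in auto)
  then show ?thesis using b by blast
qed

text \<open>By Baire's theorem, \<open>U\<close> is bounded on a relatively open part of the set \<open>B\<close> of points near
  which it is unbounded; the estimate \<open>S1\<close> propagates this bound to the gaps of \<open>B\<close>.\<close>

lemma bounded_if_lower_semicontinuous:
  fixes U :: "real \<Rightarrow> real"
  assumes lsc: "\<And>k. closed {s\<in>{t..T}. U s \<le> k}"
    and S1: "\<And>a b K s s0. t \<le> a \<Longrightarrow> b \<le> T \<Longrightarrow> \<forall>r\<in>{a..b}. U r \<le> K \<Longrightarrow> s \<in> {a..b} \<Longrightarrow> s0 \<in> {a..b} \<Longrightarrow> U s \<le> 2 * U s0 + 1"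
    and "t \<le> T"
  shows "\<exists>K. \<forall>s\<in>{t..T}. U s \<le> K"
proof -
  define B where "B = {s\<in>{t..T}. \<forall>\<delta>>0. \<forall>K. \<exists>r\<in>{t..T}. \<bar>r - s\<bar> < \<delta> \<and> K < U r}"
  have BT: "B \<subseteq> {t..T}" by (auto simp: B_def)
  have good: "\<exists>\<delta>>0. \<exists>K. \<forall>r\<in>{t..T}. \<bar>r - s\<bar> < \<delta> \<longrightarrow> U r \<le> K" if "s \<in> {t..T} - B" for s
    using that unfolding B_def by (auto simp: not_less) (meson not_less)
  have clB: "closed B"
    unfolding closed_sequential_limits
  proof (intro allI impI, elim conjE)
    fix s l assume s: "\<forall>n. s n \<in> B" "s \<longlonglongrightarrow> l"
    have l: "l \<in> {t..T}"
      using closed_sequentially[OF closed_atLeastAtMost _ s(2), of t T] s(1) BT by blast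
    show "l \<in> B" unfolding B_def
    proof (intro CollectI conjI l allI impI)
      fix \<delta> :: real and K assume "0 < \<delta>"
      then obtain n where n: "\<bar>s n - l\<bar> < \<delta> / 2"
        using LIMSEQ_D[OF s(2), of "\<delta> / 2"] by auto
      obtain r where "r \<in> {t..T}" "\<bar>r - s n\<bar> < \<delta> / 2" "K < U r"
        using s(1)[rule_format, of n] half_gt_zero[OF \<open>0 < \<delta>\<close>] unfolding B_def by blast
      then show "\<exists>r\<in>{t..T}. \<bar>r - l\<bar> < \<delta> \<and> K < U r"
        using n by (intro bexI[of _ r] conjI) linarith+
    qed
  qed
  have "B = {}"
  proof (rule ccontr)
    assume ne: "B \<noteq> {}"
    define G where "G k = B - {s\<in>{t..T}. U s \<le> real k}" for k :: nat
    have opn: "openin (top_of_set B) (G k)" for k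
    proof -
      have "G k = B \<inter> - {s\<in>{t..T}. U s \<le> real k}" by (auto simp: G_def)
      then show ?thesis using lsc[of "real k"] by (auto simp: openin_open)
    qed
    \<comment> \<open>\<open>U\<close> is finite everywhere, so the relatively open sets
      \<open>G k\<close> have empty intersection; if all were dense in \<open>B\<close>, that
      intersection would be dense in the nonempty set \<open>B\<close>.\<close>
    have "\<exists>k. \<not> B \<subseteq> closure (G k)"
    proof (rule ccontr)
      assume "\<not> ?thesis"
      then have "B \<subseteq> closure (\<Inter> (range G))"
        using opn by (intro Baire[OF clB]) auto
      moreover have "\<Inter> (range G) = {}"
      proof -
        have "s \<notin> \<Inter> (range G)" for s
          using real_nat_ceiling_ge[of "U s"] BT by (auto simp: G_def intro!: exI[of _ "nat \<lceil>U s\<rceil>"])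
        then show ?thesis by blast
      qed
      ultimately show False using ne by auto
    qed
    then obtain k b0 where b0: "b0 \<in> B" "b0 \<notin> closure (G k)" by blast
    then obtain \<rho> where \<rho>: "\<rho> > 0" "\<And>r. r \<in> G k \<Longrightarrow> \<rho> \<le> dist r b0"
      unfolding closure_approachable by (meson not_less)
    have kB: "U r \<le> real k" if "r \<in> B" "\<bar>r - b0\<bar> < \<rho>" for r
      using \<rho>(2)[of r] that BT by (fastforce simp: G_def dist_real_def)
    \<comment> \<open>The point of \<open>B\<close> reached from \<open>s\<close> lies between
      \<open>s\<close> and \<open>b0\<close>, hence again within \<open>\<rho>\<close> of
      \<open>b0\<close>, where \<open>k\<close> bounds \<open>U\<close> on \<open>B\<close>. So
      \<open>U\<close> is bounded near \<open>b0\<close>, contradicting the choice of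
      \<open>B\<close>.\<close>
    have "U s \<le> 2 * real k + 1" if s: "s \<in> {t..T}" "\<bar>s - b0\<bar> < \<rho>" for s
    proof (cases "s \<le> b0")
      case True
      have "\<exists>b\<in>B. s \<le> b \<and> b \<le> b0 \<and> U s \<le> 2 * U b + 1"
      proof (rule reach_bad_point[OF _ clB BT _ _ True b0(1)])
        show "U s \<le> 2 * U s0 + 1"
          if "t \<le> a" "b \<le> T" "\<forall>r\<in>{a..b}. U r \<le> K" "s \<in> {a..b}" "s0 \<in> {a..b}" for a b K s s0
          by (rule S1[OF that])
      qed (use good s in auto)
      then obtain b where b: "b \<in> B" "s \<le> b" "b \<le> b0" "U s \<le> 2 * U b + 1" by blast
      then have "U b \<le> real k" using s(2) by (intro kB) auto
      then show ?thesis using b(4) by linarith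
    next
      case False
      \<comment> \<open>Points to the right of \<open>b0\<close> are handled by reversing
        time.\<close>
      define U' where "U' r = U (- r)" for r
      have "\<exists>b\<in>uminus ` B. - s \<le> b \<and> b \<le> - b0 \<and> U' (- s) \<le> 2 * U' b + 1"
      proof (rule reach_bad_point[where t = "- T" and T = "- t"])
        fix a b K s s0 assume a: "- T \<le> a" "b \<le> - t" "\<forall>r\<in>{a..b}. U' r \<le> K" "s \<in> {a..b}" "s0 \<in> {a..b}"
        have "\<forall>r\<in>{- b..- a}. U r \<le> K"
        proof
          fix r assume "r \<in> {- b..- a}"
          then have "- r \<in> {a..b}" by auto
          then show "U r \<le> K" using a(3) by (auto simp: U'_def dest: bspec)
        qed
        then show "U' s \<le> 2 * U' s0 + 1"
          unfolding U'_def by (rule S1[rotated 2]) (use a in auto)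
      next
        show "closed (uminus ` B)" using clB by (rule closed_negations)
        show "uminus ` B \<subseteq> {- T..- t}" using BT by auto
        show "- T \<le> - s" "- s \<le> - b0" "- b0 \<in> uminus ` B" using s False b0 by auto
        fix q assume "q \<in> {- T..- t} - uminus ` B"
        then have "- q \<in> {t..T} - B" by (auto simp: image_iff)
        from good[OF this] obtain \<delta> K where d: "\<delta> > 0" "\<forall>r\<in>{t..T}. \<bar>r - - q\<bar> < \<delta> \<longrightarrow> U r \<le> K" by blast
        show "\<exists>\<delta>>0. \<exists>K. \<forall>r\<in>{- T..- t}. \<bar>r - q\<bar> < \<delta> \<longrightarrow> U' r \<le> K"
        proof (intro exI conjI ballI impI)
          fix r assume "r \<in> {- T..- t}" "\<bar>r - q\<bar> < \<delta>"
          then have "- r \<in> {t..T}" "\<bar>- r - - q\<bar> < \<delta>" by auto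
          then show "U' r \<le> K" using d(2) unfolding U'_def by blast
        qed (rule d(1))
      qed
      then obtain b where b: "b \<in> B" "b \<le> s" "b0 \<le> b" "U s \<le> 2 * U b + 1" by (auto simp: U'_def)
      then have "U b \<le> real k" using s(2) by (intro kB) auto
      then show ?thesis using b(4) by linarith
    qed
    moreover obtain r where "r \<in> {t..T}" "\<bar>r - b0\<bar> < \<rho>" "2 * real k + 1 < U r"
      using b0(1) \<rho>(1) unfolding B_def by blast
    ultimately show False by (metis not_less)
  qed
  then show ?thesis
    using good by (intro locally_bounded_Icc[OF \<open>t \<le> T\<close>]) fastforce
qed

text \<open>\<open>2 * K\<close> is the fixed point of the map taking \<open>c\<close> to
  \<open>K + c / 2\<close>. Iteration forgets the initial constant and leaves one determined by the
  data.\<close>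

lemma affine_iteration:
  fixes K c :: real
  assumes "Q c" "1 \<le> c" "1 \<le> K" "\<And>c. 1 \<le> c \<Longrightarrow> Q c \<Longrightarrow> Q (K + c / 2)"
  shows "\<exists>c'. c' \<le> 2 * K + c / 2 ^ k \<and> Q c'"
proof -
  have "\<exists>c'. 1 \<le> c' \<and> c' \<le> 2 * K + c / 2 ^ k \<and> Q c'"
  proof (induction k)
    case 0
    then show ?case using assms by (intro exI[of _ c]) auto
  next
    case (Suc k)
    then obtain c' where c': "1 \<le> c'" "c' \<le> 2 * K + c / 2 ^ k" "Q c'" by blast
    have "K + c' / 2 \<le> 2 * K + c / 2 ^ Suc k" using c'(2) by (simp add: field_simps)
    moreover have "1 \<le> K + c' / 2" using assms c' by simp
    ultimately show ?case using assms(4)[OF c'(1,3)] by blast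
  qed
  then show ?thesis by blast
qed

lemma le_if_le_plus_halving:
  fixes a b c :: real
  assumes "\<And>k. a \<le> b + c / 2 ^ k" shows "a \<le> b"
proof (rule LIMSEQ_le_const)
  have "(\<lambda>k. b + c * (1 / 2) ^ k) \<longlonglongrightarrow> b + c * 0"
    by (intro tendsto_intros LIMSEQ_power_zero) simp
  then show "(\<lambda>k. b + c * (1 / 2) ^ k) \<longlonglongrightarrow> b" by simp
  show "\<exists>N. \<forall>n\<ge>N. a \<le> b + c * (1 / 2) ^ n"
    using assms by (auto simp: power_divide)
qed

text \<open>\<open>w\<close> is the natural weight for bounds that are uniform in \<open>x\<close>: constants and averages over \<open>m\<close>
  of functions bounded by \<open>w\<close> are bounded by \<open>2 w\<close>.\<close>

locale growth_system =
  fixes m :: "(real^'n) measure" and t T :: real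
    and X Z dX dZ :: "real \<Rightarrow> real^'n \<Rightarrow> real^'n" and B L :: real
  assumes m: "m \<in> P2" and tT: "t \<le> T" and B: "0 \<le> B" and L: "0 < L"
    and integrable_X: "\<And>s. s \<in> {t..T} \<Longrightarrow> integrable m (X s)"
    and integrable_Z: "\<And>s. s \<in> {t..T} \<Longrightarrow> integrable m (Z s)"
    and deriv_X: "\<And>s x. s \<in> {t..T} \<Longrightarrow> ((\<lambda>r. X r x) has_vector_derivative dX s x) (at s within {t..T})"
    and deriv_Z: "\<And>s x. s \<in> {t..T} \<Longrightarrow> ((\<lambda>r. Z r x) has_vector_derivative dZ s x) (at s within {t..T})"
    and bound_X: "\<And>s x. s \<in> {t..T} \<Longrightarrow>
      norm (dX s x) \<le> B * (1 + norm (X s x) + norm (Z s x) + ((\<integral>y. norm (X s y) \<partial>m) + (\<integral>y. norm (Z s y) \<partial>m)))"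
    and bound_Z: "\<And>s x. s \<in> {t..T} \<Longrightarrow>
      norm (dZ s x) \<le> B * (1 + norm (X s x) + norm (Z s x) + ((\<integral>y. norm (X s y) \<partial>m) + (\<integral>y. norm (Z s y) \<partial>m)))"
    and initial: "\<And>x. X t x = x"
    and terminal: "\<And>x. norm (Z T x) \<le> L * (1 + norm (X T x) + (\<integral>y. norm (X T y) \<partial>m))"
    and small: "14 * B * (T - t) * (1 + 3 * L) \<le> 1"
begin

definition \<tau> :: real where "\<tau> = B * (T - t)"

definition w :: "real^'n \<Rightarrow> real" where "w x = 1 + norm x + moment1 m"

definition U :: "real \<Rightarrow> real" where "U s = (\<integral>y. norm (X s y) \<partial>m) + (\<integral>y. norm (Z s y) \<partial>m)"

definition u :: "real \<Rightarrow> real^'n \<Rightarrow> real" where "u s x = norm (X s x) + norm (Z s x)"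

lemma prob_m: "prob_space m" by (rule P2_prob_space[OF m])

lemma integrable_m_const: "integrable m (\<lambda>_. c)" for c :: real
  using finite_measure.integrable_const[OF prob_space.finite_measure[OF prob_m]] .

lemma w_ge_1: "1 \<le> w x" by (simp add: w_def moment1_nonneg)

lemma integrable_w: "integrable m w"
  unfolding w_def[abs_def] using integrable_P2_norm[OF m] integrable_m_const by simp

lemma integral_w: "(\<integral>y. w y \<partial>m) \<le> 2 * w x"
proof -
  have "(\<integral>y. w y \<partial>m) = 1 + moment1 m + moment1 m"
    unfolding w_def using integrable_P2_norm[OF m] integrable_m_const
    by (simp add: prob_space.prob_space[OF prob_m] moment1_def[symmetric])
  then show ?thesis by (simp add: w_def)
qed

lemma integral_le_w:
  assumes "\<And>y. h y \<le> c * w y" "integrable m h" "0 \<le> c" shows "(\<integral>y. h y \<partial>m) \<le> 2 * c * w x"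
proof -
  have "(\<integral>y. h y \<partial>m) \<le> (\<integral>y. c * w y \<partial>m)"
    using assms integrable_w by (intro integral_mono) auto
  also have "\<dots> \<le> c * (2 * w x)" using assms(3) integral_w by (simp add: mult_left_mono)
  finally show ?thesis by simp
qed

lemma u_nonneg: "0 \<le> u s x" by (simp add: u_def)

lemma U_nonneg: "0 \<le> U s" by (simp add: U_def)

lemma U_eq: "s \<in> {t..T} \<Longrightarrow> U s = (\<integral>y. u s y \<partial>m)"
  unfolding U_def u_def using integrable_X[of s] integrable_Z[of s] by simp

lemma integrable_u: "s \<in> {t..T} \<Longrightarrow> integrable m (u s)"
  unfolding u_def[abs_def] using integrable_X[of s] integrable_Z[of s] by simp

lemma bounds:
  assumes "s \<in> {t..T}"
  shows "norm (dX s x) \<le> B * (1 + u s x + U s)" "norm (dZ s x) \<le> B * (1 + u s x + U s)"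
  using bound_X[OF assms, of x] bound_Z[OF assms, of x] by (simp_all add: u_def U_def add.assoc)

lemma continuous_X: "continuous_on {t..T} (\<lambda>s. X s x)" and continuous_Z: "continuous_on {t..T} (\<lambda>s. Z s x)"
  unfolding continuous_on_eq_continuous_within
  using has_vector_derivative_continuous[OF deriv_X] has_vector_derivative_continuous[OF deriv_Z] by blast+

text \<open>The derivative is bounded by its values over the whole interval; as
  \<open>\<tau>\<close> is small, this takes the place of a Gronwall exponential.\<close>

lemma increments:
  assumes "t \<le> a" "b \<le> T" "\<And>r. r \<in> {a..b} \<Longrightarrow> u r x \<le> S" "\<And>r. r \<in> {a..b} \<Longrightarrow> U r \<le> K"
    and "s \<in> {a..b}" "s' \<in> {a..b}"
  shows "norm (X s x - X s' x) \<le> \<tau> * (1 + S + K)" "norm (Z s x - Z s' x) \<le> \<tau> * (1 + S + K)"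
proof -
  have SK: "0 \<le> 1 + S + K"
    using assms(3)[OF assms(5)] assms(4)[OF assms(5)] U_nonneg[of s] by (simp add: u_def add_nonneg_nonneg) (smt (verit) norm_ge_zero)
  have *: "norm (Y s x - Y s' x) \<le> B * (1 + S + K) * (s - s')"
    if "s' \<le> s" "s \<in> {a..b}" "s' \<in> {a..b}"
      and d: "\<And>r. r \<in> {t..T} \<Longrightarrow> ((\<lambda>r. Y r x) has_vector_derivative dY r x) (at r within {t..T})"
      and n: "\<And>r. r \<in> {t..T} \<Longrightarrow> norm (dY r x) \<le> B * (1 + u r x + U r)" for Y dY s s'
  proof (rule vector_mean_value[where S = "{t..T}" and u' = "\<lambda>r. dY r x"])
    fix r assume r: "r \<in> {s'..s}"
    then have r': "r \<in> {a..b}" "r \<in> {t..T}" using that assms by auto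
    show "((\<lambda>r. Y r x) has_vector_derivative dY r x) (at r within {t..T})" using d r' by blast
    have "B * (1 + u r x + U r) \<le> B * (1 + S + K)"
      using assms(3)[OF r'(1)] assms(4)[OF r'(1)] B by (intro mult_left_mono) auto
    then show "norm (dY r x) \<le> B * (1 + S + K)" using n[OF r'(2)] by linarith
  qed (use that assms in auto)
  have **: "norm (Y s x - Y s' x) \<le> \<tau> * (1 + S + K)"
    if d: "\<And>r. r \<in> {t..T} \<Longrightarrow> ((\<lambda>r. Y r x) has_vector_derivative dY r x) (at r within {t..T})"
      and n: "\<And>r. r \<in> {t..T} \<Longrightarrow> norm (dY r x) \<le> B * (1 + u r x + U r)" for Y dY
  proof -
    have "norm (Y s x - Y s' x) \<le> B * (1 + S + K) * \<bar>s - s'\<bar>"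
      using *[of s' s Y dY, OF _ assms(5,6) d n] *[of s s' Y dY, OF _ assms(6,5) d n] by (cases "s' \<le> s") (auto simp: norm_minus_commute)
    also have "\<dots> \<le> B * (1 + S + K) * (T - t)"
      using assms SK B by (intro mult_left_mono) auto
    finally show ?thesis by (simp add: \<tau>_def mult_ac)
  qed
  show "norm (X s x - X s' x) \<le> \<tau> * (1 + S + K)" by (rule **[of X dX, OF deriv_X bounds(1)])
  show "norm (Z s x - Z s' x) \<le> \<tau> * (1 + S + K)" by (rule **[of Z dZ, OF deriv_Z bounds(2)])
qed

lemma small_tau: "14 * \<tau> * (1 + 3 * L) \<le> 1"
  using small by (simp add: \<tau>_def mult.assoc)

lemma small_B: "14 * \<tau> \<le> 1" "14 * \<tau> * (3 * L) \<le> 1" "0 \<le> \<tau>"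
proof -
  show 0: "0 \<le> \<tau>" using B tT by (simp add: \<tau>_def)
  have "0 \<le> \<tau> * L" using 0 L by simp
  then show "14 * \<tau> \<le> 1" "14 * \<tau> * (3 * L) \<le> 1"
    using small_tau 0 by (simp_all add: algebra_simps)
qed

lemma bounded_u:
  assumes "a \<le> b" "t \<le> a" "b \<le> T"
  obtains s1 where "s1 \<in> {a..b}" "\<And>r. r \<in> {a..b} \<Longrightarrow> u r x \<le> u s1 x"
proof -
  have "continuous_on {a..b} (\<lambda>s. u s x)"
    unfolding u_def using continuous_X[of x] continuous_Z[of x] assms
    by (intro continuous_intros) (auto elim: continuous_on_subset)
  from continuous_attains_sup[OF compact_Icc _ this] assms that show ?thesis by auto
qed

text \<open>\<open>K\<close> only ensures that the supremum \<open>K'\<close> of \<open>U\<close> on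
  the interval is finite. Then \<open>K'\<close> is at most
  \<open>4 / 3 * U s0 + (1 + K') / 3\<close> and can be absorbed, so \<open>K\<close> disappears
  from the conclusion.\<close>

lemma bound_from_point:
  assumes ab: "t \<le> a" "b \<le> T" and K: "\<forall>r\<in>{a..b}. U r \<le> K" and s: "s \<in> {a..b}" "s0 \<in> {a..b}"
  shows "U s \<le> 2 * U s0 + 1"
proof -
  have step: "U r \<le> (4 / 3) * U s0 + (1 + K) / 3" if r: "r \<in> {a..b}" and K: "\<forall>r\<in>{a..b}. U r \<le> K" for r K
  proof -
    have rt: "r \<in> {t..T}" "s0 \<in> {t..T}" using r s ab by auto
    have K0: "0 \<le> K" using K r U_nonneg order_trans by blast
    have "u r x \<le> (4 / 3) * u s0 x + (1 + K) / 3" for x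
    proof -
      obtain s1 where s1: "s1 \<in> {a..b}" "\<And>r. r \<in> {a..b} \<Longrightarrow> u r x \<le> u s1 x"
        using bounded_u[of a b x] s ab by auto
      \<comment> \<open>The maximum of the path over the interval exceeds the value at
        \<open>s0\<close> by at most a seventh of \<open>1 + S + K\<close>, so \<open>S\<close> is
        absorbed as well.\<close>
      define S where "S = u s1 x"
      have S0: "0 \<le> S" by (simp add: S_def u_def)
      have "norm (X s1 x - X s0 x) \<le> \<tau> * (1 + S + K)" "norm (Z s1 x - Z s0 x) \<le> \<tau> * (1 + S + K)"
        using increments[OF ab s1(2) K[rule_format] s1(1) s(2)] by (auto simp: S_def)
      moreover have "\<tau> * (1 + S + K) \<le> (1 / 14) * (1 + S + K)"
        using small_B S0 K0 by (intro mult_right_mono) auto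
      ultimately have "S \<le> u s0 x + (1 / 7) * (1 + S + K)"
        unfolding S_def u_def[of s1] u_def[of s0]
        using norm_triangle_sub[of "X s1 x" "X s0 x"] norm_triangle_sub[of "Z s1 x" "Z s0 x"] by linarith
      moreover have "u r x \<le> S" using s1(2)[OF r] by (simp add: S_def)
      moreover have "0 \<le> u s0 x" by (simp add: u_def)
      ultimately show ?thesis using K0 by (simp add: field_simps)
    qed
    then have "(\<integral>y. u r y \<partial>m) \<le> (\<integral>y. (4 / 3) * u s0 y + (1 + K) / 3 \<partial>m)"
      using integrable_u[OF rt(1)] integrable_u[OF rt(2)] integrable_m_const by (intro integral_mono) auto
    also have "\<dots> = (4 / 3) * (\<integral>y. u s0 y \<partial>m) + (1 + K) / 3"
      using integrable_u[OF rt(2)] integrable_m_const[of "(1 + K) / 3"] by (simp add: prob_space.prob_space[OF prob_m])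
    finally show ?thesis using U_eq[OF rt(1)] U_eq[OF rt(2)] by simp
  qed
  define K' where "K' = Sup (U ` {a..b})"
  have bdd: "bdd_above (U ` {a..b})" using K by (auto intro!: bdd_aboveI)
  have ne: "U ` {a..b} \<noteq> {}" using s by auto
  have K': "\<forall>r\<in>{a..b}. U r \<le> K'" unfolding K'_def using bdd by (auto intro: cSUP_upper)
  have "K' \<le> (4 / 3) * U s0 + (1 + K') / 3"
    unfolding K'_def using ne step[OF _ K'] unfolding K'_def by (intro cSUP_least) auto
  then have "K' \<le> 2 * U s0 + 1" by (simp add: field_simps)
  then show ?thesis using K' s(1) by force
qed

text \<open>Fatou's lemma for the nonnegative functions \<open>u\<close>, whose paths are continuous
  in time.\<close>

lemma U_lower_semicontinuous: "closed {s\<in>{t..T}. U s \<le> k}"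
  unfolding closed_sequential_limits
proof (intro allI impI, elim conjE)
  fix s l assume s: "\<forall>n. s n \<in> {s\<in>{t..T}. U s \<le> k}" and lim: "s \<longlonglongrightarrow> l"
  have l: "l \<in> {t..T}" using closed_sequentially[OF closed_atLeastAtMost _ lim, of t T] s by blast
  have sT: "s n \<in> {t..T}" for n using s by blast
  have k: "0 \<le> k" using s U_nonneg order_trans by blast
  have nn: "(\<integral>\<^sup>+y. ennreal (u r y) \<partial>m) = ennreal (U r)" if "r \<in> {t..T}" for r
    unfolding U_eq[OF that] by (intro nn_integral_eq_integral integrable_u that AE_I2 u_nonneg)
  have "(\<lambda>n. u (s n) y) \<longlonglongrightarrow> u l y" for y
    unfolding u_def using l sT lim continuous_X[of y] continuous_Z[of y]
    by (intro tendsto_intros; elim continuous_on_tendsto_compose) auto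
  then have "(\<lambda>n. ennreal (u (s n) y)) \<longlonglongrightarrow> ennreal (u l y)" for y by (intro tendsto_ennrealI)
  then have L: "liminf (\<lambda>n. ennreal (u (s n) y)) = ennreal (u l y)" for y
    by (intro lim_imp_Liminf) auto
  have "ennreal (U l) = (\<integral>\<^sup>+y. liminf (\<lambda>n. ennreal (u (s n) y)) \<partial>m)"
    unfolding L nn[OF l] ..
  also have "\<dots> \<le> liminf (\<lambda>n. \<integral>\<^sup>+y. ennreal (u (s n) y) \<partial>m)"
    using borel_measurable_integrable[OF integrable_u[OF sT]] by (intro nn_integral_liminf) simp
  also have "\<dots> \<le> liminf (\<lambda>n. ennreal k)"
    unfolding nn[OF sT] using s by (intro Liminf_mono always_eventually allI ennreal_leI) auto
  also have "\<dots> = ennreal k" by (simp add: Liminf_const)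
  finally have "U l \<le> k" using k by simp
  then show "l \<in> {s\<in>{t..T}. U s \<le> k}" using l by simp
qed

text \<open>Once \<open>U\<close> is bounded, each \<open>x\<close> is treated by itself, forward
  from the initial value and backward from the terminal bound. The constant involves the bound on
  \<open>U\<close>, hence the solution; it only starts the iteration in
  \<open>bound_w\<close>.\<close>

lemma some_bound: "\<exists>c\<ge>1. \<forall>s\<in>{t..T}. \<forall>x. u s x \<le> c * w x"
proof -
  have "\<exists>K. \<forall>s\<in>{t..T}. U s \<le> K"
    by (rule bounded_if_lower_semicontinuous[OF U_lower_semicontinuous _ tT]) (rule bound_from_point)
  then obtain K where K: "\<forall>s\<in>{t..T}. U s \<le> K" by blast
  have tTm: "t \<in> {t..T}" "T \<in> {t..T}" using tT by auto
  have K0: "0 \<le> K" using K tTm(1) U_nonneg order_trans by blast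
  have "u s x \<le> (2 * (1 + L) * (1 + K)) * w x" if s: "s \<in> {t..T}" for s x
  proof -
    obtain s1 where s1: "s1 \<in> {t..T}" "\<And>r. r \<in> {t..T} \<Longrightarrow> u r x \<le> u s1 x"
      using bounded_u[OF tT, of x] by auto
    define S where "S = u s1 x"
    define e where "e = \<tau> * (1 + S + K)"
    have S0: "0 \<le> S" by (simp add: S_def u_def)
    have inc: "norm (X s x - X s' x) \<le> e" "norm (Z s x - Z s' x) \<le> e" if "s \<in> {t..T}" "s' \<in> {t..T}" for s s'
      using increments[OF order_refl order_refl s1(2) K[rule_format] that] unfolding e_def S_def by blast+
    have e: "0 \<le> e" "e \<le> (1 / 14) * (1 + S + K)" "3 * L * e \<le> (1 / 14) * (1 + S + K)"
    proof -
      show "0 \<le> e" using small_B S0 K0 by (simp add: e_def)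
      show "e \<le> (1 / 14) * (1 + S + K)" unfolding e_def using small_B S0 K0 by (intro mult_right_mono) auto
      have "(3 * L * \<tau>) * (1 + S + K) \<le> (1 / 14) * (1 + S + K)"
        using small_B(2) S0 K0 by (intro mult_right_mono) (auto simp: mult.commute[of L])
      then show "3 * L * e \<le> (1 / 14) * (1 + S + K)" by (simp only: e_def mult.assoc)
    qed
    have X1: "norm (X r x) \<le> norm x + e" if "r \<in> {t..T}" for r
      using inc(1)[OF that tTm(1)] norm_triangle_sub[of "X r x" "X t x"] by (simp add: initial)
    have "(\<integral>y. norm (X T y) \<partial>m) \<le> K" 
    proof -
      have "U T \<le> K" using K tTm(2) by blast
      moreover have "0 \<le> (\<integral>y. norm (Z T y) \<partial>m)" by simp
      ultimately show ?thesis unfolding U_def by linarith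
    qed
    then have "L * (1 + norm (X T x) + (\<integral>y. norm (X T y) \<partial>m)) \<le> L * (1 + (norm x + e) + K)"
      using X1[OF tTm(2)] L by (intro mult_left_mono) auto
    then have "norm (Z T x) \<le> L * (1 + norm x + K) + L * e"
      using terminal[of x] by (simp add: algebra_simps)
    then have "norm (Z s1 x) \<le> L * (1 + norm x + K) + L * e + e"
      using inc(2)[OF s1(1) tTm(2)] norm_triangle_sub[of "Z s1 x" "Z T x"] by linarith
    then have "S \<le> norm x + L * (1 + norm x + K) + L * e + 2 * e"
      using X1[OF s1(1)] by (simp add: S_def u_def)
    moreover define A where "A = norm x + L * (1 + norm x + K)"
    moreover define q where "q = L * e"
    ultimately have "S \<le> A + q + 2 * e" by simp
    moreover have "0 \<le> A"
      unfolding A_def using L K0 by (intro mult_nonneg_nonneg add_nonneg_nonneg) auto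
    moreover have "42 * q \<le> 1 + S + K" using e(3) by (simp add: q_def)
    moreover have "14 * e \<le> 1 + S + K" using e(2) by simp
    \<comment> \<open>The increments make up at most a sixth of \<open>1 + S + K\<close>, because
      1/42 + 2/14 = 1/6.\<close>
    ultimately have "S \<le> 2 * A + (1 + K)" using S0 K0 by linarith
    then have "S \<le> 2 * (norm x + L * (1 + norm x + K)) + (1 + K)" by (simp only: A_def)
    also have "\<dots> \<le> (2 * (1 + L) * (1 + K)) * (1 + norm x)"
      using K0 L by (simp add: algebra_simps)
    also have "\<dots> \<le> (2 * (1 + L) * (1 + K)) * w x"
      using K0 L moment1_nonneg[of m] by (intro mult_left_mono) (auto simp: w_def)
    finally show ?thesis using s1(2)[OF s] by (simp add: S_def)
  qed
  moreover have "1 * 1 \<le> (2 * (1 + L)) * (1 + K)" using K0 L by (intro mult_mono) auto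
  ultimately show ?thesis by (intro exI[of _ "2 * (1 + L) * (1 + K)"]) auto
qed

text \<open>The fixed point of the improvement step in \<open>bound_w\<close>, which takes
  \<open>c\<close> to \<open>1 + 4 * L + c / 2\<close>. It depends on \<open>L\<close>
  alone.\<close>

definition c_star :: real where "c_star = 2 * (1 + 4 * L)"

lemma increments_w:
  assumes c: "1 \<le> c" "\<And>s x. s \<in> {t..T} \<Longrightarrow> norm (X s x) \<le> c * w x \<and> norm (Z s x) \<le> c * w x"
    and s: "s \<in> {t..T}" "s' \<in> {t..T}"
  shows "norm (X s x - X s' x) \<le> 7 * \<tau> * c * w x" "norm (Z s x - Z s' x) \<le> 7 * \<tau> * c * w x"
proof -
  have cw: "1 \<le> c * w x" for x using mult_mono[OF c(1) w_ge_1] c(1) by simp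
  have U: "U r \<le> 4 * (c * w x)" if "r \<in> {t..T}" for r
  proof -
    have "(\<integral>y. norm (X r y) \<partial>m) \<le> 2 * c * w x" "(\<integral>y. norm (Z r y) \<partial>m) \<le> 2 * c * w x"
      using c(2)[OF that] c(1) integrable_X[OF that] integrable_Z[OF that] by (auto intro!: integral_le_w)
    then show ?thesis by (simp add: U_def)
  qed
  have u: "u r x \<le> 2 * (c * w x)" if "r \<in> {t..T}" for r using c(2)[OF that, of x] by (simp add: u_def)
  \<comment> \<open>7 = 1 + 2 + 4: the constant, the two path norms, and two means of size at most
    \<open>2 * c * w x\<close> each.\<close>
  have "\<tau> * (1 + 2 * (c * w x) + 4 * (c * w x)) \<le> \<tau> * (7 * (c * w x))"
    using cw[of x] small_B(3) by (intro mult_left_mono) auto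
  then show "norm (X s x - X s' x) \<le> 7 * \<tau> * c * w x" "norm (Z s x - Z s' x) \<le> 7 * \<tau> * c * w x"
    using increments[OF order_refl order_refl u U s] by (simp_all add: mult_ac)
qed

text \<open>A bound with constant \<open>c\<close> improves itself: \<open>X\<close> starts with
  constant 1 at time \<open>t\<close>, \<open>Z\<close> with essentially \<open>4 * L\<close> at
  time \<open>T\<close>, and the rest consists of increments worth at most
  \<open>c / 2\<close>.\<close>

lemma bound_w:
  assumes "s \<in> {t..T}"
  shows "norm (X s x) \<le> c_star * w x" "norm (Z s x) \<le> c_star * w x"
proof -
  define Q where "Q c \<longleftrightarrow> (\<forall>s\<in>{t..T}. \<forall>x. norm (X s x) \<le> c * w x \<and> norm (Z s x) \<le> c * w x)" for c
  obtain c where c: "1 \<le> c" "\<forall>s\<in>{t..T}. \<forall>x. u s x \<le> c * w x" using some_bound by blast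
  have Qc: "Q c"
    unfolding Q_def
  proof (intro ballI allI)
    fix s x assume "s \<in> {t..T}"
    then have "norm (X s x) + norm (Z s x) \<le> c * w x" using c(2) unfolding u_def by blast
    then show "norm (X s x) \<le> c * w x \<and> norm (Z s x) \<le> c * w x"
      using norm_ge_zero[of "X s x"] norm_ge_zero[of "Z s x"] by linarith
  qed
  have tTm: "t \<in> {t..T}" "T \<in> {t..T}" using tT by auto
  have step: "Q (1 + 4 * L + c / 2)" if c: "1 \<le> c" "Q c" for c
    unfolding Q_def
  proof (intro ballI allI)
    fix s x assume s: "s \<in> {t..T}"
    define e where "e = 7 * \<tau> * c"
    have e0: "0 \<le> e" using small_B(3) c(1) by (simp add: e_def mult_ac)
    have inc: "norm (X s x - X s' x) \<le> e * w x" "norm (Z s x - Z s' x) \<le> e * w x"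
      if "s \<in> {t..T}" "s' \<in> {t..T}" for s s' x
      using increments_w[OF c(1) _ that, of x] c(2) unfolding Q_def e_def by auto
    have X1: "norm (X r x) \<le> (1 + e) * w x" if "r \<in> {t..T}" for r x
      using inc(1)[OF that tTm(1), of x] norm_triangle_sub[of "X r x" "X t x"] moment1_nonneg[of m]
      by (simp add: initial distrib_right w_def)
    have "(\<integral>y. norm (X T y) \<partial>m) \<le> 2 * (1 + e) * w x"
      using e0 integrable_X[OF tTm(2)] X1[OF tTm(2)] by (intro integral_le_w) auto
    \<comment> \<open>Inside the terminal bound the constant, the state and the mean of the states
      contribute 1, 1 and 2 multiples of \<open>w x\<close>, apart from \<open>e\<close>; hence
      \<open>4 * L\<close>.\<close>
    then have "L * (1 + norm (X T x) + (\<integral>y. norm (X T y) \<partial>m)) \<le> L * (w x + (1 + e) * w x + 2 * (1 + e) * w x)"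
      using X1[OF tTm(2), of x] w_ge_1[of x] L by (intro mult_left_mono add_mono) auto
    also have "\<dots> = (4 * L + 3 * L * e) * w x" by (simp add: algebra_simps)
    finally have "norm (Z T x) \<le> (4 * L + 3 * L * e) * w x" using terminal[of x] by linarith
    then have Z1: "norm (Z s x) \<le> (4 * L + 3 * L * e + e) * w x"
      using inc(2)[OF s tTm(2), of x] norm_triangle_sub[of "Z s x" "Z T x"] by (simp add: distrib_right)
    \<comment> \<open>The smallness condition is calibrated here: 14 is twice the 7 in
      \<open>e\<close>.\<close>
    have "14 * \<tau> * (1 + 3 * L) * c \<le> 1 * c" using small_tau c(1) by (intro mult_right_mono) auto
    then have e: "3 * L * e + e \<le> c / 2" by (simp add: e_def algebra_simps)
    have "0 \<le> 3 * L * e" using L e0 by simp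
    then have le: "1 + e \<le> 1 + 4 * L + c / 2" "4 * L + 3 * L * e + e \<le> 1 + 4 * L + c / 2" using e L by linarith+
    show "norm (X s x) \<le> (1 + 4 * L + c / 2) * w x \<and> norm (Z s x) \<le> (1 + 4 * L + c / 2) * w x"
    proof
      have w0: "0 \<le> w x" using w_ge_1[of x] by simp
      show "norm (X s x) \<le> (1 + 4 * L + c / 2) * w x"
        by (rule order_trans[OF X1[OF s] mult_right_mono[OF le(1) w0]])
      show "norm (Z s x) \<le> (1 + 4 * L + c / 2) * w x"
        by (rule order_trans[OF Z1 mult_right_mono[OF le(2) w0]])
    qed
  qed
  have "norm (X s x) \<le> c_star * w x + c * w x / 2 ^ k \<and> norm (Z s x) \<le> c_star * w x + c * w x / 2 ^ k" for k
  proof -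
    have "1 \<le> 1 + 4 * L" using L by simp
    from affine_iteration[of Q, OF Qc c(1) this step, of k] obtain c' where c': "c' \<le> 2 * (1 + 4 * L) + c / 2 ^ k" "Q c'"
      by blast
    have "c' * w x \<le> (2 * (1 + 4 * L) + c / 2 ^ k) * w x"
      using c'(1) w_ge_1[of x] by (intro mult_right_mono) auto
    also have "\<dots> = c_star * w x + c * w x / 2 ^ k" by (simp add: c_star_def distrib_right)
    moreover have "norm (X s x) \<le> c' * w x \<and> norm (Z s x) \<le> c' * w x"
      using c'(2) assms unfolding Q_def by blast
    ultimately show ?thesis by linarith
  qed
  then show "norm (X s x) \<le> c_star * w x" "norm (Z s x) \<le> c_star * w x"
    by (blast intro: le_if_le_plus_halving)+
qed

text \<open>Over the short horizon the weight along the path differs from \<open>w x\<close> by at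
  most 3/20 of it, and \<open>Z\<close> moves by at most \<open>L / 4 * w x\<close>. The terminal
  bound with \<open>L\<close> thus persists with \<open>2 * L\<close>, the aperture of the cone on
  which the control is Lipschitz.\<close>

lemma adjoint_bound:
  assumes "140 * \<tau> * c_star \<le> 1" "28 * \<tau> * c_star \<le> L" and s: "s \<in> {t..T}"
  shows "norm (Z s x) \<le> 2 * L * (1 + norm (X s x) + (\<integral>y. norm (X s y) \<partial>m))"
proof -
  have tTm: "t \<in> {t..T}" "T \<in> {t..T}" using tT by auto
  define e where "e = 7 * \<tau> * c_star"
  have e: "e \<le> 1 / 20" "e \<le> L / 4" using assms by (auto simp: e_def)
  have c1: "1 \<le> c_star" using L by (simp add: c_star_def)
  have e0: "0 \<le> e" using small_B(3) c1 by (simp add: e_def mult_ac)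
  have inc: "norm (X s x - X s' x) \<le> e * w x" "norm (Z s x - Z s' x) \<le> e * w x"
    if "s \<in> {t..T}" "s' \<in> {t..T}" for s s' x
    using increments_w[OF c1 _ that, of x] bound_w unfolding e_def by auto
  have dist: "\<bar>norm (X r x) - norm x\<bar> \<le> e * w x" if "r \<in> {t..T}" for r x
    using inc(1)[OF that tTm(1), of x] norm_triangle_ineq3[of "X r x" x] by (simp add: initial)
  have mean: "\<bar>(\<integral>y. norm (X r y) \<partial>m) - moment1 m\<bar> \<le> 2 * e * w x" if r: "r \<in> {t..T}" for r
  proof -
    have i: "integrable m (\<lambda>y. norm (X r y) - norm y)" using integrable_X[OF r] integrable_P2_norm[OF m] by simp
    have "(\<integral>y. norm (X r y) \<partial>m) - moment1 m = (\<integral>y. norm (X r y) - norm y \<partial>m)"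
      using integrable_X[OF r] integrable_P2_norm[OF m] by (simp add: moment1_def)
    also have "\<bar>\<dots>\<bar> \<le> (\<integral>y. e * w y \<partial>m)"
      using norm_integral_le[of m "\<lambda>y. e * w y" "\<lambda>y. norm (X r y) - norm y"] dist[OF r] integrable_w by simp
    also have "\<dots> \<le> 2 * e * w x" using integrable_w e0 by (intro integral_le_w) auto
    finally show ?thesis .
  qed
  define V where "V r = 1 + norm (X r x) + (\<integral>y. norm (X r y) \<partial>m)" for r
  have ew: "e * w x \<le> (1 / 20) * w x" "e * w x \<le> (L / 4) * w x"
    using e w_ge_1[of x] by (auto intro!: mult_right_mono)
  have V: "\<bar>V r - w x\<bar> \<le> (3 / 20) * w x" if "r \<in> {t..T}" for r
    using dist[OF that, of x] mean[OF that] ew(1) unfolding V_def w_def[of x] by linarith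
  have "V T \<le> (23 / 20) * w x" using V[OF tTm(2)] by linarith
  then have "L * V T \<le> L * ((23 / 20) * w x)" using L by (intro mult_left_mono) auto
  then have "norm (Z T x) \<le> L * ((23 / 20) * w x)" using terminal[of x] unfolding V_def by linarith
  then have "norm (Z s x) \<le> L * ((23 / 20) * w x) + (L / 4) * w x"
    using inc(2)[OF s tTm(2), of x] norm_triangle_sub[of "Z s x" "Z T x"] ew(2) by linarith
  \<comment> \<open>23/20 + 5/20 is twice 14/20, and \<open>V s\<close> is even at least 17/20 of
    \<open>w x\<close>.\<close>
  also have "\<dots> = 2 * L * ((14 / 20) * w x)" by simp
  also have "\<dots> \<le> 2 * L * V s"
  proof (rule mult_left_mono)
    show "(14 / 20) * w x \<le> V s" using V[OF s] w_ge_1[of x] by linarith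
  qed (use L in simp)
  finally show ?thesis by (simp add: V_def)
qed

end

section \<open>Uniqueness\<close>

context control_problem
begin

text \<open>\<open>B1\<close> is the growth rate of the vector field, valid without the cone: a
  factor \<open>C\<close> of the coefficients times the \<open>C\<^sup>2\<close> of
  \<open>alpha_growth\<close>. \<open>B2\<close> is the Lipschitz rate within the cone:
  \<open>C\<^sup>2\<close> once the weights have cancelled, times the \<open>C ^ 3\<close> of
  \<open>alpha_lipschitz\<close>. The numbers arise as 6 = 2 * 3 in \<open>Phi_bound\<close> and 132
  = 22 * 6 in \<open>Phi_lipschitz\<close>.\<close>

definition B1 :: real where "B1 = 6 * C ^ 3"
definition B2 :: real where "B2 = 132 * C ^ 5"

lemma C_powers: "0 \<le> C" "C \<le> C ^ 3" "C\<^sup>2 \<le> C ^ 5" "C ^ 4 \<le> C ^ 5" "C \<le> C ^ 5" "C \<le> C ^ 4"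
  using C_ge(1) power_increasing[of 1 3 C] power_increasing[of 2 5 C] power_increasing[of 4 5 C]
    power_increasing[of 1 5 C] power_increasing[of 1 4 C] by auto

section \<open>Solutions as growth systems\<close>

context
  fixes t T :: real and m :: "(real^'n) measure" and X Z :: "real \<Rightarrow> real^'n \<Rightarrow> real^'n"
  assumes m: "m \<in> P2" and sol: "fbode_solution f df g dg \<alpha> p t T m X Z"
begin

lemma sol_facts:
  assumes "s \<in> {t..T}"
  shows "X s \<in> borel_measurable m" "distr m borel (X s) \<in> P2" "integrable m (Z s)"
    "integrable m (Phi_integrand df dg \<alpha> (X s) (Z s) m x)" "integrable m (X s)"
    "moment1 (distr m borel (X s)) = (\<integral>y. norm (X s y) \<partial>m)"
proof -
  have X: "X s \<in> borel_measurable borel" "distr m borel (X s) \<in> P2" and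
    "integrable m (Z s)" "\<And>x. integrable m (Phi_integrand df dg \<alpha> (X s) (Z s) m x)"
    using sol assms unfolding fbode_solution_def by blast+
  then show "distr m borel (X s) \<in> P2" "integrable m (Z s)" "integrable m (Phi_integrand df dg \<alpha> (X s) (Z s) m x)"
    by blast+
  show *: "X s \<in> borel_measurable m" using X(1) by (rule measurable_P2[OF m])
  show "integrable m (X s)" by (rule distr_P2_integrable[OF P2_prob_space[OF m] * X(2)])
  show "moment1 (distr m borel (X s)) = (\<integral>y. norm (X s y) \<partial>m)" by (rule moment1_distr[OF *])
qed

lemma sol_deriv:
  assumes "s \<in> {t..T}"
  shows "((\<lambda>r. X r x) has_vector_derivative f (X s x) (distr m borel (X s)) (\<alpha> (X s x) (distr m borel (X s)) (Z s x))) (at s within {t..T})"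
    "((\<lambda>r. Z r x) has_vector_derivative - Phi f df g dg \<alpha> (X s) (Z s) m x) (at s within {t..T})"
  using sol assms unfolding fbode_solution_def by blast+

lemma drift_bound:
  assumes "s \<in> {t..T}"
  shows "norm (f (X s x) (distr m borel (X s)) (\<alpha> (X s x) (distr m borel (X s)) (Z s x))) \<le>
    B1 * (1 + norm (X s x) + norm (Z s x) + ((\<integral>y. norm (X s y) \<partial>m) + (\<integral>y. norm (Z s y) \<partial>m)))"
proof -
  define \<mu> where "\<mu> = distr m borel (X s)"
  define a where "a = \<alpha> (X s x) \<mu> (Z s x)"
  define q where "q = 1 + norm (X s x) + moment1 \<mu> + norm (Z s x)"
  note F = sol_facts[OF assms]
  have \<mu>: "\<mu> \<in> P2" using F(2) by (simp add: \<mu>_def)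
  have q: "0 \<le> q" "1 + norm (X s x) + moment1 \<mu> \<le> q" using moment1_nonneg[of \<mu>] by (auto simp: q_def)
  have a: "norm a \<le> C\<^sup>2 * q" using alpha_growth[OF \<mu>] by (simp add: a_def q_def)
  have "norm (f (X s x) \<mu> a) \<le> C * (q + C\<^sup>2 * q)"
    using growth(1)[OF \<mu>, of "X s x" a] a q C_powers(1) by (smt (verit, best) mult_left_mono)
  also have "\<dots> = C * q + C ^ 3 * q" by (simp add: distrib_left power3_eq_cube power2_eq_square)
  also have "\<dots> \<le> C ^ 3 * q + C ^ 3 * q" using C_powers(2) q(1) by (intro add_mono mult_right_mono) auto
  also have "\<dots> \<le> B1 * q" using q(1) C_powers(1) by (simp add: B1_def)
  also have "\<dots> \<le> B1 * (1 + norm (X s x) + norm (Z s x) + ((\<integral>y. norm (X s y) \<partial>m) + (\<integral>y. norm (Z s y) \<partial>m)))"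
    using C_powers(1) F(6) by (intro mult_left_mono) (auto simp: q_def \<mu>_def B1_def)
  finally show ?thesis by (simp add: a_def \<mu>_def)
qed

text \<open>The derivatives of \<open>f\<close> are bounded, those of \<open>g\<close> grow
  linearly, and the control is estimated by \<open>alpha_growth\<close>. Nothing about the cone
  enters, so the a priori estimates can start from this bound.\<close>

lemma Phi_bound:
  assumes s: "s \<in> {t..T}"
  shows "norm (Phi f df g dg \<alpha> (X s) (Z s) m x) \<le>
    B1 * (1 + norm (X s x) + norm (Z s x) + ((\<integral>y. norm (X s y) \<partial>m) + (\<integral>y. norm (Z s y) \<partial>m)))"
proof -
  interpret m: prob_space m by (rule P2_prob_space[OF m])
  define \<mu> where "\<mu> = distr m borel (X s)"
  define M where "M = moment1 \<mu>"
  define N where "N = (\<integral>y. norm (Z s y) \<partial>m)"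
  define a where "a y = control \<alpha> (X s) (Z s) m y" for y
  note F = sol_facts[OF s]
  have \<mu>: "\<mu> \<in> P2" using F(2) by (simp add: \<mu>_def)
  have M: "M = (\<integral>y. norm (X s y) \<partial>m)" using F(6) by (simp add: M_def \<mu>_def)
  have M0: "0 \<le> M" by (simp add: M_def moment1_nonneg)
  have N0: "0 \<le> N" by (simp add: N_def)
  have C3: "C * (C\<^sup>2 * r) = C ^ 3 * r" for r by (simp add: power3_eq_cube power2_eq_square)
  have a: "norm (a y) \<le> C\<^sup>2 * (1 + norm (X s y) + M + norm (Z s y))" for y
    using alpha_growth[OF \<mu>] by (simp add: a_def control_def \<mu>_def M_def)
  have aC: "C * norm (a y) \<le> C ^ 3 * (1 + norm (X s y) + M + norm (Z s y))" for y
    using mult_left_mono[OF a C_powers(1)] by (simp only: C3)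
  have up: "C * r \<le> C ^ 3 * r" if "0 \<le> r" for r using C_powers(2) that by (rule mult_right_mono)
  have mult: "norm A * norm z \<le> C * norm z" if "norm A \<le> Lam_f" for A :: "(real^'n) \<Rightarrow>\<^sub>L (real^'n)" and z :: "real^'n"
    using that Lam_f_le by (intro mult_right_mono) auto
  have integrand: "norm (Phi_integrand df dg \<alpha> (X s) (Z s) m x y) \<le>
    2 * C ^ 3 * (1 + norm (X s y) + M + norm (Z s y) + norm (X s x))" for y
  proof -
    have "norm (contr (D_mu df (X s y) \<mu> (a y) (X s x)) (Z s y)) \<le> C * norm (Z s y)"
      by (rule order_trans[OF norm_contr mult[OF f_bounds(2)[OF \<mu>]]])
    moreover have "norm (grad (D_mu dg (X s y) \<mu> (a y) (X s x))) \<le> C * (1 + norm (X s y) + M + norm (a y) + norm (X s x))"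
      using order_trans[OF norm_grad growth(4)[OF \<mu>]] by (simp add: M_def)
    moreover have "norm (Phi_integrand df dg \<alpha> (X s) (Z s) m x y) \<le>
      norm (contr (D_mu df (X s y) \<mu> (a y) (X s x)) (Z s y)) + norm (grad (D_mu dg (X s y) \<mu> (a y) (X s x)))"
      unfolding Phi_integrand_def a_def[symmetric] \<mu>_def[symmetric] by (rule norm_triangle_ineq)
    ultimately have "norm (Phi_integrand df dg \<alpha> (X s) (Z s) m x y) \<le>
      C * (1 + norm (X s y) + M + norm (Z s y) + norm (X s x)) + C * norm (a y)"
      by (simp add: distrib_left)
    also have "\<dots> \<le> C ^ 3 * (1 + norm (X s y) + M + norm (Z s y) + norm (X s x)) + C ^ 3 * (1 + norm (X s y) + M + norm (Z s y))"
      using M0 by (intro add_mono up aC) auto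
    also have "\<dots> \<le> 2 * C ^ 3 * (1 + norm (X s y) + M + norm (Z s y) + norm (X s x))"
      using C_powers(1) by (simp add: distrib_left)
    finally show ?thesis .
  qed
  have int: "norm (\<integral>y. Phi_integrand df dg \<alpha> (X s) (Z s) m x y \<partial>m) \<le> 2 * C ^ 3 * (1 + 2 * M + N + norm (X s x))"
  proof -
    have "norm (\<integral>y. Phi_integrand df dg \<alpha> (X s) (Z s) m x y \<partial>m) \<le>
      (\<integral>y. 2 * C ^ 3 * (1 + norm (X s y) + M + norm (Z s y) + norm (X s x)) \<partial>m)"
      using F(3,5) by (intro norm_integral_le integrand) auto
    also have "\<dots> = 2 * C ^ 3 * (1 + M + M + N + norm (X s x))"
      using F(3,5) by (simp add: M N_def m.prob_space)
    finally show ?thesis by (simp add: add_ac)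
  qed
  have 1: "norm (contr (D_x f (X s x) \<mu> (a x)) (Z s x)) \<le> C * norm (Z s x)"
    by (rule order_trans[OF norm_contr mult[OF f_bounds(3)[OF \<mu>]]])
  have 2: "norm (grad (D_x g (X s x) \<mu> (a x))) \<le> C * (1 + norm (X s x) + M + norm (a x))"
    using order_trans[OF norm_grad growth(2)[OF \<mu>]] by (simp add: M_def)
  have "norm (contr (D_x f (X s x) \<mu> (a x)) (Z s x)) + norm (grad (D_x g (X s x) \<mu> (a x))) \<le>
    C * (1 + norm (X s x) + M + norm (Z s x)) + C * norm (a x)"
    using 1 2 by (simp add: distrib_left)
  also have "\<dots> \<le> C ^ 3 * (1 + norm (X s x) + M + norm (Z s x)) + C ^ 3 * (1 + norm (X s x) + M + norm (Z s x))"
    using M0 by (intro add_mono up aC) auto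
  finally have loc: "norm (contr (D_x f (X s x) \<mu> (a x)) (Z s x)) + norm (grad (D_x g (X s x) \<mu> (a x)))
    \<le> 2 * C ^ 3 * (1 + norm (X s x) + M + norm (Z s x))" by simp
  have "norm (Phi f df g dg \<alpha> (X s) (Z s) m x) \<le>
    norm (contr (D_x f (X s x) \<mu> (a x)) (Z s x)) + norm (grad (D_x g (X s x) \<mu> (a x))) +
    norm (\<integral>y. Phi_integrand df dg \<alpha> (X s) (Z s) m x y \<partial>m)"
    unfolding Phi_def a_def[symmetric] \<mu>_def[symmetric]
    by (rule order_trans[OF norm_triangle_ineq add_right_mono[OF norm_triangle_ineq]])
  also have "\<dots> \<le> 2 * C ^ 3 * (1 + norm (X s x) + M + norm (Z s x)) + 2 * C ^ 3 * (1 + 2 * M + N + norm (X s x))"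
    using loc int by linarith
  also have "\<dots> = 2 * C ^ 3 * (2 + 2 * norm (X s x) + 3 * M + norm (Z s x) + N)" by (simp add: algebra_simps)
  also have "\<dots> \<le> 2 * C ^ 3 * (3 * (1 + norm (X s x) + norm (Z s x) + (M + N)))"
    using C_powers(1) M0 N0 by (intro mult_left_mono) auto
  also have "\<dots> = B1 * (1 + norm (X s x) + norm (Z s x) + (M + N))" by (simp add: B1_def)
  finally show ?thesis by (simp only: M N_def)
qed

lemma growth_system:
  assumes "t \<le> T" "14 * B1 * (T - t) * (1 + 3 * Lbar) \<le> 1"
  shows "growth_system m t T X Z
    (\<lambda>s x. f (X s x) (distr m borel (X s)) (\<alpha> (X s x) (distr m borel (X s)) (Z s x)))
    (\<lambda>s x. - Phi f df g dg \<alpha> (X s) (Z s) m x) B1 Lbar"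
proof
  show "0 \<le> B1" using C_powers(1) by (simp add: B1_def)
  fix s x assume s: "s \<in> {t..T}"
  show "integrable m (X s)" "integrable m (Z s)" using sol_facts[OF s] by auto
  show "((\<lambda>r. X r x) has_vector_derivative f (X s x) (distr m borel (X s)) (\<alpha> (X s x) (distr m borel (X s)) (Z s x))) (at s within {t..T})"
    "((\<lambda>r. Z r x) has_vector_derivative - Phi f df g dg \<alpha> (X s) (Z s) m x) (at s within {t..T})"
    by (rule sol_deriv[OF s])+
  show "norm (f (X s x) (distr m borel (X s)) (\<alpha> (X s x) (distr m borel (X s)) (Z s x))) \<le>
    B1 * (1 + norm (X s x) + norm (Z s x) + ((\<integral>y. norm (X s y) \<partial>m) + (\<integral>y. norm (Z s y) \<partial>m)))"
    by (rule drift_bound[OF s])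
  show "norm (- Phi f df g dg \<alpha> (X s) (Z s) m x) \<le>
    B1 * (1 + norm (X s x) + norm (Z s x) + ((\<integral>y. norm (X s y) \<partial>m) + (\<integral>y. norm (Z s y) \<partial>m)))"
    using Phi_bound[OF s] by simp
next
  fix x
  have T: "T \<in> {t..T}" using assms(1) by simp
  show "X t x = x" using sol unfolding fbode_solution_def by blast
  have "Z T x = p (X T x) (distr m borel (X T))" using sol unfolding fbode_solution_def by blast
  then show "norm (Z T x) \<le> Lbar * (1 + norm (X T x) + (\<integral>y. norm (X T y) \<partial>m))"
    using p_growth[OF sol_facts(2)[OF T], of "X T x"] by (simp add: sol_facts(6)[OF T])
qed (use m assms Lbar in auto)

end

section \<open>Difference of two solutions\<close>

context
  fixes t T :: real and m :: "(real^'n) measure" and X Z X' Z' :: "real \<Rightarrow> real^'n \<Rightarrow> real^'n"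
  assumes m: "m \<in> P2" and sol: "fbode_solution f df g dg \<alpha> p t T m X Z"
    and sol': "fbode_solution f df g dg \<alpha> p t T m X' Z'"
begin

text \<open>Both laws are push-forwards of \<open>m\<close>, so the pair of maps itself provides a
  coupling.\<close>

lemma law_dist:
  assumes s: "s \<in> {t..T}"
  shows "W1_le (distr m borel (X s)) (distr m borel (X' s)) (\<integral>y. norm (X s y - X' s y) \<partial>m)"
  by (rule W1_le_distr[OF P2_prob_space[OF m] sol_facts(1)[OF m sol s] sol_facts(1)[OF m sol' s]])

context
  fixes s c d :: real and \<mu> \<mu>' :: "(real^'n) measure" and a a' :: "real^'n \<Rightarrow> real^'k" and E :: "real^'n \<Rightarrow> real"
  assumes s: "s \<in> {t..T}"
    and adj: "\<And>x. norm (Z s x) \<le> 2 * Lbar * (1 + norm (X s x) + moment1 (distr m borel (X s)))"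
    and \<mu>_def: "\<mu> = distr m borel (X s)" and \<mu>'_def: "\<mu>' = distr m borel (X' s)"
    and a_def: "\<And>y. a y = control \<alpha> (X s) (Z s) m y" and a'_def: "\<And>y. a' y = control \<alpha> (X' s) (Z' s) m y"
    and c_def: "c = (\<integral>y. norm (X s y - X' s y) \<partial>m)" and d_def: "d = (\<integral>y. norm (Z s y - Z' s y) \<partial>m)"
    and E_def: "\<And>y. E y = norm (X s y - X' s y) + c + norm (Z s y - Z' s y)"
begin

lemma \<mu>_P2: "\<mu> \<in> P2" and \<mu>'_P2: "\<mu>' \<in> P2"
  using sol_facts(2)[OF m sol s] sol_facts(2)[OF m sol' s] by (simp_all add: \<mu>_def \<mu>'_def)

lemma c_W1: "W1_le \<mu> \<mu>' c"
  using law_dist[OF s] by (simp add: \<mu>_def \<mu>'_def c_def)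

lemma E_nonneg: "0 \<le> c" "0 \<le> d" "0 \<le> E y"
  by (simp_all add: c_def d_def E_def)

lemma control_lipschitz: "norm (a y - a' y) \<le> 6 * C ^ 3 * E y"
  using alpha_lipschitz[OF \<mu>_P2 \<mu>'_P2 c_W1, of "Z s y" "X s y" "X' s y" "Z' s y"] adj[of y]
  by (simp add: a_def a'_def control_def \<mu>_def \<mu>'_def E_def)

lemma drift_lipschitz: "norm (f (X s x) \<mu> (a x) - f (X' s x) \<mu>' (a' x)) \<le> B2 * E x"
proof -
  have "norm (f (X s x) \<mu> (a x) - f (X' s x) \<mu>' (a' x)) \<le> C * (norm (X s x - X' s x) + c + norm (a x - a' x))"
    by (rule f_lipschitz[OF \<mu>_P2 \<mu>'_P2 c_W1])
  also have "\<dots> \<le> C * (E x + 6 * C ^ 3 * E x)"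
    using control_lipschitz[of x] C_powers(1) by (intro mult_left_mono add_mono) (auto simp: E_def)
  also have "\<dots> = C * E x + 6 * (C ^ 4 * E x)" by (simp add: distrib_left power_numeral_reduce)
  also have "\<dots> \<le> C ^ 5 * E x + 6 * (C ^ 5 * E x)"
    using C_powers E_nonneg(3)[of x] by (intro add_mono mult_left_mono mult_right_mono) auto
  also have "\<dots> \<le> B2 * E x"
    using C_powers(1) E_nonneg(3)[of x] by (simp add: B2_def)
  finally show ?thesis .
qed

text \<open>One estimate for the state term and for the integrand of \<open>Phi\<close>;
  \<open>D\<close> is the displacement of the arguments other than the control. Weight and adjoint
  belong to the same point \<open>y\<close>, also under the integral, and this is why the decay of
  the derivatives cancels the growth of \<open>Z\<close>.\<close>

lemma adjoint_term_lipschitz: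
  assumes A: "norm (A - A') \<le> C / (1 + norm (X s y) + moment1 \<mu>) * (D + norm (a y - a' y))"
    and b: "norm A' \<le> Lam_f" and G: "norm (G - G') \<le> C * (D + norm (a y - a' y))" and D: "0 \<le> D"
  shows "norm (contr A (Z s y) - contr A' (Z' s y)) + norm (grad G - grad G') \<le> 22 * C ^ 5 * (D + E y)"
proof -
  define W where "W = 1 + norm (X s y) + moment1 \<mu>"
  have W: "0 < W" using moment1_nonneg[of \<mu>] by (simp add: W_def add_pos_nonneg)
  define h where "h = D + norm (a y - a' y)"
  have h: "0 \<le> h" using D by (simp add: h_def)
  have "norm (A - A') * norm (Z s y) \<le> (C / W * h) * (2 * Lbar * W)"
    using A adj[of y] W C_powers(1) h by (intro mult_mono) (auto simp: W_def h_def \<mu>_def)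
  also have "\<dots> = 2 * C * h * Lbar" using W by simp
  also have "\<dots> \<le> 2 * C * h * C" using Lbar_le C_powers(1) h by (intro mult_left_mono) auto
  finally have 1: "norm (A - A') * norm (Z s y) \<le> 2 * C\<^sup>2 * h" by (simp add: power2_eq_square mult_ac)
  have 2: "norm A' * norm (Z s y - Z' s y) \<le> C * E y"
    using b Lam_f_le C_powers(1) E_nonneg(1) by (intro mult_mono) (auto simp: E_def)
  have "norm (grad G - grad G') \<le> C * h" using norm_grad_diff G unfolding h_def by (rule order_trans)
  also have "\<dots> \<le> C\<^sup>2 * h" using C_ge(1) h by (intro mult_right_mono) (auto simp: power2_eq_square)
  finally have "norm (contr A (Z s y) - contr A' (Z' s y)) + norm (grad G - grad G') \<le> 3 * C\<^sup>2 * h + C * E y"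
    using norm_contr_diff[of A "Z s y" A' "Z' s y"] 1 2 by linarith
  \<comment> \<open>The control contributes \<open>6 * C ^ 3\<close>, so the powers add up to
    \<open>C ^ 5\<close>, and 22 = 18 + 3 + 1.\<close>
  also have "3 * C\<^sup>2 * h \<le> 3 * C\<^sup>2 * (D + 6 * C ^ 3 * E y)"
    unfolding h_def using control_lipschitz[of y] by (intro mult_left_mono add_mono) auto
  also have "\<dots> = 3 * (C\<^sup>2 * D) + 18 * (C ^ 5 * E y)" by (simp add: distrib_left power_numeral_reduce)
  finally have "norm (contr A (Z s y) - contr A' (Z' s y)) + norm (grad G - grad G') \<le>
    3 * (C\<^sup>2 * D) + 18 * (C ^ 5 * E y) + C * E y" by simp
  also have "\<dots> \<le> 3 * (C ^ 5 * D) + 18 * (C ^ 5 * E y) + C ^ 5 * E y"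
    using C_powers E_nonneg(3)[of y] D by (intro add_mono mult_left_mono mult_right_mono) auto
  also have "\<dots> \<le> 22 * C ^ 5 * (D + E y)"
    using C_powers(1) E_nonneg(3)[of y] D by (simp add: distrib_left)
  finally show ?thesis .
qed

lemma Phi_lipschitz:
  "norm (Phi f df g dg \<alpha> (X s) (Z s) m x - Phi f df g dg \<alpha> (X' s) (Z' s) m x) \<le>
    B2 * (norm (X s x - X' s x) + norm (Z s x - Z' s x) + c + d)"
proof -
  interpret m: prob_space m by (rule P2_prob_space[OF m])
  note F = sol_facts[OF m sol s] and F' = sol_facts[OF m sol' s]
  define I where "I y = Phi_integrand df dg \<alpha> (X s) (Z s) m x y" for y
  define I' where "I' y = Phi_integrand df dg \<alpha> (X' s) (Z' s) m x y" for y
  define q where "q = norm (X s x - X' s x)"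
  have q: "0 \<le> q" by (simp add: q_def)
  have E_q: "norm (X s y - X' s y) + c \<le> E y" for y by (simp add: E_def)
  have integrand: "norm (I y - I' y) \<le> 22 * C ^ 5 * (2 * E y + q)" for y
  proof -
    define A where "A = D_mu df (X s y) \<mu> (a y) (X s x)"
    define A' where "A' = D_mu df (X' s y) \<mu>' (a' y) (X' s x)"
    define G where "G = D_mu dg (X s y) \<mu> (a y) (X s x)"
    define G' where "G' = D_mu dg (X' s y) \<mu>' (a' y) (X' s x)"
    have "norm (contr A (Z s y) - contr A' (Z' s y)) + norm (grad G - grad G') \<le>
      22 * C ^ 5 * ((norm (X s y - X' s y) + c + q) + E y)"
    proof (rule adjoint_term_lipschitz)
      show "norm (A - A') \<le> C / (1 + norm (X s y) + moment1 \<mu>) * (norm (X s y - X' s y) + c + q + norm (a y - a' y))"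
        using D_f_lipschitz(3)[OF \<mu>_P2 \<mu>'_P2 c_W1, of "X s y" "a y" "X s x" "X' s y" "a' y" "X' s x"]
        by (simp add: A_def A'_def q_def add_ac)
      show "norm A' \<le> Lam_f" unfolding A'_def by (rule f_bounds(2)[OF \<mu>'_P2])
      show "norm (G - G') \<le> C * (norm (X s y - X' s y) + c + q + norm (a y - a' y))"
        using D_g_lipschitz(3)[OF \<mu>_P2 \<mu>'_P2 c_W1, of "X s y" "a y" "X s x" "X' s y" "a' y" "X' s x"]
        by (simp add: G_def G'_def q_def add_ac)
    qed (use q E_nonneg(1) in simp)
    also have "\<dots> \<le> 22 * C ^ 5 * (2 * E y + q)"
      using C_powers(1) E_q[of y] by (intro mult_left_mono) auto
    finally have "norm (contr A (Z s y) - contr A' (Z' s y)) + norm (grad G - grad G') \<le> 22 * C ^ 5 * (2 * E y + q)" .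
    moreover have "I y - I' y = (contr A (Z s y) - contr A' (Z' s y)) + (grad G - grad G')"
      by (simp add: I_def I'_def Phi_integrand_def A_def A'_def G_def G'_def a_def a'_def \<mu>_def \<mu>'_def)
    ultimately show ?thesis using norm_triangle_ineq order_trans by metis
  qed
  have iI: "integrable m I" "integrable m I'"
    unfolding I_def[abs_def] I'_def[abs_def] using F(4) F'(4) by auto
  have "norm ((\<integral>y. I y \<partial>m) - (\<integral>y. I' y \<partial>m)) = norm (\<integral>y. I y - I' y \<partial>m)"
    using iI by simp
  also have "\<dots> \<le> (\<integral>y. 22 * C ^ 5 * (2 * E y + q) \<partial>m)"
    unfolding E_def using F(3,5) F'(3,5) by (intro norm_integral_le integrand[unfolded E_def]) auto
  \<comment> \<open>\<open>E\<close> contains the constant \<open>c\<close> besides the two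
    pointwise differences, so its mean is \<open>2 * c + d\<close>.\<close>
  also have "\<dots> = 22 * C ^ 5 * (2 * (2 * c + d) + q)"
    unfolding E_def using F(3,5) F'(3,5) by (simp add: c_def[symmetric] d_def[symmetric] m.prob_space)
  finally have int: "norm ((\<integral>y. I y \<partial>m) - (\<integral>y. I' y \<partial>m)) \<le> 22 * C ^ 5 * (2 * (2 * c + d) + q)" .
  define A where "A = D_x f (X s x) \<mu> (a x)"
  define A' where "A' = D_x f (X' s x) \<mu>' (a' x)"
  define G where "G = D_x g (X s x) \<mu> (a x)"
  define G' where "G' = D_x g (X' s x) \<mu>' (a' x)"
  have loc: "norm (contr A (Z s x) - contr A' (Z' s x)) + norm (grad G - grad G') \<le> 22 * C ^ 5 * ((q + c) + E x)"
  proof (rule adjoint_term_lipschitz)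
    show "norm (A - A') \<le> C / (1 + norm (X s x) + moment1 \<mu>) * (q + c + norm (a x - a' x))"
      using D_f_lipschitz(1)[OF \<mu>_P2 \<mu>'_P2 c_W1] by (simp add: A_def A'_def q_def)
    show "norm A' \<le> Lam_f" unfolding A'_def by (rule f_bounds(3)[OF \<mu>'_P2])
    show "norm (G - G') \<le> C * (q + c + norm (a x - a' x))"
      using D_g_lipschitz(1)[OF \<mu>_P2 \<mu>'_P2 c_W1] by (simp add: G_def G'_def q_def)
  qed (use q E_nonneg(1) in simp)
  have eq: "Phi f df g dg \<alpha> (X s) (Z s) m x - Phi f df g dg \<alpha> (X' s) (Z' s) m x =
    (contr A (Z s x) - contr A' (Z' s x)) + (grad G - grad G') + ((\<integral>y. I y \<partial>m) - (\<integral>y. I' y \<partial>m))"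
    unfolding Phi_def I_def I'_def A_def A'_def G_def G'_def a_def a'_def \<mu>_def \<mu>'_def
    by (simp only: add_diff_add)
  have "norm (Phi f df g dg \<alpha> (X s) (Z s) m x - Phi f df g dg \<alpha> (X' s) (Z' s) m x) \<le>
    norm (contr A (Z s x) - contr A' (Z' s x)) + norm (grad G - grad G') + norm ((\<integral>y. I y \<partial>m) - (\<integral>y. I' y \<partial>m))"
    unfolding eq by (rule order_trans[OF norm_triangle_ineq add_right_mono[OF norm_triangle_ineq]])
  also have "\<dots> \<le> 22 * C ^ 5 * ((q + c) + E x) + 22 * C ^ 5 * (2 * (2 * c + d) + q)"
    using loc int by linarith
  also have "\<dots> = 22 * C ^ 5 * (3 * q + 6 * c + 2 * d + norm (Z s x - Z' s x))"
    by (simp add: E_def q_def algebra_simps)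
  also have "\<dots> \<le> 22 * C ^ 5 * (6 * (q + norm (Z s x - Z' s x) + c + d))"
    using C_powers(1) q E_nonneg by (intro mult_left_mono) auto
  also have "\<dots> = B2 * (q + norm (Z s x - Z' s x) + c + d)" by (simp add: B2_def)
  finally show ?thesis by (simp only: q_def)
qed

end

text \<open>Forward for \<open>X\<close> from equal initial values, across the terminal condition,
  backward for \<open>Z\<close>. The forward part has to come first because the terminal adjoints
  differ only through the terminal states and their laws.\<close>

lemma contraction_step:
  assumes tT: "t \<le> T" and K: "0 \<le> K" and small: "48 * C * B2 * (T - t) \<le> 1"
    and adj: "\<And>s x. s \<in> {t..T} \<Longrightarrow> norm (Z s x) \<le> 2 * Lbar * (1 + norm (X s x) + moment1 (distr m borel (X s)))"
    and w: "\<And>x. 1 \<le> w x" "integrable m w" "\<And>x. (\<integral>y. w y \<partial>m) \<le> 2 * w x"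
    and bound: "\<And>s x. s \<in> {t..T} \<Longrightarrow> norm (X s x - X' s x) \<le> K * w x \<and> norm (Z s x - Z' s x) \<le> K * w x"
    and s: "s \<in> {t..T}"
  shows "norm (X s x - X' s x) \<le> K / 2 * w x \<and> norm (Z s x - Z' s x) \<le> K / 2 * w x"
proof -
  have B2: "0 \<le> B2" using C_powers(1) by (simp add: B2_def)
  define \<delta> where "\<delta> = T - t"
  \<comment> \<open>6 = 1 + 1 + 2 + 2: two pointwise differences and two means, each mean at most
    \<open>2 * K * w x\<close>.\<close>
  define e where "e = 6 * B2 * K * \<delta>"
  have e: "0 \<le> e" using B2 K tT by (simp add: e_def \<delta>_def)
  have mean: "(\<integral>y. norm (h y) \<partial>m) \<le> 2 * k * w x"
    if "\<And>y. norm (h y) \<le> k * w y" "integrable m h" "0 \<le> k" for h :: "real^'n \<Rightarrow> real^'n" and k x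
  proof -
    have "(\<integral>y. norm (h y) \<partial>m) \<le> (\<integral>y. k * w y \<partial>m)"
      using that w(2) by (intro integral_mono) auto
    also have "\<dots> \<le> k * (2 * w x)" using w(3) that(3) by (simp add: mult_left_mono)
    finally show ?thesis by simp
  qed
  have int: "integrable m (\<lambda>y. X s y - X' s y)" "integrable m (\<lambda>y. Z s y - Z' s y)" if "s \<in> {t..T}" for s
    using sol_facts(3,5)[OF m sol that] sol_facts(3,5)[OF m sol' that] by auto
  have rate: "norm (f (X r x) (distr m borel (X r)) (\<alpha> (X r x) (distr m borel (X r)) (Z r x)) -
      f (X' r x) (distr m borel (X' r)) (\<alpha> (X' r x) (distr m borel (X' r)) (Z' r x))) \<le> 6 * B2 * K * w x"
    "norm (- Phi f df g dg \<alpha> (X r) (Z r) m x - - Phi f df g dg \<alpha> (X' r) (Z' r) m x) \<le> 6 * B2 * K * w x"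
    if r: "r \<in> {t..T}" for r x
  proof -
    define c where "c = (\<integral>y. norm (X r y - X' r y) \<partial>m)"
    define d where "d = (\<integral>y. norm (Z r y - Z' r y) \<partial>m)"
    have cd: "c \<le> 2 * K * w x" "d \<le> 2 * K * w x" "0 \<le> d"
      unfolding c_def d_def using bound[OF r] int[OF r] K by (auto intro!: mean)
    have b: "norm (X r x - X' r x) \<le> K * w x" "norm (Z r x - Z' r x) \<le> K * w x" using bound[OF r] by auto
    have "norm (f (X r x) (distr m borel (X r)) (control \<alpha> (X r) (Z r) m x) -
      f (X' r x) (distr m borel (X' r)) (control \<alpha> (X' r) (Z' r) m x)) \<le>
      B2 * (norm (X r x - X' r x) + c + norm (Z r x - Z' r x))"
      by (rule drift_lipschitz[OF r adj[OF r]]) (simp_all add: c_def)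
    also have "\<dots> \<le> B2 * (6 * (K * w x))" using b cd B2 by (intro mult_left_mono) auto
    finally show "norm (f (X r x) (distr m borel (X r)) (\<alpha> (X r x) (distr m borel (X r)) (Z r x)) -
      f (X' r x) (distr m borel (X' r)) (\<alpha> (X' r x) (distr m borel (X' r)) (Z' r x))) \<le> 6 * B2 * K * w x"
      by (simp add: control_def mult_ac)
    have "norm (Phi f df g dg \<alpha> (X r) (Z r) m x - Phi f df g dg \<alpha> (X' r) (Z' r) m x) \<le>
      B2 * (norm (X r x - X' r x) + norm (Z r x - Z' r x) + c + d)"
      by (rule Phi_lipschitz[OF r adj[OF r]]) (simp_all add: c_def d_def)
    also have "\<dots> \<le> B2 * (6 * (K * w x))" using b cd B2 by (intro mult_left_mono) auto
    finally show "norm (- Phi f df g dg \<alpha> (X r) (Z r) m x - - Phi f df g dg \<alpha> (X' r) (Z' r) m x) \<le> 6 * B2 * K * w x"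
      by (simp add: norm_minus_commute mult_ac)
  qed
  have deriv: "((\<lambda>r. X r x - X' r x) has_vector_derivative
      (f (X r x) (distr m borel (X r)) (\<alpha> (X r x) (distr m borel (X r)) (Z r x)) -
      f (X' r x) (distr m borel (X' r)) (\<alpha> (X' r x) (distr m borel (X' r)) (Z' r x)))) (at r within {t..T})"
    "((\<lambda>r. Z r x - Z' r x) has_vector_derivative
      (- Phi f df g dg \<alpha> (X r) (Z r) m x - - Phi f df g dg \<alpha> (X' r) (Z' r) m x)) (at r within {t..T})"
    if "r \<in> {t..T}" for r x
    by (intro has_vector_derivative_diff sol_deriv[OF m sol that] sol_deriv[OF m sol' that])+
  have X_le: "norm (X r x - X' r x) \<le> e * w x" if r: "r \<in> {t..T}" for r x
  proof -
    have "norm ((X r x - X' r x) - (X t x - X' t x)) \<le> 6 * B2 * K * w x * (r - t)"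
      by (rule vector_mean_value[OF _ _ deriv(1) rate(1)]) (use r in auto)
    also have "\<dots> \<le> 6 * B2 * K * w x * \<delta>"
      using r B2 K w(1)[of x] by (intro mult_left_mono) (auto simp: \<delta>_def)
    finally show ?thesis using sol sol' by (simp add: fbode_solution_def e_def mult_ac)
  qed
  have T: "T \<in> {t..T}" using tT by simp
  have Z_T: "norm (Z T x - Z' T x) \<le> C * (3 * e * w x)"
  proof -
    have "norm (Z T x - Z' T x) \<le> C * (norm (X T x - X' T x) + (\<integral>y. norm (X T y - X' T y) \<partial>m))"
      using p_lipschitz[OF sol_facts(2)[OF m sol T] sol_facts(2)[OF m sol' T] law_dist[OF T], of "X T x" "X' T x"]
        sol sol' by (simp add: fbode_solution_def)
    also have "\<dots> \<le> C * (e * w x + 2 * e * w x)"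
      using X_le[OF T] mean[OF X_le[OF T] int(1)[OF T] e, of x] C_powers(1) by (intro mult_left_mono add_mono) auto
    finally show ?thesis by simp
  qed
  have "norm ((Z T x - Z' T x) - (Z s x - Z' s x)) \<le> 6 * B2 * K * w x * (T - s)"
    by (rule vector_mean_value[OF _ _ deriv(2) rate(2)]) (use s in auto)
  also have "\<dots> \<le> 6 * B2 * K * w x * \<delta>"
    using s B2 K w(1)[of x] by (intro mult_left_mono) (auto simp: \<delta>_def)
  also have "\<dots> = e * w x" by (simp add: e_def mult_ac)
  finally have Zs: "norm (Z s x - Z' s x) \<le> e * w x + C * (3 * e * w x)"
    using Z_T norm_triangle_sub[of "Z s x - Z' s x" "Z T x - Z' T x"] by (simp add: norm_minus_commute)
  define q where "q = e * w x"
  have q: "0 \<le> q" using e w(1)[of x] by (simp add: q_def)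
  have qC: "q \<le> C * q" using mult_right_mono[OF C_ge(1) q] by simp
  \<comment> \<open>48 = 6 * 8: the total \<open>e * w x * (1 + 3 * C)\<close> is at most
    \<open>4 * C * e * w x\<close>, and another factor 2 yields the halving.\<close>
  have "48 * C * B2 * \<delta> * K \<le> 1 * K" unfolding \<delta>_def using small K by (rule mult_right_mono)
  then have "8 * C * e \<le> K" by (simp add: e_def mult_ac)
  then have "8 * C * e * w x \<le> K * w x" using w(1)[of x] by (intro mult_right_mono) auto
  then have "4 * (C * q) \<le> K / 2 * w x" by (simp add: q_def mult_ac)
  moreover have "norm (Z s x - Z' s x) \<le> q + 3 * (C * q)" using Zs by (simp add: q_def mult_ac)
  moreover have "norm (X s x - X' s x) \<le> q" using X_le[OF s] by (simp add: q_def)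
  ultimately show ?thesis using q qC by linarith
qed

text \<open>\<open>bound_w\<close> makes the weighted sup norm of the difference finite, and
  \<open>contraction_step\<close> halves any bound on it; so it is 0.\<close>

theorem uniqueness:
  assumes tT: "t \<le> T" and s: "s \<in> {t..T}"
    and small: "14 * B1 * (T - t) * (1 + 3 * Lbar) \<le> 1" "280 * B1 * (T - t) * (1 + 4 * Lbar) \<le> 1"
      "56 * B1 * (T - t) * (1 + 4 * Lbar) \<le> Lbar" "48 * C * B2 * (T - t) \<le> 1"
  shows "X s x = X' s x \<and> Z s x = Z' s x"
proof -
  interpret S: growth_system m t T X Z
    "\<lambda>s x. f (X s x) (distr m borel (X s)) (\<alpha> (X s x) (distr m borel (X s)) (Z s x))"
    "\<lambda>s x. - Phi f df g dg \<alpha> (X s) (Z s) m x" B1 Lbar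
    by (rule growth_system[OF m sol tT small(1)])
  interpret S': growth_system m t T X' Z'
    "\<lambda>s x. f (X' s x) (distr m borel (X' s)) (\<alpha> (X' s x) (distr m borel (X' s)) (Z' s x))"
    "\<lambda>s x. - Phi f df g dg \<alpha> (X' s) (Z' s) m x" B1 Lbar
    by (rule growth_system[OF m sol' tT small(1)])
  have sm: "140 * S.\<tau> * S.c_star \<le> 1" "28 * S.\<tau> * S.c_star \<le> Lbar"
  proof -
    have "140 * (b * u) * (2 * v) = 280 * b * u * v" "28 * (b * u) * (2 * v) = 56 * b * u * v" for b u v :: real by simp_all
    then show "140 * S.\<tau> * S.c_star \<le> 1" "28 * S.\<tau> * S.c_star \<le> Lbar"
      using small(2,3) by (simp_all only: S.\<tau>_def S.c_star_def)
  qed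
  have adj: "norm (Z s x) \<le> 2 * Lbar * (1 + norm (X s x) + moment1 (distr m borel (X s)))" if "s \<in> {t..T}" for s x
    using S.adjoint_bound[OF sm that] by (simp add: sol_facts(6)[OF m sol that])
  have c0: "0 \<le> S.c_star" using Lbar(1) by (simp add: S.c_star_def)
  \<comment> \<open>\<open>w\<close> and \<open>c_star\<close> depend only on \<open>m\<close> and
    \<open>Lbar\<close>, hence agree for the two solutions, and \<open>2 * S.c_star\<close> is a
    valid first constant.\<close>
  have "\<forall>s\<in>{t..T}. \<forall>x. norm (X s x - X' s x) \<le> 2 * S.c_star / 2 ^ k * S.w x \<and> norm (Z s x - Z' s x) \<le> 2 * S.c_star / 2 ^ k * S.w x" for k
  proof (induction k)
    case 0
    show ?case
    proof (intro ballI allI)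
      fix s x assume s: "s \<in> {t..T}"
      show "norm (X s x - X' s x) \<le> 2 * S.c_star / 2 ^ 0 * S.w x \<and> norm (Z s x - Z' s x) \<le> 2 * S.c_star / 2 ^ 0 * S.w x"
        using S.bound_w[OF s, of x] S'.bound_w[OF s, of x] norm_diff_le_add[of "X s x" "X' s x"] norm_diff_le_add[of "Z s x" "Z' s x"]
        by simp
    qed
  next
    case (Suc k)
    show ?case
    proof (intro ballI allI)
      fix s x assume s: "s \<in> {t..T}"
      have "0 \<le> 2 * S.c_star / 2 ^ k" using c0 by simp
      from contraction_step[OF tT this small(4) adj S.w_ge_1 S.integrable_w S.integral_w _ s, of x] Suc
      show "norm (X s x - X' s x) \<le> 2 * S.c_star / 2 ^ Suc k * S.w x \<and> norm (Z s x - Z' s x) \<le> 2 * S.c_star / 2 ^ Suc k * S.w x"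
        by auto
    qed
  qed
  then have "norm (X s x - X' s x) \<le> 0 + 2 * S.c_star * S.w x / 2 ^ k \<and> norm (Z s x - Z' s x) \<le> 0 + 2 * S.c_star * S.w x / 2 ^ k" for k
    using s by simp
  then have "norm (X s x - X' s x) \<le> 0" "norm (Z s x - Z' s x) \<le> 0"
    by (blast intro: le_if_le_plus_halving)+
  then show ?thesis by simp
qed

end

end

text \<open>The four summands bound the reciprocals of the admissible lengths \<open>T - t\<close> in
  \<open>control_problem.uniqueness\<close>.\<close>

definition horizon :: "real \<Rightarrow> real \<Rightarrow> real" where
  "horizon L C = 1 / (14 * (6 * C ^ 3) * (1 + 3 * L) + 280 * (6 * C ^ 3) * (1 + 4 * L) +
    56 * (6 * C ^ 3) * (1 + 4 * L) / L + 48 * C * (132 * C ^ 5))"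

lemma horizon_pos:
  assumes "0 < L" "1 \<le> C" shows "0 < horizon L C"
  unfolding horizon_def using assms by (intro divide_pos_pos add_pos_pos mult_pos_pos) auto

lemma mult_le_1_if_le_inverse_sum:
  fixes a S \<delta> :: real
  assumes "\<delta> \<le> 1 / S" "0 \<le> \<delta>" "a \<le> S" "0 < S" shows "a * \<delta> \<le> 1"
proof -
  have "a * \<delta> \<le> S * \<delta>" using assms by (intro mult_right_mono) auto
  also have "\<dots> \<le> 1" using assms by (simp add: pos_le_divide_eq mult.commute)
  finally show ?thesis .
qed

lemma horizon_bounds:
  fixes L C \<delta> :: real
  assumes "0 < L" "1 \<le> C" "0 \<le> \<delta>" "\<delta> \<le> horizon L C"
  shows "14 * (6 * C ^ 3) * \<delta> * (1 + 3 * L) \<le> 1" "280 * (6 * C ^ 3) * \<delta> * (1 + 4 * L) \<le> 1"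
    "56 * (6 * C ^ 3) * \<delta> * (1 + 4 * L) \<le> L" "48 * C * (132 * C ^ 5) * \<delta> \<le> 1"
proof -
  define p1 where "p1 = 14 * (6 * C ^ 3) * (1 + 3 * L)"
  define p2 where "p2 = 280 * (6 * C ^ 3) * (1 + 4 * L)"
  define p3 where "p3 = 56 * (6 * C ^ 3) * (1 + 4 * L) / L"
  define p4 where "p4 = 48 * C * (132 * C ^ 5)"
  have pos: "0 < p1" "0 < p2" "0 < p3" "0 < p4"
    using assms by (auto simp: p1_def p2_def p3_def p4_def)
  have \<delta>: "\<delta> \<le> 1 / (p1 + p2 + p3 + p4)"
    using assms(4) by (simp only: horizon_def p1_def p2_def p3_def p4_def)
  have le: "a * \<delta> \<le> 1" if "a \<le> p1 + p2 + p3 + p4" for a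
    using pos by (intro mult_le_1_if_le_inverse_sum[OF \<delta> assms(3) that]) linarith
  have "p1 * \<delta> \<le> 1" "p2 * \<delta> \<le> 1" and p3: "p3 * \<delta> \<le> 1" and "p4 * \<delta> \<le> 1"
    using pos by (auto intro!: le)
  then show "14 * (6 * C ^ 3) * \<delta> * (1 + 3 * L) \<le> 1" "280 * (6 * C ^ 3) * \<delta> * (1 + 4 * L) \<le> 1"
    "48 * C * (132 * C ^ 5) * \<delta> \<le> 1"
    by (simp_all add: p1_def p2_def p4_def mult_ac)
  have "56 * (6 * C ^ 3) * \<delta> * (1 + 4 * L) = p3 * \<delta> * L"
    using assms(1) by (simp add: p3_def)
  also have "\<dots> \<le> 1 * L" using p3 assms(1) by (intro mult_right_mono) auto
  finally show "56 * (6 * C ^ 3) * \<delta> * (1 + 4 * L) \<le> L" by simp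
qed

theorem theorem9p1:
  shows "\<exists>eps7 :: real \<Rightarrow> real \<Rightarrow> real \<Rightarrow> real \<Rightarrow> real \<Rightarrow> real \<Rightarrow> real \<Rightarrow> real \<Rightarrow> real.
    \<forall>T lam_f Lam_f lb_f Lip_f lam_g Lam_g lb_g l_g lam_k Lam_k L_p
     (f :: real^'n \<Rightarrow> (real^'n) measure \<Rightarrow> real^'k \<Rightarrow> real^'n) df
     (g :: real^'n \<Rightarrow> (real^'n) measure \<Rightarrow> real^'k \<Rightarrow> real) dg
     (p :: real^'n \<Rightarrow> (real^'n) measure \<Rightarrow> real^'n)
     (\<alpha> :: real^'n \<Rightarrow> (real^'n) measure \<Rightarrow> real^'n \<Rightarrow> real^'k)
     Lbar_p k0 L_f L_g L_\<alpha>.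
      0 < T \<longrightarrow> 0 < lam_k \<longrightarrow> 0 < Lam_k \<longrightarrow>
      Lbar_p = Lbar_p_const (CARD('n)) lam_f Lam_f lam_g Lam_g lam_k Lam_k \<longrightarrow>
      k0 = k0_const (CARD('n)) lam_f Lam_f lam_g Lam_g lam_k Lam_k \<longrightarrow>
      L_f = L_f_const Lam_f f \<longrightarrow>
      L_g = L_g_const Lam_g lb_g g dg \<longrightarrow>
      L_\<alpha> = L_alpha_const Lam_f lb_f lam_g lb_g k0 \<alpha> \<longrightarrow>
      assumption_a1 lam_f Lam_f lb_f Lip_f f df \<longrightarrow>
      assumption_a2 lam_g Lam_g lb_g l_g g dg \<longrightarrow>
      assumption_P L_p Lbar_p p \<longrightarrow>
      L_p \<le> Lbar_p \<longrightarrow>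
      (\<forall>x. \<forall>\<mu>\<in>P2. \<forall>a. norm (D_a (D_a f) x \<mu> a) * (1 + norm x + moment1 \<mu>) \<le> lam_g / (40 * Lbar_p)) \<longrightarrow>
      optimal_control f g \<alpha> \<longrightarrow>
      0 < eps7 Lbar_p L_f Lam_f lb_f L_g Lam_g lb_g L_\<alpha> \<and>
      (\<forall>t T' m X Z X' Z'.
         0 \<le> t \<longrightarrow> t \<le> T' \<longrightarrow> T' \<le> T \<longrightarrow>
         T' - t \<le> eps7 Lbar_p L_f Lam_f lb_f L_g Lam_g lb_g L_\<alpha> \<longrightarrow>
         m \<in> P2 \<longrightarrow>
         fbode_solution f df g dg \<alpha> p t T' m X Z \<longrightarrow>
         fbode_solution f df g dg \<alpha> p t T' m X' Z' \<longrightarrow>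
         C1_in_time t T' X \<longrightarrow> C1_in_time t T' Z \<longrightarrow>
         C1_in_time t T' X' \<longrightarrow> C1_in_time t T' Z' \<longrightarrow>
         (\<forall>s\<in>{t..T'}. \<forall>x. X s x = X' s x \<and> Z s x = Z' s x))"
proof -
  \<comment> \<open>The horizon may depend only on the listed constants, and \<open>lam_g\<close> is
    not among them. Its inverse is recovered from \<open>L_\<alpha>\<close>, which is at least
    \<open>20 * Lam_f / (19 * lam_g)\<close>; hence the summand \<open>L_\<alpha> / Lam_f\<close>.
    \<open>L_f\<close> and \<open>L_g\<close> supply the values at the origin.\<close>
  define bound where "bound Lbar L_f Lam_f lb_f L_g Lam_g lb_g L_\<alpha> =
    1 + CARD('n) * Lbar + CARD('n) * Lam_f + L_f + L_g +
    (12 * CARD('n) * (CARD('n) * (CARD('n) * (CARD('k) * lb_f))) + 8 * Lam_f) +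
    12 * (Lam_g + lb_g) + L_\<alpha> / Lam_f" for Lbar L_f Lam_f lb_f L_g Lam_g lb_g L_\<alpha> :: real
  show ?thesis
  proof (intro exI[of _ "\<lambda>Lbar L_f Lam_f lb_f L_g Lam_g lb_g L_\<alpha>.
      horizon Lbar (bound Lbar L_f Lam_f lb_f L_g Lam_g lb_g L_\<alpha>)"] allI impI)
    fix T lam_f Lam_f lb_f Lip_f lam_g Lam_g lb_g l_g lam_k Lam_k L_p :: real
      and f :: "real^'n \<Rightarrow> (real^'n) measure \<Rightarrow> real^'k \<Rightarrow> real^'n" and df
      and g :: "real^'n \<Rightarrow> (real^'n) measure \<Rightarrow> real^'k \<Rightarrow> real" and dg
      and p :: "real^'n \<Rightarrow> (real^'n) measure \<Rightarrow> real^'n"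
      and \<alpha> :: "real^'n \<Rightarrow> (real^'n) measure \<Rightarrow> real^'n \<Rightarrow> real^'k"
      and Lbar_p k0 L_f L_g L_\<alpha> :: real
    assume Lam_k: "0 < Lam_k"
      and Lbar_p: "Lbar_p = Lbar_p_const CARD('n) lam_f Lam_f lam_g Lam_g lam_k Lam_k"
      and L_f: "L_f = L_f_const Lam_f f" and L_g: "L_g = L_g_const Lam_g lb_g g dg"
      and L_\<alpha>: "L_\<alpha> = L_alpha_const Lam_f lb_f lam_g lb_g k0 \<alpha>"
      and a1: "assumption_a1 lam_f Lam_f lb_f Lip_f f df" and a2: "assumption_a2 lam_g Lam_g lb_g l_g g dg"
      and P: "assumption_P L_p Lbar_p p" and L_p: "L_p \<le> Lbar_p"
      and D_aa: "\<forall>x. \<forall>\<mu>\<in>P2. \<forall>a. norm (D_a (D_a f) x \<mu> a) * (1 + norm x + moment1 \<mu>) \<le> lam_g / (40 * Lbar_p)"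
      and opt: "optimal_control f g \<alpha>"
    define C where "C = bound Lbar_p L_f Lam_f lb_f L_g Lam_g lb_g L_\<alpha>"
    have pos: "0 < Lam_f" "0 < lb_f" "0 < lam_g" "0 < Lam_g" "0 < lb_g"
      using a1 a2 unfolding assumption_a1_def assumption_a2_def by blast+
    have Lbar0: "0 < Lbar_p" using Lam_k unfolding Lbar_p Lbar_p_const_def by (simp add: less_max_iff_disj)
    have f0: "norm (f 0 dirac0 0) \<le> L_f" unfolding L_f L_f_const_def by simp
    have g0: "norm (D_mu dg 0 dirac0 0 0) \<le> L_g" "norm (D_x g 0 dirac0 0) \<le> L_g" "norm (D_a g 0 dirac0 0) \<le> L_g"
      unfolding L_g L_g_const_def by (auto intro!: Max_ge)
    have "20 * Lam_f / (19 * lam_g) \<le> L_\<alpha>" unfolding L_\<alpha> L_alpha_const_def by (auto intro!: Max_ge)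
    moreover have "Lam_f / lam_g \<le> 20 * Lam_f / (19 * lam_g)" using pos by (simp add: field_simps)
    ultimately have "Lam_f / lam_g \<le> L_\<alpha>" by linarith
    then have lam: "1 / lam_g \<le> L_\<alpha> / Lam_f" using pos by (simp add: field_simps)
    have nonneg: "0 \<le> CARD('n) * Lbar_p" "0 \<le> CARD('n) * Lam_f" "0 \<le> L_f" "0 \<le> L_g"
      "0 \<le> 12 * CARD('n) * (CARD('n) * (CARD('n) * (CARD('k) * lb_f))) + 8 * Lam_f"
      "0 \<le> 12 * (Lam_g + lb_g)" "0 \<le> L_\<alpha> / Lam_f"
    proof -
      show "0 \<le> L_f" using f0 norm_ge_zero order_trans by blast
      show "0 \<le> L_g" using g0(1) norm_ge_zero order_trans by blast
      have "0 \<le> 1 / lam_g" using pos by simp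
      then show "0 \<le> L_\<alpha> / Lam_f" using lam by linarith
    qed (use pos Lbar0 in auto)
    have C: "1 \<le> C" "1 / lam_g \<le> C" "CARD('n) * Lam_f \<le> C" "CARD('n) * Lbar_p \<le> C" "L_f \<le> C" "L_g \<le> C"
      "12 * CARD('n) * (CARD('n) * (CARD('n) * (CARD('k) * lb_f))) + 8 * Lam_f \<le> C" "12 * (Lam_g + lb_g) \<le> C"
      unfolding C_def bound_def using nonneg lam by linarith+
    interpret control_problem f df g dg p \<alpha> lam_f Lam_f lb_f Lip_f lam_g Lam_g lb_g l_g L_p Lbar_p C
    proof
      show "norm (D_a (D_a f) x \<mu> a) * (1 + norm x + moment1 \<mu>) \<le> lam_g / (40 * Lbar_p)" if "\<mu> \<in> P2" for x \<mu> a
        using D_aa that by blast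
    qed (fact a1 a2 P Lbar0 L_p opt C(1-4) C(7,8) order_trans[OF f0 C(5)] order_trans[OF g0(1) C(6)]
        order_trans[OF g0(2) C(6)] order_trans[OF g0(3) C(6)])+
    show "0 < horizon Lbar_p (bound Lbar_p L_f Lam_f lb_f L_g Lam_g lb_g L_\<alpha>) \<and>
      (\<forall>t T' m X Z X' Z'.
         0 \<le> t \<longrightarrow> t \<le> T' \<longrightarrow> T' \<le> T \<longrightarrow>
         T' - t \<le> horizon Lbar_p (bound Lbar_p L_f Lam_f lb_f L_g Lam_g lb_g L_\<alpha>) \<longrightarrow>
         m \<in> P2 \<longrightarrow>
         fbode_solution f df g dg \<alpha> p t T' m X Z \<longrightarrow>
         fbode_solution f df g dg \<alpha> p t T' m X' Z' \<longrightarrow>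
         C1_in_time t T' X \<longrightarrow> C1_in_time t T' Z \<longrightarrow>
         C1_in_time t T' X' \<longrightarrow> C1_in_time t T' Z' \<longrightarrow>
         (\<forall>s\<in>{t..T'}. \<forall>x. X s x = X' s x \<and> Z s x = Z' s x))"
      unfolding C_def[symmetric]
    proof (intro conjI allI impI ballI)
      show "0 < horizon Lbar_p C" by (rule horizon_pos[OF Lbar0 C(1)])
      fix t T' m X Z X' Z' s x
      assume t: "t \<le> T'" "T' - t \<le> horizon Lbar_p C" and m: "m \<in> P2"
        and sol: "fbode_solution f df g dg \<alpha> p t T' m X Z" "fbode_solution f df g dg \<alpha> p t T' m X' Z'"
        and s: "s \<in> {t..T'}"
      have "0 \<le> T' - t" using t(1) by simp
      note b = horizon_bounds[OF Lbar0 C(1) this t(2), folded B1_def B2_def]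
      show "X s x = X' s x" "Z s x = Z' s x" using uniqueness[OF m sol t(1) s b] by auto
    qed
  qed
qed

end
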